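(* Let $\mathfrak{g}=\mathfrak{sl}(2)\ltimes\mathfrak{h}_n$, $n\ge 1$, $m=2n-1$. Let $V_1=V(a_0)\oplus V(a_1)\oplus V(a_2)$ and $V_2=V(b_0)\oplus\cdots\oplus V(b_\ell)$, $\ell\ge 1$, be the socle decompositions of two uniserial $\mathfrak{g}$-modules, where $V_1$ is standard faithful and $V_2$ is of type $Z$. Then $\mathrm{soc}(V_1\otimes V_2)=S_0\oplus S_1$, where, as $\mathfrak{sl}(2)$-modules, $$S_0=\mathrm{soc}(V_1)\otimes\mathrm{soc}(V_2)\simeq\bigoplus_{k=0}^{\min\{a_0,b_0\}}V(a_0+b_0-2k),$$ and $S_1$ is as follows. Case $n=1$ ($m=1$): - $V_1=FU^+_{a_0}$, $V_2=Z(b_0,\ell)$: $S_1\simeq V(a_0+b_0+m)$. - $V_1=FU^+_{a_0}$, $V_2=Z(b_\ell,\ell)^*$: $S_1\simeq V(b_1-a_0)$ if $b_1\ge a_0$, and $S_1=0$ otherwise. - $V_1=FU^-_{a_0}$ ($a_0\ge1$), $V_2=Z(b_0,\ell)$: $S_1\simeq V(a_0-b_1)$ if $a_0\ge b_1$, and $S_1=0$ otherwise. - $V_1=FU^-_{a_0}$ ($a_0\ge 1$), $V_2=Z(b_\ell,\ell)^*$: $S_1=0$. Case $n>1$ ($m\ge3$): - $V_1=FU_{(a_0,a_0+m,a_0)}$ ($a_0\in\{0,1\}$), $V_2=Z(b_0,\ell)$: $S_1\simeq V(a_0+b_0+m)$. - $V_1=FU_{(a_0,a_0+m,a_0)}$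 ($a_0\in\{0,1\}$), $V_2=Z(b_\ell,\ell)^*$: $S_1\simeq V(b_1-a_0)$ if $a_0\le b_1$, and $S_1=0$ if $a_0>b_1$. - $V_1=FU_{(1,m-1,1)}$, $V_2=Z(b_0,\ell)$: $S_1\simeq V(m-1)$ if $b_0=0$, and $S_1=0$ otherwise. - $V_1=FU_{(1,m-1,1)}$, $V_2=Z(b_\ell,\ell)^*$: $S_1=0$.
   Context: $\mathbb{F}$ is a field of characteristic zero; all modules are finite dimensional. $V(k)$ is the irreducible $\mathfrak{sl}(2)$-module of highest weight $k$. $\mathfrak{h}_n$ is the Heisenberg Lie algebra of dimension $2n+1$ with center $\mathbb{F}z$; $\mathfrak{sl}(2)$ acts by derivations with $\mathfrak{h}_n=\mathfrak{h}_n(m)\oplus\mathbb{F}z$, $\mathfrak{h}_n(m)\simeq V(m)$, $\mathbb{F}z\simeq V(0)$; $\mathfrak{g}=\mathfrak{sl}(2)\ltimes\mathfrak{h}_n$. For a $\mathfrak{g}$-module $U$, $\mathrm{soc}(U)$ is the sum of its irreducible submodules; $\mathrm{soc}^0(U)=0$, $\mathrm{soc}^i(U)/\mathrm{soc}^{i-1}(U)=\mathrm{soc}(U/\mathrm{soc}^{i-1}(U))$; $U$ is uniserial if it has a unique composition series. A socle decomposition of a uniserial $U$ of length $\ell+1$ is $U=V(a_0)\oplus\cdots\oplus V(a_\ell)$ (irreducible $\mathfrak{sl}(2)$-submodules) with $\mathrm{soc}^{i+1}(U)=V(a_0)\oplus\cdots\oplus V(a_i)$. For socle decompositions $V=\bigoplus_iV(a_i)$,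 $W=\bigoplus_jV(b_j)$, $S_t=S_t(V,W)=\big(\bigoplus_{i+j=t}V(a_i)\otimes V(b_j)\big)^{\mathfrak{h}_n}$ (vectors killed by $\mathfrak{h}_n$, with $x(v\otimes w)=xv\otimes w+v\otimes xw$). Type $Z$: for integers $\alpha,\ell\ge0$, $Z(\alpha,\ell)$ is the $\mathfrak{sl}(2)$-module $V(\alpha)\oplus V(\alpha+m)\oplus\cdots\oplus V(\alpha+\ell m)$ (this is its socle decomposition) on which $z$ acts trivially and $\mathfrak{h}_n(m)$ kills $V(\alpha)$ and maps $V(\alpha+im)$ to $V(\alpha+(i-1)m)$ via a nonzero $\mathfrak{sl}(2)$-equivariant map $\mathfrak{h}_n(m)\otimes V(\alpha+im)\to V(\alpha+(i-1)m)$ (unique up to scalar). $Z(\alpha,\ell)^*$ is its dual, with socle decomposition $V(\alpha+\ell m)\oplus\cdots\oplus V(\alpha)$; thus writing $V_2=Z(b_\ell,\ell)^*$ means $b_j=b_\ell+(\ell-j)m$. Modules $Z(\alpha,\ell)$ and $Z(\alpha,\ell)^*$ are said to be of type $Z$. Faithful modules: a uniserial $\mathfrak{g}$-module is faithful iff $z$ acts nontrivially. Every faithful uniserial $\mathfrak{g}$-module has length $3$ and socle decomposition $V(a_0)\oplus V(a_1)\oplus V(a_0)$, with $\mathfrak{h}_n(m)$ mapping $V(a_2)\to V(a_1)\to V(a_0)$ by nonzero equivariant maps and $z$ acting as a nonzero isomorphism $V(a_2)\to V(a_0)$; it is determined up to isomorphism by the triple, denoted $FU_{(a_0,a_1,a_0)}$.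 The occurring triples are: $n=1$: $(a,a+1,a)$, $a\ge0$ (written $FU^+_a$) and $(a,a-1,a)$, $a\ge1$ (written $FU^-_a$); $n=2$: $(0,3,0),(1,4,1),(1,2,1),(4,3,4)$; $n\ge3$: $(0,m,0),(1,m+1,1),(1,m-1,1)$. Standard faithful means faithful and not isomorphic to the $n=2$ module $FU_{(4,3,4)}$. *)

theory Defs
  imports "Jordan_Normal_Form.Matrix"
begin

text \<open>Basis of g = sl(2) semidirect h_n:  e, h, f, z and x_0 .. x_m  (m = 2n-1),
  where h_n(m) = span of the x_i is V(m) in its standard basis
  (h x_i = (m-2i) x_i, f x_i = x_(i+1), e x_i = i(m-i+1) x_(i-1)) and
  [x_i, x_j] = omega(x_i,x_j) z with omega the (unique up to scalar)
  sl(2)-invariant symplectic form, omega(x_i,x_(m-i)) = (-1)^i.\<close>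

datatype gen = GE | GH | GF | GZ | GX nat

definition gbasis :: "nat \<Rightarrow> gen set" where
  "gbasis n = {GE, GH, GF, GZ} \<union> GX ` {..2*n-1}"

text \<open>Structure constants: gbr n a b c = coefficient of c in [a,b].\<close>
fun gbr :: "nat \<Rightarrow> gen \<Rightarrow> gen \<Rightarrow> gen \<Rightarrow> 'a::field_char_0" where
  "gbr n GH GE = (\<lambda>c. if c = GE then 2 else 0)"
| "gbr n GE GH = (\<lambda>c. if c = GE then -2 else 0)"
| "gbr n GH GF = (\<lambda>c. if c = GF then -2 else 0)"
| "gbr n GF GH = (\<lambda>c. if c = GF then 2 else 0)"
| "gbr n GE GF = (\<lambda>c. if c = GH then 1 else 0)"
| "gbr n GF GE = (\<lambda>c. if c = GH then -1 else 0)"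
| "gbr n GH (GX i) = (\<lambda>c. if c = GX i then of_int (int (2*n-1) - 2 * int i) else 0)"
| "gbr n (GX i) GH = (\<lambda>c. if c = GX i then - of_int (int (2*n-1) - 2 * int i) else 0)"
| "gbr n GE (GX i) = (\<lambda>c. if 1 \<le> i \<and> c = GX (i-1) then of_nat (i * (2*n - i)) else 0)"
| "gbr n (GX i) GE = (\<lambda>c. if 1 \<le> i \<and> c = GX (i-1) then - of_nat (i * (2*n - i)) else 0)"
| "gbr n GF (GX i) = (\<lambda>c. if i < 2*n-1 \<and> c = GX (i+1) then 1 else 0)"
| "gbr n (GX i) GF = (\<lambda>c. if i < 2*n-1 \<and> c = GX (i+1) then -1 else 0)"
| "gbr n (GX i) (GX j) = (\<lambda>c. if c = GZ \<and> i + j = 2*n-1 then (-1)^i else 0)"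
| "gbr n _ _ = (\<lambda>c. 0)"

definition comm_mat :: "'a::ring mat \<Rightarrow> 'a mat \<Rightarrow> 'a mat" where
  "comm_mat A B = A * B - B * A"

definition lin_rep :: "nat \<Rightarrow> nat \<Rightarrow> (gen \<Rightarrow> 'a::field_char_0 mat) \<Rightarrow> (gen \<Rightarrow> 'a) \<Rightarrow> 'a mat" where
  "lin_rep n d \<rho> c = mat d d (\<lambda>(r,s). \<Sum>b\<in>gbasis n. c b * \<rho> b $$ (r,s))"

definition gmod :: "nat \<Rightarrow> nat \<Rightarrow> (gen \<Rightarrow> 'a::field_char_0 mat) \<Rightarrow> bool" where
  "gmod n d \<rho> \<longleftrightarrow> (\<forall>b. \<rho> b \<in> carrier_mat d d) \<and>
     (\<forall>a\<in>gbasis n. \<forall>b\<in>gbasis n. comm_mat (\<rho> a) (\<rho> b) = lin_rep n d \<rho> (gbr n a b))"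

definition faithful :: "nat \<Rightarrow> nat \<Rightarrow> (gen \<Rightarrow> 'a::field_char_0 mat) \<Rightarrow> bool" where
  "faithful n d \<rho> \<longleftrightarrow> (\<forall>c. lin_rep n d \<rho> c = 0\<^sub>m d d \<longrightarrow> (\<forall>b\<in>gbasis n. c b = 0))"

definition subspace :: "nat \<Rightarrow> 'a::field vec set \<Rightarrow> bool" where
  "subspace d W \<longleftrightarrow> W \<subseteq> carrier_vec d \<and> 0\<^sub>v d \<in> W \<and>
     (\<forall>u\<in>W. \<forall>v\<in>W. u + v \<in> W) \<and> (\<forall>c. \<forall>u\<in>W. c \<cdot>\<^sub>v u \<in> W)"

definition vspan :: "nat \<Rightarrow> 'a::field vec set \<Rightarrow> 'a vec set" where
  "vspan d S = \<Inter>{W. subspace d W \<and> S \<subseteq> W}"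

definition ssum :: "'a::field vec set \<Rightarrow> 'a vec set \<Rightarrow> 'a vec set" where
  "ssum U W = {u + w | u w. u \<in> U \<and> w \<in> W}"

fun lsum :: "nat \<Rightarrow> 'a::field vec set list \<Rightarrow> 'a vec set" where
  "lsum d [] = {0\<^sub>v d}"
| "lsum d (W # Ws) = ssum W (lsum d Ws)"

fun direct_list :: "nat \<Rightarrow> 'a::field vec set list \<Rightarrow> bool" where
  "direct_list d [] = True"
| "direct_list d (W # Ws) = (W \<inter> lsum d Ws = {0\<^sub>v d} \<and> direct_list d Ws)"

definition stdV :: "nat \<Rightarrow> gen \<Rightarrow> 'a::field_char_0 mat" where
  "stdV k X = mat (k+1) (k+1) (\<lambda>(i,j).
     (if X = GH then (if i = j then of_int (int k - 2 * int j) else 0)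
      else if X = GF then (if i = j + 1 then 1 else 0)
      else if X = GE then (if i + 1 = j then of_nat (j * (k + 1 - j)) else 0)
      else 0))"

fun stdVs :: "nat list \<Rightarrow> gen \<Rightarrow> 'a::field_char_0 mat" where
  "stdVs [] X = 0\<^sub>m 0 0"
| "stdVs (k # ks) X = four_block_mat (stdV k X) (0\<^sub>m (k+1) (sum_list (map Suc ks)))
      (0\<^sub>m (sum_list (map Suc ks)) (k+1)) (stdVs ks X)"

definition sl2_iso :: "nat \<Rightarrow> (gen \<Rightarrow> 'a::field_char_0 mat) \<Rightarrow> 'a vec set \<Rightarrow> nat list \<Rightarrow> bool" where
  "sl2_iso d \<rho> W ks \<longleftrightarrow> (let D = sum_list (map Suc ks) in
     \<exists>P. P \<in> carrier_mat d D \<and>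
       (\<forall>v\<in>carrier_vec D. P *\<^sub>v v = 0\<^sub>v d \<longrightarrow> v = 0\<^sub>v D) \<and>
       W = (\<lambda>v. P *\<^sub>v v) ` carrier_vec D \<and>
       (\<forall>X\<in>{GE, GH, GF}. \<rho> X * P = P * stdVs ks X))"

definition gsubmod :: "nat \<Rightarrow> nat \<Rightarrow> (gen \<Rightarrow> 'a::field_char_0 mat) \<Rightarrow> 'a vec set \<Rightarrow> bool" where
  "gsubmod n d \<rho> U \<longleftrightarrow> subspace d U \<and> (\<forall>b\<in>gbasis n. \<forall>u\<in>U. \<rho> b *\<^sub>v u \<in> U)"

definition gcovers :: "nat \<Rightarrow> nat \<Rightarrow> (gen \<Rightarrow> 'a::field_char_0 mat) \<Rightarrow> 'a vec set \<Rightarrow> 'a vec set \<Rightarrow> bool" where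
  "gcovers n d \<rho> Y X \<longleftrightarrow> gsubmod n d \<rho> Y \<and> gsubmod n d \<rho> X \<and> Y \<subset> X \<and>
     \<not> (\<exists>T. gsubmod n d \<rho> T \<and> Y \<subset> T \<and> T \<subset> X)"

text \<open>Preimage of soc(U/Y) in U.\<close>
definition soc_rel :: "nat \<Rightarrow> nat \<Rightarrow> (gen \<Rightarrow> 'a::field_char_0 mat) \<Rightarrow> 'a vec set \<Rightarrow> 'a vec set" where
  "soc_rel n d \<rho> Y = vspan d (Y \<union> \<Union>{X. gcovers n d \<rho> Y X})"

definition gsoc :: "nat \<Rightarrow> nat \<Rightarrow> (gen \<Rightarrow> 'a::field_char_0 mat) \<Rightarrow> 'a vec set" where
  "gsoc n d \<rho> = soc_rel n d \<rho> {0\<^sub>v d}"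

definition gsoc_i :: "nat \<Rightarrow> nat \<Rightarrow> (gen \<Rightarrow> 'a::field_char_0 mat) \<Rightarrow> nat \<Rightarrow> 'a vec set" where
  "gsoc_i n d \<rho> i = (soc_rel n d \<rho> ^^ i) {0\<^sub>v d}"

definition comp_series :: "nat \<Rightarrow> nat \<Rightarrow> (gen \<Rightarrow> 'a::field_char_0 mat) \<Rightarrow> 'a vec set list \<Rightarrow> bool" where
  "comp_series n d \<rho> Us \<longleftrightarrow> Us \<noteq> [] \<and> hd Us = {0\<^sub>v d} \<and> last Us = carrier_vec d \<and>
     (\<forall>i. i + 1 < length Us \<longrightarrow> gcovers n d \<rho> (Us ! i) (Us ! (i+1)))"

definition uniserial :: "nat \<Rightarrow> nat \<Rightarrow> (gen \<Rightarrow> 'a::field_char_0 mat) \<Rightarrow> bool" where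
  "uniserial n d \<rho> \<longleftrightarrow> (\<exists>!Us. comp_series n d \<rho> Us)"

definition socle_decomp :: "nat \<Rightarrow> nat \<Rightarrow> (gen \<Rightarrow> 'a::field_char_0 mat) \<Rightarrow> 'a vec set list \<Rightarrow> nat list \<Rightarrow> bool" where
  "socle_decomp n d \<rho> Ws as \<longleftrightarrow> length Ws = length as \<and>
     (\<forall>i<length Ws. sl2_iso d \<rho> (Ws ! i) [as ! i]) \<and>
     direct_list d Ws \<and> lsum d Ws = carrier_vec d \<and>
     (\<forall>i<length Ws. gsoc_i n d \<rho> (Suc i) = lsum d (take (Suc i) Ws))"

definition is_Zmod :: "nat \<Rightarrow> nat \<Rightarrow> (gen \<Rightarrow> 'a::field_char_0 mat) \<Rightarrow> nat \<Rightarrow> nat \<Rightarrow> bool" where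
  "is_Zmod n d \<rho> \<alpha> l \<longleftrightarrow> gmod n d \<rho> \<and> \<rho> GZ = 0\<^sub>m d d \<and>
     (\<exists>Ws. length Ws = l + 1 \<and>
        (\<forall>i\<le>l. sl2_iso d \<rho> (Ws ! i) [\<alpha> + i * (2*n-1)]) \<and>
        direct_list d Ws \<and> lsum d Ws = carrier_vec d \<and>
        (\<forall>j\<le>2*n-1. \<forall>w\<in>Ws ! 0. \<rho> (GX j) *\<^sub>v w = 0\<^sub>v d) \<and>
        (\<forall>i. 1 \<le> i \<and> i \<le> l \<longrightarrow>
           (\<forall>j\<le>2*n-1. \<forall>w\<in>Ws ! i. \<rho> (GX j) *\<^sub>v w \<in> Ws ! (i-1)) \<and>
           (\<exists>j\<le>2*n-1. \<exists>w\<in>Ws ! i. \<rho> (GX j) *\<^sub>v w \<noteq> 0\<^sub>v d)))"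

definition gdual :: "(gen \<Rightarrow> 'a::field_char_0 mat) \<Rightarrow> gen \<Rightarrow> 'a mat" where
  "gdual \<rho> b = - transpose_mat (\<rho> b)"

definition giso :: "nat \<Rightarrow> nat \<Rightarrow> (gen \<Rightarrow> 'a::field_char_0 mat) \<Rightarrow> nat \<Rightarrow> (gen \<Rightarrow> 'a mat) \<Rightarrow> bool" where
  "giso n d \<rho> d' \<rho>' \<longleftrightarrow> d = d' \<and>
     (\<exists>P\<in>carrier_mat d d. invertible_mat P \<and> (\<forall>b\<in>gbasis n. P * \<rho>' b = \<rho> b * P))"

definition typeZ :: "nat \<Rightarrow> nat \<Rightarrow> (gen \<Rightarrow> 'a::field_char_0 mat) \<Rightarrow> bool" where
  "typeZ n d \<rho> \<longleftrightarrow> (\<exists>\<alpha> l. is_Zmod n d \<rho> \<alpha> l) \<or>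
     (\<exists>\<alpha> l \<rho>'. is_Zmod n d \<rho>' \<alpha> l \<and> giso n d \<rho> d (gdual \<rho>'))"

definition kron_mat :: "'a::semiring_1 mat \<Rightarrow> 'a mat \<Rightarrow> 'a mat" where
  "kron_mat A B = mat (dim_row A * dim_row B) (dim_col A * dim_col B)
     (\<lambda>(i,j). A $$ (i div dim_row B, j div dim_col B) * B $$ (i mod dim_row B, j mod dim_col B))"

definition kron_vec :: "'a::semiring_1 vec \<Rightarrow> 'a vec \<Rightarrow> 'a vec" where
  "kron_vec u w = vec (dim_vec u * dim_vec w) (\<lambda>i. u $ (i div dim_vec w) * w $ (i mod dim_vec w))"

definition tens_rep :: "nat \<Rightarrow> (gen \<Rightarrow> 'a::field_char_0 mat) \<Rightarrow> nat \<Rightarrow> (gen \<Rightarrow> 'a mat) \<Rightarrow> gen \<Rightarrow> 'a mat" where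
  "tens_rep d1 \<rho>1 d2 \<rho>2 b = kron_mat (\<rho>1 b) (1\<^sub>m d2) + kron_mat (1\<^sub>m d1) (\<rho>2 b)"

definition tens_sub :: "nat \<Rightarrow> nat \<Rightarrow> 'a::field_char_0 vec set \<Rightarrow> 'a vec set \<Rightarrow> 'a vec set" where
  "tens_sub d1 d2 U W = vspan (d1 * d2) {kron_vec u w | u w. u \<in> U \<and> w \<in> W}"

definition hinv :: "nat \<Rightarrow> nat \<Rightarrow> (gen \<Rightarrow> 'a::field_char_0 mat) \<Rightarrow> 'a vec set \<Rightarrow> 'a vec set" where
  "hinv n d \<rho> U = {v \<in> U. \<rho> GZ *\<^sub>v v = 0\<^sub>v d \<and> (\<forall>i\<le>2*n-1. \<rho> (GX i) *\<^sub>v v = 0\<^sub>v d)}"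

definition S_t :: "nat \<Rightarrow> nat \<Rightarrow> (gen \<Rightarrow> 'a::field_char_0 mat) \<Rightarrow> 'a vec set list \<Rightarrow>
    nat \<Rightarrow> (gen \<Rightarrow> 'a mat) \<Rightarrow> 'a vec set list \<Rightarrow> nat \<Rightarrow> 'a vec set" where
  "S_t n d1 \<rho>1 Ws1 d2 \<rho>2 Ws2 t = hinv n (d1 * d2) (tens_rep d1 \<rho>1 d2 \<rho>2)
     (lsum (d1 * d2) [tens_sub d1 d2 (Ws1 ! i) (Ws2 ! (t - i)).
        i \<leftarrow> [0..<Suc t], i < length Ws1 \<and> t - i < length Ws2])"

end

theory Submission
  imports Defs
begin

text \<open>Each \<open>h\<^sub>n\<close>-invariant subspace of a module on which \<open>h\<^sub>n\<close> acts nilpotently is a completely reducible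
  sl(2)-module, so the socle of the tensor product is its space of \<open>h\<^sub>n\<close>-invariants. On \<open>V\<^sub>1\<close> parity of
  the weights forces z to act only from the top level to the bottom one, which excludes the top level from
  every invariant; and since on \<open>V\<^sub>2\<close> an element of positive level is never killed by all \<open>x\<^sub>i\<close> (the common
  kernel inside one level is an sl(2)-submodule of an irreducible), an invariant lives in the levels
  (0,0), (0,1), (1,0). The (0,0) part is unconstrained and decomposes by Clebsch--Gordan. The remaining part is
  the solution space of a linear system whose coefficients are those of the equivariant maps
  \<open>V(m) \<otimes> V(b) \<rightarrow> V(a)\<close> with a = b - m, a = b + m or (a,b) = (1,m-1); these are binomial, and the system is
  solved explicitly in each case.\<close>

text \<open>The field need not be algebraically closed and complete reducibility is not assumed.
  Both are replaced by the fact that every module in play carries a basis of h-eigenvectors with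
  integer weights: then a subspace stable under e, f, h is generated by its highest weight vectors
  (\<open>hw_generate\<close>), and only these have to be found. The given socle decompositions and
  those hidden in the definition of type Z are a priori unrelated. They agree because the levels of
  a type Z module have pairwise distinct highest weights, so that every irreducible sl(2)-submodule
  is a level. Linear algebra is turned back into representation theory by one principle: a stable
  subspace spanned by one nonzero vector of each weight K, K-2, ..., -K is V(K). Solving the linear
  system therefore means exhibiting K+1 weight solutions. Except for (1,m-1,1) with m >= 3, the
  cases with solutions are rescaled by factorials so that the unknowns become constant along
  antidiagonals; the antidiagonals that survive the boundary conditions number K+1, which is where
  the comparison of a_0 with b_1 comes from.\<close>

declare index_mult_mat_vec [simp del]

section \<open>Linear combinations\<close>

lemma smult_0_vec: "v \<in> carrier_vec d \<Longrightarrow> (0::'a::field) \<cdot>\<^sub>v v = 0\<^sub>v d"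
  by (rule eq_vecI) (auto dest: carrier_vecD)

text \<open>Families over arbitrary index types replace lists or sets of vectors: levels, pairs and
  tensor indices are all index sets, and a change of basis is a change of the coefficient function.
  The entrywise form reduces every identity to one between finite sums.\<close>

definition lc :: "nat \<Rightarrow> 'i set \<Rightarrow> ('i \<Rightarrow> 'a::field) \<Rightarrow> ('i \<Rightarrow> 'a vec) \<Rightarrow> 'a vec" where
  "lc d I c p = vec d (\<lambda>r. \<Sum>i\<in>I. c i * p i $ r)"

definition sp :: "nat \<Rightarrow> 'i set \<Rightarrow> ('i \<Rightarrow> 'a::field vec) \<Rightarrow> 'a vec set" where
  "sp d I p = range (\<lambda>c. lc d I c p)"

text \<open>Independence of a family, so a repeated vector counts as a dependence. Finiteness and
  the carrier are included so that a basis is handed around as a single fact.\<close>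

definition indep :: "nat \<Rightarrow> 'i set \<Rightarrow> ('i \<Rightarrow> 'a::field vec) \<Rightarrow> bool" where
  "indep d I p \<longleftrightarrow> finite I \<and> p ` I \<subseteq> carrier_vec d \<and> (\<forall>c. lc d I c p = 0\<^sub>v d \<longrightarrow> (\<forall>i\<in>I. c i = 0))"

lemma lc_carrier [simp]: "lc d I c p \<in> carrier_vec d"
  by (simp add: lc_def)

lemma lc_dim [simp]: "dim_vec (lc d I c p) = d"
  by (simp add: lc_def)

lemma lc_index [simp]: "r < d \<Longrightarrow> lc d I c p $ r = (\<Sum>i\<in>I. c i * p i $ r)"
  by (simp add: lc_def)

lemma lc_cong: "(\<And>i. i \<in> I \<Longrightarrow> c i = c' i) \<Longrightarrow> (\<And>i. i \<in> I \<Longrightarrow> c i \<noteq> 0 \<Longrightarrow> p i = p' i) \<Longrightarrow> lc d I c p = lc d I c' p'"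
  unfolding lc_def
  by (intro arg_cong[of _ _ "vec d"] ext sum.cong refl) (metis mult_zero_left)

lemma lc_in_sp [simp]: "lc d I c p \<in> sp d I p"
  by (simp add: sp_def)

lemma sp_E: "v \<in> sp d I p \<Longrightarrow> (\<And>c. v = lc d I c p \<Longrightarrow> thesis) \<Longrightarrow> thesis"
  by (auto simp: sp_def)

lemma sp_carrier: "sp d I p \<subseteq> carrier_vec d"
  by (auto simp: sp_def)

lemma mult_mat_vec_index: "A \<in> carrier_mat d' d \<Longrightarrow> v \<in> carrier_vec d \<Longrightarrow> r < d' \<Longrightarrow>
    (A *\<^sub>v v) $ r = (\<Sum>s<d. A $$ (r,s) * v $ s)"
  unfolding carrier_mat_def carrier_vec_def
  by (simp add: index_mult_mat_vec scalar_prod_def lessThan_atLeast0)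

lemma mult_mat_vec_in [simp]: "A \<in> carrier_mat d' d \<Longrightarrow> A *\<^sub>v v \<in> carrier_vec d'"
  by (metis carrier_matD(1) carrier_vec_dim_vec dim_mult_mat_vec)

lemma mult_mat_zero_vec [simp]: "A \<in> carrier_mat d' d \<Longrightarrow> A *\<^sub>v 0\<^sub>v d = (0\<^sub>v d' :: 'a::field vec)"
proof (rule eq_vecI)
  assume A: "A \<in> carrier_mat d' d"
  fix r assume "r < dim_vec (0\<^sub>v d' :: 'a vec)"
  then have r: "r < d'" by simp
  have "0\<^sub>v d \<in> carrier_vec d" by simp
  from mult_mat_vec_index[OF A this r] show "(A *\<^sub>v 0\<^sub>v d) $ r = 0\<^sub>v d' $ r" using r by simp
qed simp

lemma mult_mat_vec_sq [simp]: "A \<in> carrier_mat d d \<Longrightarrow> A *\<^sub>v v \<in> carrier_vec d"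
  by (rule mult_mat_vec_in)

lemma mult_mat_zero_vec_sq [simp]: "A \<in> carrier_mat d d \<Longrightarrow> A *\<^sub>v 0\<^sub>v d = (0\<^sub>v d :: 'a::field vec)"
  by (rule mult_mat_zero_vec)

lemma mult_lc:
  assumes A: "A \<in> carrier_mat d' d" and p: "\<And>i. i \<in> I \<Longrightarrow> p i \<in> carrier_vec d"
  shows "A *\<^sub>v lc d I c p = lc d' I c (\<lambda>i. A *\<^sub>v p i)"
proof (intro eq_vecI)
  fix r assume "r < dim_vec (lc d' I c (\<lambda>i. A *\<^sub>v p i))"
  then have r: "r < d'" by simp
  have "(A *\<^sub>v lc d I c p) $ r = (\<Sum>s<d. \<Sum>i\<in>I. c i * (A $$ (r,s) * p i $ s))"
    using A r by (simp add: mult_mat_vec_index sum_distrib_left algebra_simps)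
  also have "\<dots> = (\<Sum>i\<in>I. \<Sum>s<d. c i * (A $$ (r,s) * p i $ s))" by (rule sum.swap)
  also have "\<dots> = (\<Sum>i\<in>I. c i * (A *\<^sub>v p i) $ r)"
    using p by (intro sum.cong) (simp_all add: mult_mat_vec_index[OF A _ r] sum_distrib_left)
  finally show "(A *\<^sub>v lc d I c p) $ r = lc d' I c (\<lambda>i. A *\<^sub>v p i) $ r" using r by simp
qed (use A in simp)

lemma lc_add: "lc d I c p + lc d I c' p = lc d I (\<lambda>i. c i + c' i) p"
  by (rule eq_vecI) (simp_all add: sum.distrib algebra_simps)

lemma lc_add2: "(\<And>i. i \<in> I \<Longrightarrow> p i \<in> carrier_vec d) \<Longrightarrow> (\<And>i. i \<in> I \<Longrightarrow> p' i \<in> carrier_vec d) \<Longrightarrow>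
   lc d I c p + lc d I c p' = lc d I c (\<lambda>i. p i + p' i)"
proof (rule eq_vecI)
  assume p: "\<And>i. i \<in> I \<Longrightarrow> p' i \<in> carrier_vec d"
  fix r assume "r < dim_vec (lc d I c (\<lambda>i. p i + p' i))"
  then have r: "r < d" by simp
  have "c i * p i $ r + c i * p' i $ r = c i * (p i + p' i) $ r" if "i \<in> I" for i
    using carrier_vecD[OF p[OF that]] r by (simp add: distrib_left)
  then show "(lc d I c p + lc d I c p') $ r = lc d I c (\<lambda>i. p i + p' i) $ r"
    using r by (simp add: sum.distrib[symmetric])
qed simp

lemma lc_smult: "a \<cdot>\<^sub>v lc d I c p = lc d I (\<lambda>i. a * c i) p"
  by (rule eq_vecI) (simp_all add: sum_distrib_left algebra_simps)

lemma lc_smult2: "(\<And>i. i \<in> I \<Longrightarrow> p i \<in> carrier_vec d) \<Longrightarrow>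
   lc d I c (\<lambda>i. a i \<cdot>\<^sub>v p i) = lc d I (\<lambda>i. c i * a i) p"
proof (rule eq_vecI)
  assume p: "\<And>i. i \<in> I \<Longrightarrow> p i \<in> carrier_vec d"
  fix r assume "r < dim_vec (lc d I (\<lambda>i. c i * a i) p)"
  then have r: "r < d" by simp
  have "c i * (a i \<cdot>\<^sub>v p i) $ r = c i * a i * p i $ r" if "i \<in> I" for i
    using carrier_vecD[OF p[OF that]] r by (simp add: mult.assoc)
  then show "lc d I c (\<lambda>i. a i \<cdot>\<^sub>v p i) $ r = lc d I (\<lambda>i. c i * a i) p $ r"
    using r by (auto intro!: sum.cong simp del: mult_cancel_left)
qed simp

lemma lc_lc: "lc d I c (\<lambda>i. lc d J (B i) p) = lc d J (\<lambda>j. \<Sum>i\<in>I. c i * B i j) p"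
proof (rule eq_vecI)
  fix r assume "r < dim_vec (lc d J (\<lambda>j. \<Sum>i\<in>I. c i * B i j) p)"
  then have r: "r < d" by simp
  have "(\<Sum>i\<in>I. \<Sum>j\<in>J. c i * (B i j * p j $ r)) = (\<Sum>j\<in>J. \<Sum>i\<in>I. c i * (B i j * p j $ r))" by (rule sum.swap)
  then show "lc d I c (\<lambda>i. lc d J (B i) p) $ r = lc d J (\<lambda>j. \<Sum>i\<in>I. c i * B i j) p $ r"
    using r by (simp add: sum_distrib_left sum_distrib_right mult.assoc)
qed simp

lemma lc_zero:
  fixes p :: "'i \<Rightarrow> 'a::field vec"
  shows "(\<And>i. i \<in> I \<Longrightarrow> c i \<noteq> 0 \<Longrightarrow> p i = 0\<^sub>v d) \<Longrightarrow> lc d I c p = 0\<^sub>v d"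
proof (rule eq_vecI)
  assume z: "\<And>i. i \<in> I \<Longrightarrow> c i \<noteq> 0 \<Longrightarrow> p i = 0\<^sub>v d"
  fix r assume "r < dim_vec (0\<^sub>v d :: 'a vec)"
  then have r: "r < d" by simp
  have "c i * p i $ r = 0" if "i \<in> I" for i using z[OF that] r by (cases "c i = 0") auto
  then show "lc d I c p $ r = 0\<^sub>v d $ r" using r by (simp del: mult_eq_0_iff)
qed simp

lemma lc_empty [simp]: "lc d {} c p = 0\<^sub>v d"
  by (rule lc_zero) simp

lemma lc_insert: "finite I \<Longrightarrow> i \<notin> I \<Longrightarrow> p i \<in> carrier_vec d \<Longrightarrow> lc d (insert i I) c p = c i \<cdot>\<^sub>v p i + lc d I c p"
  by (rule eq_vecI) (simp_all add: carrier_vecD)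

lemma lc_Un: "finite I \<Longrightarrow> finite J \<Longrightarrow> I \<inter> J = {} \<Longrightarrow> lc d (I \<union> J) c p = lc d I c p + lc d J c p"
  by (rule eq_vecI) (simp_all add: sum.union_disjoint)

lemma lc_mono: "finite J \<Longrightarrow> I \<subseteq> J \<Longrightarrow> (\<And>i. i \<in> J - I \<Longrightarrow> c i = 0) \<Longrightarrow> lc d I c p = lc d J c p"
  by (rule eq_vecI) (auto intro!: sum.mono_neutral_left)

lemma lc_single:
  assumes "finite I" "i \<in> I" "p i \<in> carrier_vec d" "\<And>j. j \<in> I \<Longrightarrow> j \<noteq> i \<Longrightarrow> c j = 0"
  shows "lc d I c p = c i \<cdot>\<^sub>v p i"
proof (rule eq_vecI)
  fix r assume "r < dim_vec (c i \<cdot>\<^sub>v p i)"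
  then have r: "r < d" using assms(3) by simp
  have "(\<Sum>j\<in>I. c j * p j $ r) = (\<Sum>j\<in>{i}. c j * p j $ r)"
    using assms by (intro sum.mono_neutral_right) auto
  then show "lc d I c p $ r = (c i \<cdot>\<^sub>v p i) $ r" using r assms(3) by simp
qed (use assms(3) in simp)

lemma sp_member: "finite I \<Longrightarrow> i \<in> I \<Longrightarrow> p i \<in> carrier_vec d \<Longrightarrow> p i \<in> sp d I p"
  using lc_single[of I i p d "\<lambda>j. if j = i then 1 else 0"] lc_in_sp[of d I _ p] by (metis one_smult_vec)

lemma lc_reindex: "inj_on g J \<Longrightarrow> lc d (g ` J) c p = lc d J (\<lambda>j. c (g j)) (\<lambda>j. p (g j))"
  by (rule eq_vecI) (simp_all add: sum.reindex)

lemma indepD: "indep d I p \<Longrightarrow> lc d I c p = 0\<^sub>v d \<Longrightarrow> i \<in> I \<Longrightarrow> c i = 0"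
  by (auto simp: indep_def)

lemma indep_finite: "indep d I p \<Longrightarrow> finite I"
  by (auto simp: indep_def)

lemma indep_carrier: "indep d I p \<Longrightarrow> i \<in> I \<Longrightarrow> p i \<in> carrier_vec d"
  by (auto simp: indep_def)

lemma indep_eqD:
  assumes "indep d I p" "lc d I c p = lc d I c' p" "i \<in> I" shows "c i = c' i"
proof -
  have "lc d I (\<lambda>i. c i - c' i) p = lc d I c p + (-1) \<cdot>\<^sub>v lc d I c' p"
    by (simp add: lc_smult lc_add)
  also have "\<dots> = 0\<^sub>v d" using assms(2) by (intro eq_vecI) auto
  finally show ?thesis using indepD[OF assms(1), of "\<lambda>i. c i - c' i" i] assms(3) by simp
qed

lemma indep_nonzero: "indep d I p \<Longrightarrow> i \<in> I \<Longrightarrow> p i \<noteq> 0\<^sub>v d"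
proof
  assume a: "indep d I p" "i \<in> I" "p i = 0\<^sub>v d"
  have "lc d I (\<lambda>j. if j = i then 1 else 0) p = 0\<^sub>v d" by (rule lc_zero) (use a in \<open>auto split: if_splits\<close>)
  from indepD[OF a(1) this a(2)] show False by simp
qed

subsection \<open>Subspaces\<close>

lemma subspace_carrier: "subspace d W \<Longrightarrow> v \<in> W \<Longrightarrow> v \<in> carrier_vec d"
  by (auto simp: subspace_def)
lemma subspace_zero: "subspace d W \<Longrightarrow> 0\<^sub>v d \<in> W"
  by (auto simp: subspace_def)
lemma subspace_add: "subspace d W \<Longrightarrow> u \<in> W \<Longrightarrow> v \<in> W \<Longrightarrow> u + v \<in> W"
  by (auto simp: subspace_def)
lemma subspace_smult: "subspace d W \<Longrightarrow> u \<in> W \<Longrightarrow> c \<cdot>\<^sub>v u \<in> W"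
  by (auto simp: subspace_def)

lemma subspace_lc:
  assumes "subspace d W" "finite I" "\<And>i. i \<in> I \<Longrightarrow> c i \<noteq> 0 \<Longrightarrow> p i \<in> W" "\<And>i. i \<in> I \<Longrightarrow> p i \<in> carrier_vec d"
  shows "lc d I c p \<in> W"
  using assms(2,3,4)
proof (induction I)
  case empty
  then show ?case using subspace_zero[OF assms(1)] by simp
next
  case (insert i I)
  have "c i \<cdot>\<^sub>v p i \<in> W"
  proof (cases "c i = 0")
    case True
    then have "c i \<cdot>\<^sub>v p i = 0\<^sub>v d" using carrier_vecD[OF insert.prems(2)[of i]] by (intro eq_vecI) simp_all
    then show ?thesis using subspace_zero[OF assms(1)] by simp
  qed (use insert.prems in \<open>simp add: subspace_smult[OF assms(1)]\<close>)
  then show ?case using insert by (simp add: lc_insert subspace_add[OF assms(1)])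
qed

lemma subspace_smult_cancel:
  assumes "subspace d W" "c \<cdot>\<^sub>v u \<in> W" "c \<noteq> 0" shows "u \<in> W"
proof -
  have "inverse c \<cdot>\<^sub>v (c \<cdot>\<^sub>v u) = u" using assms(3) by (intro eq_vecI) auto
  then show ?thesis using subspace_smult[OF assms(1,2), of "inverse c"] by simp
qed

lemma subspace_sp: "subspace d (sp d I p)"
  unfolding subspace_def
proof (intro conjI ballI allI)
  have "lc d I (\<lambda>_. 0) p = 0\<^sub>v d" by (rule lc_zero) simp
  then show "0\<^sub>v d \<in> sp d I p" by (metis lc_in_sp)
qed (auto simp: sp_def lc_add lc_smult)

lemma sp_least: "subspace d W \<Longrightarrow> finite I \<Longrightarrow> p ` I \<subseteq> W \<Longrightarrow> sp d I p \<subseteq> W"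
  by (auto simp: sp_def intro!: subspace_lc dest: subspace_carrier)

lemma subspace_carrier_vec: "subspace d (carrier_vec d)"
  by (auto simp: subspace_def)

lemma subspace_0: "subspace d {0\<^sub>v d}"
  by (auto simp: subspace_def)

lemma subspace_Int: "subspace d U \<Longrightarrow> subspace d W \<Longrightarrow> subspace d (U \<inter> W)"
  by (auto simp: subspace_def)

lemma subspace_vspan: "S \<subseteq> carrier_vec d \<Longrightarrow> subspace d (vspan d S)"
  using subspace_carrier_vec by (fastforce simp: subspace_def vspan_def)

lemma vspan_superset: "S \<subseteq> vspan d S"
  by (auto simp: vspan_def)

lemma vspan_least: "subspace d W \<Longrightarrow> S \<subseteq> W \<Longrightarrow> vspan d S \<subseteq> W"
  by (auto simp: vspan_def)

lemma subspace_ssum: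
  assumes "subspace d U" "subspace d W" shows "subspace d (ssum U W)"
  unfolding subspace_def
proof (intro conjI ballI allI)
  note c = subspace_carrier[OF assms(1)] subspace_carrier[OF assms(2)]
  show "ssum U W \<subseteq> carrier_vec d" using c by (auto simp: ssum_def)
  have "0\<^sub>v d = 0\<^sub>v d + (0\<^sub>v d :: 'a vec)" by (intro eq_vecI) auto
  then show "0\<^sub>v d \<in> ssum U W" using assms unfolding ssum_def by (blast dest: subspace_zero)
  fix x y assume "x \<in> ssum U W" "y \<in> ssum U W"
  then obtain u w u' w' where x: "x = u + w" "y = u' + w'" and m: "u \<in> U" "w \<in> W" "u' \<in> U" "w' \<in> W" by (auto simp: ssum_def)
  have "x + y = (u + u') + (w + w')" unfolding x
    using carrier_vecD[OF c(1)[OF m(1)]] carrier_vecD[OF c(2)[OF m(2)]] carrier_vecD[OF c(1)[OF m(3)]] carrier_vecD[OF c(2)[OF m(4)]]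
    by (intro eq_vecI) (simp_all add: algebra_simps)
  then show "x + y \<in> ssum U W" using m assms unfolding ssum_def by (blast intro: subspace_add)
next
  note c = subspace_carrier[OF assms(1)] subspace_carrier[OF assms(2)]
  fix x and k :: 'a assume "x \<in> ssum U W"
  then obtain u w where x: "x = u + w" and m: "u \<in> U" "w \<in> W" by (auto simp: ssum_def)
  have "k \<cdot>\<^sub>v x = k \<cdot>\<^sub>v u + k \<cdot>\<^sub>v w" unfolding x using c(1)[OF m(1)] c(2)[OF m(2)] by (rule smult_add_distrib_vec)
  then show "k \<cdot>\<^sub>v x \<in> ssum U W" using m assms unfolding ssum_def by (blast intro: subspace_smult)
qed

lemma ssum_upper:
  assumes "subspace d U" "subspace d W" shows "U \<subseteq> ssum U W" "W \<subseteq> ssum U W"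
proof -
  have "u \<in> ssum U W" if "u \<in> U" for u
    using that subspace_zero[OF assms(2)] right_zero_vec[OF subspace_carrier[OF assms(1) that]] unfolding ssum_def
    by (metis (mono_tags, lifting) mem_Collect_eq)
  moreover have "w \<in> ssum U W" if "w \<in> W" for w
    using that subspace_zero[OF assms(1)] left_zero_vec[OF subspace_carrier[OF assms(2) that]] unfolding ssum_def
    by (metis (mono_tags, lifting) mem_Collect_eq)
  ultimately show "U \<subseteq> ssum U W" "W \<subseteq> ssum U W" by auto
qed

lemma ssum_least: "subspace d X \<Longrightarrow> U \<subseteq> X \<Longrightarrow> W \<subseteq> X \<Longrightarrow> ssum U W \<subseteq> X"
  unfolding ssum_def subspace_def by blast

lemma sp_Un:
  assumes "finite I" "finite J" "I \<inter> J = {}"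
  shows "sp d (I \<union> J) p = ssum (sp d I p) (sp d J p)"
proof (intro equalityI subsetI)
  fix v assume "v \<in> sp d (I \<union> J) p"
  then obtain c where "v = lc d (I \<union> J) c p" by (auto simp: sp_def)
  then show "v \<in> ssum (sp d I p) (sp d J p)" using lc_Un[OF assms, of d c p] unfolding ssum_def by (blast intro: lc_in_sp)
next
  fix v assume "v \<in> ssum (sp d I p) (sp d J p)"
  then obtain c c' where v: "v = lc d I c p + lc d J c' p" by (auto simp: ssum_def sp_def)
  let ?c = "\<lambda>i. if i \<in> I then c i else c' i"
  have "lc d (I \<union> J) ?c p = lc d I ?c p + lc d J ?c p" by (rule lc_Un[OF assms])
  moreover have "lc d I ?c p = lc d I c p" by (rule lc_cong) auto
  moreover have "lc d J ?c p = lc d J c' p" using assms(3) by (intro lc_cong) auto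
  ultimately show "v \<in> sp d (I \<union> J) p" unfolding v by (metis lc_in_sp)
qed

lemma indep_Un:
  assumes I: "indep d I p" and J: "indep d J p" and "I \<inter> J = {}" and "sp d I p \<inter> sp d J p = {0\<^sub>v d}"
  shows "indep d (I \<union> J) p"
proof -
  have "c i = 0" if z: "lc d (I \<union> J) c p = 0\<^sub>v d" and i: "i \<in> I \<union> J" for c i
  proof -
    have s: "lc d I c p + lc d J c p = 0\<^sub>v d" using z lc_Un[OF indep_finite[OF I] indep_finite[OF J] assms(3), of d c p] by simp
    have "lc d I c p = (-1) \<cdot>\<^sub>v lc d J c p"
    proof (intro eq_vecI)
      fix r assume "r < dim_vec ((-1) \<cdot>\<^sub>v lc d J c p)"
      then have r: "r < d" by simp
      have "(lc d I c p + lc d J c p) $ r = 0" using s r by simp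
      then show "lc d I c p $ r = ((-1) \<cdot>\<^sub>v lc d J c p) $ r" using r by (simp add: eq_neg_iff_add_eq_0)
    qed simp
    then have "lc d I c p \<in> sp d J p" by (simp add: lc_smult)
    then have 1: "lc d I c p = 0\<^sub>v d" using assms(4) lc_in_sp[of d I c p] by blast
    then have "lc d J c p = 0\<^sub>v d" using s by simp
    then show ?thesis using 1 i indepD[OF I] indepD[OF J] by blast
  qed
  then show ?thesis using I J by (auto simp: indep_def)
qed

section \<open>Bases of direct sums of lists of subspaces\<close>

lemma lsum_drop:
  "i < length Ws \<Longrightarrow> lsum d (drop i Ws) = ssum (Ws ! i) (lsum d (drop (Suc i) Ws))"
  by (metis Cons_nth_drop_Suc lsum.simps(2))

lemma direct_drop:
  "i < length Ws \<Longrightarrow> direct_list d (drop i Ws) \<longleftrightarrow> Ws ! i \<inter> lsum d (drop (Suc i) Ws) = {0\<^sub>v d} \<and> direct_list d (drop (Suc i) Ws)"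
  by (metis Cons_nth_drop_Suc direct_list.simps(2))

text \<open>\<open>direct_list\<close> compares each summand with the sum of the later ones, so the
  induction runs over the tails \<open>drop i Ws\<close>, from the empty tail backwards. The glued
  basis is indexed by pairs of a position in the list and an index within that summand.\<close>

lemma direct_list_basis:
  assumes dir: "direct_list d Ws"
    and W: "\<And>j. j < length Ws \<Longrightarrow> finite (K j) \<and> Ws ! j = sp d (K j) (p j) \<and> indep d (K j) (p j)"
  shows "indep d (SIGMA j:{..<length Ws}. K j) (\<lambda>(j,k). p j k) \<and>
         sp d (SIGMA j:{..<length Ws}. K j) (\<lambda>(j,k). p j k) = lsum d Ws"
proof -
  let ?p = "\<lambda>(j,k). p j k"
  have pair: "lc d (Pair i ` K i) c ?p = lc d (K i) (\<lambda>k. c (i,k)) (p i)" for i c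
    using lc_reindex[of "Pair i" "K i" d c ?p] by (simp add: inj_on_def)
  have sp_pair: "sp d (Pair i ` K i) ?p = sp d (K i) (p i)" for i
  proof -
    have 1: "lc d (K i) c (p i) = lc d (Pair i ` K i) (\<lambda>jk. c (snd jk)) ?p" for c
      using pair[of i "\<lambda>jk. c (snd jk)"] by simp
    show ?thesis
    proof (intro equalityI subsetI)
      fix v assume "v \<in> sp d (Pair i ` K i) ?p"
      then obtain c where "v = lc d (Pair i ` K i) c ?p" by (rule sp_E)
      then show "v \<in> sp d (K i) (p i)" using pair[of i c] by (metis lc_in_sp)
    next
      fix v assume "v \<in> sp d (K i) (p i)"
      then obtain c where "v = lc d (K i) c (p i)" by (rule sp_E)
      then show "v \<in> sp d (Pair i ` K i) ?p" using 1[of c] by (metis lc_in_sp)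
    qed
  qed
  have ind_pair: "indep d (Pair i ` K i) ?p" if "i < length Ws" for i
    unfolding indep_def
  proof (intro conjI allI impI ballI)
    show "finite (Pair i ` K i)" "?p ` (Pair i ` K i) \<subseteq> carrier_vec d" using W[OF that] by (auto simp: indep_def simp del: W)
    fix c jk assume a: "lc d (Pair i ` K i) c ?p = 0\<^sub>v d" "jk \<in> Pair i ` K i"
    then obtain k where k: "jk = (i,k)" "k \<in> K i" by auto
    have "indep d (K i) (p i)" using W[OF that] by simp
    from indepD[OF this a(1)[unfolded pair] k(2)] show "c jk = 0" using k by simp
  qed
  have "indep d (SIGMA j:{i..<length Ws}. K j) ?p \<and>
         sp d (SIGMA j:{i..<length Ws}. K j) ?p = lsum d (drop i Ws) \<and> direct_list d (drop i Ws)"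
    if "i \<le> length Ws" for i
    using that
  proof (induction "length Ws - i" arbitrary: i)
    case 0
    then have i: "i = length Ws" by simp
    show ?case unfolding i by (auto simp: indep_def sp_def)
  next
    case (Suc n)
    then have i: "i < length Ws" by simp
    have dirall: "direct_list d (drop j Ws)" if "j \<le> length Ws" for j
      using that
    proof (induction j)
      case 0
      then show ?case using dir by simp
    next
      case (Suc j)
      then show ?case using direct_drop[of j Ws d] by simp
    qed
    have IH: "indep d (SIGMA j:{Suc i..<length Ws}. K j) ?p" "sp d (SIGMA j:{Suc i..<length Ws}. K j) ?p = lsum d (drop (Suc i) Ws)"
      using Suc i by auto
    have eq: "(SIGMA j:{i..<length Ws}. K j) = Pair i ` K i \<union> (SIGMA j:{Suc i..<length Ws}. K j)"
    proof (intro equalityI subsetI)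
      fix x assume "x \<in> (SIGMA j:{i..<length Ws}. K j)"
      then show "x \<in> Pair i ` K i \<union> (SIGMA j:{Suc i..<length Ws}. K j)" by (cases x; cases "fst x = i") auto
    qed (use i in auto)
    have dj: "Pair i ` K i \<inter> (SIGMA j:{Suc i..<length Ws}. K j) = {}" by auto
    have int: "Ws ! i \<inter> lsum d (drop (Suc i) Ws) = {0\<^sub>v d}" using direct_drop[OF i, of d] dirall[of i] i by simp
    have 1: "indep d (SIGMA j:{i..<length Ws}. K j) ?p"
      unfolding eq using int IH W[OF i] by (intro indep_Un ind_pair i dj) (simp_all add: sp_pair)
    have 2: "sp d (SIGMA j:{i..<length Ws}. K j) ?p = lsum d (drop i Ws)"
      unfolding eq lsum_drop[OF i] using IH W[OF i] indep_finite[OF IH(1)]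
      by (subst sp_Un[OF _ _ dj]) (simp_all add: sp_pair)
    show ?case using 1 2 dirall[of i] i by simp
  qed
  from this[of 0] show ?thesis by (simp add: lessThan_atLeast0)
qed

section \<open>Weight modules of sl(2)\<close>

definition pw :: "'a::field mat \<Rightarrow> nat \<Rightarrow> 'a vec \<Rightarrow> 'a vec" where
  "pw A n v = ((\<lambda>v. A *\<^sub>v v) ^^ n) v"

lemma pw_0 [simp]: "pw A 0 v = v" by (simp add: pw_def)
lemma pw_Suc: "pw A (Suc n) v = A *\<^sub>v pw A n v" by (simp add: pw_def)
lemma pw_Suc2: "pw A (Suc n) v = pw A n (A *\<^sub>v v)" by (simp add: pw_def funpow_swap1)
lemma pw_plus: "pw A (m + n) v = pw A m (pw A n v)" by (simp add: pw_def funpow_add)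

lemma pw_carrier [simp]: "A \<in> carrier_mat d d \<Longrightarrow> v \<in> carrier_vec d \<Longrightarrow> pw A n v \<in> carrier_vec d"
  by (cases n) (simp_all add: pw_Suc)

lemma pw_zero [simp]: "A \<in> carrier_mat d d \<Longrightarrow> pw A n (0\<^sub>v d) = 0\<^sub>v d"
  by (induction n) (simp_all add: pw_Suc)

lemma pw_in: "(\<And>v. v \<in> G \<Longrightarrow> A *\<^sub>v v \<in> G) \<Longrightarrow> v \<in> G \<Longrightarrow> pw A n v \<in> G"
  by (induction n) (simp_all add: pw_Suc)

lemma pw_smult: "A \<in> carrier_mat d d \<Longrightarrow> v \<in> carrier_vec d \<Longrightarrow> pw A n (c \<cdot>\<^sub>v v) = c \<cdot>\<^sub>v pw A n v"
proof (induction n)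
  case (Suc n)
  then show ?case using mult_mat_vec[of A d d "pw A n v" c] by (simp add: pw_Suc)
qed simp

lemma pw_add: "A \<in> carrier_mat d d \<Longrightarrow> v \<in> carrier_vec d \<Longrightarrow> u \<in> carrier_vec d \<Longrightarrow> pw A n (v + u) = pw A n v + pw A n u"
proof (induction n)
  case (Suc n)
  then show ?case using mult_add_distrib_mat_vec[of A d d "pw A n v" "pw A n u"] by (simp add: pw_Suc)
qed simp

lemma pw_lc: "A \<in> carrier_mat d d \<Longrightarrow> (\<And>i. i \<in> I \<Longrightarrow> p i \<in> carrier_vec d) \<Longrightarrow> pw A n (lc d I c p) = lc d I c (\<lambda>i. pw A n (p i))"
proof (induction n)
  case (Suc n)
  then show ?case using mult_lc[of A d d I "\<lambda>i. pw A n (p i)" c] by (simp add: pw_Suc)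
qed simp

lemma smult_vec_zero [simp]: "(c::'a::field) \<cdot>\<^sub>v 0\<^sub>v d = 0\<^sub>v d"
  by (rule eq_vecI) auto

lemma smult_eq_0D:
  assumes "(c::'a::field) \<cdot>\<^sub>v v = 0\<^sub>v d" "c \<noteq> 0" shows "v = 0\<^sub>v d"
proof -
  have "inverse c \<cdot>\<^sub>v (c \<cdot>\<^sub>v v) = v" using assms(2) by (simp add: smult_smult_assoc)
  then show ?thesis using assms by simp
qed

lemma smult_eq_cancel:
  assumes "a \<cdot>\<^sub>v v = b \<cdot>\<^sub>v v" "v \<in> carrier_vec d" "v \<noteq> 0\<^sub>v d" shows "a = (b::'a::field)"
proof (rule ccontr)
  assume "a \<noteq> b"
  have "(a - b) \<cdot>\<^sub>v v = 0\<^sub>v d"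
  proof (rule eq_vecI)
    fix r assume "r < dim_vec (0\<^sub>v d :: 'a vec)"
    then have r: "r < d" by simp
    have "(a \<cdot>\<^sub>v v) $ r = (b \<cdot>\<^sub>v v) $ r" using assms(1) by simp
    then show "((a - b) \<cdot>\<^sub>v v) $ r = 0\<^sub>v d $ r" using r carrier_vecD[OF assms(2)] by (simp add: algebra_simps)
  qed (use carrier_vecD[OF assms(2)] in simp)
  from smult_eq_0D[OF this] show False using \<open>a \<noteq> b\<close> assms(3) by simp
qed

text \<open>The image of the standard basis of V(k) under an embedding. At j = 0 the coefficient in
  the clause for E is 0, so the truncated index \<open>j - 1\<close> does no harm and
  \<open>p 0\<close> is a highest weight vector. Only \<open>p 0\<close> is required to be nonzero;
  independence is a consequence (\<open>chain_indep\<close>).\<close>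

definition chain :: "nat \<Rightarrow> 'a::field_char_0 mat \<Rightarrow> 'a mat \<Rightarrow> 'a mat \<Rightarrow> nat \<Rightarrow> (nat \<Rightarrow> 'a vec) \<Rightarrow> bool" where
  "chain d E F H k p \<longleftrightarrow> (\<forall>j\<le>k. p j \<in> carrier_vec d) \<and> p 0 \<noteq> 0\<^sub>v d \<and>
     (\<forall>j\<le>k. H *\<^sub>v p j = of_int (int k - 2 * int j) \<cdot>\<^sub>v p j) \<and>
     (\<forall>j\<le>k. E *\<^sub>v p j = of_nat (j * (k + 1 - j)) \<cdot>\<^sub>v p (j - 1)) \<and>
     (\<forall>j<k. F *\<^sub>v p j = p (j + 1)) \<and> F *\<^sub>v p k = 0\<^sub>v d"

lemma chainD:
  assumes "chain d E F H k p"
  shows "j \<le> k \<Longrightarrow> p j \<in> carrier_vec d" "p 0 \<noteq> 0\<^sub>v d"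
    "j \<le> k \<Longrightarrow> H *\<^sub>v p j = of_int (int k - 2 * int j) \<cdot>\<^sub>v p j"
    "j \<le> k \<Longrightarrow> E *\<^sub>v p j = of_nat (j * (k + 1 - j)) \<cdot>\<^sub>v p (j - 1)"
    "j < k \<Longrightarrow> F *\<^sub>v p j = p (j + 1)" "F *\<^sub>v p k = 0\<^sub>v d"
  using assms by (auto simp: chain_def)

text \<open>Diagonalisability of h with integer eigenvalues, kept as data: every module considered
  comes with such a basis, so no eigenvalue has to be looked for in the field.\<close>

definition weights :: "nat \<Rightarrow> 'a::field_char_0 mat \<Rightarrow> 'i set \<Rightarrow> ('i \<Rightarrow> 'a vec) \<Rightarrow> ('i \<Rightarrow> int) \<Rightarrow> bool" where
  "weights d H I b w \<longleftrightarrow> indep d I b \<and> sp d I b = carrier_vec d \<and> (\<forall>i\<in>I. H *\<^sub>v b i = of_int (w i) \<cdot>\<^sub>v b i)"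

text \<open>The commutation relations are stated as identities on vectors, the form in which they
  apply to iterated actions of E and F.\<close>

locale sl2 =
  fixes d :: nat and E F H :: "'a::field_char_0 mat"
  assumes E [simp]: "E \<in> carrier_mat d d" and F [simp]: "F \<in> carrier_mat d d" and H [simp]: "H \<in> carrier_mat d d"
    and EF: "v \<in> carrier_vec d \<Longrightarrow> E *\<^sub>v (F *\<^sub>v v) = F *\<^sub>v (E *\<^sub>v v) + H *\<^sub>v v"
    and HE: "v \<in> carrier_vec d \<Longrightarrow> H *\<^sub>v (E *\<^sub>v v) = E *\<^sub>v (H *\<^sub>v v) + 2 \<cdot>\<^sub>v (E *\<^sub>v v)"
    and HF: "v \<in> carrier_vec d \<Longrightarrow> H *\<^sub>v (F *\<^sub>v v) = F *\<^sub>v (H *\<^sub>v v) + (-2) \<cdot>\<^sub>v (F *\<^sub>v v)"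
begin

text \<open>The Chevalley involution: with E and F exchanged and H negated, every statement on
  highest weight vectors becomes one on lowest weight vectors.\<close>

lemma swap: "sl2 d F E (- H)"
proof -
  have n: "(- H) *\<^sub>v v = (-1) \<cdot>\<^sub>v (H *\<^sub>v v)" if v: "v \<in> carrier_vec d" for v
  proof -
    have "(- H) *\<^sub>v v = - (H *\<^sub>v v)" using v by (intro uminus_mult_mat_vec) (simp add: carrier_vecD carrier_matD[OF H])
    also have "\<dots> = (-1) \<cdot>\<^sub>v (H *\<^sub>v v)" by (rule eq_vecI) auto
    finally show ?thesis .
  qed
  have d: "dim_vec (X *\<^sub>v v) = d" if "X \<in> carrier_mat d d" for X :: "'a mat" and v using carrier_matD[OF that] by simp
  have m: "X *\<^sub>v ((-1) \<cdot>\<^sub>v (H *\<^sub>v v)) = (-1) \<cdot>\<^sub>v (X *\<^sub>v (H *\<^sub>v v))" if "X \<in> carrier_mat d d" for X v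
    using that by (intro mult_mat_vec) auto
  show ?thesis
  proof
    fix v :: "'a vec" assume v: "v \<in> carrier_vec d"
    show "F *\<^sub>v (E *\<^sub>v v) = E *\<^sub>v (F *\<^sub>v v) + (- H) *\<^sub>v v"
      using EF[OF v] by (intro eq_vecI) (simp_all add: n[OF v] d[OF E] d[OF F] d[OF H] carrier_matD(1)[OF E] carrier_matD(1)[OF F] carrier_matD(1)[OF H])
    show "(- H) *\<^sub>v (F *\<^sub>v v) = F *\<^sub>v ((- H) *\<^sub>v v) + 2 \<cdot>\<^sub>v (F *\<^sub>v v)"
      using HF[OF v] by (intro eq_vecI) (simp_all add: n[OF v] n[OF mult_mat_vec_in[OF F]] m d[OF E] d[OF F] d[OF H] carrier_matD(1)[OF E] carrier_matD(1)[OF F] carrier_matD(1)[OF H])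
    show "(- H) *\<^sub>v (E *\<^sub>v v) = E *\<^sub>v ((- H) *\<^sub>v v) + (- 2) \<cdot>\<^sub>v (E *\<^sub>v v)"
      using HE[OF v] by (intro eq_vecI) (simp_all add: n[OF v] n[OF mult_mat_vec_in[OF E]] m d[OF E] d[OF F] d[OF H] carrier_matD(1)[OF E] carrier_matD(1)[OF F] carrier_matD(1)[OF H])
  qed simp_all
qed

lemma swap_weight: "v \<in> carrier_vec d \<Longrightarrow> H *\<^sub>v v = c \<cdot>\<^sub>v v \<Longrightarrow> (- H) *\<^sub>v v = (- c) \<cdot>\<^sub>v v"
  using uminus_mult_mat_vec[of v H] carrier_matD[OF H] by (intro eq_vecI) (auto dest: carrier_vecD)

lemma swap_weight': "v \<in> carrier_vec d \<Longrightarrow> (- H) *\<^sub>v v = c \<cdot>\<^sub>v v \<Longrightarrow> H *\<^sub>v v = (- c) \<cdot>\<^sub>v v"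
proof -
  assume v: "v \<in> carrier_vec d" and e: "(- H) *\<^sub>v v = c \<cdot>\<^sub>v v"
  have "- (H *\<^sub>v v) = c \<cdot>\<^sub>v v" using uminus_mult_mat_vec[of v H] carrier_matD[OF H] v e by (simp add: carrier_vecD)
  then have h: "(- (H *\<^sub>v v)) $ r = (c \<cdot>\<^sub>v v) $ r" for r by simp
  show "H *\<^sub>v v = (- c) \<cdot>\<^sub>v v"
  proof (rule eq_vecI)
    fix r assume "r < dim_vec ((- c) \<cdot>\<^sub>v v)"
    then show "(H *\<^sub>v v) $ r = ((- c) \<cdot>\<^sub>v v) $ r" using h[of r] carrier_matD[OF H] carrier_vecD[OF v] by (simp add: minus_equation_iff)
  qed (use carrier_matD[OF H] carrier_vecD[OF v] in simp)
qed

lemma H_E: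
  assumes v: "v \<in> carrier_vec d" and c: "H *\<^sub>v v = c \<cdot>\<^sub>v v"
  shows "H *\<^sub>v (E *\<^sub>v v) = (c + 2) \<cdot>\<^sub>v (E *\<^sub>v v)"
  using HE[OF v] mult_mat_vec[OF E v, of c] by (simp add: c add_smult_distrib_vec)

lemma H_F:
  assumes v: "v \<in> carrier_vec d" and c: "H *\<^sub>v v = c \<cdot>\<^sub>v v"
  shows "H *\<^sub>v (F *\<^sub>v v) = (c - 2) \<cdot>\<^sub>v (F *\<^sub>v v)"
  using HF[OF v] mult_mat_vec[OF F v, of c] add_smult_distrib_vec[of c "-2" "F *\<^sub>v v"] by (simp add: c)

lemma H_pwE:
  assumes v: "v \<in> carrier_vec d" and c: "H *\<^sub>v v = c \<cdot>\<^sub>v v"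
  shows "H *\<^sub>v pw E n v = (c + 2 * of_nat n) \<cdot>\<^sub>v pw E n v"
proof (induction n)
  case (Suc n)
  show ?case using H_E[OF pw_carrier[OF E v] Suc] by (simp add: pw_Suc algebra_simps)
qed (use c in simp)

lemma H_pwF:
  assumes v: "v \<in> carrier_vec d" and c: "H *\<^sub>v v = c \<cdot>\<^sub>v v"
  shows "H *\<^sub>v pw F n v = (c - 2 * of_nat n) \<cdot>\<^sub>v pw F n v"
proof (induction n)
  case (Suc n)
  show ?case using H_F[OF pw_carrier[OF F v] Suc] by (simp add: pw_Suc algebra_simps)
qed (use c in simp)

text \<open>Moving E past the j+1 factors F leaves behind the weights c, c-2, ..., c-2j, whose sum
  is (j+1)(c-j).\<close>

lemma E_pwF:
  assumes v: "v \<in> carrier_vec d" and c: "H *\<^sub>v v = c \<cdot>\<^sub>v v" and e: "E *\<^sub>v v = 0\<^sub>v d"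
  shows "E *\<^sub>v pw F (Suc j) v = (of_nat (Suc j) * (c - of_nat j)) \<cdot>\<^sub>v pw F j v"
proof (induction j)
  case 0
  show ?case using EF[OF v] e c v mult_mat_zero_vec_sq[OF F] by (simp add: pw_Suc left_zero_vec[of _ d])
next
  case (Suc j)
  let ?w = "pw F (Suc j) v"
  have w: "?w \<in> carrier_vec d" using v by simp
  have "E *\<^sub>v pw F (Suc (Suc j)) v = F *\<^sub>v (E *\<^sub>v ?w) + H *\<^sub>v ?w" using EF[OF w] by (simp add: pw_Suc)
  also have "F *\<^sub>v (E *\<^sub>v ?w) = (of_nat (Suc j) * (c - of_nat j)) \<cdot>\<^sub>v ?w"
    unfolding Suc using mult_mat_vec[OF F pw_carrier[OF F v], of "of_nat (Suc j) * (c - of_nat j)" j] by (simp add: pw_Suc)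
  also have "H *\<^sub>v ?w = (c - 2 * of_nat (Suc j)) \<cdot>\<^sub>v ?w" by (rule H_pwF[OF v c])
  also have "(of_nat (Suc j) * (c - of_nat j)) \<cdot>\<^sub>v ?w + (c - 2 * of_nat (Suc j)) \<cdot>\<^sub>v ?w
      = (of_nat (Suc j) * (c - of_nat j) + (c - 2 * of_nat (Suc j))) \<cdot>\<^sub>v ?w" by (rule add_smult_distrib_vec[symmetric])
  also have "of_nat (Suc j) * (c - of_nat j) + (c - 2 * of_nat (Suc j)) = of_nat (Suc (Suc j)) * (c - of_nat (Suc j))"
    by (simp add: algebra_simps)
  finally show ?case .
qed

text \<open>Iterates \<open>E_pwF\<close>. The product is nonzero exactly when c avoids 0, ..., j-1,
  and this is what makes E^j and F^j mutually inverse up to a scalar on the relevant weight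
  vectors.\<close>

lemma pwE_pwF:
  assumes v: "v \<in> carrier_vec d" and c: "H *\<^sub>v v = c \<cdot>\<^sub>v v" and e: "E *\<^sub>v v = 0\<^sub>v d"
  shows "pw E j (pw F j v) = (\<Prod>t<j. of_nat (Suc t) * (c - of_nat t)) \<cdot>\<^sub>v v"
proof (induction j)
  case (Suc j)
  have "pw E (Suc j) (pw F (Suc j) v) = pw E j (E *\<^sub>v pw F (Suc j) v)" by (rule pw_Suc2)
  also have "\<dots> = (of_nat (Suc j) * (c - of_nat j)) \<cdot>\<^sub>v pw E j (pw F j v)"
    unfolding E_pwF[OF v c e] using v by (intro pw_smult[of _ d]) auto
  finally show ?case unfolding Suc by (simp add: smult_smult_assoc mult.commute)
qed simp

lemma pwE_pwF_0:
  assumes v: "v \<in> carrier_vec d" and c: "H *\<^sub>v v = c \<cdot>\<^sub>v v" and e: "E *\<^sub>v v = 0\<^sub>v d" and "j < i"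
  shows "pw E i (pw F j v) = 0\<^sub>v d"
proof -
  have "pw E i (pw F j v) = pw E (i - j) (pw E j (pw F j v))" using assms(4) by (simp add: pw_plus[symmetric])
  also have "\<dots> = (\<Prod>t<j. of_nat (Suc t) * (c - of_nat t)) \<cdot>\<^sub>v pw E (i - j) v"
    unfolding pwE_pwF[OF v c e] using v by (intro pw_smult[of _ d]) auto
  also have "pw E (i - j) v = 0\<^sub>v d" using assms(4) e by (cases "i - j") (auto simp: pw_Suc2)
  finally show ?thesis by simp
qed

lemma hw_chain:
  assumes v: "v \<in> carrier_vec d" "v \<noteq> 0\<^sub>v d" and c: "H *\<^sub>v v = of_nat k \<cdot>\<^sub>v v" and e: "E *\<^sub>v v = 0\<^sub>v d"
    and z: "pw F (Suc k) v = 0\<^sub>v d"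
  shows "chain d E F H k (\<lambda>j. pw F j v)"
  unfolding chain_def
proof (intro conjI allI impI)
  fix j assume j: "j \<le> k"
  show "H *\<^sub>v pw F j v = of_int (int k - 2 * int j) \<cdot>\<^sub>v pw F j v" using H_pwF[OF v(1) c] by simp
  show "E *\<^sub>v pw F j v = of_nat (j * (k + 1 - j)) \<cdot>\<^sub>v pw F (j - 1) v"
  proof (cases j)
    case 0
    then show ?thesis using e v by (simp add: smult_0_vec[of _ d])
  next
    case (Suc i)
    then have "of_nat (Suc i) * (of_nat k - of_nat i) = (of_nat (j * (k + 1 - j)) :: 'a)"
      using j of_nat_diff[of i k, where 'a='a] by (simp only: of_nat_mult Suc_eq_plus1[symmetric] diff_Suc_Suc)
    then show ?thesis using E_pwF[OF v(1) c e, of i] Suc by simp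
  qed
qed (use v z in \<open>auto simp: pw_Suc\<close>)

section \<open>Standard bases of V(k): leading terms, independence, irreducibility\<close>

context
  fixes k p assumes ch: "chain d E F H k p"
begin

lemma chain_pw: "j \<le> k \<Longrightarrow> p j = pw F j (p 0)"
proof (induction j)
  case (Suc j)
  then show ?case using chainD(5)[OF ch, of j] by (simp add: pw_Suc)
qed simp

lemma chain_hw: "p 0 \<in> carrier_vec d" "H *\<^sub>v p 0 = of_nat k \<cdot>\<^sub>v p 0" "E *\<^sub>v p 0 = 0\<^sub>v d"
  using chainD(1)[OF ch, of 0] chainD(3)[OF ch, of 0] chainD(4)[OF ch, of 0] by (auto simp: smult_0_vec)

text \<open>With J the largest index in the support of v, E^J kills every \<open>p j\<close> with j
  < J and carries \<open>p J\<close> to a multiple of \<open>p 0\<close>, which is nonzero because J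
  is at most k.\<close>

lemma chain_top:
  assumes v: "v \<in> sp d {..k} p" "v \<noteq> 0\<^sub>v d"
  obtains J a where "J \<le> k" "a \<noteq> 0" "pw E J v = a \<cdot>\<^sub>v p 0"
proof -
  obtain c where c: "v = lc d {..k} c p" using v(1) by (rule sp_E)
  have ex: "\<exists>j\<le>k. c j \<noteq> 0"
  proof (rule ccontr)
    assume "\<not> ?thesis"
    then have "v = 0\<^sub>v d" unfolding c by (intro lc_zero) auto
    then show False using v(2) by simp
  qed
  define J where "J = Max {j. j \<le> k \<and> c j \<noteq> 0}"
  have fin: "finite {j. j \<le> k \<and> c j \<noteq> 0}" by simp
  have J: "J \<le> k" "c J \<noteq> 0" using Max_in[OF fin] ex unfolding J_def by blast+
  have gt: "c j = 0" if "j > J" "j \<le> k" for j using Max_ge[OF fin, of j] that unfolding J_def by fastforce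
  have "pw E J v = lc d {..k} c (\<lambda>j. pw E J (p j))"
    unfolding c using chainD(1)[OF ch] by (intro pw_lc) auto
  also have "\<dots> = lc d {..k} (\<lambda>j. if j = J then c J else 0) (\<lambda>j. pw E J (p j))"
  proof -
    have "pw E J (p j) = 0\<^sub>v d" if "j < J" for j
      using pwE_pwF_0[OF chain_hw that] chain_pw[of j] that J by simp
    then show ?thesis using gt J by (intro eq_vecI) (auto intro!: sum.cong simp: linorder_neq_iff)
  qed
  also have "\<dots> = c J \<cdot>\<^sub>v pw E J (p J)" using J chainD(1)[OF ch J(1)] by (subst lc_single[where i = J]) auto
  also have "\<dots> = (c J * (\<Prod>t<J. of_nat (Suc t) * (of_nat k - of_nat t))) \<cdot>\<^sub>v p 0"
    unfolding chain_pw[OF J(1)] pwE_pwF[OF chain_hw] by (simp add: smult_smult_assoc)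
  finally have 1: "pw E J v = (c J * (\<Prod>t<J. of_nat (Suc t) * (of_nat k - of_nat t))) \<cdot>\<^sub>v p 0" .
  have "(\<Prod>t<J. of_nat (Suc t) * (of_nat k - of_nat t) :: 'a) \<noteq> 0"
    using J by (auto simp: prod_zero_iff simp del: of_nat_Suc)
  then show ?thesis using that[OF J(1) _ 1] J(2) by simp
qed

text \<open>The leading index argument of \<open>chain_top\<close> applied to a relation: E^J, with
  J the top index of the relation, leaves a single nonzero term.\<close>

lemma chain_indep: "indep d {..k} p"
proof -
  have nz: "j \<le> k \<Longrightarrow> pw E j (p j) \<noteq> 0\<^sub>v d" for j
  proof
    assume j: "j \<le> k" "pw E j (p j) = 0\<^sub>v d"
    then have "(\<Prod>t<j. of_nat (Suc t) * (of_nat k - of_nat t)) \<cdot>\<^sub>v p 0 = 0\<^sub>v d"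
      using pwE_pwF[OF chain_hw, of j] chain_pw[of j] by simp
    moreover have "(\<Prod>t<j. of_nat (Suc t) * (of_nat k - of_nat t) :: 'a) \<noteq> 0"
      using j by (auto simp: prod_zero_iff simp del: of_nat_Suc)
    ultimately show False using smult_eq_0D chainD(2)[OF ch] by blast
  qed
  have "c j = 0" if "lc d {..k} c p = 0\<^sub>v d" "j \<le> k" for c j
  proof (rule ccontr)
    assume cj: "c j \<noteq> 0"
    have fin: "finite {j. j \<le> k \<and> c j \<noteq> 0}" by simp
    define J where "J = Max {j. j \<le> k \<and> c j \<noteq> 0}"
    have J: "J \<le> k" "c J \<noteq> 0" using Max_in[OF fin] cj that unfolding J_def by blast+
    have gt: "c j = 0" if "j > J" "j \<le> k" for j using Max_ge[OF fin, of j] that unfolding J_def by fastforce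
    have "0\<^sub>v d = pw E J (lc d {..k} c p)" using that by simp
    also have "\<dots> = lc d {..k} c (\<lambda>j. pw E J (p j))"
      using chainD(1)[OF ch] by (intro pw_lc) auto
    also have "\<dots> = lc d {..k} (\<lambda>j. if j = J then c J else 0) (\<lambda>j. pw E J (p j))"
    proof -
      have "pw E J (p j) = 0\<^sub>v d" if "j < J" for j
        using pwE_pwF_0[OF chain_hw that] chain_pw[of j] that J by simp
      then show ?thesis using gt J by (intro eq_vecI) (auto intro!: sum.cong simp: linorder_neq_iff)
    qed
    also have "\<dots> = c J \<cdot>\<^sub>v pw E J (p J)" using J chainD(1)[OF ch J(1)] by (subst lc_single[where i = J]) auto
    finally have "c J \<cdot>\<^sub>v pw E J (p J) = 0\<^sub>v d" by simp
    then show False using smult_eq_0D J nz by blast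
  qed
  then show ?thesis using chainD(1)[OF ch] by (auto simp: indep_def)
qed

text \<open>Irreducibility of V(k): by \<open>chain_top\<close> the stable subspace Y contains
  \<open>p 0\<close>, and F generates the remaining \<open>p j\<close> from it.\<close>

lemma chain_min:
  assumes Y: "subspace d Y" "\<And>v. v \<in> Y \<Longrightarrow> E *\<^sub>v v \<in> Y" "\<And>v. v \<in> Y \<Longrightarrow> F *\<^sub>v v \<in> Y"
    and v: "v \<in> Y" "v \<in> sp d {..k} p" "v \<noteq> 0\<^sub>v d"
  shows "sp d {..k} p \<subseteq> Y"
proof -
  obtain J a where J: "a \<noteq> 0" "pw E J v = a \<cdot>\<^sub>v p 0" using chain_top[OF v(2,3)] by blast
  have "pw E J v \<in> Y" by (rule pw_in) (use Y v in auto)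
  then have p0: "p 0 \<in> Y" using J subspace_smult_cancel[OF Y(1)] by simp
  have "p j \<in> Y" if "j \<le> k" for j unfolding chain_pw[OF that] by (rule pw_in) (use Y p0 in auto)
  then show ?thesis using Y(1) by (intro sp_least) auto
qed

end

section \<open>Weights, highest weight vectors and generation by them\<close>

context
  fixes I :: "'i set" and b w assumes wt: "weights d H I b w"
begin

lemma weight_bound:
  assumes v: "v \<in> carrier_vec d" "v \<noteq> 0\<^sub>v d" "H *\<^sub>v v = of_int \<mu> \<cdot>\<^sub>v v"
  shows "\<mu> \<in> w ` I"
proof (rule ccontr)
  assume \<mu>: "\<mu> \<notin> w ` I"
  have ind: "indep d I b" and Hb: "\<And>i. i \<in> I \<Longrightarrow> H *\<^sub>v b i = of_int (w i) \<cdot>\<^sub>v b i" using wt by (auto simp: weights_def)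
  obtain c where c: "v = lc d I c b" using v wt by (auto simp: weights_def sp_def)
  have "H *\<^sub>v v = lc d I c (\<lambda>i. H *\<^sub>v b i)" unfolding c using indep_carrier[OF ind] by (intro mult_lc) auto
  also have "\<dots> = lc d I c (\<lambda>i. of_int (w i) \<cdot>\<^sub>v b i)" by (rule lc_cong) (auto simp: Hb)
  also have "\<dots> = lc d I (\<lambda>i. c i * of_int (w i)) b" using indep_carrier[OF ind] by (intro lc_smult2) auto
  finally have "lc d I (\<lambda>i. c i * of_int (w i)) b = lc d I (\<lambda>i. of_int \<mu> * c i) b" using v(3) by (simp add: c lc_smult)
  from indep_eqD[OF ind this] have "\<And>i. i \<in> I \<Longrightarrow> c i * (of_int (w i) - of_int \<mu>) = 0" by (simp add: algebra_simps)
  then have "c i = 0" if "i \<in> I" for i using \<mu> that by force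
  then have "v = 0\<^sub>v d" unfolding c by (intro lc_zero) auto
  then show False using v(2) by simp
qed

lemma finite_weights: "finite (w ` I)"
  using wt by (auto simp: weights_def indep_def)

text \<open>Otherwise the nonzero vectors E^n v would realise the infinitely many weights \<mu> +
  2n, whereas every weight occurs among the finitely many \<open>w i\<close>.\<close>

lemma pwE_nilpotent:
  assumes v: "v \<in> carrier_vec d" "H *\<^sub>v v = of_int \<mu> \<cdot>\<^sub>v v"
  shows "\<exists>n. pw E n v = 0\<^sub>v d"
proof (rule ccontr)
  assume n: "\<not> ?thesis"
  have "\<mu> + 2 * int n \<in> w ` I" for n
    using weight_bound[of "pw E n v" "\<mu> + 2 * int n"] n v H_pwE[OF v] by simp
  then have "range (\<lambda>n. \<mu> + 2 * int n) \<subseteq> w ` I" by auto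
  moreover have "infinite (range (\<lambda>n. \<mu> + 2 * int n))" by (subst finite_image_iff) (auto simp: inj_def)
  ultimately show False using finite_weights finite_subset by blast
qed

text \<open>If \<mu> is not a natural number, the factor (j+1)(\<mu> - j) of \<open>E_pwF\<close>
  never vanishes, so no F^j v is zero and infinitely many weights occur.\<close>

lemma hw_nat:
  assumes v: "v \<in> carrier_vec d" "v \<noteq> 0\<^sub>v d" "H *\<^sub>v v = of_int \<mu> \<cdot>\<^sub>v v" "E *\<^sub>v v = 0\<^sub>v d"
  shows "\<exists>k. \<mu> = int k"
proof (rule ccontr)
  assume k: "\<not> ?thesis"
  have nz: "pw F j v \<noteq> 0\<^sub>v d" for j
  proof (induction j)
    case (Suc j)
    have "of_int \<mu> - of_nat j \<noteq> (0::'a)"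
      using k by (metis eq_iff_diff_eq_0 of_int_eq_iff of_int_of_nat_eq)
    then have "of_nat (Suc j) * (of_int \<mu> - of_nat j) \<noteq> (0::'a)" by (simp del: of_nat_Suc)
    then have "E *\<^sub>v pw F (Suc j) v \<noteq> 0\<^sub>v d" using E_pwF[OF v(1,3,4), of j] Suc smult_eq_0D by metis
    then show ?case by auto
  qed (use v in simp)
  have "\<mu> - 2 * int n \<in> w ` I" for n
    using weight_bound[of "pw F n v" "\<mu> - 2 * int n"] nz v H_pwF[OF v(1,3)] by simp
  then have "range (\<lambda>n. \<mu> - 2 * int n) \<subseteq> w ` I" by auto
  moreover have "infinite (range (\<lambda>n. \<mu> - 2 * int n))" by (subst finite_image_iff) (auto simp: inj_def)
  ultimately show False using finite_weights finite_subset by blast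
qed

text \<open>For \<mu> = k the vector F^(k+1) v is again killed by E, since the factor k - k appears,
  and it has the negative weight -k-2. By \<open>hw_nat\<close> it must vanish.\<close>

lemma hw_chain_weights:
  assumes v: "v \<in> carrier_vec d" "v \<noteq> 0\<^sub>v d" "H *\<^sub>v v = of_int \<mu> \<cdot>\<^sub>v v" "E *\<^sub>v v = 0\<^sub>v d"
  obtains k where "\<mu> = int k" "chain d E F H k (\<lambda>j. pw F j v)"
proof -
  obtain k where k: "\<mu> = int k" using hw_nat[OF v] by blast
  have "pw F (Suc k) v = 0\<^sub>v d"
  proof (rule ccontr)
    assume nz: "pw F (Suc k) v \<noteq> 0\<^sub>v d"
    have "E *\<^sub>v pw F (Suc k) v = 0\<^sub>v d" unfolding E_pwF[OF v(1,3,4)] k using v by (simp add: smult_0_vec)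
    moreover have "H *\<^sub>v pw F (Suc k) v = of_int (- int k - 2) \<cdot>\<^sub>v pw F (Suc k) v"
      unfolding H_pwF[OF v(1,3)] k by (simp add: algebra_simps)
    ultimately show False using hw_nat[of "pw F (Suc k) v" "- int k - 2"] nz v by force
  qed
  then show ?thesis using that[OF k] hw_chain[OF v(1,2) _ v(4), of k] v(3) k by simp
qed

lemma weights_swap: "weights d (- H) I b (\<lambda>i. - w i)"
  using wt by (auto simp: weights_def intro!: swap_weight dest: indep_carrier)

text \<open>A subspace stable under H contains the weight components of its vectors, so an inclusion
  may be tested on weight vectors.\<close>

lemma weight_induct:
  assumes S: "subspace d S" "\<And>v. v \<in> S \<Longrightarrow> H *\<^sub>v v \<in> S" and G: "subspace d G"
    and step: "\<And>v \<mu>. v \<in> S \<Longrightarrow> H *\<^sub>v v = of_int \<mu> \<cdot>\<^sub>v v \<Longrightarrow> v \<in> G"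
  shows "S \<subseteq> G"
proof
  have ind: "indep d I b" and fin: "finite I" and Hb: "\<And>i. i \<in> I \<Longrightarrow> H *\<^sub>v b i = of_int (w i) \<cdot>\<^sub>v b i"
    using wt by (auto simp: weights_def indep_def)
  \<comment> \<open>Eigenvectors with distinct eigenvalues whose sum lies in S lie in S themselves:
    applying H - l0 removes one term and multiplies each other term by the nonzero scalar l -
    l0.\<close>
  have split: "\<forall>l\<in>L. y l \<in> S" if "finite L" "\<And>l. l \<in> L \<Longrightarrow> y l \<in> carrier_vec d"
      "\<And>l. l \<in> L \<Longrightarrow> H *\<^sub>v y l = of_int l \<cdot>\<^sub>v y l" "lc d L (\<lambda>_. 1) y \<in> S" for L :: "int set" and y
    using that
  proof (induction L arbitrary: y)
    case (insert l0 L)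
    let ?s = "lc d (insert l0 L) (\<lambda>_. 1) y"
    have "H *\<^sub>v ?s = lc d (insert l0 L) (\<lambda>_. 1) (\<lambda>l. H *\<^sub>v y l)" using insert.prems by (intro mult_lc) auto
    also have "\<dots> = lc d (insert l0 L) (\<lambda>_. 1) (\<lambda>l. of_int l \<cdot>\<^sub>v y l)" using insert.prems by (intro lc_cong) auto
    also have "\<dots> = lc d (insert l0 L) (\<lambda>l. of_int l) y" using insert.prems by (subst lc_smult2) auto
    finally have "H *\<^sub>v ?s + (- of_int l0) \<cdot>\<^sub>v ?s = lc d (insert l0 L) (\<lambda>l. of_int l - of_int l0) y"
      by (simp add: lc_smult lc_add)
    also have "\<dots> = lc d L (\<lambda>l. of_int l - of_int l0) y"
      using insert.hyps by (intro lc_mono[symmetric]) auto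
    also have "\<dots> = lc d L (\<lambda>_. 1) (\<lambda>l. (of_int l - of_int l0) \<cdot>\<^sub>v y l)" using insert.prems by (subst lc_smult2) auto
    finally have "lc d L (\<lambda>_. 1) (\<lambda>l. (of_int l - of_int l0) \<cdot>\<^sub>v y l) \<in> S"
      using subspace_add[OF S(1) S(2)[OF insert.prems(3)] subspace_smult[OF S(1) insert.prems(3)], of "- of_int l0"] by simp
    moreover have "H *\<^sub>v ((of_int l - of_int l0) \<cdot>\<^sub>v y l) = of_int l \<cdot>\<^sub>v ((of_int l - of_int l0) \<cdot>\<^sub>v y l)" if "l \<in> L" for l
      using mult_mat_vec[OF H, of "y l"] insert.prems that by (simp add: smult_smult_assoc mult.commute)
    ultimately have IH: "\<forall>l\<in>L. (of_int l - of_int l0) \<cdot>\<^sub>v y l \<in> S"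
      using insert.prems by (intro insert.IH) auto
    have yL: "y l \<in> S" if "l \<in> L" for l
      using IH that insert.hyps subspace_smult_cancel[OF S(1), of "of_int l - of_int l0" "y l"] by force
    have "?s = y l0 + lc d L (\<lambda>_. 1) y" using insert lc_insert[of L l0 y d "\<lambda>_. 1"] by simp
    then have "y l0 = ?s + (-1) \<cdot>\<^sub>v lc d L (\<lambda>_. 1) y" using insert.prems(1)[of l0] by (intro eq_vecI) (auto dest: carrier_vecD)
    moreover have "lc d L (\<lambda>_. 1) y \<in> S" using insert yL by (intro subspace_lc[OF S(1)]) auto
    ultimately have "y l0 \<in> S" using insert.prems(3) S(1) by (metis subspace_add subspace_smult)
    then show ?case using yL by simp
  qed simp
  fix v assume v: "v \<in> S"
  then obtain c where c: "v = lc d I c b" using wt subspace_carrier[OF S(1) v] by (auto simp: weights_def sp_def)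
  define y where "y l = lc d {i\<in>I. w i = l} c b" for l
  have v_eq: "v = lc d (w ` I) (\<lambda>_. 1) y"
  proof (rule eq_vecI)
    fix r assume "r < dim_vec (lc d (w ` I) (\<lambda>_. 1) y)"
    then show "v $ r = lc d (w ` I) (\<lambda>_. 1) y $ r"
      unfolding c using sum.image_gen[OF fin, of "\<lambda>i. c i * b i $ r" w] by (simp add: y_def)
  qed (simp add: c)
  have Hy: "H *\<^sub>v y l = of_int l \<cdot>\<^sub>v y l" for l
  proof -
    have "H *\<^sub>v y l = lc d {i\<in>I. w i = l} c (\<lambda>i. H *\<^sub>v b i)" unfolding y_def using indep_carrier[OF ind] by (intro mult_lc) auto
    also have "\<dots> = lc d {i\<in>I. w i = l} c (\<lambda>i. of_int l \<cdot>\<^sub>v b i)" by (rule lc_cong) (auto simp: Hb)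
    also have "\<dots> = of_int l \<cdot>\<^sub>v y l" unfolding y_def using indep_carrier[OF ind] by (subst lc_smult2) (auto simp: lc_smult mult.commute)
    finally show ?thesis .
  qed
  have "\<forall>l\<in>w ` I. y l \<in> S"
  proof (intro split finite_weights)
    show "lc d (w ` I) (\<lambda>_. 1) y \<in> S" using v v_eq by simp
  qed (auto simp: Hy, simp add: y_def)
  then have "\<forall>l\<in>w ` I. y l \<in> G" using step Hy by blast
  then show "v \<in> G" unfolding v_eq by (intro subspace_lc[OF G] finite_weights) (auto simp: y_def)
qed

end

text \<open>Induction on the power of E that kills v. If E^(n+1) v = 0, then u = E^n v is a highest
  weight vector, hence in G, and E^n F^n u = \<kappa> u. Subtracting F^n u / \<kappa> from v gives a
  vector of the same weight that is killed already by E^n. Nonnegativity of the weight keeps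
  \<kappa> nonzero.\<close>

lemma hw_generate_nonneg:
  assumes S: "subspace d S" "\<And>v. v \<in> S \<Longrightarrow> E *\<^sub>v v \<in> S" "\<And>v. v \<in> S \<Longrightarrow> F *\<^sub>v v \<in> S"
    and G: "subspace d G" "\<And>v. v \<in> G \<Longrightarrow> F *\<^sub>v v \<in> G"
    and hw: "\<And>v \<mu>. v \<in> S \<Longrightarrow> E *\<^sub>v v = 0\<^sub>v d \<Longrightarrow> H *\<^sub>v v = of_int \<mu> \<cdot>\<^sub>v v \<Longrightarrow> v \<in> G"
    and v: "v \<in> S" "H *\<^sub>v v = of_nat w \<cdot>\<^sub>v v" "pw E n v = 0\<^sub>v d"
  shows "v \<in> G"
  using v
proof (induction n arbitrary: v)
  case 0
  then show ?case using subspace_zero[OF G(1)] by simp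
next
  case (Suc n)
  have vc: "v \<in> carrier_vec d" using subspace_carrier[OF S(1)] Suc by auto
  define u where "u = pw E n v"
  have uS: "u \<in> S" unfolding u_def by (rule pw_in) (use S Suc in auto)
  have uc: "u \<in> carrier_vec d" using vc by (simp add: u_def)
  have Hu: "H *\<^sub>v u = of_int (int (w + 2 * n)) \<cdot>\<^sub>v u" unfolding u_def using H_pwE[OF vc Suc.prems(2)] by simp
  have Eu: "E *\<^sub>v u = 0\<^sub>v d" using Suc.prems(3) by (simp add: u_def pw_Suc)
  have "u \<in> G" by (rule hw[OF uS Eu Hu])
  then have fG: "pw F n u \<in> G" using G by (intro pw_in) auto
  have fS: "pw F n u \<in> S" using S uS by (intro pw_in) auto
  \<comment> \<open>The weight w + 2n of u exceeds every t < n, so no factor of the product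
    vanishes.\<close>
  define \<kappa> :: 'a where "\<kappa> = (\<Prod>t<n. of_nat (Suc t) * (of_int (int (w + 2 * n)) - of_nat t))"
  have "of_int (int (w + 2 * n)) - of_nat t \<noteq> (0::'a)" if "t < n" for t
  proof
    assume "of_int (int (w + 2 * n)) - of_nat t = (0::'a)"
    then have "of_nat (w + 2 * n) = (of_nat t :: 'a)" by simp
    then have "w + 2 * n = t" by (rule of_nat_eq_iff[THEN iffD1])
    then show False using that by simp
  qed
  then have \<kappa>: "\<kappa> \<noteq> 0" unfolding \<kappa>_def by (auto simp: prod_zero_iff simp del: of_nat_Suc)
  have EF: "pw E n (pw F n u) = \<kappa> \<cdot>\<^sub>v u" unfolding \<kappa>_def by (rule pwE_pwF[OF uc Hu Eu])
  define v' where "v' = v + (- inverse \<kappa>) \<cdot>\<^sub>v pw F n u"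
  have "v' \<in> S" unfolding v'_def using S Suc fS by (auto intro: subspace_add subspace_smult)
  moreover have "H *\<^sub>v v' = of_nat w \<cdot>\<^sub>v v'"
  proof -
    have "H *\<^sub>v pw F n u = of_nat w \<cdot>\<^sub>v pw F n u" using H_pwF[OF uc Hu, of n] by simp
    moreover have "H *\<^sub>v v' = H *\<^sub>v v + H *\<^sub>v ((- inverse \<kappa>) \<cdot>\<^sub>v pw F n u)"
      unfolding v'_def using vc uc by (intro mult_add_distrib_mat_vec[OF H]) auto
    moreover have "H *\<^sub>v ((- inverse \<kappa>) \<cdot>\<^sub>v pw F n u) = (- inverse \<kappa>) \<cdot>\<^sub>v (H *\<^sub>v pw F n u)"
      using uc by (intro mult_mat_vec[OF H]) auto
    ultimately show ?thesis unfolding v'_def using Suc.prems(2) vc uc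
      by (simp add: smult_add_distrib_vec[of _ d] smult_smult_assoc mult.commute)
  qed
  moreover have "pw E n v' = 0\<^sub>v d"
  proof -
    have "pw E n v' = pw E n v + pw E n ((- inverse \<kappa>) \<cdot>\<^sub>v pw F n u)" unfolding v'_def using vc uc by (intro pw_add) auto
    also have "pw E n ((- inverse \<kappa>) \<cdot>\<^sub>v pw F n u) = (- inverse \<kappa>) \<cdot>\<^sub>v (\<kappa> \<cdot>\<^sub>v u)" unfolding EF[symmetric] using uc by (intro pw_smult[of _ d]) auto
    also have "pw E n v + \<dots> = 0\<^sub>v d" using \<kappa> uc by (intro eq_vecI) (auto simp: u_def dest: carrier_vecD)
    finally show ?thesis .
  qed
  ultimately have v'G: "v' \<in> G" by (rule Suc.IH)
  have "v = v' + inverse \<kappa> \<cdot>\<^sub>v pw F n u" unfolding v'_def using carrier_vecD[OF vc] carrier_vecD[OF pw_carrier[OF F uc]]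
    by (intro eq_vecI) auto
  then show ?case using v'G fG G(1) by (metis subspace_add subspace_smult)
qed

text \<open>The substitute for complete reducibility. Weight vectors of nonnegative weight are
  covered by \<open>hw_generate_nonneg\<close>; for negative weights the same lemma is used with E
  and F exchanged, which requires the lowest weight vectors of S to lie in G as well.\<close>

lemma hw_generate:
  assumes wt: "weights d H I b w"
    and S: "subspace d S" "\<And>v. v \<in> S \<Longrightarrow> E *\<^sub>v v \<in> S" "\<And>v. v \<in> S \<Longrightarrow> F *\<^sub>v v \<in> S" "\<And>v. v \<in> S \<Longrightarrow> H *\<^sub>v v \<in> S"
    and G: "subspace d G" "\<And>v. v \<in> G \<Longrightarrow> E *\<^sub>v v \<in> G" "\<And>v. v \<in> G \<Longrightarrow> F *\<^sub>v v \<in> G"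
    and hw: "\<And>v \<mu>. v \<in> S \<Longrightarrow> E *\<^sub>v v = 0\<^sub>v d \<Longrightarrow> H *\<^sub>v v = of_int \<mu> \<cdot>\<^sub>v v \<Longrightarrow> v \<in> G"
  shows "S \<subseteq> G"
proof (rule weight_induct[OF wt S(1,4) G(1)])
  fix v \<mu> assume v: "v \<in> S" "H *\<^sub>v v = of_int \<mu> \<cdot>\<^sub>v v"
  have vc: "v \<in> carrier_vec d" using subspace_carrier[OF S(1) v(1)] .
  show "v \<in> G"
  proof (cases "\<mu> \<ge> 0")
    case True
    then obtain k where k: "\<mu> = int k" using nonneg_int_cases by blast
    obtain n where n: "pw E n v = 0\<^sub>v d" using pwE_nilpotent[OF wt vc v(2)] by blast
    show ?thesis by (rule hw_generate_nonneg[OF S(1-3) G(1,3) hw v(1) _ n]) (use v(2) k in simp_all)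
  next
    case False
    interpret s: sl2 d F E "- H" by (rule swap)
    define k where "k = nat (- \<mu>)"
    have k: "\<mu> = - int k" using False by (simp add: k_def)
    note wt' = weights_swap[OF wt]
    have v': "(- H) *\<^sub>v v = of_int (int k) \<cdot>\<^sub>v v" using swap_weight[OF vc v(2)] k by simp
    obtain n where n: "pw F n v = 0\<^sub>v d" using s.pwE_nilpotent[OF wt' vc v'] by blast
    \<comment> \<open>A lowest weight vector g of weight -j is recovered from the highest weight
      vector E^j g, since F^j E^j g is a nonzero multiple of g.\<close>
    have lw: "g \<in> G" if g: "g \<in> S" "F *\<^sub>v g = 0\<^sub>v d" "(- H) *\<^sub>v g = of_int \<nu> \<cdot>\<^sub>v g" for g \<nu>
    proof (cases "g = 0\<^sub>v d")
      case True
      then show ?thesis using subspace_zero[OF G(1)] by simp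
    next
      case nz: False
      have gc: "g \<in> carrier_vec d" using subspace_carrier[OF S(1) g(1)] .
      obtain j where j: "\<nu> = int j" "chain d F E (- H) j (\<lambda>i. pw E i g)"
        by (rule s.hw_chain_weights[OF wt' gc nz g(3,2)])
      define u where "u = pw E j g"
      have Hg: "H *\<^sub>v g = (- of_int \<nu>) \<cdot>\<^sub>v g" using swap_weight'[OF gc g(3)] .
      have "H *\<^sub>v u = of_int (int j) \<cdot>\<^sub>v u" unfolding u_def H_pwE[OF gc Hg] j(1) by simp
      moreover have "E *\<^sub>v u = 0\<^sub>v d" using chainD(6)[OF j(2)] by (simp add: u_def)
      moreover have "u \<in> S" unfolding u_def by (rule pw_in) (use S g in auto)
      ultimately have "u \<in> G" using hw by blast
      then have "pw F j u \<in> G" using G by (intro pw_in) auto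
      moreover have "pw F j u = (\<Prod>t<j. of_nat (Suc t) * (of_int \<nu> - of_nat t)) \<cdot>\<^sub>v g"
        unfolding u_def by (rule s.pwE_pwF[OF gc g(3,2)])
      moreover have "(\<Prod>t<j. of_nat (Suc t) * (of_int \<nu> - of_nat t) :: 'a) \<noteq> 0"
        unfolding j(1) by (auto simp: prod_zero_iff simp del: of_nat_Suc)
      ultimately show ?thesis using subspace_smult_cancel[OF G(1)] by metis
    qed
    show ?thesis by (rule s.hw_generate_nonneg[OF S(1,3,2) G(1,2) lw v(1) _ n]) (use v' in simp_all)
  qed
qed

end

lemma sp_stable:
  assumes "A \<in> carrier_mat d d" "finite I" "\<And>i. i \<in> I \<Longrightarrow> p i \<in> carrier_vec d" "\<And>i. i \<in> I \<Longrightarrow> A *\<^sub>v p i \<in> sp d I p" "v \<in> sp d I p"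
  shows "A *\<^sub>v v \<in> sp d I p"
proof -
  obtain c where c: "v = lc d I c p" using assms(5) by (rule sp_E)
  have "A *\<^sub>v v = lc d I c (\<lambda>i. A *\<^sub>v p i)" unfolding c using assms by (intro mult_lc) auto
  also have "\<dots> \<in> sp d I p" using assms by (intro subspace_lc subspace_sp) auto
  finally show ?thesis .
qed

lemma chain_stable:
  assumes ch: "chain d E F H k p" and c: "E \<in> carrier_mat d d" "F \<in> carrier_mat d d" "H \<in> carrier_mat d d"
    and v: "v \<in> sp d {..k} p"
  shows "E *\<^sub>v v \<in> sp d {..k} p" "F *\<^sub>v v \<in> sp d {..k} p" "H *\<^sub>v v \<in> sp d {..k} p"
proof -
  note s = subspace_smult[OF subspace_sp] and z = subspace_zero[OF subspace_sp]
  have m: "p j \<in> sp d {..k} p" if "j \<le> k" for j using that chainD(1)[OF ch that] by (intro sp_member) auto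
  show "E *\<^sub>v v \<in> sp d {..k} p"
    by (rule sp_stable[OF c(1) _ _ _ v]) (auto simp: chainD[OF ch] intro!: s m)
  show "H *\<^sub>v v \<in> sp d {..k} p"
    by (rule sp_stable[OF c(3) _ _ _ v]) (auto simp: chainD[OF ch] intro!: s m)
  have "F *\<^sub>v p j \<in> sp d {..k} p" if "j \<le> k" for j
    using that chainD(5)[OF ch, of j] chainD(6)[OF ch] z by (cases "j < k") (auto intro!: m)
  then show "F *\<^sub>v v \<in> sp d {..k} p"
    by (intro sp_stable[OF c(2) _ _ _ v]) (auto simp: chainD[OF ch])
qed

section \<open>Recognising V(K) by its weight lines\<close>

context sl2 begin

text \<open>Applying H minus one eigenvalue to a relation removes the corresponding vector, so
  induction on the index set applies.\<close>

lemma indep_weights: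
  assumes "finite I" "\<And>i. i \<in> I \<Longrightarrow> u i \<in> carrier_vec d" "\<And>i. i \<in> I \<Longrightarrow> u i \<noteq> 0\<^sub>v d"
    "\<And>i. i \<in> I \<Longrightarrow> H *\<^sub>v u i = of_int (w i) \<cdot>\<^sub>v u i" "inj_on w I"
  shows "indep d I u"
  using assms
proof (induction I)
  case empty
  then show ?case by (simp add: indep_def)
next
  case (insert i I)
  have I: "indep d I u" using insert by (auto simp: inj_on_insert)
  have "c j = 0" if z: "lc d (insert i I) c u = 0\<^sub>v d" and j: "j \<in> insert i I" for c j
  proof -
    let ?s = "lc d (insert i I) c u"
    have "H *\<^sub>v ?s = lc d (insert i I) c (\<lambda>j. H *\<^sub>v u j)" using insert.prems by (intro mult_lc) auto
    also have "\<dots> = lc d (insert i I) c (\<lambda>j. of_int (w j) \<cdot>\<^sub>v u j)" using insert.prems by (intro lc_cong) auto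
    also have "\<dots> = lc d (insert i I) (\<lambda>j. c j * of_int (w j)) u" using insert.prems by (subst lc_smult2) auto
    finally have "H *\<^sub>v ?s + (- of_int (w i)) \<cdot>\<^sub>v ?s = lc d (insert i I) (\<lambda>j. c j * (of_int (w j) - of_int (w i))) u"
      by (simp add: lc_smult lc_add algebra_simps)
    then have "lc d (insert i I) (\<lambda>j. c j * (of_int (w j) - of_int (w i))) u = 0\<^sub>v d" using z by simp
    moreover have "lc d I (\<lambda>j. c j * (of_int (w j) - of_int (w i))) u = lc d (insert i I) (\<lambda>j. c j * (of_int (w j) - of_int (w i))) u"
      using insert.hyps by (intro lc_mono) auto
    ultimately have *: "c j * (of_int (w j) - of_int (w i)) = 0" if "j \<in> I" for j using indepD[OF I _ that, of "\<lambda>j. c j * (of_int (w j) - of_int (w i))"] by simp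
    have cI: "c j = 0" if "j \<in> I" for j
    proof -
      have "w j \<noteq> w i" using inj_onD[OF insert.prems(4), of j i] that insert.hyps by auto
      then show ?thesis using *[OF that] by simp
    qed
    have "?s = c i \<cdot>\<^sub>v u i" using insert.prems insert.hyps cI by (intro lc_single) auto
    then have "c i = 0" using z smult_eq_0D[of "c i" "u i" d] insert.prems(2)[OF insertI1] by auto
    then show ?thesis using cI j by auto
  qed
  moreover have "u ` insert i I \<subseteq> carrier_vec d" using insert.prems(1) by auto
  ultimately show ?case using insert.hyps(1) by (simp add: indep_def)
qed

text \<open>The \<open>u N\<close> are not assumed to be related by F. But every weight space of S
  is a line or 0, and the weights K+2 and -K-2 do not occur; so \<open>u 0\<close> is a highest
  weight vector with F^(K+1) (u 0) = 0, and F^j (u 0), being nonzero, spans the same line as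
  \<open>u j\<close>.\<close>

lemma weight_line_chain:
  assumes S: "subspace d S" "\<And>v. v \<in> S \<Longrightarrow> E *\<^sub>v v \<in> S" "\<And>v. v \<in> S \<Longrightarrow> F *\<^sub>v v \<in> S"
    and u: "\<And>N. N \<le> K \<Longrightarrow> u N \<in> S" "\<And>N. N \<le> K \<Longrightarrow> u N \<noteq> 0\<^sub>v d"
      "\<And>N. N \<le> K \<Longrightarrow> H *\<^sub>v u N = of_int (int K - 2 * int N) \<cdot>\<^sub>v u N"
    and gen: "\<And>v. v \<in> S \<Longrightarrow> \<exists>t. v = lc d {..K} t u"
  shows "\<exists>p. chain d E F H K p \<and> S = sp d {..K} p"
proof -
  have uc: "u N \<in> carrier_vec d" if "N \<le> K" for N using subspace_carrier[OF S(1) u(1)[OF that]] .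
  have ind: "indep d {..K} u" by (rule indep_weights[where w = "\<lambda>N. int K - 2 * int N"]) (use u uc in \<open>auto simp: inj_on_def\<close>)
  have wt: "\<exists>t. v = lc d {..K} t u \<and> (\<forall>N\<le>K. int K - 2 * int N \<noteq> \<mu> \<longrightarrow> t N = 0)"
    if v: "v \<in> S" "H *\<^sub>v v = of_int \<mu> \<cdot>\<^sub>v v" for v \<mu>
  proof -
    obtain t where t: "v = lc d {..K} t u" using gen v by blast
    have "H *\<^sub>v v = lc d {..K} t (\<lambda>N. H *\<^sub>v u N)" unfolding t using uc by (intro mult_lc) auto
    also have "\<dots> = lc d {..K} t (\<lambda>N. of_int (int K - 2 * int N) \<cdot>\<^sub>v u N)" using u by (intro lc_cong) auto
    also have "\<dots> = lc d {..K} (\<lambda>N. t N * of_int (int K - 2 * int N)) u" using uc by (subst lc_smult2) auto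
    finally have "lc d {..K} (\<lambda>N. t N * of_int (int K - 2 * int N)) u = lc d {..K} (\<lambda>N. of_int \<mu> * t N) u"
      using v(2) by (simp add: t lc_smult)
    from indep_eqD[OF ind this] have e: "\<And>N. N \<le> K \<Longrightarrow> t N * of_int (int K - 2 * int N) = of_int \<mu> * t N" by simp
    have "t N = 0" if "N \<le> K" "int K - 2 * int N \<noteq> \<mu>" for N
    proof (rule ccontr)
      assume "t N \<noteq> 0"
      then have "(of_int (int K - 2 * int N) :: 'a) = of_int \<mu>" using e[OF that(1)] by simp
      then show False using that(2) by (simp only: of_int_eq_iff)
    qed
    then show ?thesis using t by blast
  qed
  have zero: "v = 0\<^sub>v d" if v: "v \<in> S" "H *\<^sub>v v = of_int \<mu> \<cdot>\<^sub>v v" "\<And>N. N \<le> K \<Longrightarrow> int K - 2 * int N \<noteq> \<mu>" for v \<mu>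
  proof -
    obtain t where "v = lc d {..K} t u" "\<forall>N\<le>K. int K - 2 * int N \<noteq> \<mu> \<longrightarrow> t N = 0" using wt[OF v(1,2)] by blast
    then show ?thesis using v(3) by (auto intro!: lc_zero)
  qed
  have H0: "H *\<^sub>v u 0 = of_int (int K) \<cdot>\<^sub>v u 0" using u(3)[of 0] by simp
  have E0: "E *\<^sub>v u 0 = 0\<^sub>v d"
    using H_E[OF uc[of 0] H0] by (intro zero[of _ "int K + 2"] S u) auto
  have pS: "pw F j (u 0) \<in> S" for j using S u by (intro pw_in) auto
  have F0: "pw F (Suc K) (u 0) = 0\<^sub>v d"
    using H_pwF[OF uc[of 0] H0, of "Suc K"] by (intro zero[of _ "int K - 2 * int (Suc K)"] pS) auto
  define p where "p j = pw F j (u 0)" for j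
  have ch: "chain d E F H K p" unfolding p_def by (rule hw_chain) (use uc[of 0] u(2)[of 0] H0 E0 F0 in auto)
  \<comment> \<open>\<open>p j\<close> is nonzero of weight K - 2j, hence a nonzero multiple of
    \<open>u j\<close>, and the scalar can be cancelled.\<close>
  have "u j \<in> sp d {..K} p" if j: "j \<le> K" for j
  proof -
    have "H *\<^sub>v p j = of_int (int K - 2 * int j) \<cdot>\<^sub>v p j" using chainD(3)[OF ch j] .
    then obtain t where t: "p j = lc d {..K} t u" "\<forall>N\<le>K. int K - 2 * int N \<noteq> int K - 2 * int j \<longrightarrow> t N = 0"
      using wt[of "p j"] pS unfolding p_def by blast
    have 1: "p j = t j \<cdot>\<^sub>v u j" unfolding t(1) using j t(2) uc by (intro lc_single) auto
    have "p j \<noteq> 0\<^sub>v d" using indep_nonzero[OF chain_indep[OF ch]] j by simp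
    then have "t j \<noteq> 0" using 1 uc[OF j] by (auto simp: smult_0_vec)
    moreover have "p j \<in> sp d {..K} p" using j chainD(1)[OF ch] by (intro sp_member) auto
    ultimately show ?thesis using 1 subspace_smult_cancel[OF subspace_sp] by metis
  qed
  then have "S \<subseteq> sp d {..K} p" using gen by (auto dest!: gen intro!: subspace_lc subspace_sp uc)
  moreover have "sp d {..K} p \<subseteq> S" using pS by (intro sp_least S) (auto simp: p_def)
  ultimately show ?thesis using ch by blast
qed

end

subsection \<open>Coordinates for isomorphisms with the standard modules\<close>

lemma mult_mat_vec_lc:
  assumes "P \<in> carrier_mat d D" "v \<in> carrier_vec D"
  shows "P *\<^sub>v v = lc d {..<D} (\<lambda>j. v $ j) (col P)"
proof (rule eq_vecI)
  fix r assume "r < dim_vec (lc d {..<D} (\<lambda>j. v $ j) (col P))"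
  then show "(P *\<^sub>v v) $ r = lc d {..<D} (\<lambda>j. v $ j) (col P) $ r"
    using mult_mat_vec_index[OF assms] carrier_matD[OF assms(1)] by (simp add: mult.commute)
qed (use assms in auto)

lemma stdV_carrier [simp]: "stdV k X \<in> carrier_mat (Suc k) (Suc k)"
  by (simp add: stdV_def)

lemma stdVs_carrier [simp]: "stdVs ks X \<in> carrier_mat (sum_list (map Suc ks)) (sum_list (map Suc ks))"
proof (induction ks)
  case (Cons k ks)
  show ?case using four_block_carrier_mat[OF stdV_carrier[of k X] Cons] by simp
qed simp

text \<open>The columns of the embedding P form the family p: injectivity is independence, the image
  is the span, and the intertwining equation is compared column by column.\<close>

lemma sl2_iso_iff:
  fixes \<rho> :: "gen \<Rightarrow> 'a::field_char_0 mat"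
  assumes \<rho>: "\<And>b. \<rho> b \<in> carrier_mat d d"
  defines "D \<equiv> \<lambda>ks. sum_list (map Suc ks)"
  shows "sl2_iso d \<rho> W ks \<longleftrightarrow> (\<exists>p. indep d {..<D ks} p \<and> W = sp d {..<D ks} p \<and>
     (\<forall>X\<in>{GE,GH,GF}. \<forall>j<D ks. \<rho> X *\<^sub>v p j = lc d {..<D ks} (\<lambda>i. stdVs ks X $$ (i,j)) p))"
proof -
  let ?D = "D ks"
  have std: "(stdVs ks X :: 'a mat) \<in> carrier_mat ?D ?D" for X unfolding D_def by simp
  have colm: "col (A * P) j = A *\<^sub>v col P j" if "A \<in> carrier_mat d d'" "P \<in> carrier_mat d' d''" "j < d''" for A P :: "'a mat" and d' d'' j
    using that by (intro eq_vecI) (auto simp: index_mult_mat_vec)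
  have main: "(\<forall>X\<in>{GE,GH,GF}. \<rho> X * P = P * stdVs ks X) \<longleftrightarrow>
      (\<forall>X\<in>{GE,GH,GF}. \<forall>j<?D. \<rho> X *\<^sub>v col P j = lc d {..<?D} (\<lambda>i. stdVs ks X $$ (i,j)) (col P))"
    if P: "P \<in> carrier_mat d ?D" for P
  proof -
    have "\<rho> X * P = P * stdVs ks X \<longleftrightarrow> (\<forall>j<?D. \<rho> X *\<^sub>v col P j = lc d {..<?D} (\<lambda>i. stdVs ks X $$ (i,j)) (col P))" for X
    proof -
      have c: "\<rho> X * P \<in> carrier_mat d ?D" "P * stdVs ks X \<in> carrier_mat d ?D" using \<rho>[of X] P std[of X] by auto
      have "\<rho> X * P = P * stdVs ks X \<longleftrightarrow> (\<forall>j<?D. col (\<rho> X * P) j = col (P * stdVs ks X) j)"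
        using carrier_matD[OF c(1)] carrier_matD[OF c(2)] by (auto intro!: mat_col_eqI simp del: index_mult_mat)
      also have "\<dots> \<longleftrightarrow> (\<forall>j<?D. \<rho> X *\<^sub>v col P j = P *\<^sub>v col (stdVs ks X) j)"
        using colm[OF \<rho> P] colm[OF P std] by auto
      also have "\<dots> \<longleftrightarrow> (\<forall>j<?D. \<rho> X *\<^sub>v col P j = lc d {..<?D} (\<lambda>i. stdVs ks X $$ (i,j)) (col P))"
      proof -
        have "P *\<^sub>v col (stdVs ks X) j = lc d {..<?D} (\<lambda>i. stdVs ks X $$ (i,j)) (col P)" if "j < ?D" for j
        proof -
          have "P *\<^sub>v col (stdVs ks X) j = lc d {..<?D} (\<lambda>i. col (stdVs ks X) j $ i) (col P)"
            using std[of X] that by (intro mult_mat_vec_lc[OF P]) auto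
          also have "\<dots> = lc d {..<?D} (\<lambda>i. stdVs ks X $$ (i,j)) (col P)"
            using std[of X] that by (intro lc_cong) auto
          finally show ?thesis .
        qed
        then show ?thesis by simp
      qed
      finally show ?thesis .
    qed
    then show ?thesis by blast
  qed
  have inj: "(\<forall>v\<in>carrier_vec ?D. P *\<^sub>v v = 0\<^sub>v d \<longrightarrow> v = 0\<^sub>v ?D) \<longleftrightarrow> indep d {..<?D} (col P)"
    if P: "P \<in> carrier_mat d ?D" for P :: "'a mat"
  proof
    assume a: "\<forall>v\<in>carrier_vec ?D. P *\<^sub>v v = 0\<^sub>v d \<longrightarrow> v = 0\<^sub>v ?D"
    have "c i = 0" if z: "lc d {..<?D} c (col P) = 0\<^sub>v d" and i: "i < ?D" for c i
    proof -
      have "P *\<^sub>v vec ?D c = lc d {..<?D} (\<lambda>j. vec ?D c $ j) (col P)" by (intro mult_mat_vec_lc[OF P]) auto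
      also have "\<dots> = lc d {..<?D} c (col P)" by (rule lc_cong) auto
      finally have "vec ?D c = 0\<^sub>v ?D" using a z by simp
      then have "vec ?D c $ i = 0\<^sub>v ?D $ i" by simp
      then show ?thesis using i by simp
    qed
    then show "indep d {..<?D} (col P)" using P by (auto simp: indep_def)
  next
    assume a: "indep d {..<?D} (col P)"
    show "\<forall>v\<in>carrier_vec ?D. P *\<^sub>v v = 0\<^sub>v d \<longrightarrow> v = 0\<^sub>v ?D"
    proof (intro ballI impI)
      fix v :: "'a vec" assume v: "v \<in> carrier_vec ?D" "P *\<^sub>v v = 0\<^sub>v d"
      then have "v $ i = 0" if "i < ?D" for i using indepD[OF a, of "\<lambda>j. v $ j" i] mult_mat_vec_lc[OF P v(1)] that by simp
      then show "v = 0\<^sub>v ?D" using v(1) by (intro eq_vecI) auto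
    qed
  qed
  have img: "(\<lambda>v. P *\<^sub>v v) ` carrier_vec ?D = sp d {..<?D} (col P)" if P: "P \<in> carrier_mat d ?D" for P :: "'a mat"
  proof (intro equalityI subsetI)
    fix x assume "x \<in> sp d {..<?D} (col P)"
    then obtain c where x: "x = lc d {..<?D} c (col P)" by (rule sp_E)
    have "P *\<^sub>v vec ?D c = lc d {..<?D} (\<lambda>j. vec ?D c $ j) (col P)" by (intro mult_mat_vec_lc[OF P]) auto
    also have "\<dots> = x" unfolding x by (rule lc_cong) auto
    finally show "x \<in> (\<lambda>v. P *\<^sub>v v) ` carrier_vec ?D" by (metis imageI vec_carrier)
  next
    fix x assume "x \<in> (\<lambda>v. P *\<^sub>v v) ` carrier_vec ?D"
    then obtain v where "v \<in> carrier_vec ?D" "x = P *\<^sub>v v" by auto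
    then show "x \<in> sp d {..<?D} (col P)" using mult_mat_vec_lc[OF P] by simp
  qed
  show ?thesis
  proof
    assume "sl2_iso d \<rho> W ks"
    then obtain P where P: "P \<in> carrier_mat d ?D" "\<forall>v\<in>carrier_vec ?D. P *\<^sub>v v = 0\<^sub>v d \<longrightarrow> v = 0\<^sub>v ?D"
      "W = (\<lambda>v. P *\<^sub>v v) ` carrier_vec ?D" "\<forall>X\<in>{GE,GH,GF}. \<rho> X * P = P * stdVs ks X"
      unfolding sl2_iso_def Let_def D_def by blast
    show "\<exists>p. indep d {..<D ks} p \<and> W = sp d {..<D ks} p \<and>
     (\<forall>X\<in>{GE,GH,GF}. \<forall>j<D ks. \<rho> X *\<^sub>v p j = lc d {..<D ks} (\<lambda>i. stdVs ks X $$ (i,j)) p)"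
      using P(2-4) inj[OF P(1)] img[OF P(1)] main[OF P(1)] by (intro exI[of _ "col P"]) simp
  next
    assume "\<exists>p. indep d {..<D ks} p \<and> W = sp d {..<D ks} p \<and>
     (\<forall>X\<in>{GE,GH,GF}. \<forall>j<D ks. \<rho> X *\<^sub>v p j = lc d {..<D ks} (\<lambda>i. stdVs ks X $$ (i,j)) p)"
    then obtain p where p: "indep d {..<?D} p" "W = sp d {..<?D} p"
      "\<forall>X\<in>{GE,GH,GF}. \<forall>j<?D. \<rho> X *\<^sub>v p j = lc d {..<?D} (\<lambda>i. stdVs ks X $$ (i,j)) p" by blast
    define P where "P = mat d ?D (\<lambda>(i,j). p j $ i)"
    have P: "P \<in> carrier_mat d ?D" by (simp add: P_def)
    have col: "col P j = p j" if "j < ?D" for j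
      using indep_carrier[OF p(1), of j] that by (intro eq_vecI) (auto simp: P_def dest: carrier_vecD)
    have lcp: "lc d {..<?D} c (col P) = lc d {..<?D} c p" for c by (rule lc_cong) (auto simp: col)
    have "indep d {..<?D} (col P)" using p(1) P unfolding indep_def lcp by auto
    moreover have "W = sp d {..<?D} (col P)" unfolding p(2) sp_def lcp ..
    ultimately have "P \<in> carrier_mat d ?D \<and> (\<forall>v\<in>carrier_vec ?D. P *\<^sub>v v = 0\<^sub>v d \<longrightarrow> v = 0\<^sub>v ?D) \<and>
      W = (\<lambda>v. P *\<^sub>v v) ` carrier_vec ?D \<and> (\<forall>X\<in>{GE,GH,GF}. \<rho> X * P = P * stdVs ks X)"
      unfolding main[OF P] inj[OF P] img[OF P] using p(3) P col lcp by simp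
    then show "sl2_iso d \<rho> W ks" unfolding sl2_iso_def Let_def D_def by blast
  qed
qed

lemma stdVs_single: "stdVs [k] X = stdV k X"
  by (rule eq_matI) (auto simp: stdV_def)

text \<open>For one summand the entries of \<open>stdV\<close> spell out the clauses of
  \<open>chain\<close>, and independence is supplied by \<open>chain_indep\<close>.\<close>

lemma sl2_iso_single:
  fixes \<rho> :: "gen \<Rightarrow> 'a::field_char_0 mat"
  assumes \<rho>: "\<And>b. \<rho> b \<in> carrier_mat d d" and sl: "sl2 d (\<rho> GE) (\<rho> GF) (\<rho> GH)"
  shows "sl2_iso d \<rho> W [k] \<longleftrightarrow> (\<exists>p. chain d (\<rho> GE) (\<rho> GF) (\<rho> GH) k p \<and> W = sp d {..k} p)"
proof -
  interpret sl2 d "\<rho> GE" "\<rho> GF" "\<rho> GH" by (rule sl)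
  have D: "{..<sum_list (map Suc [k])} = {..k}" by auto
  have eq: "(\<forall>X\<in>{GE,GH,GF}. \<forall>j<sum_list (map Suc [k]). \<rho> X *\<^sub>v p j = lc d {..<sum_list (map Suc [k])} (\<lambda>i. stdVs [k] X $$ (i,j)) p)
      \<longleftrightarrow> (\<forall>j\<le>k. \<rho> GH *\<^sub>v p j = of_int (int k - 2 * int j) \<cdot>\<^sub>v p j) \<and>
     (\<forall>j\<le>k. \<rho> GE *\<^sub>v p j = of_nat (j * (k + 1 - j)) \<cdot>\<^sub>v p (j - 1)) \<and>
     (\<forall>j<k. \<rho> GF *\<^sub>v p j = p (j + 1)) \<and> \<rho> GF *\<^sub>v p k = 0\<^sub>v d"
    if p: "\<And>j. j \<le> k \<Longrightarrow> p j \<in> carrier_vec d" for p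
  proof -
    have H: "lc d {..k} (\<lambda>i. stdV k GH $$ (i,j)) p = of_int (int k - 2 * int j) \<cdot>\<^sub>v p j" if "j \<le> k" for j
      using that p by (subst lc_single[where i = j]) (auto simp: stdV_def)
    have E: "lc d {..k} (\<lambda>i. stdV k GE $$ (i,j)) p = of_nat (j * (k + 1 - j)) \<cdot>\<^sub>v p (j - 1)" if "j \<le> k" for j
    proof (cases j)
      case 0
      then show ?thesis using p[of 0] by (subst lc_zero) (auto simp: smult_0_vec stdV_def)
    next
      case (Suc i)
      then show ?thesis using that p by (subst lc_single[where i = i]) (auto simp: stdV_def)
    qed
    have F: "lc d {..k} (\<lambda>i. stdV k GF $$ (i,j)) p = p (j + 1)" if "j < k" for j
      using that p by (subst lc_single[where i = "j + 1"]) (auto simp: stdV_def)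
    have F0: "lc d {..k} (\<lambda>i. stdV k GF $$ (i,k)) p = 0\<^sub>v d" by (rule lc_zero) (auto simp: stdV_def)
    have F': "(\<forall>j\<le>k. \<rho> GF *\<^sub>v p j = lc d {..k} (\<lambda>i. stdV k GF $$ (i,j)) p) \<longleftrightarrow> (\<forall>j<k. \<rho> GF *\<^sub>v p j = p (j + 1)) \<and> \<rho> GF *\<^sub>v p k = 0\<^sub>v d"
      using F F0 by (auto simp: le_less)
    show ?thesis unfolding D stdVs_single using H E F' by (auto simp: less_Suc_eq_le)
  qed
  show ?thesis unfolding sl2_iso_iff[OF \<rho>]
  proof (intro iffI; elim exE)
    fix p assume a: "indep d {..<sum_list (map Suc [k])} p \<and> W = sp d {..<sum_list (map Suc [k])} p \<and>
      (\<forall>X\<in>{GE,GH,GF}. \<forall>j<sum_list (map Suc [k]). \<rho> X *\<^sub>v p j = lc d {..<sum_list (map Suc [k])} (\<lambda>i. stdVs [k] X $$ (i,j)) p)"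
    then have i: "indep d {..k} p" unfolding D by blast
    have c: "\<And>j. j \<le> k \<Longrightarrow> p j \<in> carrier_vec d" using indep_carrier[OF i] by simp
    have "chain d (\<rho> GE) (\<rho> GF) (\<rho> GH) k p" unfolding chain_def using a eq[OF c] c indep_nonzero[OF i, of 0] by auto
    then show "\<exists>p. chain d (\<rho> GE) (\<rho> GF) (\<rho> GH) k p \<and> W = sp d {..k} p" using a unfolding D by blast
  next
    fix p assume a: "chain d (\<rho> GE) (\<rho> GF) (\<rho> GH) k p \<and> W = sp d {..k} p"
    then have ch: "chain d (\<rho> GE) (\<rho> GF) (\<rho> GH) k p" by simp
    have c: "\<And>j. j \<le> k \<Longrightarrow> p j \<in> carrier_vec d" using chainD(1)[OF ch] .
    have e: "(\<forall>j\<le>k. \<rho> GH *\<^sub>v p j = of_int (int k - 2 * int j) \<cdot>\<^sub>v p j) \<and>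
     (\<forall>j\<le>k. \<rho> GE *\<^sub>v p j = of_nat (j * (k + 1 - j)) \<cdot>\<^sub>v p (j - 1)) \<and>
     (\<forall>j<k. \<rho> GF *\<^sub>v p j = p (j + 1)) \<and> \<rho> GF *\<^sub>v p k = 0\<^sub>v d"
      using ch unfolding chain_def by simp
    have "indep d {..<sum_list (map Suc [k])} p" unfolding D by (rule chain_indep[OF ch])
    moreover have "W = sp d {..<sum_list (map Suc [k])} p" unfolding D using a by simp
    ultimately show "\<exists>p. indep d {..<sum_list (map Suc [k])} p \<and> W = sp d {..<sum_list (map Suc [k])} p \<and>
      (\<forall>X\<in>{GE,GH,GF}. \<forall>j<sum_list (map Suc [k]). \<rho> X *\<^sub>v p j = lc d {..<sum_list (map Suc [k])} (\<lambda>i. stdVs [k] X $$ (i,j)) p)"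
      using eq[OF c, THEN iffD2, OF _ e] by blast
  qed
qed

lemma sl2_iso_Nil: "(\<And>b. \<rho> b \<in> carrier_mat d d) \<Longrightarrow> sl2_iso d \<rho> {0\<^sub>v d} []"
  by (simp add: sl2_iso_iff indep_def sp_def)

text \<open>Block diagonal standard modules correspond to concatenated families, the second one
  shifted by k + 1; the trivial intersection makes the concatenation independent.\<close>

lemma sl2_iso_Cons:
  fixes \<rho> :: "gen \<Rightarrow> 'a::field_char_0 mat"
  assumes \<rho>: "\<And>b. \<rho> b \<in> carrier_mat d d"
    and 1: "sl2_iso d \<rho> W1 [k]" and 2: "sl2_iso d \<rho> W2 ks" and int: "W1 \<inter> W2 = {0\<^sub>v d}"
  shows "sl2_iso d \<rho> (ssum W1 W2) (k # ks)"
proof -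
  define D2 where "D2 = sum_list (map Suc ks)"
  obtain p1 where p1: "indep d {..<Suc k} p1" "W1 = sp d {..<Suc k} p1"
     "\<And>X j. X \<in> {GE,GH,GF} \<Longrightarrow> j < Suc k \<Longrightarrow> \<rho> X *\<^sub>v p1 j = lc d {..<Suc k} (\<lambda>i. stdV k X $$ (i,j)) p1"
    using 1 unfolding sl2_iso_iff[OF \<rho>] stdVs_single by auto
  obtain p2 where p2: "indep d {..<D2} p2" "W2 = sp d {..<D2} p2"
     "\<And>X j. X \<in> {GE,GH,GF} \<Longrightarrow> j < D2 \<Longrightarrow> \<rho> X *\<^sub>v p2 j = lc d {..<D2} (\<lambda>i. stdVs ks X $$ (i,j)) p2"
    using 2 unfolding sl2_iso_iff[OF \<rho>] D2_def by auto
  define p where "p j = (if j < Suc k then p1 j else p2 (j - Suc k))" for j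
  define sh where "sh j = Suc k + j" for j
  let ?J = "sh ` {..<D2}"
  have L: "lc d {..<Suc k} c p = lc d {..<Suc k} c p1" for c by (rule lc_cong) (auto simp: p_def)
  have R: "lc d ?J c p = lc d {..<D2} (\<lambda>j. c (sh j)) p2" for c
    using lc_reindex[of sh "{..<D2}" d c p] by (simp add: p_def sh_def inj_on_def)
  have U: "{..<Suc k + D2} = {..<Suc k} \<union> ?J"
  proof (intro equalityI subsetI)
    fix x assume "x \<in> {..<Suc k + D2}"
    then show "x \<in> {..<Suc k} \<union> ?J" by (cases "x < Suc k") (auto simp: sh_def intro!: image_eqI[of _ _ "x - Suc k"])
  qed (auto simp: sh_def)
  have dj: "{..<Suc k} \<inter> ?J = {}" by (auto simp: sh_def)
  have spJ: "sp d ?J p = W2"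
  proof -
    have "lc d {..<D2} c p2 = lc d ?J (\<lambda>j. c (j - Suc k)) p" for c unfolding R by (simp add: sh_def)
    then have "lc d {..<D2} c p2 \<in> sp d ?J p" for c by simp
    then show ?thesis unfolding p2(2) by (auto simp: R elim!: sp_E)
  qed
  have spI: "sp d {..<Suc k} p = W1" unfolding p1(2) sp_def L ..
  have indI: "indep d {..<Suc k} p" using p1(1) unfolding indep_def L by (auto simp: p_def)
  have indJ: "indep d ?J p" unfolding indep_def R
  proof (intro conjI allI impI ballI)
    show "p ` ?J \<subseteq> carrier_vec d" using indep_carrier[OF p2(1)] by (auto simp: p_def sh_def)
    fix c i assume "lc d {..<D2} (\<lambda>j. c (sh j)) p2 = 0\<^sub>v d" "i \<in> ?J"
    then show "c i = 0" using indepD[OF p2(1), of "\<lambda>j. c (sh j)"] by auto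
  qed simp
  have "indep d {..<Suc k + D2} p" unfolding U by (rule indep_Un[OF indI indJ dj]) (simp add: spI spJ int)
  moreover have "ssum W1 W2 = sp d {..<Suc k + D2} p" unfolding U by (subst sp_Un[OF _ _ dj]) (simp_all add: spI spJ)
  moreover have "\<rho> X *\<^sub>v p j = lc d {..<Suc k + D2} (\<lambda>i. stdVs (k # ks) X $$ (i,j)) p" if X: "X \<in> {GE,GH,GF}" and j: "j < Suc k + D2" for X j
  proof -
    have std: "(stdVs ks X :: 'a mat) \<in> carrier_mat D2 D2" unfolding D2_def by simp
    have sum: "lc d {..<Suc k + D2} (\<lambda>i. stdVs (k # ks) X $$ (i,j)) p = lc d {..<Suc k} (\<lambda>i. stdVs (k # ks) X $$ (i,j)) p1
        + lc d {..<D2} (\<lambda>i. stdVs (k # ks) X $$ (sh i,j)) p2"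
      unfolding U by (subst lc_Un[OF _ _ dj]) (simp_all add: L R del: stdVs.simps)
    have ent: "stdVs (k # ks) X $$ (i,j') = (if i < Suc k then if j' < Suc k then stdV k X $$ (i,j') else 0
         else if j' < Suc k then 0 else stdVs ks X $$ (i - Suc k, j' - Suc k) :: 'a)" if "i < Suc k + D2" "j' < Suc k + D2" for i j'
      using that stdV_carrier[of k X, where 'a='a] std by (simp add: D2_def[symmetric] del: stdV_carrier)
    show ?thesis
    proof (cases "j < Suc k")
      case True
      have "lc d {..<Suc k} (\<lambda>i. stdVs (k # ks) X $$ (i,j)) p1 = lc d {..<Suc k} (\<lambda>i. stdV k X $$ (i,j)) p1"
        using True by (intro lc_cong) (simp_all add: ent sh_def del: stdVs.simps)
      moreover have "lc d {..<D2} (\<lambda>i. stdVs (k # ks) X $$ (sh i,j)) p2 = 0\<^sub>v d"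
        using True by (intro lc_zero) (simp_all add: ent sh_def del: stdVs.simps)
      ultimately show ?thesis using p1(3)[OF X True] True unfolding sum by (simp add: p_def)
    next
      case False
      have "lc d {..<Suc k} (\<lambda>i. stdVs (k # ks) X $$ (i,j)) p1 = 0\<^sub>v d"
        using False j by (intro lc_zero) (simp_all add: ent sh_def del: stdVs.simps)
      moreover have "lc d {..<D2} (\<lambda>i. stdVs (k # ks) X $$ (sh i,j)) p2 = lc d {..<D2} (\<lambda>i. stdVs ks X $$ (i,j - Suc k)) p2"
        using False j by (intro lc_cong) (simp_all add: ent sh_def del: stdVs.simps)
      ultimately show ?thesis using p2(3)[OF X, of "j - Suc k"] False j unfolding sum by (simp add: p_def)
    qed
  qed
  ultimately show ?thesis unfolding sl2_iso_iff[OF \<rho>] by (auto simp: D2_def)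
qed

section \<open>Representations of g and their socles\<close>

text \<open>Each bracket of two basis elements is a scalar multiple of a single basis element, so
  one scalar s and one element g suffice to state it.\<close>

definition rel :: "nat \<Rightarrow> (gen \<Rightarrow> 'a::field_char_0 mat) \<Rightarrow> gen \<Rightarrow> gen \<Rightarrow> 'a \<Rightarrow> gen \<Rightarrow> bool" where
  "rel d \<rho> a b s g \<longleftrightarrow> (\<forall>v\<in>carrier_vec d. \<rho> a *\<^sub>v (\<rho> b *\<^sub>v v) = \<rho> b *\<^sub>v (\<rho> a *\<^sub>v v) + s \<cdot>\<^sub>v (\<rho> g *\<^sub>v v))"

text \<open>The relations are written for m in place of 2n-1. At the two ends of V(m) the
  coefficient is 0, so the elements \<open>GX (m + 1)\<close> and \<open>GX (0 - 1)\<close> named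
  there contribute nothing.\<close>

definition g_rep :: "nat \<Rightarrow> nat \<Rightarrow> (gen \<Rightarrow> 'a::field_char_0 mat) \<Rightarrow> bool" where
  "g_rep m d \<rho> \<longleftrightarrow> (\<forall>b. \<rho> b \<in> carrier_mat d d) \<and>
     rel d \<rho> GE GF 1 GH \<and> rel d \<rho> GH GE 2 GE \<and> rel d \<rho> GH GF (-2) GF \<and>
     (\<forall>a\<in>{GE, GF, GH}. rel d \<rho> a GZ 0 GZ) \<and>
     (\<forall>i\<le>m. rel d \<rho> GH (GX i) (of_int (int m - 2 * int i)) (GX i) \<and>
        rel d \<rho> GE (GX i) (of_nat (i * (m + 1 - i))) (GX (i - 1)) \<and>
        rel d \<rho> GF (GX i) (if i < m then 1 else 0) (GX (i + 1)) \<and>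
        rel d \<rho> (GX i) (GX (m - i)) ((-1) ^ i) GZ \<and>
        rel d \<rho> (GX i) GZ 0 GZ)"

lemma lin_rep_single:
  assumes "\<And>c. c \<in> gbasis n \<Longrightarrow> f c = (if c = g then s else 0)" "g \<in> gbasis n \<or> s = 0" "\<rho> g \<in> carrier_mat d d"
  shows "lin_rep n d \<rho> f = s \<cdot>\<^sub>m \<rho> g"
proof (rule eq_matI)
  have fin: "finite (gbasis n)" by (simp add: gbasis_def)
  fix r t assume "r < dim_row (s \<cdot>\<^sub>m \<rho> g)" "t < dim_col (s \<cdot>\<^sub>m \<rho> g)"
  then have rt: "r < d" "t < d" using assms(3) by auto
  have "(\<Sum>b\<in>gbasis n. f b * \<rho> b $$ (r,t)) = (\<Sum>b\<in>gbasis n. if b = g then s * \<rho> g $$ (r,t) else 0)"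
    by (rule sum.cong) (auto simp: assms(1))
  also have "\<dots> = s * \<rho> g $$ (r,t)" using fin assms(2) by auto
  finally show "lin_rep n d \<rho> f $$ (r,t) = (s \<cdot>\<^sub>m \<rho> g) $$ (r,t)" using rt assms(3) by (simp add: lin_rep_def)
qed (use assms(3) in \<open>auto simp: lin_rep_def\<close>)

lemma gmod_rel:
  assumes g: "gmod n d \<rho>" and ab: "a \<in> gbasis n" "b \<in> gbasis n"
    and f: "\<And>c. c \<in> gbasis n \<Longrightarrow> gbr n a b c = (if c = g then s else 0)" "g \<in> gbasis n \<or> s = 0"
  shows "rel d \<rho> a b s g"
  unfolding rel_def
proof
  fix v :: "'a vec" assume v: "v \<in> carrier_vec d"
  have c: "\<rho> x \<in> carrier_mat d d" for x using g by (simp add: gmod_def)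
  have "comm_mat (\<rho> a) (\<rho> b) = s \<cdot>\<^sub>m \<rho> g" using g ab lin_rep_single[of n "gbr n a b" g s \<rho> d] f c by (auto simp: gmod_def)
  then have "(\<rho> a * \<rho> b - \<rho> b * \<rho> a) *\<^sub>v v = (s \<cdot>\<^sub>m \<rho> g) *\<^sub>v v" by (simp add: comm_mat_def)
  moreover have "(\<rho> a * \<rho> b - \<rho> b * \<rho> a) *\<^sub>v v = \<rho> a * \<rho> b *\<^sub>v v - \<rho> b * \<rho> a *\<^sub>v v"
    using c by (intro minus_mult_distrib_mat_vec[OF _ _ v, of _ d] mult_carrier_mat[of _ d d]) auto
  moreover have "\<rho> a * \<rho> b *\<^sub>v v = \<rho> a *\<^sub>v (\<rho> b *\<^sub>v v)" "\<rho> b * \<rho> a *\<^sub>v v = \<rho> b *\<^sub>v (\<rho> a *\<^sub>v v)"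
    using assoc_mult_mat_vec[OF c c v] by auto
  moreover have "(s \<cdot>\<^sub>m \<rho> g) *\<^sub>v v = s \<cdot>\<^sub>v (\<rho> g *\<^sub>v v)"
    using c[of g] v by (intro eq_vecI) (auto simp: index_mult_mat_vec)
  ultimately have e: "\<rho> a *\<^sub>v (\<rho> b *\<^sub>v v) - \<rho> b *\<^sub>v (\<rho> a *\<^sub>v v) = s \<cdot>\<^sub>v (\<rho> g *\<^sub>v v)" by simp
  show "\<rho> a *\<^sub>v (\<rho> b *\<^sub>v v) = \<rho> b *\<^sub>v (\<rho> a *\<^sub>v v) + s \<cdot>\<^sub>v (\<rho> g *\<^sub>v v)"
    unfolding e[symmetric] using carrier_matD(1)[OF c[of a]] carrier_matD(1)[OF c[of b]] by (intro eq_vecI) auto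
qed

lemma gmod_g_rep:
  assumes g: "gmod n d \<rho>" and n: "n \<ge> 1"
  shows "g_rep (2 * n - 1) d \<rho>"
proof -
  have X: "GX i \<in> gbasis n \<longleftrightarrow> i \<le> 2 * n - 1" for i by (auto simp: gbasis_def)
  have o: "GE \<in> gbasis n" "GF \<in> gbasis n" "GH \<in> gbasis n" "GZ \<in> gbasis n" by (auto simp: gbasis_def)
  have m: "2 * n - 1 + 1 = 2 * n" using n by simp
  show ?thesis unfolding g_rep_def m
  proof (intro conjI ballI allI impI)
    show "\<rho> b \<in> carrier_mat d d" for b using g by (simp add: gmod_def)
    fix a assume "a \<in> {GE, GF, GH}"
    then show "rel d \<rho> a GZ 0 GZ" using o by (intro gmod_rel[OF g]) auto
  next
    fix i assume i: "i \<le> 2 * n - 1"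
    show "rel d \<rho> GE (GX i) (of_nat (i * (2 * n - i))) (GX (i - 1))"
      using i o by (intro gmod_rel[OF g]) (auto simp: X)
    show "rel d \<rho> (GX i) (GX (2 * n - 1 - i)) ((-1) ^ i) GZ" using i o by (intro gmod_rel[OF g]) (auto simp: X)
  qed (use o in \<open>auto intro!: gmod_rel[OF g] simp: X\<close>)
qed

lemma g_repD:
  assumes "g_rep m d \<rho>"
  shows "\<rho> b \<in> carrier_mat d d" "sl2 d (\<rho> GE) (\<rho> GF) (\<rho> GH)"
    "a \<in> {GE, GF, GH} \<Longrightarrow> rel d \<rho> a GZ 0 GZ"
    "i \<le> m \<Longrightarrow> rel d \<rho> GH (GX i) (of_int (int m - 2 * int i)) (GX i)"
    "i \<le> m \<Longrightarrow> rel d \<rho> GE (GX i) (of_nat (i * (m + 1 - i))) (GX (i - 1))"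
    "i \<le> m \<Longrightarrow> rel d \<rho> GF (GX i) (if i < m then 1 else 0) (GX (i + 1))"
    "i \<le> m \<Longrightarrow> rel d \<rho> (GX i) (GX (m - i)) ((-1) ^ i) GZ"
    "i \<le> m \<Longrightarrow> rel d \<rho> (GX i) GZ 0 GZ"
  using assms by (auto simp: g_rep_def rel_def sl2_def)

lemma relD: "rel d \<rho> a b s g \<Longrightarrow> v \<in> carrier_vec d \<Longrightarrow> \<rho> a *\<^sub>v (\<rho> b *\<^sub>v v) = \<rho> b *\<^sub>v (\<rho> a *\<^sub>v v) + s \<cdot>\<^sub>v (\<rho> g *\<^sub>v v)"
  by (simp add: rel_def)

definition killed :: "nat \<Rightarrow> nat \<Rightarrow> (gen \<Rightarrow> 'a::field_char_0 mat) \<Rightarrow> 'a vec \<Rightarrow> bool" where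
  "killed m d \<rho> v \<longleftrightarrow> \<rho> GZ *\<^sub>v v = 0\<^sub>v d \<and> (\<forall>i\<le>m. \<rho> (GX i) *\<^sub>v v = 0\<^sub>v d)"

lemma hinv_eq: "hinv n d \<rho> U = {v \<in> U. killed (2 * n - 1) d \<rho> v}"
  by (simp add: hinv_def killed_def)

text \<open>The vectors killed by every product of \<open>t\<close> basis elements of \<open>h\<^sub>n\<close>.\<close>

fun nilp :: "nat \<Rightarrow> nat \<Rightarrow> (gen \<Rightarrow> 'a::field_char_0 mat) \<Rightarrow> nat \<Rightarrow> 'a vec set" where
  "nilp m d \<rho> 0 = {0\<^sub>v d}"
| "nilp m d \<rho> (Suc t) = {v \<in> carrier_vec d. \<rho> GZ *\<^sub>v v \<in> nilp m d \<rho> t \<and> (\<forall>i\<le>m. \<rho> (GX i) *\<^sub>v v \<in> nilp m d \<rho> t)}"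

lemma subspace_preimage:
  assumes "A \<in> carrier_mat d d" "subspace d W" shows "subspace d {v \<in> carrier_vec d. A *\<^sub>v v \<in> W}"
  using assms by (auto simp: subspace_def mult_add_distrib_mat_vec mult_mat_vec)

lemma subspace_INT: "(\<And>W. W \<in> \<W> \<Longrightarrow> subspace d W) \<Longrightarrow> subspace d (carrier_vec d \<inter> \<Inter>\<W>)"
  by (auto simp: subspace_def)

lemma gsubmod_subspace: "gsubmod n d \<rho> U \<Longrightarrow> subspace d U"
  by (simp add: gsubmod_def)

text \<open>The vectors that \<open>\<rho> b\<close> sends into the span form a subspace containing
  every member of the union, hence the whole span.\<close>

lemma gsubmod_vspan:
  assumes c: "\<And>b. \<rho> b \<in> carrier_mat d d" and U: "\<And>U. U \<in> \<U> \<Longrightarrow> gsubmod n d \<rho> U"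
  shows "gsubmod n d \<rho> (vspan d (\<Union>\<U>))"
proof -
  let ?V = "vspan d (\<Union>\<U>)"
  have car: "\<Union>\<U> \<subseteq> carrier_vec d" using U by (auto dest!: gsubmod_subspace subspace_carrier)
  have sV: "subspace d ?V" by (rule subspace_vspan[OF car])
  have "?V \<subseteq> {v \<in> carrier_vec d. \<rho> b *\<^sub>v v \<in> ?V}" if b: "b \<in> gbasis n" for b
  proof (rule vspan_least[OF subspace_preimage[OF c sV]])
    show "\<Union>\<U> \<subseteq> {v \<in> carrier_vec d. \<rho> b *\<^sub>v v \<in> ?V}"
    proof
      fix v assume "v \<in> \<Union>\<U>"
      then obtain U0 where U0: "U0 \<in> \<U>" "v \<in> U0" by auto
      then have "\<rho> b *\<^sub>v v \<in> U0" using U[OF U0(1)] b by (auto simp: gsubmod_def)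
      then have "\<rho> b *\<^sub>v v \<in> ?V" using vspan_superset[of "\<Union>\<U>" d] U0 by auto
      then show "v \<in> {v \<in> carrier_vec d. \<rho> b *\<^sub>v v \<in> ?V}" using car U0 by auto
    qed
  qed
  then show ?thesis using sV by (auto simp: gsubmod_def)
qed

lemma gsubmod_0: "(\<And>b. \<rho> b \<in> carrier_mat d d) \<Longrightarrow> gsubmod n d \<rho> {0\<^sub>v d}"
  by (auto simp: gsubmod_def subspace_0)

lemma gsubmod_soc_rel:
  assumes c: "\<And>b. \<rho> b \<in> carrier_mat d d" and Y: "gsubmod n d \<rho> Y"
  shows "gsubmod n d \<rho> (soc_rel n d \<rho> Y)"
proof -
  have "soc_rel n d \<rho> Y = vspan d (\<Union>(insert Y {X. gcovers n d \<rho> Y X}))" by (simp add: soc_rel_def)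
  also have "gsubmod n d \<rho> \<dots>" using Y by (intro gsubmod_vspan c) (auto simp: gcovers_def)
  finally show ?thesis .
qed

lemma gsubmod_gsoc_i:
  assumes c: "\<And>b. \<rho> b \<in> carrier_mat d d"
  shows "gsubmod n d \<rho> (gsoc_i n d \<rho> i)"
  by (induction i) (auto simp: gsoc_i_def intro!: gsubmod_0 gsubmod_soc_rel c)

lemma gsoc_i_1: "gsoc_i n d \<rho> (Suc 0) = gsoc n d \<rho>"
  by (simp add: gsoc_i_def gsoc_def)

lemma gsubmod_Int: "gsubmod n d \<rho> U \<Longrightarrow> gsubmod n d \<rho> W \<Longrightarrow> gsubmod n d \<rho> (U \<inter> W)"
  by (auto simp: gsubmod_def subspace_Int)

lemma gbasis_cases: "b \<in> gbasis n \<Longrightarrow> (b = GE \<Longrightarrow> P) \<Longrightarrow> (b = GF \<Longrightarrow> P) \<Longrightarrow> (b = GH \<Longrightarrow> P) \<Longrightarrow> (b = GZ \<Longrightarrow> P) \<Longrightarrow>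
   (\<And>i. b = GX i \<Longrightarrow> i \<le> 2 * n - 1 \<Longrightarrow> P) \<Longrightarrow> P"
  by (auto simp: gbasis_def)

text \<open>h_n is an ideal: x(av) = a(xv) - [a,x]v, and both terms vanish when v is killed by
  h_n.\<close>

lemma killed_stable:
  assumes g: "g_rep m d \<rho>" and v: "v \<in> carrier_vec d" "killed m d \<rho> v" and a: "a \<in> {GE, GF, GH}"
  shows "killed m d \<rho> (\<rho> a *\<^sub>v v)"
proof -
  note c = g_repD(1)[OF g]
  have key: "\<rho> b *\<^sub>v (\<rho> a *\<^sub>v v) = 0\<^sub>v d" if r: "rel d \<rho> a b s x" and b: "\<rho> b *\<^sub>v v = 0\<^sub>v d" and x: "s = 0 \<or> \<rho> x *\<^sub>v v = 0\<^sub>v d" for b s x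
  proof -
    have "s \<cdot>\<^sub>v (\<rho> x *\<^sub>v v) = 0\<^sub>v d" using x c[of x] by (auto simp: smult_0_vec)
    then have "0\<^sub>v d = \<rho> b *\<^sub>v (\<rho> a *\<^sub>v v) + 0\<^sub>v d" using relD[OF r v(1)] b c[of a] by simp
    then show ?thesis using c[of b] by (metis mult_mat_vec_sq right_zero_vec)
  qed
  have z: "\<rho> GZ *\<^sub>v v = 0\<^sub>v d" and x: "\<And>i. i \<le> m \<Longrightarrow> \<rho> (GX i) *\<^sub>v v = 0\<^sub>v d" using v(2) by (auto simp: killed_def)
  have "\<rho> GZ *\<^sub>v (\<rho> a *\<^sub>v v) = 0\<^sub>v d" by (rule key[OF g_repD(3)[OF g a] z]) simp
  moreover have "\<rho> (GX i) *\<^sub>v (\<rho> a *\<^sub>v v) = 0\<^sub>v d" if i: "i \<le> m" for i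
    using a key[OF _ x[OF i]] g_repD(4-6)[OF g i] x[of "i - 1"] x[of "i + 1"] x[OF i] i by (cases "i < m") auto
  ultimately show ?thesis by (simp add: killed_def)
qed

text \<open>In a minimal submodule take a nonzero vector of least nilpotency order: h_n sends it to
  vectors of smaller order in the same submodule, that is to 0, so the submodule meets the
  invariants and, being minimal, lies in them. Conversely an invariant highest weight vector
  generates a copy of V(k) on which h_n acts by 0; this is a minimal submodule, and by
  \<open>hw_generate\<close> such vectors account for all invariants.\<close>

lemma gsoc_eq_hinv:
  fixes \<rho> :: "gen \<Rightarrow> 'a::field_char_0 mat"
  assumes g: "g_rep (2 * n - 1) d \<rho>" and wt: "weights d (\<rho> GH) I b w" and nil: "carrier_vec d \<subseteq> nilp (2 * n - 1) d \<rho> T"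
  shows "gsoc n d \<rho> = hinv n d \<rho> (carrier_vec d)"
proof -
  let ?m = "2 * n - 1"
  note c = g_repD(1)[OF g]
  interpret sl2 d "\<rho> GE" "\<rho> GF" "\<rho> GH" by (rule g_repD(2)[OF g])
  define S where "S = hinv n d \<rho> (carrier_vec d)"
  have S_eq: "S = carrier_vec d \<inter> \<Inter>((\<lambda>a. {v \<in> carrier_vec d. \<rho> a *\<^sub>v v \<in> {0\<^sub>v d}}) ` insert GZ (GX ` {..?m}))"
    unfolding S_def hinv_def by auto
  have sS: "subspace d S" unfolding S_eq
    by (rule subspace_INT) (use subspace_preimage[OF c subspace_0] in \<open>simp only: image_iff, blast\<close>)
  have Sk: "v \<in> S \<longleftrightarrow> v \<in> carrier_vec d \<and> killed ?m d \<rho> v" for v by (simp add: S_def hinv_eq)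
  have st: "\<rho> a *\<^sub>v v \<in> S" if "a \<in> {GE, GF, GH}" "v \<in> S" for a v
    using killed_stable[OF g _ _ that(1)] that(2) c[of a] by (auto simp: Sk)
  have gS: "gsubmod n d \<rho> S" unfolding gsubmod_def
  proof (intro conjI ballI sS)
    fix b v assume b: "b \<in> gbasis n" and v: "v \<in> S"
    have 0: "0\<^sub>v d \<in> S" using subspace_zero[OF sS] .
    show "\<rho> b *\<^sub>v v \<in> S" by (rule gbasis_cases[OF b]) (use v st 0 in \<open>auto simp: Sk killed_def\<close>)
  qed
  have 1: "gsoc n d \<rho> \<subseteq> S"
    unfolding gsoc_def soc_rel_def
  proof (rule vspan_least[OF sS], intro Un_least subsetI)
    fix v assume "v \<in> \<Union> {X. gcovers n d \<rho> {0\<^sub>v d} X}"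
    then obtain X where X: "gcovers n d \<rho> {0\<^sub>v d} X" "v \<in> X" by auto
    then have gX: "gsubmod n d \<rho> X" and X0: "{0\<^sub>v d} \<subset> X" by (auto simp: gcovers_def)
    have ex: "\<exists>t. \<exists>u\<in>X. u \<noteq> 0\<^sub>v d \<and> u \<in> nilp ?m d \<rho> t"
      using X0 nil subspace_carrier[OF gsubmod_subspace[OF gX]] by blast
    define t where "t = (LEAST t. \<exists>u\<in>X. u \<noteq> 0\<^sub>v d \<and> u \<in> nilp ?m d \<rho> t)"
    obtain u where u: "u \<in> X" "u \<noteq> 0\<^sub>v d" "u \<in> nilp ?m d \<rho> t" using LeastI_ex[OF ex] unfolding t_def by blast
    have lt: "y = 0\<^sub>v d" if "y \<in> X" "y \<in> nilp ?m d \<rho> s" "s < t" for y s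
      using not_less_Least[of s "\<lambda>t. \<exists>u\<in>X. u \<noteq> 0\<^sub>v d \<and> u \<in> nilp ?m d \<rho> t"] that unfolding t_def by blast
    obtain s where s: "t = Suc s" using u(2,3) by (cases t) auto
    have "u \<in> S"
    proof -
      have "\<rho> b *\<^sub>v u \<in> X" if "b \<in> gbasis n" for b using gX u(1) that by (auto simp: gsubmod_def)
      then have "\<rho> GZ *\<^sub>v u \<in> X" "\<And>i. i \<le> ?m \<Longrightarrow> \<rho> (GX i) *\<^sub>v u \<in> X" by (auto simp: gbasis_def)
      then show ?thesis using u(3) lt s by (auto simp: Sk killed_def)
    qed
    then have ne: "{0\<^sub>v d} \<subset> X \<inter> S" using u subspace_zero[OF sS] X0 by blast
    have "X \<inter> S = X" using X(1) gsubmod_Int[OF gX gS] ne unfolding gcovers_def by blast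
    then show "v \<in> S" using X(2) by blast
  qed (use subspace_zero[OF sS] in simp)
  have gG: "gsubmod n d \<rho> (gsoc n d \<rho>)" unfolding gsoc_def by (intro gsubmod_soc_rel gsubmod_0 c)
  have Gst: "\<rho> a *\<^sub>v v \<in> gsoc n d \<rho>" if "a \<in> gbasis n" "v \<in> gsoc n d \<rho>" for a v using gG that by (auto simp: gsubmod_def)
  have bas: "GE \<in> gbasis n" "GF \<in> gbasis n" "GH \<in> gbasis n" by (auto simp: gbasis_def)
  have 2: "S \<subseteq> gsoc n d \<rho>"
  proof (rule hw_generate[OF wt sS _ _ _ gsubmod_subspace[OF gG]])
    fix v and \<mu> :: int assume v: "v \<in> S" "\<rho> GE *\<^sub>v v = 0\<^sub>v d" "\<rho> GH *\<^sub>v v = of_int \<mu> \<cdot>\<^sub>v v"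
    show "v \<in> gsoc n d \<rho>"
    proof (cases "v = 0\<^sub>v d")
      case True
      then show ?thesis using subspace_zero[OF gsubmod_subspace[OF gG]] by simp
    next
      case False
      have vc: "v \<in> carrier_vec d" using subspace_carrier[OF sS v(1)] .
      obtain k where ch: "chain d (\<rho> GE) (\<rho> GF) (\<rho> GH) k (\<lambda>j. pw (\<rho> GF) j v)"
        using hw_chain_weights[OF wt vc False v(3,2)] by blast
      let ?X = "sp d {..k} (\<lambda>j. pw (\<rho> GF) j v)"
      have XS: "?X \<subseteq> S" using v(1) st by (intro sp_least[OF sS]) (auto intro!: pw_in)
      have vX: "v \<in> ?X" using sp_member[of "{..k}" 0 "\<lambda>j. pw (\<rho> GF) j v" d] vc by simp
      have gX: "gsubmod n d \<rho> ?X" unfolding gsubmod_def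
      proof (intro conjI ballI subspace_sp)
        fix b u assume b: "b \<in> gbasis n" and u: "u \<in> ?X"
        note s = chain_stable[OF ch c c c u] and k = subsetD[OF XS u, unfolded Sk killed_def]
        show "\<rho> b *\<^sub>v u \<in> ?X" by (rule gbasis_cases[OF b]) (use s k subspace_zero[OF subspace_sp[of d]] in auto)
      qed
      have "gcovers n d \<rho> {0\<^sub>v d} ?X" unfolding gcovers_def
      proof (intro conjI gsubmod_0 gX c notI)
        show "{0\<^sub>v d} \<subset> ?X" using vX False subspace_zero[OF subspace_sp[of d]] by blast
        assume "\<exists>Y. gsubmod n d \<rho> Y \<and> {0\<^sub>v d} \<subset> Y \<and> Y \<subset> ?X"
        then obtain Y where Y: "gsubmod n d \<rho> Y" "{0\<^sub>v d} \<subset> Y" "Y \<subset> ?X" by blast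
        obtain u where u: "u \<in> Y" "u \<noteq> 0\<^sub>v d" using Y(2) by blast
        have "?X \<subseteq> Y" using Y bas u by (intro chain_min[OF ch gsubmod_subspace[OF Y(1)] _ _ u(1) _ u(2)]) (auto simp: gsubmod_def)
        then show False using Y(3) by blast
      qed
      then have "?X \<subseteq> {0\<^sub>v d} \<union> \<Union>{X. gcovers n d \<rho> {0\<^sub>v d} X}" by auto
      then have "?X \<subseteq> gsoc n d \<rho>" unfolding gsoc_def soc_rel_def by (rule subset_trans[OF _ vspan_superset])
      then show ?thesis using vX by blast
    qed
  qed (use st Gst bas in auto)
  show ?thesis using 1 2 unfolding S_def by blast
qed

lemma subspace_nilp: "g_rep m d \<rho> \<Longrightarrow> subspace d (nilp m d \<rho> t)"
proof (induction t)
  case (Suc t)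
  note c = g_repD(1)[OF Suc.prems]
  have "nilp m d \<rho> (Suc t) = carrier_vec d \<inter> \<Inter>((\<lambda>a. {v \<in> carrier_vec d. \<rho> a *\<^sub>v v \<in> nilp m d \<rho> t}) ` insert GZ (GX ` {..m}))"
    by auto
  then show ?case using Suc by (simp only:) (rule subspace_INT, auto intro!: subspace_preimage c)
qed (simp add: subspace_0)

section \<open>Tensor products\<close>

lemma div_mod_less:
  assumes "k < d1 * (d2::nat)" shows "k div d2 < d1" "k mod d2 < d2"
proof -
  have "d2 > 0" using assms by (cases d2) auto
  then show "k div d2 < d1" "k mod d2 < d2" using assms by (auto simp: less_mult_imp_div_less)
qed

lemma kron_carrier [simp]: "u \<in> carrier_vec d1 \<Longrightarrow> w \<in> carrier_vec d2 \<Longrightarrow> kron_vec u w \<in> carrier_vec (d1 * d2)"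
  by (metis carrier_vecD kron_vec_def vec_carrier)

lemma kron_index: "u \<in> carrier_vec d1 \<Longrightarrow> w \<in> carrier_vec d2 \<Longrightarrow> k < d1 * d2 \<Longrightarrow>
    kron_vec u w $ k = u $ (k div d2) * w $ (k mod d2)"
  using carrier_vecD[of u d1] carrier_vecD[of w d2] by (simp add: kron_vec_def)

lemma kron_index_pair: "u \<in> carrier_vec d1 \<Longrightarrow> w \<in> carrier_vec d2 \<Longrightarrow> r < d1 \<Longrightarrow> s < d2 \<Longrightarrow>
    kron_vec u w $ (r * d2 + s) = u $ r * w $ s"
proof -
  assume a: "u \<in> carrier_vec d1" "w \<in> carrier_vec d2" "r < d1" "s < d2"
  have "r * d2 + s < Suc r * d2" using a(4) by simp
  also have "\<dots> \<le> d1 * d2" using a(3) by (intro mult_le_mono1) simp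
  finally show ?thesis using a by (simp add: kron_index)
qed

lemma pair_less: "r < d1 \<Longrightarrow> s < d2 \<Longrightarrow> r * d2 + s < d1 * (d2::nat)"
proof -
  assume a: "r < d1" "s < d2"
  have "r * d2 + s < Suc r * d2" using a by simp
  also have "\<dots> \<le> d1 * d2" using a by (intro mult_le_mono1) simp
  finally show ?thesis .
qed

lemma sum_pair: "(\<Sum>k<d1 * d2. f k) = (\<Sum>r<d1. \<Sum>s<d2. f (r * d2 + s :: nat))"
proof -
  have "(\<Sum>s<d2. f (r * d2 + s)) = sum f {r * d2..<r * d2 + d2}" for r
    by (rule sum.reindex_bij_witness[where i = "\<lambda>k. k - r * d2" and j = "\<lambda>s. r * d2 + s"]) auto
  then show ?thesis by (simp add: sum.nat_group)
qed

lemma kron_mat_carrier [simp]: "A \<in> carrier_mat n1 n2 \<Longrightarrow> B \<in> carrier_mat m1 m2 \<Longrightarrow> kron_mat A B \<in> carrier_mat (n1 * m1) (n2 * m2)"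
  by (auto simp: kron_mat_def)

text \<open>Entry indices are read as r * d2 + s with s < d2, so the sum over (r, s) is a product of
  two sums.\<close>

lemma kron_mat_vec:
  assumes A: "A \<in> carrier_mat d1 d1" and B: "B \<in> carrier_mat d2 d2" and u: "u \<in> carrier_vec d1" and w: "w \<in> carrier_vec d2"
  shows "kron_mat A B *\<^sub>v kron_vec u w = kron_vec (A *\<^sub>v u) (B *\<^sub>v (w :: 'a::field vec))"
proof (rule eq_vecI)
  have AB: "kron_mat A B \<in> carrier_mat (d1 * d2) (d1 * d2)" using A B by simp
  have AuBw: "A *\<^sub>v u \<in> carrier_vec d1" "B *\<^sub>v w \<in> carrier_vec d2" using A B by auto
  fix k assume "k < dim_vec (kron_vec (A *\<^sub>v u) (B *\<^sub>v w))"
  then have k: "k < d1 * d2" using carrier_vecD[OF kron_carrier[OF AuBw]] by simp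
  note dm = div_mod_less[OF k]
  have "(kron_mat A B *\<^sub>v kron_vec u w) $ k = (\<Sum>t<d1*d2. kron_mat A B $$ (k,t) * kron_vec u w $ t)"
    using u w by (intro mult_mat_vec_index[OF AB _ k]) simp
  also have "\<dots> = (\<Sum>r<d1. \<Sum>s<d2. kron_mat A B $$ (k,r*d2+s) * kron_vec u w $ (r*d2+s))" by (rule sum_pair)
  also have "\<dots> = (\<Sum>r<d1. \<Sum>s<d2. (A $$ (k div d2,r) * u $ r) * (B $$ (k mod d2,s) * w $ s))"
    using carrier_matD[OF A] carrier_matD[OF B] k by (intro sum.cong refl) (simp add: kron_index_pair[OF u w] kron_mat_def pair_less)
  also have "\<dots> = (\<Sum>r<d1. A $$ (k div d2,r) * u $ r) * (\<Sum>s<d2. B $$ (k mod d2,s) * w $ s)" by (simp add: sum_product)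
  also have "\<dots> = kron_vec (A *\<^sub>v u) (B *\<^sub>v w) $ k"
    by (simp add: kron_index[OF AuBw k] mult_mat_vec_index[OF A u dm(1)] mult_mat_vec_index[OF B w dm(2)])
  finally show "(kron_mat A B *\<^sub>v kron_vec u w) $ k = kron_vec (A *\<^sub>v u) (B *\<^sub>v w) $ k" .
qed (use A B in \<open>auto simp: kron_vec_def kron_mat_def\<close>)

lemma tens_carrier: "(\<And>b. \<rho>1 b \<in> carrier_mat d1 d1) \<Longrightarrow> (\<And>b. \<rho>2 b \<in> carrier_mat d2 d2) \<Longrightarrow> tens_rep d1 \<rho>1 d2 \<rho>2 b \<in> carrier_mat (d1 * d2) (d1 * d2)"
  by (simp add: tens_rep_def)

lemma tens_kron:
  assumes "\<And>b. \<rho>1 b \<in> carrier_mat d1 d1" "\<And>b. \<rho>2 b \<in> carrier_mat d2 d2" "u \<in> carrier_vec d1" "w \<in> carrier_vec d2"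
  shows "tens_rep d1 \<rho>1 d2 \<rho>2 b *\<^sub>v kron_vec u w = kron_vec (\<rho>1 b *\<^sub>v u) w + kron_vec u (\<rho>2 b *\<^sub>v w)"
proof -
  have "tens_rep d1 \<rho>1 d2 \<rho>2 b *\<^sub>v kron_vec u w = kron_mat (\<rho>1 b) (1\<^sub>m d2) *\<^sub>v kron_vec u w + kron_mat (1\<^sub>m d1) (\<rho>2 b) *\<^sub>v kron_vec u w"
    unfolding tens_rep_def using assms by (intro add_mult_distrib_mat_vec[of _ "d1*d2" "d1*d2"]) auto
  then show ?thesis using assms(3,4)
    by (simp add: kron_mat_vec[OF assms(1) one_carrier_mat assms(3,4)] kron_mat_vec[OF one_carrier_mat assms(2-4)])
qed

lemma kron_lc:
  assumes "\<And>i. i \<in> I \<Longrightarrow> p i \<in> carrier_vec d1" "\<And>j. j \<in> J \<Longrightarrow> q j \<in> carrier_vec d2"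
  shows "kron_vec (lc d1 I c p) (lc d2 J e q) = lc (d1 * d2) (I \<times> J) (\<lambda>(i,j). c i * e j) (\<lambda>(i,j). kron_vec (p i) (q j))"
proof (rule eq_vecI)
  fix k assume "k < dim_vec (lc (d1 * d2) (I \<times> J) (\<lambda>(i,j). c i * e j) (\<lambda>(i,j). kron_vec (p i) (q j)))"
  then have k: "k < d1 * d2" by simp
  note dm = div_mod_less[OF k]
  have "kron_vec (lc d1 I c p) (lc d2 J e q) $ k = (\<Sum>i\<in>I. c i * p i $ (k div d2)) * (\<Sum>j\<in>J. e j * q j $ (k mod d2))"
    using dm by (simp add: kron_index[OF lc_carrier lc_carrier k])
  also have "\<dots> = (\<Sum>i\<in>I. \<Sum>j\<in>J. c i * e j * kron_vec (p i) (q j) $ k)"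
    unfolding sum_product using assms by (intro sum.cong refl) (simp add: kron_index[OF _ _ k])
  also have "\<dots> = (\<Sum>ij\<in>I \<times> J. (case ij of (i,j) \<Rightarrow> c i * e j) * (case ij of (i,j) \<Rightarrow> kron_vec (p i) (q j)) $ k)"
    by (simp add: sum.cartesian_product case_prod_unfold)
  finally show "kron_vec (lc d1 I c p) (lc d2 J e q) $ k = lc (d1 * d2) (I \<times> J) (\<lambda>(i,j). c i * e j) (\<lambda>(i,j). kron_vec (p i) (q j)) $ k"
    using k by simp
qed (simp add: kron_vec_def)

text \<open>Reading the entries r * d2 + s for a fixed s gives a relation among the
  \<open>p i\<close>, whose coefficients are the entries at s of combinations of the
  \<open>q j\<close>. These coefficients vanish for all s, so independence of q finishes the
  argument.\<close>

lemma kron_indep: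
  fixes p :: "'i \<Rightarrow> 'a::field vec"
  assumes p: "indep d1 I p" and q: "indep d2 J q"
  shows "indep (d1 * d2) (I \<times> J) (\<lambda>(i,j). kron_vec (p i) (q j))"
proof -
  have "c (i,j) = 0" if z: "lc (d1 * d2) (I \<times> J) c (\<lambda>(i,j). kron_vec (p i) (q j)) = 0\<^sub>v (d1 * d2)" and ij: "i \<in> I" "j \<in> J" for c i j
  proof -
    have "(\<Sum>j\<in>J. c (i,j) * q j $ s) = 0" if i: "i \<in> I" and s: "s < d2" for i s
    proof -
      have "lc d1 I (\<lambda>i. \<Sum>j\<in>J. c (i,j) * q j $ s) p = 0\<^sub>v d1"
      proof (rule eq_vecI)
        fix r assume "r < dim_vec (0\<^sub>v d1 :: 'a vec)"
        then have r: "r < d1" by simp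
        have "0 = lc (d1 * d2) (I \<times> J) c (\<lambda>(i,j). kron_vec (p i) (q j)) $ (r * d2 + s)"
          unfolding z using pair_less[OF r s] by simp
        also have "\<dots> = (\<Sum>i\<in>I. \<Sum>j\<in>J. c (i,j) * (kron_vec (p i) (q j) $ (r * d2 + s)))"
          using pair_less[OF r s] by (simp add: sum.cartesian_product case_prod_unfold)
        also have "\<dots> = (\<Sum>i\<in>I. \<Sum>j\<in>J. c (i,j) * (p i $ r * q j $ s))"
          using kron_index_pair[OF indep_carrier[OF p] indep_carrier[OF q] r s] by (intro sum.cong refl) simp
        also have "\<dots> = lc d1 I (\<lambda>i. \<Sum>j\<in>J. c (i,j) * q j $ s) p $ r"
          using r by (simp add: sum_distrib_left mult_ac)
        finally show "lc d1 I (\<lambda>i. \<Sum>j\<in>J. c (i,j) * q j $ s) p $ r = 0\<^sub>v d1 $ r" using r by simp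
      qed simp
      from indepD[OF p this i] show ?thesis .
    qed
    then have "lc d2 J (\<lambda>j. c (i,j)) q = 0\<^sub>v d2" using ij by (intro eq_vecI) auto
    from indepD[OF q this ij(2)] show ?thesis .
  qed
  then show ?thesis using indep_finite[OF p] indep_finite[OF q] indep_carrier[OF p] indep_carrier[OF q]
    unfolding indep_def by auto
qed

lemma unit_span: "v \<in> carrier_vec d \<Longrightarrow> v = lc d {..<d} (\<lambda>i. v $ i) (unit_vec d)"
  by (rule eq_vecI) (auto simp: unit_vec_def if_distrib cong: if_cong)

text \<open>The tensors of unit vectors are the unit vectors of the product space, and by
  bilinearity they lie in the span.\<close>

lemma kron_span:
  fixes p :: "'i \<Rightarrow> 'a::field vec"
  assumes p: "sp d1 I p = carrier_vec d1" "finite I" "\<And>i. i \<in> I \<Longrightarrow> p i \<in> carrier_vec d1"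
    and q: "sp d2 J q = carrier_vec d2" "finite J" "\<And>j. j \<in> J \<Longrightarrow> q j \<in> carrier_vec d2"
  shows "sp (d1 * d2) (I \<times> J) (\<lambda>(i,j). kron_vec (p i) (q j)) = carrier_vec (d1 * d2)"
proof (intro equalityI subsetI)
  fix v :: "'a vec" assume v: "v \<in> carrier_vec (d1 * d2)"
  have k: "kron_vec (unit_vec d1 r) (unit_vec d2 s) \<in> sp (d1 * d2) (I \<times> J) (\<lambda>(i,j). kron_vec (p i) (q j))" for r s
  proof -
    have "unit_vec d1 r \<in> sp d1 I p" "unit_vec d2 s \<in> sp d2 J q" using p(1) q(1) by auto
    then obtain c e where "unit_vec d1 r = lc d1 I c p" "unit_vec d2 s = lc d2 J e q" by (auto simp: sp_def)
    then show ?thesis using kron_lc[of I p d1 J q d2 c e] p(3) q(3) by simp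
  qed
  have "v = lc (d1 * d2) ({..<d1} \<times> {..<d2}) (\<lambda>(r,s). v $ (r * d2 + s)) (\<lambda>(r,s). kron_vec (unit_vec d1 r) (unit_vec d2 s))"
  proof (rule eq_vecI)
    fix t assume "t < dim_vec (lc (d1 * d2) ({..<d1} \<times> {..<d2}) (\<lambda>(r,s). v $ (r * d2 + s)) (\<lambda>(r,s). kron_vec (unit_vec d1 r) (unit_vec d2 s)))"
    then have t: "t < d1 * d2" by simp
    note dm = div_mod_less[OF t]
    have "(\<Sum>rs\<in>{..<d1} \<times> {..<d2}. (case rs of (r,s) \<Rightarrow> v $ (r * d2 + s)) * (case rs of (r,s) \<Rightarrow> kron_vec (unit_vec d1 r) (unit_vec d2 s)) $ t)
      = (\<Sum>rs\<in>{..<d1} \<times> {..<d2}. if rs = (t div d2, t mod d2) then v $ t else 0)"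
      using t dm by (intro sum.cong refl) (auto simp: kron_index[of _ d1 _ d2] unit_vec_def split: if_splits)
    also have "\<dots> = v $ t" using dm by simp
    finally show "v $ t = lc (d1 * d2) ({..<d1} \<times> {..<d2}) (\<lambda>(r,s). v $ (r * d2 + s)) (\<lambda>(r,s). kron_vec (unit_vec d1 r) (unit_vec d2 s)) $ t"
      using t by simp
  qed (use v in auto)
  also have "\<dots> \<in> sp (d1 * d2) (I \<times> J) (\<lambda>(i,j). kron_vec (p i) (q j))"
    using k by (intro subspace_lc subspace_sp) auto
  finally show "v \<in> sp (d1 * d2) (I \<times> J) (\<lambda>(i,j). kron_vec (p i) (q j))" .
qed (use sp_carrier in blast)

lemma tens_sub_sp:
  assumes p: "finite I" "\<And>i. i \<in> I \<Longrightarrow> p i \<in> carrier_vec d1"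
    and q: "finite J" "\<And>j. j \<in> J \<Longrightarrow> q j \<in> carrier_vec d2"
  shows "tens_sub d1 d2 (sp d1 I p) (sp d2 J q) = sp (d1 * d2) (I \<times> J) (\<lambda>(i,j). kron_vec (p i) (q j))"
proof (intro equalityI)
  show "tens_sub d1 d2 (sp d1 I p) (sp d2 J q) \<subseteq> sp (d1 * d2) (I \<times> J) (\<lambda>(i,j). kron_vec (p i) (q j))"
    unfolding tens_sub_def
  proof (intro vspan_least subspace_sp subsetI)
    fix x assume "x \<in> {kron_vec u w |u w. u \<in> sp d1 I p \<and> w \<in> sp d2 J q}"
    then obtain c e where "x = kron_vec (lc d1 I c p) (lc d2 J e q)" by (auto elim!: sp_E)
    then show "x \<in> sp (d1 * d2) (I \<times> J) (\<lambda>(i,j). kron_vec (p i) (q j))" using kron_lc[of I p d1 J q d2, OF p(2) q(2)] by simp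
  qed
  have "{kron_vec u w |u w. u \<in> sp d1 I p \<and> w \<in> sp d2 J q} \<subseteq> carrier_vec (d1 * d2)"
    by (auto intro!: kron_carrier dest!: subsetD[OF sp_carrier])
  then have s: "subspace (d1 * d2) (tens_sub d1 d2 (sp d1 I p) (sp d2 J q))" unfolding tens_sub_def by (rule subspace_vspan)
  have "kron_vec (p i) (q j) \<in> tens_sub d1 d2 (sp d1 I p) (sp d2 J q)" if "i \<in> I" "j \<in> J" for i j
    unfolding tens_sub_def using sp_member[of I i p d1] sp_member[of J j q d2] p q that
    by (intro subsetD[OF vspan_superset]) blast
  then show "sp (d1 * d2) (I \<times> J) (\<lambda>(i,j). kron_vec (p i) (q j)) \<subseteq> tens_sub d1 d2 (sp d1 I p) (sp d2 J q)"
    using p q by (intro sp_least[OF s]) auto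
qed

lemma tens_lc:
  assumes c: "\<And>b. \<rho>1 b \<in> carrier_mat d1 d1" "\<And>b. \<rho>2 b \<in> carrier_mat d2 d2"
    and p: "\<And>i. i \<in> I \<Longrightarrow> p i \<in> carrier_vec d1" and q: "\<And>j. j \<in> J \<Longrightarrow> q j \<in> carrier_vec d2"
  shows "tens_rep d1 \<rho>1 d2 \<rho>2 b *\<^sub>v lc (d1 * d2) (I \<times> J) c (\<lambda>(i,j). kron_vec (p i) (q j)) =
    lc (d1 * d2) (I \<times> J) c (\<lambda>(i,j). kron_vec (\<rho>1 b *\<^sub>v p i) (q j) + kron_vec (p i) (\<rho>2 b *\<^sub>v q j))"
proof -
  have "tens_rep d1 \<rho>1 d2 \<rho>2 b *\<^sub>v lc (d1 * d2) (I \<times> J) c (\<lambda>(i,j). kron_vec (p i) (q j)) =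
    lc (d1 * d2) (I \<times> J) c (\<lambda>ij. tens_rep d1 \<rho>1 d2 \<rho>2 b *\<^sub>v (case ij of (i,j) \<Rightarrow> kron_vec (p i) (q j)))"
    using p q by (intro mult_lc tens_carrier[OF c]) auto
  also have "\<dots> = lc (d1 * d2) (I \<times> J) c (\<lambda>(i,j). kron_vec (\<rho>1 b *\<^sub>v p i) (q j) + kron_vec (p i) (\<rho>2 b *\<^sub>v q j))"
    using p q by (intro lc_cong) (auto simp: tens_kron[OF c])
  finally show ?thesis .
qed

text \<open>On a pure tensor the mixed terms (au)(bw) and (bu)(aw) are symmetric in a and b and
  cancel in the commutator. Tensors of unit vectors span, and the relation is linear in v.\<close>

lemma tens_rel:
  assumes c1: "\<And>b. \<rho>1 b \<in> carrier_mat d1 d1" and c2: "\<And>b. \<rho>2 b \<in> carrier_mat d2 d2"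
    and r1: "rel d1 \<rho>1 a b s g" and r2: "rel d2 \<rho>2 a b s g"
  shows "rel (d1 * d2) (tens_rep d1 \<rho>1 d2 \<rho>2) a b s g"
  unfolding rel_def
proof
  let ?T = "tens_rep d1 \<rho>1 d2 \<rho>2" and ?D = "d1 * d2"
  fix v :: "'a vec" assume v: "v \<in> carrier_vec ?D"
  let ?U = "\<lambda>(r,s). kron_vec (unit_vec d1 r) (unit_vec d2 s) :: 'a vec"
  have "sp ?D ({..<d1} \<times> {..<d2}) ?U = carrier_vec ?D"
    by (rule kron_span) (use unit_span sp_carrier in \<open>auto simp: sp_def\<close>)
  then obtain e where e: "v = lc ?D ({..<d1} \<times> {..<d2}) e ?U" using v by (auto simp: sp_def)
  have T: "?T x \<in> carrier_mat ?D ?D" for x by (rule tens_carrier[OF c1 c2])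
  have Tlc: "?T x *\<^sub>v lc ?D ({..<d1} \<times> {..<d2}) e f = lc ?D ({..<d1} \<times> {..<d2}) e (\<lambda>i. ?T x *\<^sub>v f i)"
    if "\<And>i. f i \<in> carrier_vec ?D" for x f using that by (intro mult_lc T)
  have U: "?U i \<in> carrier_vec ?D" for i by (cases i) auto
  have key: "?T a *\<^sub>v (?T b *\<^sub>v kron_vec u w) = ?T b *\<^sub>v (?T a *\<^sub>v kron_vec u w) + s \<cdot>\<^sub>v (?T g *\<^sub>v kron_vec u w)"
    if u: "u \<in> carrier_vec d1" and w: "w \<in> carrier_vec d2" for u w
  proof -
    note tk = tens_kron[OF c1 c2]
    have c1v: "\<rho>1 x *\<^sub>v y \<in> carrier_vec d1" for x y using c1[of x] by simp
    have c2v: "\<rho>2 x *\<^sub>v y \<in> carrier_vec d2" for x y using c2[of x] by simp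
    have two: "?T y *\<^sub>v (?T x *\<^sub>v kron_vec u w) = (kron_vec (\<rho>1 y *\<^sub>v (\<rho>1 x *\<^sub>v u)) w + kron_vec (\<rho>1 x *\<^sub>v u) (\<rho>2 y *\<^sub>v w))
        + (kron_vec (\<rho>1 y *\<^sub>v u) (\<rho>2 x *\<^sub>v w) + kron_vec u (\<rho>2 y *\<^sub>v (\<rho>2 x *\<^sub>v w)))" for x y
      using u w c1v c2v by (simp add: tk mult_add_distrib_mat_vec[OF T])
    note twoab = two[of a b] and twoba = two[of b a]
    show ?thesis
    proof (rule eq_vecI)
      let ?R = "?T b *\<^sub>v (?T a *\<^sub>v kron_vec u w) + s \<cdot>\<^sub>v (?T g *\<^sub>v kron_vec u w)"
      fix k assume "k < dim_vec ?R"
      then have k: "k < ?D" using carrier_matD[OF T[of g]] by simp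
      note dm = div_mod_less[OF k]
      have dk: "dim_vec (kron_vec x y) = ?D" if "x \<in> carrier_vec d1" "y \<in> carrier_vec d2" for x y :: "'a vec"
        using carrier_vecD[OF kron_carrier[OF that]] .
      have r1': "(\<rho>1 a *\<^sub>v (\<rho>1 b *\<^sub>v u)) $ (k div d2) = (\<rho>1 b *\<^sub>v (\<rho>1 a *\<^sub>v u)) $ (k div d2) + s * (\<rho>1 g *\<^sub>v u) $ (k div d2)"
        using relD[OF r1 u] dm carrier_matD[OF c1] by simp
      have r2': "(\<rho>2 a *\<^sub>v (\<rho>2 b *\<^sub>v w)) $ (k mod d2) = (\<rho>2 b *\<^sub>v (\<rho>2 a *\<^sub>v w)) $ (k mod d2) + s * (\<rho>2 g *\<^sub>v w) $ (k mod d2)"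
        using relD[OF r2 w] dm carrier_matD[OF c2] by simp
      show "(?T a *\<^sub>v (?T b *\<^sub>v kron_vec u w)) $ k = ?R $ k"
        unfolding twoab twoba unfolding tk[OF u w] using u w c1v c2v k
        by (simp add: dk kron_index[where ?d1.0 = d1 and ?d2.0 = d2] r1' r2' algebra_simps)
    qed (use carrier_matD[OF T[of a]] carrier_matD[OF T[of g]] in simp)
  qed
  have "?T a *\<^sub>v (?T b *\<^sub>v v) = lc ?D ({..<d1} \<times> {..<d2}) e (\<lambda>i. ?T a *\<^sub>v (?T b *\<^sub>v ?U i))"
    unfolding e using U T by (simp add: Tlc)
  also have "\<dots> = lc ?D ({..<d1} \<times> {..<d2}) e (\<lambda>i. ?T b *\<^sub>v (?T a *\<^sub>v ?U i) + s \<cdot>\<^sub>v (?T g *\<^sub>v ?U i))"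
    by (intro lc_cong) (auto simp: key)
  also have "\<dots> = lc ?D ({..<d1} \<times> {..<d2}) e (\<lambda>i. ?T b *\<^sub>v (?T a *\<^sub>v ?U i)) + lc ?D ({..<d1} \<times> {..<d2}) e (\<lambda>i. s \<cdot>\<^sub>v (?T g *\<^sub>v ?U i))"
    using T by (intro lc_add2[symmetric]) auto
  also have "lc ?D ({..<d1} \<times> {..<d2}) e (\<lambda>i. s \<cdot>\<^sub>v (?T g *\<^sub>v ?U i)) = s \<cdot>\<^sub>v lc ?D ({..<d1} \<times> {..<d2}) e (\<lambda>i. ?T g *\<^sub>v ?U i)"
    using T by (subst lc_smult2) (auto simp: lc_smult mult.commute)
  also have "lc ?D ({..<d1} \<times> {..<d2}) e (\<lambda>i. ?T b *\<^sub>v (?T a *\<^sub>v ?U i)) = ?T b *\<^sub>v (?T a *\<^sub>v v)"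
    unfolding e using U T by (simp add: Tlc)
  also have "lc ?D ({..<d1} \<times> {..<d2}) e (\<lambda>i. ?T g *\<^sub>v ?U i) = ?T g *\<^sub>v v"
    unfolding e using U T by (simp add: Tlc)
  finally show "?T a *\<^sub>v (?T b *\<^sub>v v) = ?T b *\<^sub>v (?T a *\<^sub>v v) + s \<cdot>\<^sub>v (?T g *\<^sub>v v)" .
qed

lemma tens_g_rep:
  assumes g1: "g_rep m d1 \<rho>1" and g2: "g_rep m d2 \<rho>2"
  shows "g_rep m (d1 * d2) (tens_rep d1 \<rho>1 d2 \<rho>2)"
proof -
  note R = tens_rel[OF g_repD(1)[OF g1] g_repD(1)[OF g2]]
  have c: "tens_rep d1 \<rho>1 d2 \<rho>2 b \<in> carrier_mat (d1 * d2) (d1 * d2)" for b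
    by (rule tens_carrier[OF g_repD(1)[OF g1] g_repD(1)[OF g2]])
  show ?thesis unfolding g_rep_def
    by (intro conjI ballI allI impI c R; use g1 g2 in \<open>unfold g_rep_def, blast\<close>)
qed

lemma tens_weights:
  assumes g1: "g_rep m d1 \<rho>1" and g2: "g_rep m d2 \<rho>2"
    and w1: "weights d1 (\<rho>1 GH) I p w1" and w2: "weights d2 (\<rho>2 GH) J q w2"
  shows "weights (d1 * d2) (tens_rep d1 \<rho>1 d2 \<rho>2 GH) (I \<times> J) (\<lambda>(i,j). kron_vec (p i) (q j)) (\<lambda>(i,j). w1 i + w2 j)"
  unfolding weights_def
proof (intro conjI ballI)
  have p: "indep d1 I p" "sp d1 I p = carrier_vec d1" and q: "indep d2 J q" "sp d2 J q = carrier_vec d2" using w1 w2 by (auto simp: weights_def)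
  show "indep (d1 * d2) (I \<times> J) (\<lambda>(i,j). kron_vec (p i) (q j))" by (rule kron_indep[OF p(1) q(1)])
  show "sp (d1 * d2) (I \<times> J) (\<lambda>(i,j). kron_vec (p i) (q j)) = carrier_vec (d1 * d2)"
    by (rule kron_span[OF p(2) indep_finite[OF p(1)] indep_carrier[OF p(1)] q(2) indep_finite[OF q(1)] indep_carrier[OF q(1)]])
  fix ij assume "ij \<in> I \<times> J"
  then obtain i j where ij: "ij = (i,j)" "i \<in> I" "j \<in> J" by auto
  have c: "p i \<in> carrier_vec d1" "q j \<in> carrier_vec d2" using indep_carrier[OF p(1)] indep_carrier[OF q(1)] ij by auto
  have "\<rho>1 GH *\<^sub>v p i = of_int (w1 i) \<cdot>\<^sub>v p i" "\<rho>2 GH *\<^sub>v q j = of_int (w2 j) \<cdot>\<^sub>v q j" using w1 w2 ij by (auto simp: weights_def)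
  then have "tens_rep d1 \<rho>1 d2 \<rho>2 GH *\<^sub>v kron_vec (p i) (q j) = kron_vec (of_int (w1 i) \<cdot>\<^sub>v p i) (q j) + kron_vec (p i) (of_int (w2 j) \<cdot>\<^sub>v q j)"
    using tens_kron[OF g_repD(1)[OF g1] g_repD(1)[OF g2] c] by simp
  also have "\<dots> = of_int (w1 i + w2 j) \<cdot>\<^sub>v kron_vec (p i) (q j)"
  proof (rule eq_vecI)
    fix k assume "k < dim_vec (of_int (w1 i + w2 j) \<cdot>\<^sub>v kron_vec (p i) (q j))"
    then have k: "k < d1 * d2" using c by (simp add: carrier_vecD[OF kron_carrier[OF c]])
    have dk: "dim_vec (kron_vec x y) = d1 * d2" if "x \<in> carrier_vec d1" "y \<in> carrier_vec d2" for x y :: "'a vec"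
      using carrier_vecD[OF kron_carrier[OF that]] .
    show "(kron_vec (of_int (w1 i) \<cdot>\<^sub>v p i) (q j) + kron_vec (p i) (of_int (w2 j) \<cdot>\<^sub>v q j)) $ k = (of_int (w1 i + w2 j) \<cdot>\<^sub>v kron_vec (p i) (q j)) $ k"
      using c k div_mod_less[OF k] by (simp add: dk kron_index[where ?d1.0 = d1 and ?d2.0 = d2] carrier_vecD[OF c(1)] carrier_vecD[OF c(2)] algebra_simps)
  qed (use c in \<open>simp add: kron_vec_def\<close>)
  finally show "tens_rep d1 \<rho>1 d2 \<rho>2 GH *\<^sub>v (case ij of (i,j) \<Rightarrow> kron_vec (p i) (q j)) = of_int (case ij of (i,j) \<Rightarrow> w1 i + w2 j) \<cdot>\<^sub>v (case ij of (i,j) \<Rightarrow> kron_vec (p i) (q j))"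
    using ij by simp
qed

lemma kron_zero: "u \<in> carrier_vec d1 \<Longrightarrow> kron_vec u (0\<^sub>v d2) = (0\<^sub>v (d1 * d2) :: 'a::field vec)"
  "w \<in> carrier_vec d2 \<Longrightarrow> kron_vec (0\<^sub>v d1) w = (0\<^sub>v (d1 * d2) :: 'a::field vec)"
proof -
  assume u: "u \<in> carrier_vec d1"
  show "kron_vec u (0\<^sub>v d2) = 0\<^sub>v (d1 * d2)"
    using kron_index[OF u zero_carrier_vec[of d2]] carrier_vecD[OF kron_carrier[OF u zero_carrier_vec[of d2]]] div_mod_less
    by (intro eq_vecI) auto
next
  assume w: "w \<in> carrier_vec d2"
  show "kron_vec (0\<^sub>v d1) w = 0\<^sub>v (d1 * d2)"
    using kron_index[OF zero_carrier_vec[of d1] w] carrier_vecD[OF kron_carrier[OF zero_carrier_vec[of d1] w]] div_mod_less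
    by (intro eq_vecI) auto
qed

text \<open>By the Leibniz rule an element of h_n lowers the order of one factor at a time. Order 0
  means the zero vector, at which point the tensor vanishes.\<close>

lemma tens_nilp_kron:
  assumes g1: "g_rep m d1 \<rho>1" and g2: "g_rep m d2 \<rho>2"
  shows "u \<in> nilp m d1 \<rho>1 s \<Longrightarrow> w \<in> nilp m d2 \<rho>2 t \<Longrightarrow> kron_vec u w \<in> nilp m (d1 * d2) (tens_rep d1 \<rho>1 d2 \<rho>2) (s + t)"
proof (induction "s + t" arbitrary: s t u w rule: less_induct)
  case less
  let ?T = "tens_rep d1 \<rho>1 d2 \<rho>2"
  note sub = subspace_nilp[OF tens_g_rep[OF g1 g2]]
  have u: "u \<in> carrier_vec d1" and w: "w \<in> carrier_vec d2"
    using subspace_carrier[OF subspace_nilp[OF g1]] subspace_carrier[OF subspace_nilp[OF g2]] less.prems by auto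
  show ?case
  proof (cases "s = 0 \<or> t = 0")
    case True
    then have "kron_vec u w = 0\<^sub>v (d1 * d2)" using less.prems u w by (auto simp: kron_zero)
    then show ?thesis using subspace_zero[OF sub] by simp
  next
    case False
    then obtain s' t' where st: "s = Suc s'" "t = Suc t'" by (metis not0_implies_Suc)
    have "?T b *\<^sub>v kron_vec u w \<in> nilp m (d1 * d2) ?T (s' + t)" if b: "b = GZ \<or> (\<exists>i\<le>m. b = GX i)" for b
    proof -
      have 1: "\<rho>1 b *\<^sub>v u \<in> nilp m d1 \<rho>1 s'" and 2: "\<rho>2 b *\<^sub>v w \<in> nilp m d2 \<rho>2 t'" using b less.prems st by auto
      have "kron_vec (\<rho>1 b *\<^sub>v u) w \<in> nilp m (d1 * d2) ?T (s' + t)" using 1 less.prems st by (intro less.hyps) auto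
      moreover have "kron_vec u (\<rho>2 b *\<^sub>v w) \<in> nilp m (d1 * d2) ?T (s + t')" using 2 less.prems st by (intro less.hyps) auto
      moreover have "s + t' = s' + t" using st by simp
      ultimately show ?thesis
        using tens_kron[OF g_repD(1)[OF g1] g_repD(1)[OF g2] u w] subspace_add[OF sub] by simp
    qed
    then show ?thesis using u w st by auto
  qed
qed

lemma tens_nilp:
  assumes g1: "g_rep m d1 \<rho>1" and g2: "g_rep m d2 \<rho>2"
    and n1: "carrier_vec d1 \<subseteq> nilp m d1 \<rho>1 s" and n2: "carrier_vec d2 \<subseteq> nilp m d2 \<rho>2 t"
  shows "carrier_vec (d1 * d2) \<subseteq> nilp m (d1 * d2) (tens_rep d1 \<rho>1 d2 \<rho>2) (s + t)"
proof -
  let ?U = "\<lambda>(r,s). kron_vec (unit_vec d1 r) (unit_vec d2 s) :: 'a vec"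
  have "sp (d1 * d2) ({..<d1} \<times> {..<d2}) ?U = carrier_vec (d1 * d2)"
    by (rule kron_span) (use unit_span sp_carrier in \<open>auto simp: sp_def\<close>)
  moreover have "sp (d1 * d2) ({..<d1} \<times> {..<d2}) ?U \<subseteq> nilp m (d1 * d2) (tens_rep d1 \<rho>1 d2 \<rho>2) (s + t)"
    using n1 n2 by (intro sp_least subspace_nilp[OF tens_g_rep[OF g1 g2]]) (auto intro!: tens_nilp_kron[OF g1 g2])
  ultimately show ?thesis by simp
qed

section \<open>Equivariant maps from V(m) tensor V(b) to V(a) in coordinates\<close>

text \<open>\<open>M i l j\<close> stands for the coefficient of \<open>p\<^sub>l\<close> in \<open>x\<^sub>i q\<^sub>j\<close>, where p and q are the standard bases of V(a) and
  V(b): the three clauses are the commutation relations with h, e (for \<open>x\<^sub>0\<close> only) and f.\<close>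

definition equivariant :: "nat \<Rightarrow> nat \<Rightarrow> nat \<Rightarrow> (nat \<Rightarrow> nat \<Rightarrow> nat \<Rightarrow> 'a::field_char_0) \<Rightarrow> bool" where
  "equivariant m a b M \<longleftrightarrow>
     (\<forall>i\<le>m. \<forall>l\<le>a. \<forall>j\<le>b. M i l j \<noteq> 0 \<longrightarrow> int a - 2 * int l = int m - 2 * int i + (int b - 2 * int j)) \<and>
     (\<forall>l<a. \<forall>j\<le>b. of_nat ((l + 1) * (a - l)) * M 0 (l + 1) j = (if j = 0 then 0 else of_nat (j * (b + 1 - j)) * M 0 l (j - 1))) \<and>
     (\<forall>i<m. \<forall>l\<le>a. \<forall>j\<le>b. M (i + 1) l j = (if l = 0 then 0 else M i (l - 1) j) - (if j < b then M i l (j + 1) else 0))"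

text \<open>The solutions, up to scalars, for b = a + m, for a = b + m and for a = 1, b = m - 1.\<close>

definition raise :: "nat \<Rightarrow> nat \<Rightarrow> nat \<Rightarrow> nat \<Rightarrow> 'a::field_char_0" where
  "raise m i l j = (if i + j = l + m then (-1) ^ i * of_nat (j choose (m - i)) else 0)"

definition lower :: "nat \<Rightarrow> nat \<Rightarrow> nat \<Rightarrow> nat \<Rightarrow> nat \<Rightarrow> 'a::field_char_0" where
  "lower m a i l j = (if l = i + j then of_nat ((a - l) choose (m - i)) else 0)"

definition special :: "nat \<Rightarrow> nat \<Rightarrow> nat \<Rightarrow> nat \<Rightarrow> 'a::field_char_0" where
  "special m i l j = (if i + j + 1 = l + m then if l = 0 then (-1) ^ i else (-1) ^ (i + 1) * of_nat i else 0)"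

lemma equivariantD:
  assumes "equivariant m a b M"
  shows "i \<le> m \<Longrightarrow> l \<le> a \<Longrightarrow> j \<le> b \<Longrightarrow> M i l j \<noteq> 0 \<Longrightarrow> int a - 2 * int l = int m - 2 * int i + (int b - 2 * int j)"
    and "l < a \<Longrightarrow> j \<le> b \<Longrightarrow> of_nat ((l + 1) * (a - l)) * M 0 (l + 1) j = (if j = 0 then 0 else of_nat (j * (b + 1 - j)) * M 0 l (j - 1))"
    and "i < m \<Longrightarrow> l \<le> a \<Longrightarrow> j \<le> b \<Longrightarrow> M (i + 1) l j = (if l = 0 then 0 else M i (l - 1) j) - (if j < b then M i l (j + 1) else 0)"
  using assms unfolding equivariant_def by blast+

text \<open>The relation with f expresses x_(i+1) through x_i, so proportionality at i = 0
  propagates to all i.\<close>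

lemma equivariant_unique:
  fixes M N :: "nat \<Rightarrow> nat \<Rightarrow> nat \<Rightarrow> 'a::field_char_0"
  assumes M: "\<And>i l j. i < m \<Longrightarrow> l \<le> a \<Longrightarrow> j \<le> b \<Longrightarrow> M (i + 1) l j = (if l = 0 then 0 else M i (l - 1) j) - (if j < b then M i l (j + 1) else 0)"
    and N: "\<And>i l j. i < m \<Longrightarrow> l \<le> a \<Longrightarrow> j \<le> b \<Longrightarrow> N (i + 1) l j = (if l = 0 then 0 else N i (l - 1) j) - (if j < b then N i l (j + 1) else 0)"
    and 0: "\<And>l j. l \<le> a \<Longrightarrow> j \<le> b \<Longrightarrow> M 0 l j = c * N 0 l j"
  shows "i \<le> m \<Longrightarrow> l \<le> a \<Longrightarrow> j \<le> b \<Longrightarrow> M i l j = c * N i l j"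
proof (induction i arbitrary: l j)
  case (Suc i)
  have "M (i + 1) l j = c * N (i + 1) l j"
    unfolding M[OF Suc_le_lessD[OF Suc.prems(1)] Suc.prems(2,3)] N[OF Suc_le_lessD[OF Suc.prems(1)] Suc.prems(2,3)]
    using Suc by (simp add: right_diff_distrib)
  then show ?case by simp
qed (use 0 in simp)

text \<open>By weights x_0 maps q_(l+m) to a multiple of p_l. The relation with e then reads (l+1)
  M_(l+1) = (l+1+m) M_l after cancelling a - l, a recursion solved by C(l+m, m), and the relation
  with f holds for \<open>raise\<close> by Pascal's rule. The scalar is the entry
  \<open>M 0 0 m\<close>.\<close>

lemma equivariant_raise:
  assumes e: "equivariant m a b M" and b: "b = a + m"
  shows "\<exists>c. \<forall>i\<le>m. \<forall>l\<le>a. \<forall>j\<le>b. M i l j = c * raise m i l j"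
proof (intro exI allI impI)
  have f: "M 0 l (l + m) = of_nat ((l + m) choose m) * M 0 0 m" if "l \<le> a" for l
    using that
  proof (induction l)
    case (Suc l)
    have "of_nat ((l + 1) * (a - l)) * M 0 (l + 1) (l + 1 + m) = of_nat ((l + 1 + m) * (a - l)) * M 0 l (l + m)"
      using equivariantD(2)[OF e, of l "l + 1 + m"] Suc.prems by (simp add: b)
    then have "of_nat (a - l) * (of_nat (l + 1) * M 0 (l + 1) (l + 1 + m)) = of_nat (a - l) * (of_nat (l + 1 + m) * M 0 l (l + m))"
      by (simp only: of_nat_mult mult_ac)
    moreover have "of_nat (a - l) \<noteq> (0::'a)" using Suc.prems by simp
    ultimately have "of_nat (l + 1) * M 0 (l + 1) (l + 1 + m) = of_nat (l + 1 + m) * M 0 l (l + m)" by (simp only: mult_cancel_left) simp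
    also have "\<dots> = of_nat ((l + 1 + m) * ((l + m) choose m)) * M 0 0 m" using Suc by (simp only: of_nat_mult) simp
    also have "(l + 1 + m) * ((l + m) choose m) = (l + 1) * ((l + 1 + m) choose m)"
      using binomial_absorb_comp[of "l + 1 + m" m] by simp
    also have "of_nat ((l + 1) * ((l + 1 + m) choose m)) * M 0 0 m = of_nat (l + 1) * (of_nat ((l + 1 + m) choose m) * M 0 0 m)"
      by (simp only: of_nat_mult mult.assoc)
    finally have "M 0 (l + 1) (l + 1 + m) = of_nat ((l + 1 + m) choose m) * M 0 0 m"
      by (simp only: mult_cancel_left of_nat_eq_0_iff) simp
    then show ?case by simp
  qed simp
  have wt: "j = l + m" if "l \<le> a" "j \<le> b" "M 0 l j \<noteq> 0" for l j
    using equivariantD(1)[OF e _ that] b by simp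
  fix i l j assume ilj: "i \<le> m" "l \<le> a" "j \<le> b"
  show "M i l j = M 0 0 m * raise m i l j"
  proof (rule equivariant_unique[where m = m and a = a and b = b, OF _ _ _ ilj])
    show "M (i + 1) l j = (if l = 0 then 0 else M i (l - 1) j) - (if j < b then M i l (j + 1) else 0)"
      if "i < m" "l \<le> a" "j \<le> b" for i l j by (rule equivariantD(3)[OF e that])
    show "raise m (i + 1) l j = (if l = 0 then 0 else raise m i (l - 1) j) - (if j < b then raise m i l (j + 1) else (0::'a))"
      if "i < m" "l \<le> a" "j \<le> b" for i l j
    proof (cases "i + 1 + j = l + m")
      case True
      \<comment> \<open>With m = i + 1 + r the three entries are C(j, r), C(j, r+1) and C(j+1, r+1)
        up to sign. For l = 0 one has j = r, so the absent entry C(j, r+1) is 0 anyway.\<close>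
      define r where "r = m - (i + 1)"
      have r: "m = i + 1 + r" using that(1) by (simp add: r_def)
      have j: "j = l + r" using True r by simp
      have "j < b" using that j r b by simp
      moreover have "of_nat (Suc j choose Suc r) = (of_nat (j choose r) + of_nat (j choose Suc r) :: 'a)" by (simp only: binomial_Suc_Suc of_nat_add)
      moreover have "l = 0 \<Longrightarrow> j choose Suc r = 0" using j by simp
      ultimately show ?thesis using r j by (cases "l = 0") (auto simp: raise_def algebra_simps)
    qed (auto simp: raise_def)
    show "M 0 l j = M 0 0 m * raise m 0 l j" if "l \<le> a" "j \<le> b" for l j
      using f[OF that(1)] wt[OF that] by (cases "j = l + m") (auto simp: raise_def mult.commute)
  qed
qed

text \<open>Here x_0 is diagonal by weights, and the relation with e gives (a-j) M_(j+1) = (b-j)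
  M_j, which is solved by C(a-j, m) because b = a - m. Dividing by \<open>a choose m\<close>
  normalises the solution at j = 0.\<close>

lemma equivariant_lower:
  assumes e: "equivariant m a b M" and a: "a = b + m"
  shows "\<exists>c. \<forall>i\<le>m. \<forall>l\<le>a. \<forall>j\<le>b. M i l j = c * lower m a i l j"
proof (intro exI allI impI)
  let ?c = "M 0 0 0 / of_nat (a choose m)"
  have f: "M 0 j j = ?c * of_nat ((a - j) choose m)" if "j \<le> b" for j
    using that
  proof (induction j)
    case 0
    have "of_nat (a choose m) \<noteq> (0::'a)" using a by simp
    then show ?case by simp
  next
    case (Suc j)
    have "of_nat ((j + 1) * (a - j)) * M 0 (j + 1) (j + 1) = of_nat ((j + 1) * (b + 1 - (j + 1))) * M 0 j j"
      using equivariantD(2)[OF e, of j "j + 1"] Suc.prems by (simp add: a)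
    then have "of_nat (j + 1) * (of_nat (a - j) * M 0 (j + 1) (j + 1)) = of_nat (j + 1) * (of_nat (b - j) * M 0 j j)"
      by (simp only: of_nat_mult mult_ac) simp
    then have "of_nat (a - j) * M 0 (j + 1) (j + 1) = of_nat (b - j) * M 0 j j" by (simp only: mult_cancel_left of_nat_eq_0_iff) simp
    also have "\<dots> = ?c * of_nat ((b - j) * ((a - j) choose m))" using Suc by simp
    also have "(b - j) * ((a - j) choose m) = (a - j) * ((a - (j + 1)) choose m)"
      using binomial_absorb_comp[of "a - j" m] a Suc.prems by simp
    also have "?c * of_nat ((a - j) * ((a - (j + 1)) choose m)) = of_nat (a - j) * (?c * of_nat ((a - (j + 1)) choose m))"
      by (simp only: of_nat_mult mult_ac)
    finally show ?case using Suc.prems a by (simp only: mult_cancel_left of_nat_eq_0_iff) simp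
  qed
  have wt: "l = j" if "l \<le> a" "j \<le> b" "M 0 l j \<noteq> 0" for l j
    using equivariantD(1)[OF e _ that] a by simp
  fix i l j assume ilj: "i \<le> m" "l \<le> a" "j \<le> b"
  show "M i l j = ?c * lower m a i l j"
  proof (rule equivariant_unique[where m = m and a = a and b = b, OF _ _ _ ilj])
    show "M (i + 1) l j = (if l = 0 then 0 else M i (l - 1) j) - (if j < b then M i l (j + 1) else 0)"
      if "i < m" "l \<le> a" "j \<le> b" for i l j by (rule equivariantD(3)[OF e that])
    show "lower m a (i + 1) l j = (if l = 0 then 0 else lower m a i (l - 1) j) - (if j < b then lower m a i l (j + 1) else (0::'a))"
      if "i < m" "l \<le> a" "j \<le> b" for i l j
    proof (cases "l = i + 1 + j")
      case True
      \<comment> \<open>Pascal's rule again. At j = b one has a - l = r, so the absent entry C(a-l,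
        r+1) is 0 anyway.\<close>
      define r where "r = m - (i + 1)"
      have r: "m = i + 1 + r" using that(1) by (simp add: r_def)
      have s: "a - (l - 1) = Suc (a - l)" using True that by simp
      have "of_nat (Suc (a - l) choose Suc r) = (of_nat ((a - l) choose r) + of_nat ((a - l) choose Suc r) :: 'a)" by (simp only: binomial_Suc_Suc of_nat_add)
      moreover have "\<not> j < b \<Longrightarrow> (a - l) choose Suc r = 0" using that True r a by simp
      ultimately show ?thesis using r True s by (auto simp: lower_def algebra_simps)
    qed (auto simp: lower_def)
    show "M 0 l j = ?c * lower m a 0 l j" if "l \<le> a" "j \<le> b" for l j
      using f[OF that(2)] wt[OF that] by (cases "l = j") (auto simp: lower_def)
  qed
qed

text \<open>For weight reasons x_0 has a single possibly nonzero entry, from the lowest vector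
  q_(m-1) to p_0; the relation with f determines everything else from it.\<close>

lemma equivariant_special:
  assumes e: "equivariant m a b M" and a: "a = 1" and b: "b = m - 1" and m: "m \<ge> 1"
  shows "\<exists>c. \<forall>i\<le>m. \<forall>l\<le>a. \<forall>j\<le>b. M i l j = c * special m i l j"
proof (intro exI allI impI)
  have wt: "l = 0 \<and> j = m - 1" if "l \<le> a" "j \<le> b" "M 0 l j \<noteq> 0" for l j
  proof -
    have "int a - 2 * int l = int m - 2 * int 0 + (int b - 2 * int j)" by (rule equivariantD(1)[OF e _ that]) simp
    then show ?thesis using that a b m by auto
  qed
  fix i l j assume ilj: "i \<le> m" "l \<le> a" "j \<le> b"
  show "M i l j = M 0 0 (m - 1) * special m i l j"
  proof (rule equivariant_unique[where m = m and a = a and b = b, OF _ _ _ ilj])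
    show "M (i + 1) l j = (if l = 0 then 0 else M i (l - 1) j) - (if j < b then M i l (j + 1) else 0)"
      if "i < m" "l \<le> a" "j \<le> b" for i l j by (rule equivariantD(3)[OF e that])
    show "special m (i + 1) l j = (if l = 0 then 0 else special m i (l - 1) j) - (if j < b then special m i l (j + 1) else (0::'a))"
      if "i < m" "l \<le> a" "j \<le> b" for i l j
    proof -
      have "l = 0 \<or> l = 1" using that a by auto
      then show ?thesis
      proof
        assume "l = 0"
        then show ?thesis using that b by (auto simp: special_def)
      next
        assume l: "l = 1"
        show ?thesis
        proof (cases "i + j + 1 = m")
          case True
          then have "j < b \<longleftrightarrow> i \<noteq> 0" using b by auto
          then show ?thesis using l True by (auto simp: special_def algebra_simps)
        qed (use l in \<open>auto simp: special_def\<close>)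
      qed
    qed
    show "M 0 l j = M 0 0 (m - 1) * special m 0 l j" if "l \<le> a" "j \<le> b" for l j
      using wt[OF that] that a b m by (cases "l = 0 \<and> j = m - 1") (auto simp: special_def)
  qed
qed

subsection \<open>The linear system describing the invariants of degree one\<close>

text \<open>\<open>\<alpha>\<close> and \<open>\<beta>\<close> are the coordinates of a vector of \<open>V(a\<^sub>0) \<otimes> V(b\<^sub>1) \<oplus> V(a\<^sub>1) \<otimes> V(b\<^sub>0)\<close>; the equations say that
  its image in \<open>V(a\<^sub>0) \<otimes> V(b\<^sub>0)\<close> under every \<open>x\<^sub>i\<close> vanishes.\<close>

definition sol :: "nat \<Rightarrow> nat \<Rightarrow> nat \<Rightarrow> nat \<Rightarrow> nat \<Rightarrow> (nat \<Rightarrow> nat \<Rightarrow> nat \<Rightarrow> 'a::field_char_0) \<Rightarrow> (nat \<Rightarrow> nat \<Rightarrow> nat \<Rightarrow> 'a) \<Rightarrow>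
    (nat \<Rightarrow> nat \<Rightarrow> 'a) \<Rightarrow> (nat \<Rightarrow> nat \<Rightarrow> 'a) \<Rightarrow> bool" where
  "sol m a0 a1 b0 b1 M1 M2 \<alpha> \<beta> \<longleftrightarrow> (\<forall>i\<le>m. \<forall>k\<le>a0. \<forall>l\<le>b0.
     (\<Sum>j\<le>b1. \<alpha> k j * M2 i l j) + (\<Sum>k'\<le>a1. M1 i k k' * \<beta> k' l) = 0)"

definition sol_zero where
  "sol_zero m a0 a1 b0 b1 M1 M2 \<longleftrightarrow> (\<forall>\<alpha> \<beta>. sol m a0 a1 b0 b1 M1 M2 \<alpha> \<beta> \<longrightarrow>
     (\<forall>k\<le>a0. \<forall>j\<le>b1. \<alpha> k j = 0) \<and> (\<forall>k\<le>a1. \<forall>j\<le>b0. \<beta> k j = 0))"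

text \<open>Tailored to \<open>weight_line_chain\<close>: one nonzero solution of each weight K -
  2N, and together they span. A solution consists of two arrays, on V(a_0) x V(b_1) and on V(a_1) x
  V(b_0), hence two support conditions.\<close>

definition sol_basis where
  "sol_basis m a0 a1 b0 b1 M1 M2 K A B \<longleftrightarrow>
     (\<forall>N\<le>K. sol m a0 a1 b0 b1 M1 M2 (A N) (B N)) \<and>
     (\<forall>N\<le>K. \<forall>k\<le>a0. \<forall>j\<le>b1. A N k j \<noteq> 0 \<longrightarrow> int a0 + int b1 - 2 * (int k + int j) = int K - 2 * int N) \<and>
     (\<forall>N\<le>K. \<forall>k\<le>a1. \<forall>j\<le>b0. B N k j \<noteq> 0 \<longrightarrow> int a1 + int b0 - 2 * (int k + int j) = int K - 2 * int N) \<and>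
     (\<forall>N\<le>K. (\<exists>k\<le>a0. \<exists>j\<le>b1. A N k j \<noteq> 0) \<or> (\<exists>k\<le>a1. \<exists>j\<le>b0. B N k j \<noteq> 0)) \<and>
     (\<forall>\<alpha> \<beta>. sol m a0 a1 b0 b1 M1 M2 \<alpha> \<beta> \<longrightarrow> (\<exists>t.
        (\<forall>k\<le>a0. \<forall>j\<le>b1. \<alpha> k j = (\<Sum>N\<le>K. t N * A N k j)) \<and> (\<forall>k\<le>a1. \<forall>j\<le>b0. \<beta> k j = (\<Sum>N\<le>K. t N * B N k j))))"

definition sol_line where
  "sol_line m a0 a1 b0 b1 M1 M2 K \<longleftrightarrow> (\<exists>A B. sol_basis m a0 a1 b0 b1 M1 M2 K A B)"

text \<open>With s = m - i the binomial coefficient of \<open>raise\<close> becomes C(l+s, s), a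
  form that rescaling by factorials can absorb.\<close>

lemma sol_reverse: "sol m a0 a1 b0 b1 M1 M2 \<alpha> \<beta> \<longleftrightarrow> (\<forall>s\<le>m. \<forall>k\<le>a0. \<forall>l\<le>b0.
     (\<Sum>j\<le>b1. \<alpha> k j * M2 (m - s) l j) + (\<Sum>k'\<le>a1. M1 (m - s) k k' * \<beta> k' l) = 0)"
proof -
  have "(\<forall>i\<le>m. P i) \<longleftrightarrow> (\<forall>s\<le>m. P (m - s))" for P by (metis diff_diff_cancel diff_le_self)
  from this[of "\<lambda>i. \<forall>k\<le>a0. \<forall>l\<le>b0. (\<Sum>j\<le>b1. \<alpha> k j * M2 i l j) + (\<Sum>k'\<le>a1. M1 i k k' * \<beta> k' l) = 0"]
  show ?thesis unfolding sol_def .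
qed

text \<open>Exchanging the tensor factors transposes the unknowns. This yields the case of a
  lowering V_1 and a raising V_2 from the opposite one.\<close>

lemma sol_swap: "sol m a0 a1 b0 b1 M1 M2 \<alpha> \<beta> \<longleftrightarrow> sol m b0 b1 a0 a1 M2 M1 (\<lambda>k j. \<beta> j k) (\<lambda>k j. \<alpha> j k)"
  unfolding sol_def by (auto simp: add.commute mult.commute)

lemma sol_zero_swap: "sol_zero m b0 b1 a0 a1 M2 M1 \<Longrightarrow> sol_zero m a0 a1 b0 b1 M1 M2"
  unfolding sol_zero_def
proof (intro allI impI)
  fix \<alpha> \<beta> assume z: "\<forall>\<alpha> \<beta>. sol m b0 b1 a0 a1 M2 M1 \<alpha> \<beta> \<longrightarrow> (\<forall>k\<le>b0. \<forall>j\<le>a1. \<alpha> k j = 0) \<and> (\<forall>k\<le>b1. \<forall>j\<le>a0. \<beta> k j = 0)"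
    and "sol m a0 a1 b0 b1 M1 M2 \<alpha> \<beta>"
  then have "sol m b0 b1 a0 a1 M2 M1 (\<lambda>k j. \<beta> j k) (\<lambda>k j. \<alpha> j k)" using sol_swap by blast
  then show "(\<forall>k\<le>a0. \<forall>j\<le>b1. \<alpha> k j = 0) \<and> (\<forall>k\<le>a1. \<forall>j\<le>b0. \<beta> k j = 0)"
    using z[rule_format, of "\<lambda>k j. \<beta> j k" "\<lambda>k j. \<alpha> j k"] by blast
qed

lemma sol_line_swap:
  assumes "sol_line m b0 b1 a0 a1 M2 M1 K" shows "sol_line m a0 a1 b0 b1 M1 M2 K"
proof -
  obtain A B where AB: "sol_basis m b0 b1 a0 a1 M2 M1 K A B" using assms unfolding sol_line_def by blast
  have "sol_basis m a0 a1 b0 b1 M1 M2 K (\<lambda>N k j. B N j k) (\<lambda>N k j. A N j k)" unfolding sol_basis_def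
  proof (intro conjI allI impI)
    fix N assume N: "N \<le> K"
    show "sol m a0 a1 b0 b1 M1 M2 (\<lambda>k j. B N j k) (\<lambda>k j. A N j k)"
      using AB N sol_swap[of m a0 a1 b0 b1 M1 M2 "\<lambda>k j. B N j k" "\<lambda>k j. A N j k"] unfolding sol_basis_def by simp
    have "(\<exists>k\<le>b0. \<exists>j\<le>a1. A N k j \<noteq> 0) \<or> (\<exists>k\<le>b1. \<exists>j\<le>a0. B N k j \<noteq> 0)" using AB N unfolding sol_basis_def by simp
    then show "(\<exists>k\<le>a0. \<exists>j\<le>b1. B N j k \<noteq> 0) \<or> (\<exists>k\<le>a1. \<exists>j\<le>b0. A N j k \<noteq> 0)" by blast
    fix k j
    show "int a0 + int b1 - 2 * (int k + int j) = int K - 2 * int N" if "k \<le> a0" "j \<le> b1" "B N j k \<noteq> 0"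
      using AB N that unfolding sol_basis_def by (simp add: add.commute)
    show "int a1 + int b0 - 2 * (int k + int j) = int K - 2 * int N" if "k \<le> a1" "j \<le> b0" "A N j k \<noteq> 0"
      using AB N that unfolding sol_basis_def by (simp add: add.commute)
  next
    fix \<alpha> \<beta> assume "sol m a0 a1 b0 b1 M1 M2 \<alpha> \<beta>"
    then have "sol m b0 b1 a0 a1 M2 M1 (\<lambda>k j. \<beta> j k) (\<lambda>k j. \<alpha> j k)" using sol_swap by blast
    moreover have "\<forall>\<alpha> \<beta>. sol m b0 b1 a0 a1 M2 M1 \<alpha> \<beta> \<longrightarrow> (\<exists>t.
        (\<forall>k\<le>b0. \<forall>j\<le>a1. \<alpha> k j = (\<Sum>N\<le>K. t N * A N k j)) \<and> (\<forall>k\<le>b1. \<forall>j\<le>a0. \<beta> k j = (\<Sum>N\<le>K. t N * B N k j)))"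
      using AB unfolding sol_basis_def by simp
    ultimately obtain t where "\<forall>k\<le>b0. \<forall>j\<le>a1. \<beta> j k = (\<Sum>N\<le>K. t N * A N k j)" "\<forall>k\<le>b1. \<forall>j\<le>a0. \<alpha> j k = (\<Sum>N\<le>K. t N * B N k j)" by blast
    then show "\<exists>t. (\<forall>k\<le>a0. \<forall>j\<le>b1. \<alpha> k j = (\<Sum>N\<le>K. t N * B N j k)) \<and> (\<forall>k\<le>a1. \<forall>j\<le>b0. \<beta> k j = (\<Sum>N\<le>K. t N * A N j k))"
      by blast
  qed
  then show ?thesis unfolding sol_line_def by blast
qed

lemma sum_at:
  fixes f :: "'i \<Rightarrow> 'a::comm_monoid_add"
  assumes "finite I" "\<And>j. j \<in> I \<Longrightarrow> j \<noteq> i \<Longrightarrow> f j = 0" shows "sum f I = (if i \<in> I then f i else 0)"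
proof (cases "i \<in> I")
  case True
  then have "sum f I = sum f {i}" using assms by (intro sum.mono_neutral_right) auto
  then show ?thesis using True by simp
next
  case False
  then show ?thesis using assms by (auto intro!: sum.neutral)
qed

section \<open>Evaluation of the sums of the system: each has at most one nonzero term\<close>

context
  fixes m a0 a1 b0 b1 :: nat and M1 M2 :: "nat \<Rightarrow> nat \<Rightarrow> nat \<Rightarrow> 'a::field_char_0" and c1 c2 :: 'a
  assumes c1: "c1 \<noteq> 0" and c2: "c2 \<noteq> 0" and m: "m \<ge> 1"
begin

lemma raise_right:
  assumes "\<And>i l j. i \<le> m \<Longrightarrow> l \<le> b0 \<Longrightarrow> j \<le> b1 \<Longrightarrow> M2 i l j = c2 * raise m i l j" "b1 = b0 + m"
    "s \<le> m" "l \<le> b0"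
  shows "(\<Sum>j\<le>b1. \<alpha> j * M2 (m - s) l j) = c2 * (-1) ^ (m - s) * of_nat ((l + s) choose s) * \<alpha> (l + s)"
proof -
  have "(\<Sum>j\<le>b1. \<alpha> j * M2 (m - s) l j) = (if l + s \<in> {..b1} then \<alpha> (l + s) * M2 (m - s) l (l + s) else 0)"
    using assms by (intro sum_at) (auto simp: raise_def)
  then show ?thesis using assms by (simp add: raise_def mult_ac)
qed

lemma raise_left:
  assumes "\<And>i l j. i \<le> m \<Longrightarrow> l \<le> a0 \<Longrightarrow> j \<le> a1 \<Longrightarrow> M1 i l j = c1 * raise m i l j" "a1 = a0 + m"
    "s \<le> m" "k \<le> a0"
  shows "(\<Sum>j\<le>a1. M1 (m - s) k j * \<beta> j) = c1 * (-1) ^ (m - s) * of_nat ((k + s) choose s) * \<beta> (k + s)"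
proof -
  have "(\<Sum>j\<le>a1. M1 (m - s) k j * \<beta> j) = (if k + s \<in> {..a1} then M1 (m - s) k (k + s) * \<beta> (k + s) else 0)"
    using assms by (intro sum_at) (auto simp: raise_def)
  then show ?thesis using assms by (simp add: raise_def mult_ac)
qed

lemma lower_right:
  assumes "\<And>i l j. i \<le> m \<Longrightarrow> l \<le> b0 \<Longrightarrow> j \<le> b1 \<Longrightarrow> M2 i l j = c2 * lower m b0 i l j"
    "i \<le> m" "l \<le> b0"
  shows "(\<Sum>j\<le>b1. \<alpha> j * M2 i l j) = (if i \<le> l \<and> l - i \<le> b1 then c2 * of_nat ((b0 - l) choose (m - i)) * \<alpha> (l - i) else 0)"
proof -
  have "(\<Sum>j\<le>b1. \<alpha> j * M2 i l j) = (if l - i \<in> {..b1} then \<alpha> (l - i) * M2 i l (l - i) else 0)"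
    using assms by (intro sum_at) (auto simp: lower_def)
  then show ?thesis using assms by (auto simp: lower_def mult_ac)
qed

lemma lower_left:
  assumes "\<And>i l j. i \<le> m \<Longrightarrow> l \<le> a0 \<Longrightarrow> j \<le> a1 \<Longrightarrow> M1 i l j = c1 * lower m a0 i l j"
    "i \<le> m" "k \<le> a0"
  shows "(\<Sum>j\<le>a1. M1 i k j * \<beta> j) = (if i \<le> k \<and> k - i \<le> a1 then c1 * of_nat ((a0 - k) choose (m - i)) * \<beta> (k - i) else 0)"
proof -
  have "(\<Sum>j\<le>a1. M1 i k j * \<beta> j) = (if k - i \<in> {..a1} then M1 i k (k - i) * \<beta> (k - i) else 0)"
    using assms by (intro sum_at) (auto simp: lower_def)
  then show ?thesis using assms by (auto simp: lower_def mult_ac)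
qed

text \<open>The target V(1) has only the rows 0 and 1. Row 0 at s = 0 and row 1 at s = m would need
  the columns -1 and m, which do not exist; hence the zero branches.\<close>

lemma special_left:
  assumes "\<And>i l j. i \<le> m \<Longrightarrow> l \<le> a0 \<Longrightarrow> j \<le> a1 \<Longrightarrow> M1 i l j = c1 * special m i l j" "a0 = 1" "a1 = m - 1"
    "s \<le> m"
  shows "(\<Sum>j\<le>a1. M1 (m - s) 0 j * \<beta> j) = (if s = 0 then 0 else c1 * (-1) ^ (m - s) * \<beta> (s - 1))"
    and "(\<Sum>j\<le>a1. M1 (m - s) 1 j * \<beta> j) = (if s = m then 0 else - (c1 * (-1) ^ (m - s) * of_nat (m - s) * \<beta> s))"
proof -
  have "(\<Sum>j\<le>a1. M1 (m - s) 0 j * \<beta> j) = (if s - 1 \<in> {..a1} then M1 (m - s) 0 (s - 1) * \<beta> (s - 1) else 0)"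
    using assms by (intro sum_at) (auto simp: special_def)
  then show "(\<Sum>j\<le>a1. M1 (m - s) 0 j * \<beta> j) = (if s = 0 then 0 else c1 * (-1) ^ (m - s) * \<beta> (s - 1))"
    using assms by (auto simp: special_def)
  have "(\<Sum>j\<le>a1. M1 (m - s) 1 j * \<beta> j) = (if s \<in> {..a1} then M1 (m - s) 1 s * \<beta> s else 0)"
    using assms by (intro sum_at) (auto simp: special_def)
  then show "(\<Sum>j\<le>a1. M1 (m - s) 1 j * \<beta> j) = (if s = m then 0 else - (c1 * (-1) ^ (m - s) * of_nat (m - s) * \<beta> s))"
    using assms m by (auto simp: special_def)
qed

end

text \<open>The rescaled systems say that an array does not change under (k, q) -> (k+1, q-1); here
  this step is iterated along an antidiagonal.\<close>

lemma antidiagonal: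
  fixes g :: "nat \<Rightarrow> nat \<Rightarrow> 'a"
  assumes "\<And>k q. k < a \<Longrightarrow> 1 \<le> q \<Longrightarrow> q \<le> Q \<Longrightarrow> g k q = g (k + 1) (q - 1)"
  shows "k + e \<le> a \<Longrightarrow> e \<le> q \<Longrightarrow> q \<le> Q \<Longrightarrow> g k q = g (k + e) (q - e)"
proof (induction e)
  case (Suc e)
  then show ?case using assms[of "k + e" "q - e"] by (simp add: Suc_diff_Suc numeral_2_eq_2)
qed simp

lemma choose_fact: "of_nat ((l + s) choose s) * (fact l * fact s) = (fact (l + s) :: 'a::field_char_0)"
  using binomial_fact_lemma[of s "l + s"] by (metis add_diff_cancel_right' le_add2 mult.commute of_nat_fact of_nat_mult)

text \<open>With g = c2 k! j! \<alpha> and h = c1 k! j! \<beta> the system reads g(k, l+s) = -h(k+s,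
  l). Eliminating h between neighbouring equations makes g constant on antidiagonals, and h is -g.
  No boundary condition interferes: every k + j = N from 0 to a0 + b0 + m carries one
  solution.\<close>

lemma sol_raise_raise:
  fixes M1 M2 :: "nat \<Rightarrow> nat \<Rightarrow> nat \<Rightarrow> 'a::field_char_0"
  assumes c: "c1 \<noteq> 0" "c2 \<noteq> 0" and m: "m \<ge> 1"
    and M1: "\<And>i l j. i \<le> m \<Longrightarrow> l \<le> a0 \<Longrightarrow> j \<le> a1 \<Longrightarrow> M1 i l j = c1 * raise m i l j" and a1: "a1 = a0 + m"
    and M2: "\<And>i l j. i \<le> m \<Longrightarrow> l \<le> b0 \<Longrightarrow> j \<le> b1 \<Longrightarrow> M2 i l j = c2 * raise m i l j" and b1: "b1 = b0 + m"
  shows "sol_line m a0 a1 b0 b1 M1 M2 (a0 + b0 + m)"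
proof -
  let ?K = "a0 + b0 + m"
  \<comment> \<open>The solution with g = 1 and h = -1 on the antidiagonal N and 0 elsewhere, scaled
    back to \<alpha> and \<beta>.\<close>
  define A :: "nat \<Rightarrow> nat \<Rightarrow> nat \<Rightarrow> 'a" where "A N k j = (if k + j = N then 1 / (c2 * fact k * fact j) else 0)" for N k j
  define B :: "nat \<Rightarrow> nat \<Rightarrow> nat \<Rightarrow> 'a" where "B N k j = (if k + j = N then - 1 / (c1 * fact k * fact j) else 0)" for N k j
  have sol: "sol m a0 a1 b0 b1 M1 M2 \<alpha> \<beta> \<longleftrightarrow> (\<forall>s\<le>m. \<forall>k\<le>a0. \<forall>l\<le>b0.
     c2 * fact k * fact (l + s) * \<alpha> k (l + s) + c1 * fact (k + s) * fact l * \<beta> (k + s) l = 0)" for \<alpha> \<beta>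
  proof -
    have "(\<Sum>j\<le>b1. \<alpha> k j * M2 (m - s) l j) + (\<Sum>k'\<le>a1. M1 (m - s) k k' * \<beta> k' l) = 0 \<longleftrightarrow>
      c2 * fact k * fact (l + s) * \<alpha> k (l + s) + c1 * fact (k + s) * fact l * \<beta> (k + s) l = 0"
      if "s \<le> m" "k \<le> a0" "l \<le> b0" for s k l
    proof -
      let ?u = "c2 * of_nat ((l + s) choose s) * \<alpha> k (l + s) + c1 * of_nat ((k + s) choose s) * \<beta> (k + s) l"
      have "(\<Sum>j\<le>b1. \<alpha> k j * M2 (m - s) l j) + (\<Sum>k'\<le>a1. M1 (m - s) k k' * \<beta> k' l) = (-1) ^ (m - s) * ?u"
        using raise_right[OF c m M2 b1, of s l "\<alpha> k"] raise_left[OF c m M1 a1, of s k "\<lambda>k'. \<beta> k' l"] that by (simp add: algebra_simps)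
      then have "(\<Sum>j\<le>b1. \<alpha> k j * M2 (m - s) l j) + (\<Sum>k'\<le>a1. M1 (m - s) k k' * \<beta> k' l) = 0 \<longleftrightarrow> (fact l * fact s * fact k) * ?u = 0" by simp
      also have "(fact l * fact s * fact k) * ?u = c2 * fact k * (of_nat ((l + s) choose s) * (fact l * fact s)) * \<alpha> k (l + s)
         + c1 * (of_nat ((k + s) choose s) * (fact k * fact s)) * fact l * \<beta> (k + s) l" by (simp add: algebra_simps)
      finally show ?thesis unfolding choose_fact .
    qed
    then show ?thesis unfolding sol_reverse by auto
  qed
  have "sol_basis m a0 a1 b0 b1 M1 M2 ?K A B" unfolding sol_basis_def
  proof (intro conjI allI impI)
    fix N assume N: "N \<le> ?K"
    show "sol m a0 a1 b0 b1 M1 M2 (A N) (B N)" unfolding sol using c by (auto simp: A_def B_def add_ac)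
    show "int a0 + int b1 - 2 * (int k + int j) = int ?K - 2 * int N" if "A N k j \<noteq> 0" for k j
      using that b1 by (auto simp: A_def split: if_splits)
    show "int a1 + int b0 - 2 * (int k + int j) = int ?K - 2 * int N" if "B N k j \<noteq> 0" for k j
      using that a1 by (auto simp: B_def split: if_splits)
    have "A N (min a0 N) (N - min a0 N) \<noteq> 0" "N - min a0 N \<le> b1" using c N b1 by (auto simp: A_def)
    then show "(\<exists>k\<le>a0. \<exists>j\<le>b1. A N k j \<noteq> 0) \<or> (\<exists>k\<le>a1. \<exists>j\<le>b0. B N k j \<noteq> 0)" by (meson min.cobounded1)
  next
    fix \<alpha> \<beta> assume s: "sol m a0 a1 b0 b1 M1 M2 \<alpha> \<beta>"
    define g where "g k j = c2 * fact k * fact j * \<alpha> k j" for k j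
    define h where "h k j = c1 * fact k * fact j * \<beta> k j" for k j
    have gh: "g k (l + s) = - h (k + s) l" if "s \<le> m" "k \<le> a0" "l \<le> b0" for s k l
      using s that unfolding sol g_def h_def by (simp add: eq_neg_iff_add_eq_0)
    have step: "g k q = g (k + 1) (q - 1)" if "k < a0" "1 \<le> q" "q \<le> b1" for k q
    proof -
      \<comment> \<open>The same entry of h is reached from (k, q) with shift s and from (k+1, q-1)
        with shift s - 1. This needs 1 <= s, and q - b0 <= s keeps the second index of h within
        V(b0); both are compatible with s <= m.\<close>
      define s where "s = max 1 (q - b0)"
      have s: "1 \<le> s" "s \<le> m" "s \<le> q" "q - s \<le> b0" using that b1 m by (auto simp: s_def)
      have "g k (q - s + s) = - h (k + s) (q - s)" using that s by (intro gh) auto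
      moreover have "g (k + 1) (q - s + (s - 1)) = - h (k + 1 + (s - 1)) (q - s)" using that s by (intro gh) auto
      ultimately show ?thesis using s by simp
    qed
    \<comment> \<open>The common value on the antidiagonal N, read off at its point with the largest
      first index.\<close>
    define t where "t N = g (min a0 N) (N - min a0 N)" for N
    have gt: "g k j = t (k + j)" if "k \<le> a0" "j \<le> b1" for k j
    proof -
      have "g k j = g (k + (min a0 (k + j) - k)) (j - (min a0 (k + j) - k))"
        by (rule antidiagonal[where a = a0 and Q = b1 and g = g, OF step]) (use that in auto)
      moreover have "k + (min a0 (k + j) - k) = min a0 (k + j)" "j - (min a0 (k + j) - k) = k + j - min a0 (k + j)" using that by auto
      ultimately show ?thesis by (simp add: t_def)
    qed
    have ht: "h k j = - t (k + j)" if "k \<le> a1" "j \<le> b0" for k j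
    proof -
      \<comment> \<open>The shift s = min k m brings the first index back into the range of g,
        because a1 = a0 + m.\<close>
      have "g (k - min k m) (j + min k m) = - h (k - min k m + min k m) j" using that a1 by (intro gh) auto
      moreover have "g (k - min k m) (j + min k m) = t (k - min k m + (j + min k m))" using that a1 b1 by (intro gt) auto
      ultimately show ?thesis by simp
    qed
    show "\<exists>t. (\<forall>k\<le>a0. \<forall>j\<le>b1. \<alpha> k j = (\<Sum>N\<le>?K. t N * A N k j)) \<and> (\<forall>k\<le>a1. \<forall>j\<le>b0. \<beta> k j = (\<Sum>N\<le>?K. t N * B N k j))"
    proof (intro exI[of _ t] conjI allI impI)
      fix k j assume kj: "k \<le> a0" "j \<le> b1"
      have S: "(\<Sum>N\<le>?K. t N * A N k j) = (if k + j \<in> {..?K} then t (k + j) * A (k + j) k j else 0)"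
        by (rule sum_at) (auto simp: A_def)
      show "\<alpha> k j = (\<Sum>N\<le>?K. t N * A N k j)" unfolding S using gt[OF kj] kj b1 c by (simp add: A_def g_def field_simps)
    next
      fix k j assume kj: "k \<le> a1" "j \<le> b0"
      have S: "(\<Sum>N\<le>?K. t N * B N k j) = (if k + j \<in> {..?K} then t (k + j) * B (k + j) k j else 0)"
        by (rule sum_at) (auto simp: B_def)
      show "\<beta> k j = (\<Sum>N\<le>?K. t N * B N k j)" unfolding S using ht[OF kj] kj a1 c by (simp add: B_def h_def field_simps eq_neg_iff_add_eq_0)
    qed
  qed
  then show ?thesis unfolding sol_line_def by blast
qed

text \<open>The equations for x_m express \<beta> k j through \<alpha> (k+m) (j-m); those for x_0
  express \<alpha> k j through \<beta> k j, with a nonzero binomial in front of \<alpha>. So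
  \<alpha> at column j is a multiple of \<alpha> at column j - m, and the descent ends in 0.\<close>

lemma sol_lower_lower:
  fixes M1 M2 :: "nat \<Rightarrow> nat \<Rightarrow> nat \<Rightarrow> 'a::field_char_0"
  assumes c: "c1 \<noteq> 0" "c2 \<noteq> 0" and m: "m \<ge> 1"
    and M1: "\<And>i l j. i \<le> m \<Longrightarrow> l \<le> a0 \<Longrightarrow> j \<le> a1 \<Longrightarrow> M1 i l j = c1 * lower m a0 i l j" and a0: "a0 = a1 + m"
    and M2: "\<And>i l j. i \<le> m \<Longrightarrow> l \<le> b0 \<Longrightarrow> j \<le> b1 \<Longrightarrow> M2 i l j = c2 * lower m b0 i l j" and b0: "b0 = b1 + m"
  shows "sol_zero m a0 a1 b0 b1 M1 M2"
  unfolding sol_zero_def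
proof (intro allI impI)
  fix \<alpha> \<beta> assume s: "sol m a0 a1 b0 b1 M1 M2 \<alpha> \<beta>"
  have eq: "(if i \<le> l \<and> l - i \<le> b1 then c2 * of_nat ((b0 - l) choose (m - i)) * \<alpha> k (l - i) else 0) +
     (if i \<le> k \<and> k - i \<le> a1 then c1 * of_nat ((a0 - k) choose (m - i)) * \<beta> (k - i) l else 0) = 0" if "i \<le> m" "k \<le> a0" "l \<le> b0" for i k l

    using s[unfolded sol_def, rule_format, OF that]
    unfolding lower_right[where ?b1.0 = b1, OF c m M2 that(1,3), where \<alpha> = "\<alpha> k", simplified]
      lower_left[where ?a1.0 = a1, OF c m M1 that(1,2), where \<beta> = "\<lambda>k'. \<beta> k' l", simplified] .
  \<comment> \<open>For x_m both binomials equal 1. If j < m, the column j - m does not exist and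
    \<beta> vanishes outright.\<close>
  have ba: "c1 * \<beta> k j = (if m \<le> j then - c2 * \<alpha> (k + m) (j - m) else 0)" if "k \<le> a1" "j \<le> b0" for k j
    using eq[of m "k + m" j] that a0 b0 by (auto simp: eq_neg_iff_add_eq_0 add.commute split: if_splits)
  have al: "k \<le> a0 \<Longrightarrow> j \<le> b1 \<Longrightarrow> \<alpha> k j = 0" for k j
  proof (induction j arbitrary: k rule: less_induct)
    case (less j)
    have n: "of_nat ((b0 - j) choose m) \<noteq> (0::'a)" using less.prems b0 by simp
    show ?case
    proof (cases "k \<le> a1")
      case True
      have "m \<le> j \<Longrightarrow> \<alpha> (k + m) (j - m) = 0" using True less m a0 by (intro less.IH) auto
      then have "\<beta> k j = 0" using ba[of k j] True less.prems b0 c by (auto split: if_splits)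
      then show ?thesis using eq[of 0 k j] less.prems n c b0 by (auto split: if_splits)
    next
      case False
      then show ?thesis using eq[of 0 k j] less.prems n c b0 by (auto split: if_splits)
    qed
  qed
  have "\<beta> k j = 0" if "k \<le> a1" "j \<le> b0" for k j
    using ba[OF that] al[of "k + m" "j - m"] that a0 b0 c by (auto split: if_splits)
  then show "(\<forall>k\<le>a0. \<forall>j\<le>b1. \<alpha> k j = 0) \<and> (\<forall>k\<le>a1. \<forall>j\<le>b0. \<beta> k j = 0)" using al by blast
qed

text \<open>The equation of x_0 in row 1 and that of x_m in row 0 contain no \<beta>, so they kill
  \<alpha>; the remaining equations of row 0 then give \<beta> = 0.\<close>

lemma sol_special_lower:
  fixes M1 M2 :: "nat \<Rightarrow> nat \<Rightarrow> nat \<Rightarrow> 'a::field_char_0"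
  assumes c: "c1 \<noteq> 0" "c2 \<noteq> 0" and m: "m \<ge> 1"
    and M1: "\<And>i l j. i \<le> m \<Longrightarrow> l \<le> a0 \<Longrightarrow> j \<le> a1 \<Longrightarrow> M1 i l j = c1 * special m i l j" and a: "a0 = 1" "a1 = m - 1"
    and M2: "\<And>i l j. i \<le> m \<Longrightarrow> l \<le> b0 \<Longrightarrow> j \<le> b1 \<Longrightarrow> M2 i l j = c2 * lower m b0 i l j" and b0: "b0 = b1 + m"
  shows "sol_zero m a0 a1 b0 b1 M1 M2"
  unfolding sol_zero_def
proof (intro allI impI)
  fix \<alpha> \<beta> assume s: "sol m a0 a1 b0 b1 M1 M2 \<alpha> \<beta>"
  have eq: "(if i \<le> l \<and> l - i \<le> b1 then c2 * of_nat ((b0 - l) choose (m - i)) * \<alpha> k (l - i) else 0) + (\<Sum>k'\<le>a1. M1 i k k' * \<beta> k' l) = 0"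
    if "i \<le> m" "k \<le> a0" "l \<le> b0" for i k l
    using s[unfolded sol_def, rule_format, OF that]
    unfolding lower_right[where ?b1.0 = b1, OF c m M2 that(1,3), where \<alpha> = "\<alpha> k", simplified] .
  have 1: "\<alpha> 1 j = 0" if "j \<le> b1" for j
  proof -
    have "of_nat ((b0 - j) choose m) \<noteq> (0::'a)" using that b0 by simp
    then show ?thesis using eq[of 0 1 j] special_left(2)[OF c m M1 a, of m "\<lambda>k'. \<beta> k' j"] that a b0 c by simp
  qed
  have 0: "\<alpha> 0 j = 0" if "j \<le> b1" for j
    using eq[of m 0 "j + m"] special_left(1)[OF c m M1 a, of 0 "\<lambda>k'. \<beta> k' (j + m)"] that a b0 c by simp
  have al: "\<alpha> k j = 0" if "k \<le> a0" "j \<le> b1" for k j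
    using that a 0 1 by (cases "k = 0") (auto simp: le_Suc_eq)
  have "\<beta> k j = 0" if "k \<le> a1" "j \<le> b0" for k j
    using eq[of "m - (k + 1)" 0 j] special_left(1)[OF c m M1 a, of "k + 1" "\<lambda>k'. \<beta> k' j"] that a m c al[of 0 "j - (m - (k + 1))"]
    by (auto split: if_splits)
  then show "(\<forall>k\<le>a0. \<forall>j\<le>b1. \<alpha> k j = 0) \<and> (\<forall>k\<le>a1. \<forall>j\<le>b0. \<beta> k j = 0)" using al by blast
qed

text \<open>The system written row by row for V(1), with the common sign (-1)^(m-s)
  cancelled.\<close>

lemma special_raise_eqs:
  fixes M1 M2 :: "nat \<Rightarrow> nat \<Rightarrow> nat \<Rightarrow> 'a::field_char_0"
  assumes c: "c1 \<noteq> 0" "c2 \<noteq> 0" and m: "m \<ge> 1"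
    and M1: "\<And>i l j. i \<le> m \<Longrightarrow> l \<le> a0 \<Longrightarrow> j \<le> a1 \<Longrightarrow> M1 i l j = c1 * special m i l j" and a: "a0 = 1" "a1 = m - 1"
    and M2: "\<And>i l j. i \<le> m \<Longrightarrow> l \<le> b0 \<Longrightarrow> j \<le> b1 \<Longrightarrow> M2 i l j = c2 * raise m i l j" and b1: "b1 = b0 + m"
  shows "sol m a0 a1 b0 b1 M1 M2 \<alpha> \<beta> \<longleftrightarrow> (\<forall>s\<le>m. \<forall>l\<le>b0.
     c2 * of_nat ((l + s) choose s) * \<alpha> 0 (l + s) = (if s = 0 then 0 else - c1 * \<beta> (s - 1) l) \<and>
     c2 * of_nat ((l + s) choose s) * \<alpha> 1 (l + s) = (if s = m then 0 else c1 * of_nat (m - s) * \<beta> s l))"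
proof -
  have eq0: "(\<Sum>j\<le>b1. \<alpha> 0 j * M2 (m - s) l j) + (\<Sum>k'\<le>a1. M1 (m - s) 0 k' * \<beta> k' l) = 0 \<longleftrightarrow>
      c2 * of_nat ((l + s) choose s) * \<alpha> 0 (l + s) = (if s = 0 then 0 else - c1 * \<beta> (s - 1) l)" if "s \<le> m" "l \<le> b0" for s l
  proof -
    have "(\<Sum>j\<le>b1. \<alpha> 0 j * M2 (m - s) l j) + (\<Sum>k'\<le>a1. M1 (m - s) 0 k' * \<beta> k' l) =
      (-1) ^ (m - s) * (c2 * of_nat ((l + s) choose s) * \<alpha> 0 (l + s) - (if s = 0 then 0 else - c1 * \<beta> (s - 1) l))"
      using raise_right[OF c m M2 b1 that, of "\<alpha> 0"] special_left(1)[OF c m M1 a that(1), of "\<lambda>k'. \<beta> k' l"] by (simp add: algebra_simps)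
    then show ?thesis by simp
  qed
  have eq1: "(\<Sum>j\<le>b1. \<alpha> 1 j * M2 (m - s) l j) + (\<Sum>k'\<le>a1. M1 (m - s) 1 k' * \<beta> k' l) = 0 \<longleftrightarrow>
      c2 * of_nat ((l + s) choose s) * \<alpha> 1 (l + s) = (if s = m then 0 else c1 * of_nat (m - s) * \<beta> s l)" if "s \<le> m" "l \<le> b0" for s l
  proof -
    have "(\<Sum>j\<le>b1. \<alpha> 1 j * M2 (m - s) l j) + (\<Sum>k'\<le>a1. M1 (m - s) 1 k' * \<beta> k' l) =
      (-1) ^ (m - s) * (c2 * of_nat ((l + s) choose s) * \<alpha> 1 (l + s) - (if s = m then 0 else c1 * of_nat (m - s) * \<beta> s l))"
      using raise_right[OF c m M2 b1 that, of "\<alpha> 1"] special_left(2)[OF c m M1 a that(1), of "\<lambda>k'. \<beta> k' l"] by (simp add: algebra_simps)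
    then show ?thesis by simp
  qed
  have k01: "k = 0 \<or> k = 1" if "k \<le> a0" for k using that a by auto
  show ?thesis
  proof
    assume s: "sol m a0 a1 b0 b1 M1 M2 \<alpha> \<beta>"
    show "\<forall>s\<le>m. \<forall>l\<le>b0.
     c2 * of_nat ((l + s) choose s) * \<alpha> 0 (l + s) = (if s = 0 then 0 else - c1 * \<beta> (s - 1) l) \<and>
     c2 * of_nat ((l + s) choose s) * \<alpha> 1 (l + s) = (if s = m then 0 else c1 * of_nat (m - s) * \<beta> s l)"
    proof (intro allI impI)
      fix s l assume sl: "s \<le> m" "l \<le> b0"
      have e: "(\<Sum>j\<le>b1. \<alpha> k j * M2 (m - s) l j) + (\<Sum>k'\<le>a1. M1 (m - s) k k' * \<beta> k' l) = 0" if "k \<le> a0" for k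
        using s sl that unfolding sol_reverse by blast
      show "c2 * of_nat ((l + s) choose s) * \<alpha> 0 (l + s) = (if s = 0 then 0 else - c1 * \<beta> (s - 1) l) \<and>
         c2 * of_nat ((l + s) choose s) * \<alpha> 1 (l + s) = (if s = m then 0 else c1 * of_nat (m - s) * \<beta> s l)"
        using eq0[OF sl] eq1[OF sl] e[of 0] e[of 1] a by simp
    qed
  next
    assume r: "\<forall>s\<le>m. \<forall>l\<le>b0.
     c2 * of_nat ((l + s) choose s) * \<alpha> 0 (l + s) = (if s = 0 then 0 else - c1 * \<beta> (s - 1) l) \<and>
     c2 * of_nat ((l + s) choose s) * \<alpha> 1 (l + s) = (if s = m then 0 else c1 * of_nat (m - s) * \<beta> s l)"
    show "sol m a0 a1 b0 b1 M1 M2 \<alpha> \<beta>" unfolding sol_reverse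
    proof (intro allI impI)
      fix s k l assume skl: "s \<le> m" "k \<le> a0" "l \<le> b0"
      show "(\<Sum>j\<le>b1. \<alpha> k j * M2 (m - s) l j) + (\<Sum>k'\<le>a1. M1 (m - s) k k' * \<beta> k' l) = 0"
        using k01[OF skl(2)] eq0[OF skl(1,3)] eq1[OF skl(1,3)] r skl by blast
    qed
  qed
qed

text \<open>For b0 = 0 the equations merely compute \<alpha> from the m arbitrary numbers
  \<open>\<beta> k 0\<close>, which gives V(m-1). For b0 > 0 the columns l = 0 and l = 1 give two
  incompatible expressions for the same entries of \<alpha>, and everything is forced to be
  0.\<close>

lemma sol_special_raise:
  fixes M1 M2 :: "nat \<Rightarrow> nat \<Rightarrow> nat \<Rightarrow> 'a::field_char_0"
  assumes c: "c1 \<noteq> 0" "c2 \<noteq> 0" and m: "m \<ge> 1"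
    and M1: "\<And>i l j. i \<le> m \<Longrightarrow> l \<le> a0 \<Longrightarrow> j \<le> a1 \<Longrightarrow> M1 i l j = c1 * special m i l j" and a: "a0 = 1" "a1 = m - 1"
    and M2: "\<And>i l j. i \<le> m \<Longrightarrow> l \<le> b0 \<Longrightarrow> j \<le> b1 \<Longrightarrow> M2 i l j = c2 * raise m i l j" and b1: "b1 = b0 + m"
  shows "b0 = 0 \<Longrightarrow> sol_line m a0 a1 b0 b1 M1 M2 (m - 1)" and "b0 \<noteq> 0 \<Longrightarrow> sol_zero m a0 a1 b0 b1 M1 M2"
proof -
  have sol: "sol m a0 a1 b0 b1 M1 M2 \<alpha> \<beta> \<longleftrightarrow> (\<forall>s\<le>m. \<forall>l\<le>b0.
     c2 * of_nat ((l + s) choose s) * \<alpha> 0 (l + s) = (if s = 0 then 0 else - c1 * \<beta> (s - 1) l) \<and>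
     c2 * of_nat ((l + s) choose s) * \<alpha> 1 (l + s) = (if s = m then 0 else c1 * of_nat (m - s) * \<beta> s l))" for \<alpha> \<beta>
    by (rule special_raise_eqs[OF c m M1 a M2 b1])
  {
    assume b0: "b0 = 0"
    \<comment> \<open>The solution in which c1 times \<open>\<beta> k 0\<close> is 1 for k = N and 0
      otherwise.\<close>
    define A :: "nat \<Rightarrow> nat \<Rightarrow> nat \<Rightarrow> 'a" where "A N k j = (if k = 0 then if j = N + 1 then - 1 / c2 else 0 else if j = N then of_nat (m - N) / c2 else 0)" for N k j
    define B :: "nat \<Rightarrow> nat \<Rightarrow> nat \<Rightarrow> 'a" where "B N k j = (if k = N then 1 / c1 else 0)" for N k j
    have "sol_basis m a0 a1 b0 b1 M1 M2 (m - 1) A B" unfolding sol_basis_def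
    proof (intro conjI allI impI)
      fix N assume N: "N \<le> m - 1"
      show "sol m a0 a1 b0 b1 M1 M2 (A N) (B N)" unfolding sol using c b0 N m by (auto simp: A_def B_def)
      show "int a0 + int b1 - 2 * (int k + int j) = int (m - 1) - 2 * int N" if "k \<le> a0" "A N k j \<noteq> 0" for k j
        using that b1 a b0 m by (auto simp: A_def split: if_splits)
      show "int a1 + int b0 - 2 * (int k + int j) = int (m - 1) - 2 * int N" if "j \<le> b0" "B N k j \<noteq> 0" for k j
        using that a b0 by (auto simp: B_def split: if_splits)
      have "A N 0 (N + 1) \<noteq> 0" "N + 1 \<le> b1" using c N b1 m by (auto simp: A_def)
      then show "(\<exists>k\<le>a0. \<exists>j\<le>b1. A N k j \<noteq> 0) \<or> (\<exists>k\<le>a1. \<exists>j\<le>b0. B N k j \<noteq> 0)" by blast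
    next
      fix \<alpha> \<beta> assume s: "sol m a0 a1 b0 b1 M1 M2 \<alpha> \<beta>"
      have e: "c2 * \<alpha> 0 s = (if s = 0 then 0 else - c1 * \<beta> (s - 1) 0)" "c2 * \<alpha> 1 s = (if s = m then 0 else c1 * of_nat (m - s) * \<beta> s 0)"
        if "s \<le> m" for s
        using s[unfolded sol, rule_format, of s 0] that by auto
      show "\<exists>t. (\<forall>k\<le>a0. \<forall>j\<le>b1. \<alpha> k j = (\<Sum>N\<le>m-1. t N * A N k j)) \<and> (\<forall>k\<le>a1. \<forall>j\<le>b0. \<beta> k j = (\<Sum>N\<le>m-1. t N * B N k j))"
      proof (intro exI[of _ "\<lambda>N. c1 * \<beta> N 0"] conjI allI impI)
        fix k j assume kj: "k \<le> a0" "j \<le> b1"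
        show "\<alpha> k j = (\<Sum>N\<le>m-1. c1 * \<beta> N 0 * A N k j)"
        proof (cases "k = 0")
          case True
          have "(\<Sum>N\<le>m-1. c1 * \<beta> N 0 * A N k j) = (if j - 1 \<in> {..m-1} then c1 * \<beta> (j - 1) 0 * A (j - 1) k j else 0)"
            using True by (intro sum_at) (auto simp: A_def)
          then show ?thesis using True e(1)[of j] kj b1 b0 c m by (cases "j = 0") (auto simp: A_def field_simps)
        next
          case False
          then have k: "k = 1" using kj a by simp
          have "(\<Sum>N\<le>m-1. c1 * \<beta> N 0 * A N k j) = (if j \<in> {..m-1} then c1 * \<beta> j 0 * A j k j else 0)"
            using False by (intro sum_at) (auto simp: A_def)
          then show ?thesis using k e(2)[of j] kj b1 b0 c m by (cases "j = m") (auto simp: A_def field_simps)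
        qed
      next
        fix k j assume kj: "k \<le> a1" "j \<le> b0"
        have "(\<Sum>N\<le>m-1. c1 * \<beta> N 0 * B N k j) = (if k \<in> {..m-1} then c1 * \<beta> k 0 * B k k j else 0)"
          by (rule sum_at) (auto simp: B_def)
        then show "\<beta> k j = (\<Sum>N\<le>m-1. c1 * \<beta> N 0 * B N k j)" using kj a b0 c by (simp add: B_def)
      qed
    qed
    then show "sol_line m a0 a1 b0 b1 M1 M2 (m - 1)" unfolding sol_line_def by blast
  next
    assume b0: "b0 \<noteq> 0"
    show "sol_zero m a0 a1 b0 b1 M1 M2" unfolding sol_zero_def
    proof (intro allI impI)
      fix \<alpha> \<beta> assume s: "sol m a0 a1 b0 b1 M1 M2 \<alpha> \<beta>"
      define X where "X j = c2 * \<alpha> 0 j" for j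
      define Y where "Y j = c2 * \<alpha> 1 j" for j
      define b where "b k l = c1 * \<beta> k l" for k l
      have e1: "of_nat ((l + Suc s) choose Suc s) * X (l + Suc s) = - b s l" if "s < m" "l \<le> b0" for s l
        using s[unfolded sol, rule_format, of "Suc s" l] that unfolding X_def b_def by (simp add: mult_ac del: binomial_Suc_Suc)
      have e0: "X l = 0" if "l \<le> b0" for l
        using s[unfolded sol, rule_format, of 0 l] that unfolding X_def by simp
      have f1: "of_nat ((l + s) choose s) * Y (l + s) = of_nat (m - s) * b s l" if "s < m" "l \<le> b0" for s l
        using s[unfolded sol, rule_format, of s l] that unfolding Y_def b_def by (simp add: mult_ac)
      have f0: "Y (l + m) = 0" if "l \<le> b0" for l
      proof -
        have "of_nat ((l + m) choose m) * Y (l + m) = 0"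
          using s[unfolded sol, rule_format, of m l] that unfolding Y_def by (simp add: mult_ac)
        then show ?thesis by simp
      qed
      have X: "X j = 0" if j: "j \<le> b1" for j
      proof -
        consider "j \<le> b0" | "j > b0" "j > m" | "j > b0" "j \<le> m" by linarith
        then show ?thesis
        proof cases
          case 1
          then show ?thesis by (rule e0)
        next
          case 2
          \<comment> \<open>Here l is at least 1, so m - 1 + l is an index at which
            \<open>f0\<close> makes Y vanish; hence \<open>b (m - 1) l\<close> and with it
            \<open>X j\<close> are 0.\<close>
          define l where "l = j - m"
          have l: "j = l + Suc (m - 1)" "l \<le> b0" "1 \<le> l" using 2 j b1 m by (auto simp: l_def)
          have "Y (l + (m - 1)) = 0" using f0[of "l - 1"] l m by simp
          then have "b (m - 1) l = 0" using f1[of "m - 1" l] l m by simp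
          then show ?thesis using e1[of "m - 1" l] l m by simp
        next
          case 3
          then obtain r where r: "j = Suc (Suc r)" using b0 by (metis Suc_lessE gr0_implies_Suc less_nat_zero_code neq0_conv)
          \<comment> \<open>Both X at r+2 and Y at r+1 are computed once from l = 0 and once from l
            = 1, through \<open>b (Suc r) 0\<close> and \<open>b r 1\<close>. Eliminating these two
            leaves \<open>X j\<close> times the difference of (r+1)(m-r-1) and (m-r)(r+2), and the
            first product is the smaller one.\<close>
          have 1: "X j = - b (Suc r) 0" using e1[of "Suc r" 0] 3 r by simp
          have 2: "of_nat (Suc (Suc r)) * X j = - b r 1" using e1[of r 1] 3 r b0 by simp
          have 4: "Y (Suc r) = of_nat (m - Suc r) * b (Suc r) 0" using f1[of "Suc r" 0] 3 r by simp
          have 5: "of_nat (Suc r) * Y (Suc r) = of_nat (m - r) * b r 1" using f1[of r 1] 3 r b0 by simp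
          have "of_nat (Suc r) * (of_nat (m - Suc r) * X j) = of_nat (m - r) * (of_nat (Suc (Suc r)) * X j)"
            using 4 5 unfolding 2 unfolding 1 by (simp add: mult_ac)
          then have "(of_nat (Suc r * (m - Suc r)) - of_nat ((m - r) * Suc (Suc r))) * X j = 0"
            by (simp only: of_nat_mult left_diff_distrib mult.assoc) simp
          moreover have "Suc r * (m - Suc r) \<noteq> (m - r) * Suc (Suc r)"
          proof -
            have "m - r = Suc (m - Suc r)" using 3 r by simp
            moreover have "Suc r * x < Suc x * Suc (Suc r)" for x by (simp add: algebra_simps)
            ultimately show ?thesis by (metis less_irrefl)
          qed
          ultimately show ?thesis by (metis mult_eq_0_iff of_nat_eq_iff right_minus_eq)
        qed
      qed
      have b: "b s l = 0" if "s < m" "l \<le> b0" for s l using e1[OF that] X[of "l + Suc s"] that b1 by simp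
      have Y: "Y j = 0" if "j \<le> b1" for j
      proof (cases "j < m")
        case True
        then show ?thesis using f1[of j 0] b[of j 0] by simp
      next
        case False
        then show ?thesis using f0[of "j - m"] that b1 by simp
      qed
      have "\<alpha> k j = 0" if "k \<le> a0" "j \<le> b1" for k j
        using that a X[of j] Y[of j] c by (cases "k = 0") (auto simp: X_def Y_def le_Suc_eq)
      moreover have "\<beta> k j = 0" if "k \<le> a1" "j \<le> b0" for k j
        using b[of k j] that a m c by (simp add: b_def)
      ultimately show "(\<forall>k\<le>a0. \<forall>j\<le>b1. \<alpha> k j = 0) \<and> (\<forall>k\<le>a1. \<forall>j\<le>b0. \<beta> k j = 0)" by blast
    qed
  }
qed

text \<open>The rescaled arrays satisfy g(k, l+s) = -\<epsilon> h(k+s, l) with \<epsilon> = (-1)^m.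
  So g is constant along the antidiagonals of the strip k <= a0, q <= b0 + m, and since it is 0 for
  q < m and for q > b0, it vanishes on every antidiagonal that meets one of these regions. The
  survivors are those with a0 + m <= k + q <= b0: b1 - a0 + 1 of them if a0 <= b1, and none
  otherwise.\<close>

lemma sol_raise_lower:
  fixes M1 M2 :: "nat \<Rightarrow> nat \<Rightarrow> nat \<Rightarrow> 'a::field_char_0"
  assumes c: "c1 \<noteq> 0" "c2 \<noteq> 0" and m: "m \<ge> 1"
    and M1: "\<And>i l j. i \<le> m \<Longrightarrow> l \<le> a0 \<Longrightarrow> j \<le> a1 \<Longrightarrow> M1 i l j = c1 * raise m i l j" and a1: "a1 = a0 + m"
    and M2: "\<And>i l j. i \<le> m \<Longrightarrow> l \<le> b0 \<Longrightarrow> j \<le> b1 \<Longrightarrow> M2 i l j = c2 * lower m b0 i l j" and b0: "b0 = b1 + m"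
  shows "a0 \<le> b1 \<Longrightarrow> sol_line m a0 a1 b0 b1 M1 M2 (b1 - a0)" and "b1 < a0 \<Longrightarrow> sol_zero m a0 a1 b0 b1 M1 M2"
proof -
  \<comment> \<open>The index is q = j + m because the equation for s and l involves the column j =
    l + s - m. The value 0 outside the range encodes that this column need not exist, and it
    supplies the boundary conditions.\<close>
  define g :: "(nat \<Rightarrow> nat \<Rightarrow> 'a) \<Rightarrow> nat \<Rightarrow> nat \<Rightarrow> 'a" where
    "g \<alpha> k q = (if m \<le> q \<and> q \<le> b0 then c2 * (-1) ^ k * fact k / fact (b0 - q) * \<alpha> k (q - m) else 0)" for \<alpha> k q
  define h :: "(nat \<Rightarrow> nat \<Rightarrow> 'a) \<Rightarrow> nat \<Rightarrow> nat \<Rightarrow> 'a" where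
    "h \<beta> k l = c1 * (-1) ^ k * fact k / fact (b0 - l) * \<beta> k l" for \<beta> k l
  define \<epsilon> :: 'a where "\<epsilon> = (-1) ^ m"
  have sq: "(-1) ^ k * (-1) ^ k = (1::'a)" for k by (simp flip: power_add mult_2)
  have \<epsilon>2: "\<epsilon> * \<epsilon> = 1" by (simp add: \<epsilon>_def power_mult_distrib[symmetric])
  have sol: "sol m a0 a1 b0 b1 M1 M2 \<alpha> \<beta> \<longleftrightarrow> (\<forall>s\<le>m. \<forall>k\<le>a0. \<forall>l\<le>b0. g \<alpha> k (l + s) + \<epsilon> * h \<beta> (k + s) l = 0)" for \<alpha> \<beta>
  proof -
    have "(\<Sum>j\<le>b1. \<alpha> k j * M2 (m - s) l j) + (\<Sum>k'\<le>a1. M1 (m - s) k k' * \<beta> k' l) = 0 \<longleftrightarrow> g \<alpha> k (l + s) + \<epsilon> * h \<beta> (k + s) l = 0"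
      if skl: "s \<le> m" "k \<le> a0" "l \<le> b0" for s k l
    proof -
      \<comment> \<open>This factor absorbs both binomials: C(b0-l, s) s!/(b0-l)! = 1/(b0-l-s)! and
        C(k+s, s) k! s! = (k+s)!. The sign (-1)^k combines with (-1)^(m-s) to \<epsilon>
        (-1)^(k+s).\<close>
      let ?f = "(-1) ^ k * fact k * fact s / fact (b0 - l) :: 'a"
      let ?S1 = "\<Sum>j\<le>b1. \<alpha> k j * M2 (m - s) l j" and ?S2 = "\<Sum>k'\<le>a1. M1 (m - s) k k' * \<beta> k' l"
      have ms: "m - (m - s) = s" using skl by simp
      have S1: "?S1 = (if m - s \<le> l \<and> l - (m - s) \<le> b1 then c2 * of_nat ((b0 - l) choose s) * \<alpha> k (l - (m - s)) else 0)"
        using lower_right[where ?b1.0 = b1, OF c m M2, of "m - s" l "\<alpha> k"] skl unfolding ms by simp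
      have S2: "?S2 = c1 * (-1) ^ (m - s) * of_nat ((k + s) choose s) * \<beta> (k + s) l"
        using raise_left[OF c m M1 a1, of s k "\<lambda>k'. \<beta> k' l"] skl by simp
      have "?f * ?S1 = g \<alpha> k (l + s)"
      proof (cases "m \<le> l + s \<and> l + s \<le> b0")
        case True
        then have "of_nat ((b0 - (l + s) + s) choose s) * (fact (b0 - (l + s)) * fact s) = (fact (b0 - (l + s) + s) :: 'a)"
          by (intro choose_fact)
        moreover have "b0 - (l + s) + s = b0 - l" using True by simp
        ultimately have cf: "of_nat ((b0 - l) choose s) * (fact (b0 - (l + s)) * fact s) = (fact (b0 - l) :: 'a)" by simp
        have "fact s * of_nat ((b0 - l) choose s) / fact (b0 - l) = (1 / fact (b0 - (l + s)) :: 'a)"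
          unfolding cf[symmetric] using binomial_eq_0_iff[of "b0 - l" s] True by (simp add: field_simps) linarith
        moreover have "l - (m - s) = l + s - m" using skl by simp
        moreover have "m - s \<le> l \<and> l - (m - s) \<le> b1" using True skl b0 by auto
        ultimately show ?thesis unfolding S1 g_def using True by (simp add: field_simps)
      next
        case False
        then have "\<not> (m - s \<le> l \<and> l - (m - s) \<le> b1)" using skl b0 by auto
        then show ?thesis unfolding S1 g_def using False by (simp only: if_False) simp
      qed
      moreover have "?f * ?S2 = \<epsilon> * h \<beta> (k + s) l"
      proof -
        have "(-1 :: 'a) ^ k * (-1) ^ (m - s) = (-1) ^ (m - s + k + 2 * s)" by (simp add: power_add)
        also have "m - s + k + 2 * s = m + (k + s)" using skl by simp
        finally have sg: "(-1 :: 'a) ^ k * (-1) ^ (m - s) = \<epsilon> * (-1) ^ (k + s)" by (simp add: \<epsilon>_def power_add)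
        have "?f * ?S2 = c1 * ((-1) ^ k * (-1) ^ (m - s)) * (of_nat ((k + s) choose s) * (fact k * fact s)) / fact (b0 - l) * \<beta> (k + s) l"
          unfolding S2 by (simp add: field_simps)
        then show ?thesis unfolding sg choose_fact h_def by (simp add: field_simps)
      qed
      ultimately have "g \<alpha> k (l + s) + \<epsilon> * h \<beta> (k + s) l = ?f * (?S1 + ?S2)" by (simp add: distrib_left)
      then show ?thesis by simp
    qed
    then show ?thesis unfolding sol_reverse by auto
  qed
  have main: "\<exists>t. (\<forall>k\<le>a0. \<forall>j\<le>b1. \<alpha> k j = (if a0 \<le> k + j \<and> k + j \<le> b1 then t (k + j - a0) * ((-1) ^ k * fact (b1 - j) / (c2 * fact k)) else 0)) \<and>
      (\<forall>k\<le>a1. \<forall>l\<le>b0. \<beta> k l = (if a0 + m \<le> k + l \<and> k + l \<le> b0 then t (k + l - a0 - m) * (- \<epsilon> * (-1) ^ k * fact (b0 - l) / (c1 * fact k)) else 0))"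
    if s: "sol m a0 a1 b0 b1 M1 M2 \<alpha> \<beta>" for \<alpha> \<beta>
  proof -
    have gh: "g \<alpha> k (l + s) = - \<epsilon> * h \<beta> (k + s) l" if "s \<le> m" "k \<le> a0" "l \<le> b0" for s k l
      using s that unfolding sol by (simp add: eq_neg_iff_add_eq_0)
    have step: "g \<alpha> k q = g \<alpha> (k + 1) (q - 1)" if "k < a0" "1 \<le> q" "q \<le> b0 + m" for k q
    proof -
      define s where "s = max 1 (q - b0)"
      have s: "1 \<le> s" "s \<le> m" "s \<le> q" "q - s \<le> b0" using that m by (auto simp: s_def)
      have "g \<alpha> k (q - s + s) = - \<epsilon> * h \<beta> (k + s) (q - s)" using that s by (intro gh) auto
      moreover have "g \<alpha> (k + 1) (q - s + (s - 1)) = - \<epsilon> * h \<beta> (k + 1 + (s - 1)) (q - s)" using that s by (intro gh) auto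
      ultimately show ?thesis using s by simp
    qed
    note anti = antidiagonal[where a = a0 and Q = "b0 + m" and g = "g \<alpha>", OF step]
    define t where "t N = g \<alpha> a0 (N + m)" for N
    \<comment> \<open>Each case walks along the antidiagonal to a point with known value: up to q =
      b0 + 1 or down to some q < m, where g is 0, or to k = a0, where \<open>t\<close> is read
      off.\<close>
    have G: "g \<alpha> k q = (if a0 + m \<le> k + q \<and> k + q \<le> b0 then t (k + q - a0 - m) else 0)" if kq: "k \<le> a0" "q \<le> b0 + m" for k q
    proof -
      consider "k + q > b0" "q > b0" | "k + q > b0" "q \<le> b0" | "k + q < a0 + m" | "a0 + m \<le> k + q" "k + q \<le> b0" by linarith
      then show ?thesis
      proof cases
        case 1
        then show ?thesis by (simp add: g_def)
      next
        case 2
        have "g \<alpha> (k - (b0 + 1 - q)) (q + (b0 + 1 - q)) = g \<alpha> (k - (b0 + 1 - q) + (b0 + 1 - q)) (q + (b0 + 1 - q) - (b0 + 1 - q))"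
          using 2 kq m by (intro anti) auto
        moreover have "g \<alpha> (k - (b0 + 1 - q)) (q + (b0 + 1 - q)) = 0" using 2 by (simp add: g_def)
        ultimately show ?thesis using 2 by simp
      next
        case 3
        have "g \<alpha> k q = g \<alpha> (k + min (a0 - k) q) (q - min (a0 - k) q)" using kq by (intro anti) auto
        also have "\<dots> = 0" using 3 kq m by (auto simp: g_def)
        finally show ?thesis using 3 by simp
      next
        case 4
        have "g \<alpha> k q = g \<alpha> (k + (a0 - k)) (q - (a0 - k))" using 4 kq by (intro anti) auto
        then show ?thesis using 4 kq by (simp add: t_def add.commute)
      qed
    qed
    show ?thesis
    proof (intro exI[of _ t] conjI allI impI)
      fix k j assume kj: "k \<le> a0" "j \<le> b1"
      have "g \<alpha> k (j + m) = c2 * (-1) ^ k * fact k / fact (b1 - j) * \<alpha> k j" using kj b0 by (simp add: g_def)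
      then have "g \<alpha> k (j + m) * ((-1) ^ k * fact (b1 - j) / (c2 * fact k)) = ((-1) ^ k * (-1) ^ k) * \<alpha> k j"
        using c by simp
      then have "\<alpha> k j = g \<alpha> k (j + m) * ((-1) ^ k * fact (b1 - j) / (c2 * fact k))" unfolding sq by simp
      then show "\<alpha> k j = (if a0 \<le> k + j \<and> k + j \<le> b1 then t (k + j - a0) * ((-1) ^ k * fact (b1 - j) / (c2 * fact k)) else 0)"
        using G[of k "j + m"] kj b0 by (auto split: if_splits)
    next
      fix k l assume kl: "k \<le> a1" "l \<le> b0"
      have "g \<alpha> (k - min k m) (l + min k m) = - \<epsilon> * h \<beta> (k - min k m + min k m) l" using kl a1 by (intro gh) auto
      then have "h \<beta> k l = - \<epsilon> * g \<alpha> (k - min k m) (l + min k m)" using \<epsilon>2 by (simp add: mult.assoc[symmetric])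
      also have "g \<alpha> (k - min k m) (l + min k m) = (if a0 + m \<le> k + l \<and> k + l \<le> b0 then t (k + l - a0 - m) else 0)"
      proof -
        have "k - min k m + (l + min k m) = k + l" "k - min k m \<le> a0" "l + min k m \<le> b0 + m" using kl a1 by auto
        then show ?thesis using G[of "k - min k m" "l + min k m"] by simp
      qed
      finally have "h \<beta> k l = - \<epsilon> * (if a0 + m \<le> k + l \<and> k + l \<le> b0 then t (k + l - a0 - m) else 0)" .
      moreover have "h \<beta> k l * ((-1) ^ k * fact (b0 - l) / (c1 * fact k)) = ((-1) ^ k * (-1) ^ k) * \<beta> k l"
        using c by (simp add: h_def)
      then have "\<beta> k l = h \<beta> k l * ((-1) ^ k * fact (b0 - l) / (c1 * fact k))" unfolding sq by simp
      ultimately show "\<beta> k l = (if a0 + m \<le> k + l \<and> k + l \<le> b0 then t (k + l - a0 - m) * (- \<epsilon> * (-1) ^ k * fact (b0 - l) / (c1 * fact k)) else 0)"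
        by simp
    qed
  qed
  {
    assume K: "a0 \<le> b1"
    let ?K = "b1 - a0"
    \<comment> \<open>The solution with g = 1 on the antidiagonal k + q = N + a0 + m, that is k + j
      = N + a0. There \<open>B\<close> has h = -\<epsilon>, and the equation holds because
      \<epsilon> squares to 1.\<close>
    define A :: "nat \<Rightarrow> nat \<Rightarrow> nat \<Rightarrow> 'a" where "A N k j = (if k + j = N + a0 then (-1) ^ k * fact (b1 - j) / (c2 * fact k) else 0)" for N k j
    define B :: "nat \<Rightarrow> nat \<Rightarrow> nat \<Rightarrow> 'a" where "B N k l = (if k + l = N + a0 + m then - \<epsilon> * (-1) ^ k * fact (b0 - l) / (c1 * fact k) else 0)" for N k l
    have "sol_basis m a0 a1 b0 b1 M1 M2 ?K A B" unfolding sol_basis_def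
    proof (intro conjI allI impI)
      fix N assume N: "N \<le> ?K"
      have gA: "g (A N) k q = (if k + q = N + a0 + m then 1 else 0)" if "k \<le> a0" for k q
      proof (cases "k + q = N + a0 + m")
        case True
        then have "m \<le> q" "q \<le> b0" "b1 - (q - m) = b0 - q" "k + (q - m) = N + a0" using that N K b0 by auto
        then have "g (A N) k q = (-1) ^ k * (-1) ^ k" using c by (simp add: g_def A_def)
        then show ?thesis using True sq by simp
      qed (auto simp: g_def A_def)
      have hB: "h (B N) k l = (if k + l = N + a0 + m then - \<epsilon> else 0)" for k l
      proof (cases "k + l = N + a0 + m")
        case True
        then have "h (B N) k l = - \<epsilon> * ((-1) ^ k * (-1) ^ k)" using c by (simp add: h_def B_def)
        then show ?thesis using True sq by simp
      qed (simp add: h_def B_def)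
      show "sol m a0 a1 b0 b1 M1 M2 (A N) (B N)" unfolding sol using \<epsilon>2 by (simp add: gA hB)
      show "int a0 + int b1 - 2 * (int k + int j) = int ?K - 2 * int N" if "A N k j \<noteq> 0" for k j
        using that K by (auto simp: A_def split: if_splits)
      show "int a1 + int b0 - 2 * (int k + int j) = int ?K - 2 * int N" if "B N k j \<noteq> 0" for k j
        using that K a1 b0 by (auto simp: B_def split: if_splits)
      have "A N a0 N \<noteq> 0" "N \<le> b1" using c N K by (auto simp: A_def)
      then show "(\<exists>k\<le>a0. \<exists>j\<le>b1. A N k j \<noteq> 0) \<or> (\<exists>k\<le>a1. \<exists>j\<le>b0. B N k j \<noteq> 0)" by blast
    next
      fix \<alpha> \<beta> assume "sol m a0 a1 b0 b1 M1 M2 \<alpha> \<beta>"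
      from main[OF this] obtain t where t:
        "\<And>k j. k \<le> a0 \<Longrightarrow> j \<le> b1 \<Longrightarrow> \<alpha> k j = (if a0 \<le> k + j \<and> k + j \<le> b1 then t (k + j - a0) * ((-1) ^ k * fact (b1 - j) / (c2 * fact k)) else 0)"
        "\<And>k l. k \<le> a1 \<Longrightarrow> l \<le> b0 \<Longrightarrow> \<beta> k l = (if a0 + m \<le> k + l \<and> k + l \<le> b0 then t (k + l - a0 - m) * (- \<epsilon> * (-1) ^ k * fact (b0 - l) / (c1 * fact k)) else 0)"
        by blast
      show "\<exists>t. (\<forall>k\<le>a0. \<forall>j\<le>b1. \<alpha> k j = (\<Sum>N\<le>?K. t N * A N k j)) \<and> (\<forall>k\<le>a1. \<forall>j\<le>b0. \<beta> k j = (\<Sum>N\<le>?K. t N * B N k j))"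
      proof (intro exI[of _ t] conjI allI impI)
        fix k j assume kj: "k \<le> a0" "j \<le> b1"
        have S: "(\<Sum>N\<le>?K. t N * A N k j) = (if k + j - a0 \<in> {..?K} then t (k + j - a0) * A (k + j - a0) k j else 0)"
          by (rule sum_at) (auto simp: A_def)
        show "\<alpha> k j = (\<Sum>N\<le>?K. t N * A N k j)" unfolding S t(1)[OF kj] using K by (auto simp: A_def)
      next
        fix k j assume kj: "k \<le> a1" "j \<le> b0"
        have S: "(\<Sum>N\<le>?K. t N * B N k j) = (if k + j - a0 - m \<in> {..?K} then t (k + j - a0 - m) * B (k + j - a0 - m) k j else 0)"
          by (rule sum_at) (auto simp: B_def)
        show "\<beta> k j = (\<Sum>N\<le>?K. t N * B N k j)" unfolding S t(2)[OF kj] using K b0 by (auto simp: B_def)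
      qed
    qed
    then show "sol_line m a0 a1 b0 b1 M1 M2 ?K" unfolding sol_line_def by blast
  next
    assume K: "b1 < a0"
    show "sol_zero m a0 a1 b0 b1 M1 M2" unfolding sol_zero_def
    proof (intro allI impI)
      fix \<alpha> \<beta> assume "sol m a0 a1 b0 b1 M1 M2 \<alpha> \<beta>"
      from main[OF this] show "(\<forall>k\<le>a0. \<forall>j\<le>b1. \<alpha> k j = 0) \<and> (\<forall>k\<le>a1. \<forall>j\<le>b0. \<beta> k j = 0)" using K b0 by auto
    qed
  }
qed

section \<open>Uniserial modules in coordinates\<close>

lemma chain_lc:
  assumes sl: "sl2 d E F H" and ch: "chain d E F H a p"
  shows "E *\<^sub>v lc d {..a} c p = lc d {..a} (\<lambda>l. if l < a then c (l + 1) * of_nat ((l + 1) * (a - l)) else 0) p"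
    and "F *\<^sub>v lc d {..a} c p = lc d {..a} (\<lambda>l. if l = 0 then 0 else c (l - 1)) p"
    and "H *\<^sub>v lc d {..a} c p = lc d {..a} (\<lambda>l. c l * of_int (int a - 2 * int l)) p"
proof -
  interpret sl2 d E F H by (rule sl)
  note D = chainD[OF ch]
  have pc: "\<And>l. l \<in> {..a} \<Longrightarrow> p l \<in> carrier_vec d" using D(1) by auto
  have Ep: "E *\<^sub>v p l = lc d {..a} (\<lambda>l'. if l' + 1 = l then of_nat (l * (a + 1 - l)) else 0) p" if "l \<le> a" for l
  proof (cases l)
    case 0
    then show ?thesis using D(4)[of 0] pc[of 0] by (subst lc_zero) (auto simp: smult_0_vec)
  next
    case (Suc k)
    then show ?thesis using D(4)[of l] that pc by (subst lc_single[where i = k]) auto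
  qed
  have Fp: "F *\<^sub>v p l = lc d {..a} (\<lambda>l'. if l' = l + 1 then 1 else 0) p" if "l \<le> a" for l
  proof (cases "l < a")
    case True
    then show ?thesis using D(5)[of l] pc by (subst lc_single[where i = "l + 1"]) auto
  next
    case False
    then show ?thesis using D(6) that by (subst lc_zero) auto
  qed
  have "E *\<^sub>v lc d {..a} c p = lc d {..a} c (\<lambda>l. lc d {..a} (\<lambda>l'. if l' + 1 = l then of_nat (l * (a + 1 - l)) else 0) p)"
    using Ep by (subst mult_lc[OF E pc]) (auto intro!: lc_cong)
  also have "\<dots> = lc d {..a} (\<lambda>l. if l < a then c (l + 1) * of_nat ((l + 1) * (a - l)) else 0) p"
    unfolding lc_lc
  proof (rule lc_cong)
    fix l' assume l': "l' \<in> {..a}"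
    have "(\<Sum>l\<le>a. c l * (if l' + 1 = l then of_nat (l * (a + 1 - l)) else 0)) =
      (if l' + 1 \<in> {..a} then c (l' + 1) * (if l' + 1 = l' + 1 then of_nat ((l' + 1) * (a + 1 - (l' + 1))) else 0) else 0)"
      by (rule sum_at) auto
    then show "(\<Sum>l\<le>a. c l * (if l' + 1 = l then of_nat (l * (a + 1 - l)) else 0)) = (if l' < a then c (l' + 1) * of_nat ((l' + 1) * (a - l')) else 0)"
      using l' by (simp add: Suc_le_eq)
  qed simp
  finally show "E *\<^sub>v lc d {..a} c p = lc d {..a} (\<lambda>l. if l < a then c (l + 1) * of_nat ((l + 1) * (a - l)) else 0) p" .
  have "F *\<^sub>v lc d {..a} c p = lc d {..a} c (\<lambda>l. lc d {..a} (\<lambda>l'. if l' = l + 1 then 1 else 0) p)"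
    using Fp by (subst mult_lc[OF F pc]) (auto intro!: lc_cong)
  also have "\<dots> = lc d {..a} (\<lambda>l. if l = 0 then 0 else c (l - 1)) p"
    unfolding lc_lc
  proof (rule lc_cong)
    fix l' assume l': "l' \<in> {..a}"
    have "(\<Sum>l\<le>a. c l * (if l' = l + 1 then 1 else 0)) = (if l' - 1 \<in> {..a} then c (l' - 1) * (if l' = l' - 1 + 1 then 1 else 0) else 0)"
      by (rule sum_at) auto
    then show "(\<Sum>l\<le>a. c l * (if l' = l + 1 then 1 else 0)) = (if l' = 0 then 0 else c (l' - 1))"
      using l' by auto
  qed simp
  finally show "F *\<^sub>v lc d {..a} c p = lc d {..a} (\<lambda>l. if l = 0 then 0 else c (l - 1)) p" .
  have "H *\<^sub>v lc d {..a} c p = lc d {..a} c (\<lambda>l. of_int (int a - 2 * int l) \<cdot>\<^sub>v p l)"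
    using D(3) by (subst mult_lc[OF H pc]) (auto intro!: lc_cong)
  also have "\<dots> = lc d {..a} (\<lambda>l. c l * of_int (int a - 2 * int l)) p" using pc by (subst lc_smult2) auto
  finally show "H *\<^sub>v lc d {..a} c p = lc d {..a} (\<lambda>l. c l * of_int (int a - 2 * int l)) p" .
qed

text \<open>Compare the coefficients in the independent family p after applying the relations of x_i
  with h and f, and of x_0 with e, to q_j.\<close>

lemma level_equivariant:
  assumes g: "g_rep m d \<rho>" and p: "chain d (\<rho> GE) (\<rho> GF) (\<rho> GH) a p" and q: "chain d (\<rho> GE) (\<rho> GF) (\<rho> GH) b q"
    and M: "\<And>i j. i \<le> m \<Longrightarrow> j \<le> b \<Longrightarrow> \<rho> (GX i) *\<^sub>v q j = lc d {..a} (\<lambda>l. M i l j) p"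
  shows "equivariant m a b M"
proof -
  note sl = g_repD(2)[OF g] and c = g_repD(1)[OF g]
  have ind: "indep d {..a} p" by (rule sl2.chain_indep[OF sl p])
  note L = chain_lc[OF sl p] and Dq = chainD[OF q]
  have xs: "\<rho> (GX i) *\<^sub>v (t \<cdot>\<^sub>v q j) = lc d {..a} (\<lambda>l. t * M i l j) p" if "i \<le> m" "j \<le> b" for i j t
    using mult_mat_vec[OF c Dq(1)[OF that(2)], of "GX i" t] M[OF that] by (simp add: lc_smult)
  show ?thesis unfolding equivariant_def
  proof (intro conjI allI impI)
    fix i l j assume ilj: "i \<le> m" "l \<le> a" "j \<le> b" and nz: "M i l j \<noteq> 0"
    have "\<rho> GH *\<^sub>v (\<rho> (GX i) *\<^sub>v q j) = \<rho> (GX i) *\<^sub>v (\<rho> GH *\<^sub>v q j) + of_int (int m - 2 * int i) \<cdot>\<^sub>v (\<rho> (GX i) *\<^sub>v q j)"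
      by (rule relD[OF g_repD(4)[OF g ilj(1)] Dq(1)[OF ilj(3)]])
    then have "lc d {..a} (\<lambda>l. M i l j * of_int (int a - 2 * int l)) p = lc d {..a} (\<lambda>l. of_int (int b - 2 * int j) * M i l j + of_int (int m - 2 * int i) * M i l j) p"
      using ilj unfolding Dq(3)[OF ilj(3)] xs[OF ilj(1,3)] M[OF ilj(1,3)] L by (simp add: lc_smult lc_add)
    from indep_eqD[OF ind this, of l] ilj have "M i l j * of_int (int a - 2 * int l) = M i l j * of_int (int b - 2 * int j + (int m - 2 * int i))"
      by (simp add: algebra_simps)
    then have "(of_int (int a - 2 * int l) :: 'a) = of_int (int b - 2 * int j + (int m - 2 * int i))" using nz by (simp only: mult_cancel_left) simp
    then show "int a - 2 * int l = int m - 2 * int i + (int b - 2 * int j)" by (simp only: of_int_eq_iff)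
  next
    fix l j assume lj: "l < a" "j \<le> b"
    have "\<rho> GE *\<^sub>v (\<rho> (GX 0) *\<^sub>v q j) = \<rho> (GX 0) *\<^sub>v (\<rho> GE *\<^sub>v q j) + of_nat (0 * (m + 1 - 0)) \<cdot>\<^sub>v (\<rho> (GX (0 - 1)) *\<^sub>v q j)"
      by (rule relD[OF g_repD(5)[OF g] Dq(1)[OF lj(2)]]) simp
    also have "\<dots> = \<rho> (GX 0) *\<^sub>v (\<rho> GE *\<^sub>v q j) + 0\<^sub>v d" using c[of "GX 0"] by (simp add: smult_0_vec[of _ d])
    also have "\<dots> = \<rho> (GX 0) *\<^sub>v (\<rho> GE *\<^sub>v q j)" using c[of "GX 0"] by (simp add: right_zero_vec[of _ d])
    also have "\<dots> = lc d {..a} (\<lambda>l. of_nat (j * (b + 1 - j)) * M 0 l (j - 1)) p"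
      unfolding Dq(4)[OF lj(2)] using lj by (intro xs) auto
    finally have e1: "\<rho> GE *\<^sub>v (\<rho> (GX 0) *\<^sub>v q j) = lc d {..a} (\<lambda>l. of_nat (j * (b + 1 - j)) * M 0 l (j - 1)) p" .
    have "lc d {..a} (\<lambda>l. if l < a then M 0 (l + 1) j * of_nat ((l + 1) * (a - l)) else 0) p = lc d {..a} (\<lambda>l. of_nat (j * (b + 1 - j)) * M 0 l (j - 1)) p"
      using e1 unfolding M[OF le0 lj(2)] L(1) .
    from indep_eqD[OF ind this, of l] lj show "of_nat ((l + 1) * (a - l)) * M 0 (l + 1) j = (if j = 0 then 0 else of_nat (j * (b + 1 - j)) * M 0 l (j - 1))"
      by (simp add: mult.commute)
  next
    fix i l j assume ilj: "i < m" "l \<le> a" "j \<le> b"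
    have "\<rho> GF *\<^sub>v (\<rho> (GX i) *\<^sub>v q j) = \<rho> (GX i) *\<^sub>v (\<rho> GF *\<^sub>v q j) + (if i < m then 1 else 0) \<cdot>\<^sub>v (\<rho> (GX (i + 1)) *\<^sub>v q j)"
      using ilj by (intro relD[OF g_repD(6)[OF g] Dq(1)[OF ilj(3)]]) simp
    moreover have "\<rho> (GX i) *\<^sub>v (\<rho> GF *\<^sub>v q j) = lc d {..a} (\<lambda>l. if j < b then M i l (j + 1) else 0) p"
    proof (cases "j < b")
      case True
      then show ?thesis using M[of i "j + 1"] Dq(5)[OF True] ilj by simp
    next
      case False
      then have "j = b" using ilj by simp
      then show ?thesis using Dq(6) False c[of "GX i"] by (subst lc_zero) auto
    qed
    ultimately have "\<rho> GF *\<^sub>v (\<rho> (GX i) *\<^sub>v q j) = lc d {..a} (\<lambda>l. (if j < b then M i l (j + 1) else 0) + M (i + 1) l j) p"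
      using ilj M[of "i + 1" j] by (simp add: lc_add)
    then have "lc d {..a} (\<lambda>l. if l = 0 then 0 else M i (l - 1) j) p = lc d {..a} (\<lambda>l. (if j < b then M i l (j + 1) else 0) + M (i + 1) l j) p"
      unfolding M[OF less_imp_le[OF ilj(1)] ilj(3)] L(2) .
    from indep_eqD[OF ind this, of l] ilj show "M (i + 1) l j = (if l = 0 then 0 else M i (l - 1) j) - (if j < b then M i l (j + 1) else 0)"
      by (simp add: algebra_simps)
  qed
qed

section \<open>Bases adapted to a decomposition into irreducible levels\<close>

definition lev :: "(nat \<Rightarrow> nat \<Rightarrow> 'a vec) \<Rightarrow> nat \<times> nat \<Rightarrow> 'a vec" where "lev q = (\<lambda>(j,l). q j l)"
definition idx :: "nat \<Rightarrow> (nat \<Rightarrow> nat) \<Rightarrow> (nat \<times> nat) set" where "idx L c = (SIGMA j:{..L}. {..c j})"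

lemma idx_iff [simp]: "(j,l) \<in> idx L c \<longleftrightarrow> j \<le> L \<and> l \<le> c j" by (auto simp: idx_def)
lemma finite_idx [simp]: "finite (idx L c)" by (simp add: idx_def)
lemma lev_pair [simp]: "lev q (j,l) = q j l" by (simp add: lev_def)

text \<open>Records only the sl(2)-structure: level j carries a standard basis of V(c j). The double
  index is uncurried so that the whole basis is one family.\<close>

definition graded :: "nat \<Rightarrow> (gen \<Rightarrow> 'a::field_char_0 mat) \<Rightarrow> nat \<Rightarrow> (nat \<Rightarrow> nat) \<Rightarrow> (nat \<Rightarrow> nat \<Rightarrow> 'a vec) \<Rightarrow> bool" where
  "graded d \<rho> L c q \<longleftrightarrow> (\<forall>j\<le>L. chain d (\<rho> GE) (\<rho> GF) (\<rho> GH) (c j) (q j)) \<and>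
     indep d (idx L c) (lev q) \<and> sp d (idx L c) (lev q) = carrier_vec d"

text \<open>Covers both Z and its dual, with c increasing or decreasing. Injectivity of c makes the
  module multiplicity free over sl(2), so its levels are its only irreducible
  sl(2)-submodules.\<close>

definition zgraded :: "nat \<Rightarrow> nat \<Rightarrow> (gen \<Rightarrow> 'a::field_char_0 mat) \<Rightarrow> nat \<Rightarrow> (nat \<Rightarrow> nat) \<Rightarrow> (nat \<Rightarrow> nat \<Rightarrow> 'a vec) \<Rightarrow> bool" where
  "zgraded m d \<rho> L c q \<longleftrightarrow> graded d \<rho> L c q \<and> inj_on c {..L} \<and> (\<forall>v\<in>carrier_vec d. \<rho> GZ *\<^sub>v v = 0\<^sub>v d) \<and>
     (\<forall>i\<le>m. \<forall>l\<le>c 0. \<rho> (GX i) *\<^sub>v q 0 l = 0\<^sub>v d) \<and>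
     (\<forall>j<L. (\<forall>i\<le>m. \<forall>l\<le>c (Suc j). \<rho> (GX i) *\<^sub>v q (Suc j) l \<in> sp d {..c j} (q j)) \<and>
        (\<exists>i\<le>m. \<exists>l\<le>c (Suc j). \<rho> (GX i) *\<^sub>v q (Suc j) l \<noteq> 0\<^sub>v d))"

lemma lc_level: "lc d (Pair j ` A) e (lev q) = lc d A (\<lambda>l. e (j,l)) (q j)"
  using lc_reindex[of "Pair j" A d e "lev q"] by (simp add: inj_on_def)

lemma sp_level: "sp d (Pair j ` A) (lev q) = sp d A (q j)"
proof (intro equalityI subsetI)
  fix v assume "v \<in> sp d (Pair j ` A) (lev q)"
  then show "v \<in> sp d A (q j)" by (auto elim!: sp_E simp: lc_level)
next
  fix v assume "v \<in> sp d A (q j)"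
  then obtain e where "v = lc d A e (q j)" by (rule sp_E)
  then have "v = lc d (Pair j ` A) (\<lambda>(_,l). e l) (lev q)" by (simp add: lc_level)
  then show "v \<in> sp d (Pair j ` A) (lev q)" by simp
qed

lemma indep_sp_disjoint:
  assumes i: "indep d I b" and "A \<subseteq> I" "B \<subseteq> I" "A \<inter> B = {}" "v \<in> sp d A b" "v \<in> sp d B b"
  shows "v = 0\<^sub>v d"
proof -
  obtain e where e: "v = lc d A e b" using assms(5) by (rule sp_E)
  obtain f where f: "v = lc d B f b" using assms(6) by (rule sp_E)
  have fin: "finite I" by (rule indep_finite[OF i])
  have 1: "v = lc d I (\<lambda>x. if x \<in> A then e x else 0) b" unfolding e
    using lc_mono[OF fin assms(2), of "\<lambda>x. if x \<in> A then e x else 0" d b] by (simp cong: lc_cong)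
  have 2: "v = lc d I (\<lambda>x. if x \<in> B then f x else 0) b" unfolding f
    using lc_mono[OF fin assms(3), of "\<lambda>x. if x \<in> B then f x else 0" d b] by (simp cong: lc_cong)
  have "e x = 0" if "x \<in> A" for x
  proof -
    have "x \<in> I" "x \<notin> B" using that assms(2,4) by auto
    then show ?thesis using indep_eqD[OF i 1[unfolded 2], of x] that by simp
  qed
  then show ?thesis unfolding e by (intro lc_zero) auto
qed

lemma weight_coeff:
  assumes wt: "weights d H I b w" and H: "H \<in> carrier_mat d d"
    and v: "lc d I e b \<noteq> 0\<^sub>v d \<longrightarrow> H *\<^sub>v lc d I e b = of_int \<mu> \<cdot>\<^sub>v lc d I e b" and i: "i \<in> I" "e i \<noteq> 0"
  shows "w i = \<mu>"
proof -
  have ind: "indep d I b" and Hb: "\<And>i. i \<in> I \<Longrightarrow> H *\<^sub>v b i = of_int (w i) \<cdot>\<^sub>v b i" using wt by (auto simp: weights_def)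
  have "lc d I e b \<noteq> 0\<^sub>v d" using indepD[OF ind _ i(1)] i(2) by blast
  then have v': "H *\<^sub>v lc d I e b = of_int \<mu> \<cdot>\<^sub>v lc d I e b" using v by simp
  have "H *\<^sub>v lc d I e b = lc d I e (\<lambda>i. H *\<^sub>v b i)" using indep_carrier[OF ind] by (intro mult_lc H) auto
  also have "\<dots> = lc d I e (\<lambda>i. of_int (w i) \<cdot>\<^sub>v b i)" by (rule lc_cong) (auto simp: Hb)
  also have "\<dots> = lc d I (\<lambda>i. e i * of_int (w i)) b" using indep_carrier[OF ind] by (intro lc_smult2) auto
  finally have "lc d I (\<lambda>i. e i * of_int (w i)) b = lc d I (\<lambda>i. of_int \<mu> * e i) b" using v' by (simp add: lc_smult)
  from indep_eqD[OF ind this i(1)] have "e i * of_int (w i) = e i * of_int \<mu>" by (simp add: mult.commute)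
  then have "(of_int (w i) :: 'a) = of_int \<mu>" using i(2) by simp
  then show ?thesis by (simp only: of_int_eq_iff)
qed

lemma graded_weights:
  "graded d \<rho> L c q \<Longrightarrow> weights d (\<rho> GH) (idx L c) (lev q) (\<lambda>(j,l). int (c j) - 2 * int l)"
  by (auto simp: graded_def weights_def idx_def dest!: chainD(3))

lemma gradedD:
  assumes "graded d \<rho> L c q"
  shows "j \<le> L \<Longrightarrow> chain d (\<rho> GE) (\<rho> GF) (\<rho> GH) (c j) (q j)"
    "indep d (idx L c) (lev q)" "sp d (idx L c) (lev q) = carrier_vec d"
    "j \<le> L \<Longrightarrow> l \<le> c j \<Longrightarrow> q j l \<in> carrier_vec d"
  using assms by (auto simp: graded_def dest: chainD(1))

lemma level_subset: "j \<le> L \<Longrightarrow> Pair j ` {..c j} \<subseteq> idx L c" by auto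

lemma level_disjoint:
  assumes g: "graded d \<rho> L c q" and "v \<in> sp d {..c j} (q j)" "v \<in> sp d B (lev q)" "j \<le> L" "B \<subseteq> idx L c" "\<And>l. (j,l) \<notin> B"
  shows "v = 0\<^sub>v d"
  by (rule indep_sp_disjoint[OF gradedD(2)[OF g] level_subset[OF assms(4)] assms(5)]) (use assms in \<open>auto simp: sp_level\<close>)

lemma x_weight:
  assumes g: "g_rep m d \<rho>" and p: "chain d (\<rho> GE) (\<rho> GF) (\<rho> GH) a p" and "i \<le> m" "l \<le> a"
  shows "\<rho> GH *\<^sub>v (\<rho> (GX i) *\<^sub>v p l) = of_int (int m - 2 * int i + (int a - 2 * int l)) \<cdot>\<^sub>v (\<rho> (GX i) *\<^sub>v p l)"
proof -
  have pl: "p l \<in> carrier_vec d" using chainD(1)[OF p] assms by simp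
  have "\<rho> GH *\<^sub>v (\<rho> (GX i) *\<^sub>v p l) = \<rho> (GX i) *\<^sub>v (\<rho> GH *\<^sub>v p l) + of_int (int m - 2 * int i) \<cdot>\<^sub>v (\<rho> (GX i) *\<^sub>v p l)"
    by (rule relD[OF g_repD(4)[OF g assms(3)] pl])
  also have "\<rho> (GX i) *\<^sub>v (\<rho> GH *\<^sub>v p l) = of_int (int a - 2 * int l) \<cdot>\<^sub>v (\<rho> (GX i) *\<^sub>v p l)"
    unfolding chainD(3)[OF p assms(4)] by (rule mult_mat_vec[OF g_repD(1)[OF g] pl])
  finally show ?thesis by (simp add: add_smult_distrib_vec[symmetric] add.commute)
qed

text \<open>Vanishing of Ev leaves only the coefficients at the tops \<open>q j 0\<close> of the
  levels, and by injectivity of c the weight \<mu> singles out one level.\<close>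

lemma graded_hw:
  assumes rep: "g_rep m d \<rho>" and g: "graded d \<rho> L c q" and inj: "inj_on c {..L}"
    and v: "v \<in> carrier_vec d" "v \<noteq> 0\<^sub>v d" "\<rho> GE *\<^sub>v v = 0\<^sub>v d" "\<rho> GH *\<^sub>v v = of_int \<mu> \<cdot>\<^sub>v v"
  shows "\<exists>J\<le>L. \<exists>t. t \<noteq> 0 \<and> \<mu> = int (c J) \<and> v = t \<cdot>\<^sub>v q J 0"
proof -
  note cr = g_repD(1)[OF rep]
  note ind = gradedD(2)[OF g]
  have lc_car: "\<And>x. x \<in> idx L c \<Longrightarrow> lev q x \<in> carrier_vec d" using indep_carrier[OF ind] .
  obtain e where e: "v = lc d (idx L c) e (lev q)" using v(1) gradedD(3)[OF g] by (auto elim: sp_E)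
  have w: "int (c j) - 2 * int l = \<mu>" if "j \<le> L" "l \<le> c j" "e (j,l) \<noteq> 0" for j l
    using weight_coeff[OF graded_weights[OF g] cr, of e \<mu> "(j,l)"] v(4) that unfolding e by simp
  have El: "\<rho> GE *\<^sub>v lev q x = lc d (idx L c) (\<lambda>y. if fst y = fst x \<and> snd y + 1 = snd x then of_nat (snd x * (c (fst x) + 1 - snd x)) else 0) (lev q)"
    if "x \<in> idx L c" for x
  proof -
    obtain j l where "x = (j,l)" by (cases x)
    then have x: "x = (j,l)" "j \<le> L" "l \<le> c j" using that by auto
    show ?thesis
    proof (cases l)
      case 0
      then show ?thesis using chainD(4)[OF gradedD(1)[OF g x(2)] x(3)] gradedD(4)[OF g x(2), of 0] x(1)
        by (subst lc_zero) (auto simp: smult_0_vec)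
    next
      case (Suc k)
      then show ?thesis using chainD(4)[OF gradedD(1)[OF g x(2)] x(3)] gradedD(4)[OF g x(2), of k] x
        by (subst lc_single[where i = "(j,k)"]) auto
    qed
  qed
  have "0\<^sub>v d = \<rho> GE *\<^sub>v v" using v(3) by simp
  also have "\<dots> = lc d (idx L c) e (\<lambda>x. lc d (idx L c) (\<lambda>y. if fst y = fst x \<and> snd y + 1 = snd x then of_nat (snd x * (c (fst x) + 1 - snd x)) else 0) (lev q))"
    unfolding e using El by (subst mult_lc[OF cr lc_car]) (auto intro!: lc_cong)
  finally have z0: "lc d (idx L c) e (\<lambda>x. lc d (idx L c) (\<lambda>y. if fst y = fst x \<and> snd y + 1 = snd x then of_nat (snd x * (c (fst x) + 1 - snd x)) else 0) (lev q)) = 0\<^sub>v d"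
    by (rule sym)
  have z: "(\<Sum>x\<in>idx L c. e x * (if fst y = fst x \<and> snd y + 1 = snd x then of_nat (snd x * (c (fst x) + 1 - snd x)) else 0)) = 0"
    if "y \<in> idx L c" for y by (rule indepD[OF ind z0[unfolded lc_lc] that])
  have e0: "e (j,l) = 0" if jl: "j \<le> L" "l \<le> c j" "l \<noteq> 0" for j l
  proof -
    have "(\<Sum>x\<in>idx L c. e x * (if fst (j,l-1) = fst x \<and> snd (j,l-1) + 1 = snd x then of_nat (snd x * (c (fst x) + 1 - snd x)) else 0)) =
      (if (j,l) \<in> idx L c then e (j,l) * (if fst (j,l-1) = fst (j,l) \<and> snd (j,l-1) + 1 = snd (j,l) then of_nat (snd (j,l) * (c (fst (j,l)) + 1 - snd (j,l))) else 0) else 0)"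
      using jl by (intro sum_at[where i = "(j,l)" and f = "\<lambda>x. e x * (if fst (j,l-1) = fst x \<and> snd (j,l-1) + 1 = snd x then of_nat (snd x * (c (fst x) + 1 - snd x)) else 0)"]) auto
    then have "e (j,l) * of_nat (l * (c j + 1 - l)) = 0" using z[of "(j,l-1)"] jl by simp
    then show ?thesis using jl by (simp only: mult_eq_0_iff of_nat_eq_0_iff) auto
  qed
  have "\<exists>x\<in>idx L c. e x \<noteq> 0"
  proof (rule ccontr)
    assume "\<not> ?thesis"
    then have "v = 0\<^sub>v d" unfolding e by (intro lc_zero) auto
    then show False using v(2) by simp
  qed
  then obtain J l where J: "J \<le> L" "l \<le> c J" "e (J,l) \<noteq> 0" by auto
  have l: "l = 0" using e0[OF J(1,2)] J(3) by blast
  have mu: "\<mu> = int (c J)" using w[OF J] l by simp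
  have "v = e (J,0) \<cdot>\<^sub>v lev q (J,0)" unfolding e
  proof (rule lc_single)
    fix x assume x: "x \<in> idx L c" "x \<noteq> (J,0)"
    obtain j k where "x = (j,k)" by (cases x)
    then have jk: "x = (j,k)" "j \<le> L" "k \<le> c j" using x by auto
    show "e x = 0"
    proof (rule ccontr)
      assume nz: "e x \<noteq> 0"
      then have k: "k = 0" using e0[OF jk(2,3)] jk(1) by blast
      then have "c j = c J" using w[OF jk(2,3)] nz jk(1) mu by simp
      then have "j = J" using inj jk J by (auto dest: inj_onD)
      then show False using x k jk by simp
    qed
  qed (use J gradedD(4)[OF g J(1)] in auto)
  then show ?thesis using J l mu by auto
qed

text \<open>A copy of V(b) is generated by its highest weight vector, which by
  \<open>graded_hw\<close> is a multiple of some \<open>q J 0\<close>.\<close>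

lemma graded_submodule:
  assumes rep: "g_rep m d \<rho>" and g: "graded d \<rho> L c q" and inj: "inj_on c {..L}"
    and p: "chain d (\<rho> GE) (\<rho> GF) (\<rho> GH) b p"
  shows "\<exists>J\<le>L. b = c J \<and> sp d {..b} p = sp d {..c J} (q J)"
proof -
  note sl = g_repD(2)[OF rep] and cr = g_repD(1)[OF rep]
  note hw = sl2.chain_hw[OF sl p]
  obtain J t where J: "J \<le> L" "t \<noteq> 0" "int b = int (c J)" "p 0 = t \<cdot>\<^sub>v q J 0"
    using graded_hw[OF rep g inj hw(1) chainD(2)[OF p] hw(3), of "int b"] hw(2) by auto
  have bc: "b = c J" using J(3) by simp
  have pl: "p l = t \<cdot>\<^sub>v q J l" if "l \<le> b" for l
  proof -
    have "p l = pw (\<rho> GF) l (t \<cdot>\<^sub>v q J 0)" using sl2.chain_pw[OF sl p that] J(4) by simp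
    also have "\<dots> = t \<cdot>\<^sub>v pw (\<rho> GF) l (q J 0)" using gradedD(4)[OF g J(1), of 0] by (intro pw_smult[OF cr]) simp
    also have "pw (\<rho> GF) l (q J 0) = q J l" by (rule sl2.chain_pw[OF sl gradedD(1)[OF g J(1)], symmetric]) (use that bc in simp)
    finally show ?thesis .
  qed
  have qm: "q J l \<in> sp d {..c J} (q J)" if "l \<le> c J" for l using that gradedD(4)[OF g J(1)] by (intro sp_member) auto
  have pm: "p l \<in> sp d {..b} p" if "l \<le> b" for l using that chainD(1)[OF p] by (intro sp_member) auto
  have "sp d {..b} p \<subseteq> sp d {..c J} (q J)"
  proof (rule sp_least[OF subspace_sp])
    show "p ` {..b} \<subseteq> sp d {..c J} (q J)"
    proof
      fix x assume "x \<in> p ` {..b}"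
      then obtain l where "l \<le> b" "x = p l" by auto
      then show "x \<in> sp d {..c J} (q J)" using pl[of l] subspace_smult[OF subspace_sp qm[of l], of t] bc by simp
    qed
  qed simp
  moreover have "q J l \<in> sp d {..b} p" if "l \<le> c J" for l
    using subspace_smult_cancel[OF subspace_sp, of t "q J l" d "{..b}" p] pm[of l] pl[of l] that bc J(2) by simp
  then have "sp d {..c J} (q J) \<subseteq> sp d {..b} p" by (intro sp_least subspace_sp) auto
  ultimately show ?thesis using J(1) bc by blast
qed

lemma zgraded_level_injective:
  assumes rep: "g_rep m d \<rho>" and z: "zgraded m d \<rho> L c q" and j: "j < L"
    and v: "v \<in> sp d {..c (Suc j)} (q (Suc j))" "\<And>i. i \<le> m \<Longrightarrow> \<rho> (GX i) *\<^sub>v v = 0\<^sub>v d"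
  shows "v = 0\<^sub>v d"
proof (rule ccontr)
  assume nz: "v \<noteq> 0\<^sub>v d"
  note sl = g_repD(2)[OF rep] and cr = g_repD(1)[OF rep]
  have g: "graded d \<rho> L c q" and z0: "\<And>v. v \<in> carrier_vec d \<Longrightarrow> \<rho> GZ *\<^sub>v v = 0\<^sub>v d" using z by (auto simp: zgraded_def)
  let ?W = "sp d {..c (Suc j)} (q (Suc j))"
  define Y where "Y = carrier_vec d \<inter> \<Inter>((\<lambda>a. {v \<in> carrier_vec d. \<rho> a *\<^sub>v v \<in> {0\<^sub>v d}}) ` (GX ` {..m}))"
  have sY: "subspace d Y" unfolding Y_def by (rule subspace_INT) (use subspace_preimage[OF cr subspace_0] in \<open>simp only: image_iff, blast\<close>)
  have Yk: "u \<in> Y \<longleftrightarrow> u \<in> carrier_vec d \<and> killed m d \<rho> u" for u using z0 by (auto simp: Y_def killed_def)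
  have st: "\<rho> a *\<^sub>v u \<in> Y" if "a \<in> {GE, GF, GH}" "u \<in> Y" for a u
    using killed_stable[OF rep _ _ that(1)] that(2) cr[of a] by (auto simp: Yk)
  have vY: "v \<in> Y" using v subsetD[OF sp_carrier v(1)] z0 by (auto simp: Yk killed_def)
  have ch: "chain d (\<rho> GE) (\<rho> GF) (\<rho> GH) (c (Suc j)) (q (Suc j))" using gradedD(1)[OF g] j by simp
  have sub: "?W \<subseteq> Y" by (rule sl2.chain_min[OF sl ch sY]) (use st vY v(1) nz in auto)
  have qW: "q (Suc j) l \<in> ?W" if "l \<le> c (Suc j)" for l using that gradedD(4)[OF g, of "Suc j"] j by (intro sp_member) auto
  then have "\<rho> (GX i) *\<^sub>v q (Suc j) l = 0\<^sub>v d" if "i \<le> m" "l \<le> c (Suc j)" for i l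
    using subsetD[OF sub qW[OF that(2)]] that by (auto simp: Yk killed_def)
  then show False using z j by (auto simp: zgraded_def)
qed

section \<open>Nilpotency of the action of h_n on type Z modules\<close>

lemma nilp_mono:
  assumes "g_rep m d \<rho>" shows "nilp m d \<rho> t \<subseteq> nilp m d \<rho> (Suc t)"
proof (induction t)
  case 0
  then show ?case using g_repD(1)[OF assms] by auto
next
  case (Suc t)
  then show ?case by auto
qed

lemma nilp_le:
  assumes "g_rep m d \<rho>" shows "s \<le> t \<Longrightarrow> nilp m d \<rho> s \<subseteq> nilp m d \<rho> t"
  by (rule lift_Suc_mono_le[of "nilp m d \<rho>"]) (use nilp_mono[OF assms] in auto)

text \<open>The x_i lower the level by one and z acts by 0, so a vector of level j has order at most
  j + 1.\<close>

lemma zgraded_nilp: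
  assumes rep: "g_rep m d \<rho>" and z: "zgraded m d \<rho> L c q"
  shows "carrier_vec d \<subseteq> nilp m d \<rho> (Suc L)"
proof -
  note sN = subspace_nilp[OF rep]
  have g: "graded d \<rho> L c q" and z0: "\<And>v. v \<in> carrier_vec d \<Longrightarrow> \<rho> GZ *\<^sub>v v = 0\<^sub>v d" using z by (auto simp: zgraded_def)
  have "j \<le> L \<Longrightarrow> l \<le> c j \<Longrightarrow> q j l \<in> nilp m d \<rho> (Suc j)" for j l
  proof (induction j arbitrary: l)
    case 0
    then show ?case using z z0 gradedD(4)[OF g] by (auto simp: zgraded_def)
  next
    case (Suc j)
    have "sp d {..c j} (q j) \<subseteq> nilp m d \<rho> (Suc j)" using Suc by (intro sp_least[OF sN]) auto
    then have "\<rho> (GX i) *\<^sub>v q (Suc j) l \<in> nilp m d \<rho> (Suc j)" if "i \<le> m" for i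
      using z Suc.prems that unfolding zgraded_def by (meson Suc_le_eq subsetD)
    moreover have "\<rho> GZ *\<^sub>v q (Suc j) l \<in> nilp m d \<rho> (Suc j)" unfolding z0[OF gradedD(4)[OF g Suc.prems]] by (rule subspace_zero[OF sN])
    ultimately show ?case using gradedD(4)[OF g Suc.prems] by (simp del: nilp.simps add: nilp.simps(2)[of m d \<rho> "Suc j"])
  qed
  then have "lev q ` idx L c \<subseteq> nilp m d \<rho> (Suc L)"
    using subsetD[OF nilp_le[OF rep, of "Suc _" "Suc L"]] by (auto simp: idx_def simp del: nilp.simps)
  then have "sp d (idx L c) (lev q) \<subseteq> nilp m d \<rho> (Suc L)" by (intro sp_least[OF sN]) auto
  then show ?thesis using gradedD(3)[OF g] by simp
qed

section \<open>Coordinates for decomposed modules, type Z modules and their duals\<close>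

lemma graded_of_decomp:
  assumes rep: "g_rep m d \<rho>" and len: "length Ws = Suc L" and iso: "\<And>j. j \<le> L \<Longrightarrow> sl2_iso d \<rho> (Ws ! j) [c j]"
    and dir: "direct_list d Ws" and tot: "lsum d Ws = carrier_vec d"
  shows "\<exists>q. graded d \<rho> L c q \<and> (\<forall>j\<le>L. Ws ! j = sp d {..c j} (q j))"
proof -
  note sl = g_repD(2)[OF rep] and cr = g_repD(1)[OF rep]
  have "\<forall>j. \<exists>p. j \<le> L \<longrightarrow> chain d (\<rho> GE) (\<rho> GF) (\<rho> GH) (c j) p \<and> Ws ! j = sp d {..c j} p"
    using iso sl2_iso_single[OF cr sl] by blast
  then obtain q where q: "\<And>j. j \<le> L \<Longrightarrow> chain d (\<rho> GE) (\<rho> GF) (\<rho> GH) (c j) (q j) \<and> Ws ! j = sp d {..c j} (q j)"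
    by metis
  have "indep d (SIGMA j:{..<length Ws}. {..c j}) (\<lambda>(j,k). q j k) \<and>
         sp d (SIGMA j:{..<length Ws}. {..c j}) (\<lambda>(j,k). q j k) = lsum d Ws"
    using q len by (intro direct_list_basis[OF dir]) (auto intro: sl2.chain_indep[OF sl])
  then have "graded d \<rho> L c q" unfolding graded_def idx_def lev_def using q tot len by (simp add: lessThan_Suc_atMost)
  then show ?thesis using q by blast
qed

lemma Zmod_zgraded:
  assumes n: "n \<ge> 1" and Z: "is_Zmod n d \<rho> \<alpha> L"
  shows "\<exists>q. zgraded (2 * n - 1) d \<rho> L (\<lambda>j. \<alpha> + j * (2 * n - 1)) q"
proof -
  let ?c = "\<lambda>j. \<alpha> + j * (2 * n - 1)"
  have gm: "gmod n d \<rho>" using Z by (simp add: is_Zmod_def)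
  note rep = gmod_g_rep[OF gm n]
  obtain Ws where Ws: "length Ws = Suc L" "\<And>i. i \<le> L \<Longrightarrow> sl2_iso d \<rho> (Ws ! i) [?c i]" "direct_list d Ws" "lsum d Ws = carrier_vec d"
    "\<And>j w. j \<le> 2 * n - 1 \<Longrightarrow> w \<in> Ws ! 0 \<Longrightarrow> \<rho> (GX j) *\<^sub>v w = 0\<^sub>v d"
    "\<And>i j w. 1 \<le> i \<Longrightarrow> i \<le> L \<Longrightarrow> j \<le> 2 * n - 1 \<Longrightarrow> w \<in> Ws ! i \<Longrightarrow> \<rho> (GX j) *\<^sub>v w \<in> Ws ! (i - 1)"
    "\<And>i. 1 \<le> i \<Longrightarrow> i \<le> L \<Longrightarrow> \<exists>j\<le>2 * n - 1. \<exists>w\<in>Ws ! i. \<rho> (GX j) *\<^sub>v w \<noteq> 0\<^sub>v d"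
    using Z unfolding is_Zmod_def by auto
  obtain q where g: "graded d \<rho> L ?c q" and q: "\<And>j. j \<le> L \<Longrightarrow> Ws ! j = sp d {..?c j} (q j)"
    using graded_of_decomp[where c = ?c, OF rep Ws(1,2,3,4)] by auto
  have qm: "q j l \<in> Ws ! j" if "j \<le> L" "l \<le> ?c j" for j l
    unfolding q[OF that(1)] using that gradedD(4)[OF g] by (intro sp_member) auto
  have z0: "\<rho> GZ *\<^sub>v v = 0\<^sub>v d" if "v \<in> carrier_vec d" for v
    using Z that by (intro eq_vecI) (auto simp: is_Zmod_def index_mult_mat_vec)
  have "\<exists>i\<le>2*n-1. \<exists>l\<le>?c (Suc j). \<rho> (GX i) *\<^sub>v q (Suc j) l \<noteq> 0\<^sub>v d" if j: "j < L" for j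
  proof (rule ccontr)
    assume a: "\<not> ?thesis"
    obtain i w where iw: "i \<le> 2 * n - 1" "w \<in> Ws ! Suc j" "\<rho> (GX i) *\<^sub>v w \<noteq> 0\<^sub>v d" using Ws(7)[of "Suc j"] j by auto
    obtain e where "w = lc d {..?c (Suc j)} e (q (Suc j))" using iw(2) q[of "Suc j"] j by (auto elim: sp_E)
    then have "\<rho> (GX i) *\<^sub>v w = lc d {..?c (Suc j)} e (\<lambda>l. \<rho> (GX i) *\<^sub>v q (Suc j) l)"
      using gradedD(4)[OF g, of "Suc j"] j by (simp only:) (intro mult_lc[OF g_repD(1)[OF rep]], auto)
    also have "\<dots> = 0\<^sub>v d" using a iw(1) by (intro lc_zero) auto
    finally show False using iw(3) by simp
  qed
  moreover have "\<rho> (GX i) *\<^sub>v q (Suc j) l \<in> sp d {..?c j} (q j)" if "j < L" "i \<le> 2*n-1" "l \<le> ?c (Suc j)" for i j l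
    using Ws(6)[of "Suc j" i "q (Suc j) l"] qm[of "Suc j" l] q[of j] that by simp
  moreover have "inj_on ?c {..L}" using n by (auto simp: inj_on_def)
  moreover have "\<rho> (GX i) *\<^sub>v q 0 l = 0\<^sub>v d" if "i \<le> 2*n-1" "l \<le> ?c 0" for i l
    using Ws(5)[OF that(1)] qm[of 0 l] that by simp
  ultimately have "zgraded (2 * n - 1) d \<rho> L ?c q" using g z0 unfolding zgraded_def by blast
  then show ?thesis by blast
qed

text \<open>Expand the unit vectors in the basis p; the coefficients of \<open>p i\<close> are the
  entries of \<open>r i\<close>. In matrix terms these are the rows of the inverse of the matrix
  with columns p.\<close>

lemma dual_basis:
  fixes p :: "'i \<Rightarrow> 'a::field vec"
  assumes ind: "indep d I p" and span: "sp d I p = carrier_vec d"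
  shows "\<exists>r. (\<forall>i\<in>I. r i \<in> carrier_vec d) \<and> (\<forall>i\<in>I. \<forall>j\<in>I. r i \<bullet> p j = (if i = j then 1 else 0)) \<and>
     indep d I r \<and> (\<forall>w\<in>carrier_vec d. w = lc d I (\<lambda>i. w \<bullet> p i) r)"
proof -
  note pc = indep_carrier[OF ind] and fin = indep_finite[OF ind]
  have "\<forall>s. \<exists>a. unit_vec d s = lc d I a p"
  proof
    fix s
    have "unit_vec d s \<in> sp d I p" unfolding span by simp
    then show "\<exists>a. unit_vec d s = lc d I a p" by (auto elim: sp_E)
  qed
  then obtain a where a: "\<And>s. unit_vec d s = lc d I (a s) p" by metis
  define r where "r i = vec d (\<lambda>s. a s i)" for i
  have rc: "r i \<in> carrier_vec d" for i by (simp add: r_def)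
  have exp: "v = lc d I (\<lambda>i. r i \<bullet> v) p" if v: "v \<in> carrier_vec d" for v
  proof -
    have "v = lc d {..<d} (\<lambda>s. v $ s) (\<lambda>s. lc d I (a s) p)" using unit_span[OF v] by (simp add: a[symmetric])
    also have "\<dots> = lc d I (\<lambda>i. \<Sum>s<d. v $ s * a s i) p" by (rule lc_lc)
    also have "\<dots> = lc d I (\<lambda>i. r i \<bullet> v) p"
      using carrier_vecD[OF v] by (intro lc_cong) (simp_all add: scalar_prod_def r_def lessThan_atLeast0 mult.commute)
    finally show ?thesis .
  qed
  have delta: "r i \<bullet> p j = (if i = j then 1 else 0)" if ij: "i \<in> I" "j \<in> I" for i j
  proof -
    have "lc d I (\<lambda>i. r i \<bullet> p j) p = p j" using exp[OF pc[OF ij(2)]] by simp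
    also have "p j = lc d I (\<lambda>i. if i = j then 1 else 0) p"
      using lc_single[where p = p, OF fin ij(2) pc[OF ij(2)], of "\<lambda>i. if i = j then 1 else 0"] by simp
    finally have e: "lc d I (\<lambda>i. r i \<bullet> p j) p = lc d I (\<lambda>i. if i = j then 1 else 0) p" .
    show ?thesis by (rule indep_eqD[OF ind e ij(1)])
  qed
  have lcdot: "lc d I c r \<bullet> v = (\<Sum>i\<in>I. c i * (r i \<bullet> v))" if v: "v \<in> carrier_vec d" for c v
  proof -
    have "lc d I c r \<bullet> v = (\<Sum>s<d. \<Sum>i\<in>I. c i * (r i $ s * v $ s))"
      using carrier_vecD[OF v] by (simp add: scalar_prod_def lessThan_atLeast0 sum_distrib_right mult.assoc)
    also have "\<dots> = (\<Sum>i\<in>I. \<Sum>s<d. c i * (r i $ s * v $ s))" by (rule sum.swap)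
    finally show ?thesis using carrier_vecD[OF v] by (simp add: scalar_prod_def lessThan_atLeast0 sum_distrib_left)
  qed
  have "c j = 0" if z: "lc d I c r = 0\<^sub>v d" and j: "j \<in> I" for c j
  proof -
    have "0 = lc d I c r \<bullet> p j" unfolding z using pc[OF j] by simp
    also have "\<dots> = (\<Sum>i\<in>I. c i * (r i \<bullet> p j))" by (rule lcdot[OF pc[OF j]])
    also have "\<dots> = (if j \<in> I then c j * (r j \<bullet> p j) else 0)" using fin delta j by (intro sum_at) auto
    finally show ?thesis using delta j by simp
  qed
  then have "indep d I r" using fin rc by (auto simp: indep_def)
  moreover have "w = lc d I (\<lambda>i. w \<bullet> p i) r" if w: "w \<in> carrier_vec d" for w
  proof (rule eq_vecI)
    fix s assume "s < dim_vec (lc d I (\<lambda>i. w \<bullet> p i) r)"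
    then have s: "s < d" by simp
    have "w $ s = w \<bullet> unit_vec d s" using w s by simp
    also have "\<dots> = (\<Sum>t<d. \<Sum>i\<in>I. w $ t * (a s i * p i $ t))"
      unfolding a by (simp add: scalar_prod_def lessThan_atLeast0 sum_distrib_left)
    also have "\<dots> = (\<Sum>i\<in>I. \<Sum>t<d. w $ t * (a s i * p i $ t))" by (rule sum.swap)
    also have "\<dots> = (\<Sum>i\<in>I. (w \<bullet> p i) * a s i)"
      using pc by (intro sum.cong refl) (simp add: scalar_prod_def lessThan_atLeast0 sum_distrib_left carrier_vecD[OF pc] mult_ac)
    finally show "w $ s = lc d I (\<lambda>i. w \<bullet> p i) r $ s" using s by (simp add: r_def)
  qed (use w in simp)
  ultimately show ?thesis using rc delta by blast
qed

text \<open>The standard dot product is an invariant pairing of the dual module with the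
  module.\<close>

lemma gdual_scalar:
  assumes A: "\<rho> b \<in> carrier_mat d d" and w: "w \<in> carrier_vec d" and v: "v \<in> carrier_vec d"
  shows "(gdual \<rho> b *\<^sub>v w) \<bullet> v = - (w \<bullet> (\<rho> b *\<^sub>v v))"
proof -
  have At: "- transpose_mat (\<rho> b) \<in> carrier_mat d d" using A by simp
  have "(gdual \<rho> b *\<^sub>v w) \<bullet> v = (\<Sum>s<d. (\<Sum>t<d. - (\<rho> b $$ (t,s)) * w $ t) * v $ s)"
    using carrier_vecD[OF v] A unfolding gdual_def
    by (simp add: scalar_prod_def lessThan_atLeast0[symmetric] mult_mat_vec_index[OF At w])
  also have "\<dots> = (\<Sum>s<d. \<Sum>t<d. - (w $ t * (\<rho> b $$ (t,s) * v $ s)))" by (simp add: sum_distrib_left mult_ac)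
  also have "\<dots> = (\<Sum>t<d. \<Sum>s<d. - (w $ t * (\<rho> b $$ (t,s) * v $ s)))" by (rule sum.swap)
  also have "\<dots> = - (w \<bullet> (\<rho> b *\<^sub>v v))"
    using carrier_matD[OF A] by (simp add: scalar_prod_def lessThan_atLeast0[symmetric] mult_mat_vec_index[OF A v] sum_distrib_left sum_negf)
  finally show ?thesis .
qed

lemma chain_map:
  assumes ch: "chain d E F H k p" and P: "P \<in> carrier_mat d d" and inj: "\<And>v. v \<in> carrier_vec d \<Longrightarrow> P *\<^sub>v v = 0\<^sub>v d \<Longrightarrow> v = 0\<^sub>v d"
    and e: "\<And>v. v \<in> carrier_vec d \<Longrightarrow> E' *\<^sub>v (P *\<^sub>v v) = P *\<^sub>v (E *\<^sub>v v)"
      "\<And>v. v \<in> carrier_vec d \<Longrightarrow> F' *\<^sub>v (P *\<^sub>v v) = P *\<^sub>v (F *\<^sub>v v)"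
      "\<And>v. v \<in> carrier_vec d \<Longrightarrow> H' *\<^sub>v (P *\<^sub>v v) = P *\<^sub>v (H *\<^sub>v v)"
  shows "chain d E' F' H' k (\<lambda>l. P *\<^sub>v p l)"
proof -
  note D = chainD[OF ch]
  have s: "P *\<^sub>v (t \<cdot>\<^sub>v p j) = t \<cdot>\<^sub>v (P *\<^sub>v p j)" if "j \<le> k" for t j by (rule mult_mat_vec[OF P D(1)[OF that]])
  show ?thesis unfolding chain_def
  proof (intro conjI allI impI)
    fix j assume j: "j \<le> k"
    show "P *\<^sub>v p j \<in> carrier_vec d" using P by simp
    show "H' *\<^sub>v (P *\<^sub>v p j) = of_int (int k - 2 * int j) \<cdot>\<^sub>v (P *\<^sub>v p j)" using e(3)[OF D(1)[OF j]] D(3)[OF j] s[OF j] by simp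
    show "E' *\<^sub>v (P *\<^sub>v p j) = of_nat (j * (k + 1 - j)) \<cdot>\<^sub>v (P *\<^sub>v p (j - 1))" using e(1)[OF D(1)[OF j]] D(4)[OF j] s[of "j - 1"] j by simp
  next
    fix j assume j: "j < k"
    show "F' *\<^sub>v (P *\<^sub>v p j) = P *\<^sub>v p (j + 1)" using e(2)[OF D(1)[of j]] D(5)[OF j] j by simp
  next
    show "F' *\<^sub>v (P *\<^sub>v p k) = 0\<^sub>v d" using e(2)[OF D(1)[of k]] D(6) P by simp
    show "P *\<^sub>v p 0 \<noteq> 0\<^sub>v d" using inj D(1)[of 0] D(2) by blast
  qed
qed

lemma indep_rescale:
  assumes ind: "indep d I r" and \<phi>: "bij_betw \<phi> J I" and t: "\<And>j. j \<in> J \<Longrightarrow> t j \<noteq> 0"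
  shows "indep d J (\<lambda>j. t j \<cdot>\<^sub>v r (\<phi> j))"
proof -
  have fin: "finite J" using \<phi> indep_finite[OF ind] bij_betw_finite by blast
  have img: "\<phi> ` J = I" and inj: "inj_on \<phi> J" using \<phi> by (auto simp: bij_betw_def)
  have c: "r (\<phi> j) \<in> carrier_vec d" if "j \<in> J" for j using indep_carrier[OF ind] img that by auto
  have "e j = 0" if z: "lc d J e (\<lambda>j. t j \<cdot>\<^sub>v r (\<phi> j)) = 0\<^sub>v d" and j: "j \<in> J" for e j
  proof -
    have "lc d I (\<lambda>i. e (the_inv_into J \<phi> i) * t (the_inv_into J \<phi> i)) r = lc d J (\<lambda>j. e j * t j) (\<lambda>j. r (\<phi> j))"
      unfolding img[symmetric] lc_reindex[OF inj] by (rule lc_cong) (auto simp: the_inv_into_f_f[OF inj])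
    also have "\<dots> = 0\<^sub>v d" using z lc_smult2[of J "\<lambda>j. r (\<phi> j)" d e t] c by simp
    finally have "e (the_inv_into J \<phi> (\<phi> j)) * t (the_inv_into J \<phi> (\<phi> j)) = 0" using indepD[OF ind] j img by blast
    then show ?thesis using t[OF j] by (simp add: the_inv_into_f_f[OF inj j])
  qed
  then show ?thesis using fin c by (auto simp: indep_def)
qed

lemma indep_map:
  assumes ind: "indep d J s" and P: "P \<in> carrier_mat d d" and inj: "\<And>v. v \<in> carrier_vec d \<Longrightarrow> P *\<^sub>v v = 0\<^sub>v d \<Longrightarrow> v = 0\<^sub>v d"
  shows "indep d J (\<lambda>j. P *\<^sub>v s j)"
proof -
  have "e j = 0" if "lc d J e (\<lambda>j. P *\<^sub>v s j) = 0\<^sub>v d" "j \<in> J" for e j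
  proof -
    have "P *\<^sub>v lc d J e s = lc d J e (\<lambda>j. P *\<^sub>v s j)" using indep_carrier[OF ind] by (intro mult_lc[OF P]) auto
    then have "P *\<^sub>v lc d J e s = 0\<^sub>v d" using that(1) by simp
    then show ?thesis using inj indepD[OF ind _ that(2)] by simp
  qed
  then show ?thesis using indep_finite[OF ind] P by (auto simp: indep_def)
qed

text \<open>The dual of a graded basis, with the levels in reverse order and each level read from
  the bottom up with alternating signs, is again a graded basis: transposing the x_i turns arrows
  from level J+1 to J into arrows from J to J+1. The isomorphism P carries this basis to the given
  module.\<close>

lemma Zmod_dual_zgraded:
  fixes \<rho> \<rho>' :: "gen \<Rightarrow> 'a::field_char_0 mat"
  assumes n: "n \<ge> 1" and gm: "gmod n d \<rho>" and Z: "is_Zmod n d \<rho>' \<alpha> L" and iso: "giso n d \<rho> d (gdual \<rho>')"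
  shows "\<exists>q. zgraded (2 * n - 1) d \<rho> L (\<lambda>j. \<alpha> + (L - j) * (2 * n - 1)) q"
proof -
  let ?m = "2 * n - 1"
  define c0 where "c0 j = \<alpha> + j * ?m" for j
  define c where "c j = c0 (L - j)" for j
  have gm': "gmod n d \<rho>'" using Z by (simp add: is_Zmod_def)
  note cr = g_repD(1)[OF gmod_g_rep[OF gm n]] and cr' = g_repD(1)[OF gmod_g_rep[OF gm' n]]
  obtain q0 where z: "zgraded ?m d \<rho>' L c0 q0" using Zmod_zgraded[OF n Z] unfolding c0_def by blast
  have g: "graded d \<rho>' L c0 q0" using z by (simp add: zgraded_def)
  let ?I = "idx L c0"
  obtain r where rc: "\<And>i. i \<in> ?I \<Longrightarrow> r i \<in> carrier_vec d"
    and delta: "\<And>i j. i \<in> ?I \<Longrightarrow> j \<in> ?I \<Longrightarrow> r i \<bullet> lev q0 j = (if i = j then 1 else 0)"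
    and rind: "indep d ?I r" and rexp: "\<And>w. w \<in> carrier_vec d \<Longrightarrow> w = lc d ?I (\<lambda>i. w \<bullet> lev q0 i) r"
    using dual_basis[OF gradedD(2,3)[OF g]] by blast
  have lc0: "lev q0 i \<in> carrier_vec d" if "i \<in> ?I" for i using indep_carrier[OF gradedD(2)[OF g] that] .
  have dc: "gdual \<rho>' b \<in> carrier_mat d d" for b using cr'[of b] by (simp add: gdual_def)
  have act: "gdual \<rho>' b *\<^sub>v w = lc d ?I (\<lambda>i. - (w \<bullet> (\<rho>' b *\<^sub>v lev q0 i))) r" if w: "w \<in> carrier_vec d" for b w
  proof -
    have "gdual \<rho>' b *\<^sub>v w = lc d ?I (\<lambda>i. (gdual \<rho>' b *\<^sub>v w) \<bullet> lev q0 i) r" using dc by (intro rexp) simp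
    also have "\<dots> = lc d ?I (\<lambda>i. - (w \<bullet> (\<rho>' b *\<^sub>v lev q0 i))) r"
      using lc0 by (intro lc_cong) (simp_all add: gdual_scalar[OF cr' w])
    finally show ?thesis .
  qed
  have dots: "r x \<bullet> (t \<cdot>\<^sub>v lev q0 y) = (if x = y then t else 0)" if "x \<in> ?I" "y \<in> ?I" for x y t
    using delta[OF that] rc[OF that(1)] lc0[OF that(2)] by simp
  have dot0: "r x \<bullet> 0\<^sub>v d = 0" if "x \<in> ?I" for x using rc[OF that] by simp
  \<comment> \<open>Dualising negates weights, so \<open>r (J,l)\<close> has the weight of position
    c0 J - l in V(c0 J), and E and F move the index in the direction opposite to that of a standard
    basis.\<close>
  have rH: "gdual \<rho>' GH *\<^sub>v r (J,l) = (- of_int (int (c0 J) - 2 * int l)) \<cdot>\<^sub>v r (J,l)" if J: "J \<le> L" "l \<le> c0 J" for J l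
  proof -
    have "gdual \<rho>' GH *\<^sub>v r (J,l) = lc d ?I (\<lambda>i. - (r (J,l) \<bullet> (\<rho>' GH *\<^sub>v lev q0 i))) r" using rc J by (intro act) simp
    also have "\<dots> = - (r (J,l) \<bullet> (\<rho>' GH *\<^sub>v lev q0 (J,l))) \<cdot>\<^sub>v r (J,l)"
    proof (rule lc_single)
      fix y assume y: "y \<in> ?I" "y \<noteq> (J,l)"
      obtain J' l' where y': "y = (J',l')" by (cases y)
      have "\<rho>' GH *\<^sub>v lev q0 y = of_int (int (c0 J') - 2 * int l') \<cdot>\<^sub>v lev q0 y" using chainD(3)[OF gradedD(1)[OF g]] y y' by simp
      then show "- (r (J,l) \<bullet> (\<rho>' GH *\<^sub>v lev q0 y)) = 0" using dots[of "(J,l)" y] J y by simp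
    qed (use J rc in auto)
    also have "\<rho>' GH *\<^sub>v lev q0 (J,l) = of_int (int (c0 J) - 2 * int l) \<cdot>\<^sub>v lev q0 (J,l)" using chainD(3)[OF gradedD(1)[OF g]] J by simp
    finally show ?thesis using dots[of "(J,l)" "(J,l)"] J by simp
  qed
  have rE: "gdual \<rho>' GE *\<^sub>v r (J,l) = (if l < c0 J then (- of_nat ((l + 1) * (c0 J - l))) \<cdot>\<^sub>v r (J,l+1) else 0\<^sub>v d)" if J: "J \<le> L" "l \<le> c0 J" for J l
  proof -
    have e: "gdual \<rho>' GE *\<^sub>v r (J,l) = lc d ?I (\<lambda>i. - (r (J,l) \<bullet> (\<rho>' GE *\<^sub>v lev q0 i))) r" using rc J by (intro act) simp
    have co: "r (J,l) \<bullet> (\<rho>' GE *\<^sub>v lev q0 (J',l')) = (if J' = J \<and> l' = l + 1 then of_nat (l' * (c0 J' + 1 - l')) else 0)" if y: "J' \<le> L" "l' \<le> c0 J'" for J' l'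
    proof -
      have "\<rho>' GE *\<^sub>v lev q0 (J',l') = of_nat (l' * (c0 J' + 1 - l')) \<cdot>\<^sub>v lev q0 (J',l'-1)" using chainD(4)[OF gradedD(1)[OF g]] y by simp
      then have "r (J,l) \<bullet> (\<rho>' GE *\<^sub>v lev q0 (J',l')) = (if (J,l) = (J',l'-1) then of_nat (l' * (c0 J' + 1 - l')) else 0)"
        using dots[of "(J,l)" "(J',l'-1)"] J y by (simp del: lev_pair)
      then show ?thesis by (cases l') auto
    qed
    show ?thesis
    proof (cases "l < c0 J")
      case True
      have "lc d ?I (\<lambda>i. - (r (J,l) \<bullet> (\<rho>' GE *\<^sub>v lev q0 i))) r = - (r (J,l) \<bullet> (\<rho>' GE *\<^sub>v lev q0 (J,l+1))) \<cdot>\<^sub>v r (J,l+1)"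
        using True J rc co by (intro lc_single) (auto simp del: lev_pair split: if_splits)
      then show ?thesis using True J co[of J "l+1"] e by (simp del: lev_pair)
    next
      case False
      have "lc d ?I (\<lambda>i. - (r (J,l) \<bullet> (\<rho>' GE *\<^sub>v lev q0 i))) r = 0\<^sub>v d"
        using False J co by (intro lc_zero) (auto simp del: lev_pair split: if_splits)
      then show ?thesis using False e by simp
    qed
  qed
  have rF: "gdual \<rho>' GF *\<^sub>v r (J,l) = (if l = 0 then 0\<^sub>v d else (-1) \<cdot>\<^sub>v r (J,l-1))" if J: "J \<le> L" "l \<le> c0 J" for J l
  proof -
    have e: "gdual \<rho>' GF *\<^sub>v r (J,l) = lc d ?I (\<lambda>i. - (r (J,l) \<bullet> (\<rho>' GF *\<^sub>v lev q0 i))) r" using rc J by (intro act) simp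
    have co: "r (J,l) \<bullet> (\<rho>' GF *\<^sub>v lev q0 (J',l')) = (if J' = J \<and> l = l' + 1 then 1 else 0)" if y: "J' \<le> L" "l' \<le> c0 J'" for J' l'
    proof (cases "l' < c0 J'")
      case True
      then have "\<rho>' GF *\<^sub>v lev q0 (J',l') = lev q0 (J',l'+1)" using chainD(5)[OF gradedD(1)[OF g]] y by simp
      then show ?thesis using delta[of "(J,l)" "(J',l'+1)"] J y True by (auto simp del: lev_pair)
    next
      case False
      then have "\<rho>' GF *\<^sub>v lev q0 (J',l') = 0\<^sub>v d" using chainD(6)[OF gradedD(1)[OF g y(1)]] y by simp
      then show ?thesis using dot0[of "(J,l)"] J y False by (auto simp del: lev_pair)
    qed
    show ?thesis
    proof (cases "l = 0")
      case True
      have "lc d ?I (\<lambda>i. - (r (J,l) \<bullet> (\<rho>' GF *\<^sub>v lev q0 i))) r = 0\<^sub>v d"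
        using True J co by (intro lc_zero) (auto simp del: lev_pair)
      then show ?thesis using True e by simp
    next
      case False
      have "lc d ?I (\<lambda>i. - (r (J,l) \<bullet> (\<rho>' GF *\<^sub>v lev q0 i))) r = - (r (J,l) \<bullet> (\<rho>' GF *\<^sub>v lev q0 (J,l-1))) \<cdot>\<^sub>v r (J,l-1)"
        using False J rc co by (intro lc_single) (auto simp del: lev_pair split: if_splits)
      then show ?thesis using False J co[of J "l-1"] e by (simp del: lev_pair)
    qed
  qed
  \<comment> \<open>The image under x_i of a vector of level J' lies in level J' - 1, so
    \<open>r (J,l)\<close> can detect it only if J' = J + 1.\<close>
  have xq: "r (J,l) \<bullet> (\<rho>' (GX i) *\<^sub>v lev q0 (J',l')) = 0" if "J \<le> L" "l \<le> c0 J" "J' \<le> L" "l' \<le> c0 J'" "J' \<noteq> Suc J" "i \<le> ?m" for J l J' l' i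
  proof (cases J')
    case 0
    then have "\<rho>' (GX i) *\<^sub>v lev q0 (J',l') = 0\<^sub>v d" using z that by (simp add: zgraded_def)
    then show ?thesis using dot0 that by simp
  next
    case (Suc k)
    then have "\<rho>' (GX i) *\<^sub>v lev q0 (J',l') \<in> sp d (Pair k ` {..c0 k}) (lev q0)" using z that by (auto simp: zgraded_def sp_level)
    then obtain e where e: "\<rho>' (GX i) *\<^sub>v lev q0 (J',l') = lc d (Pair k ` {..c0 k}) e (lev q0)" by (rule sp_E)
    have "r (J,l) \<bullet> lc d (Pair k ` {..c0 k}) e (lev q0) = (\<Sum>s<d. \<Sum>y\<in>Pair k ` {..c0 k}. e y * (r (J,l) $ s * lev q0 y $ s))"
      by (simp add: scalar_prod_def lessThan_atLeast0 sum_distrib_left mult_ac)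
    also have "\<dots> = (\<Sum>y\<in>Pair k ` {..c0 k}. \<Sum>s<d. e y * (r (J,l) $ s * lev q0 y $ s))" by (rule sum.swap)
    also have "\<dots> = (\<Sum>y\<in>Pair k ` {..c0 k}. e y * (r (J,l) \<bullet> lev q0 y))"
      using lc0 that Suc by (intro sum.cong refl) (auto simp: scalar_prod_def lessThan_atLeast0 sum_distrib_left carrier_vecD[of _ d] simp del: lev_pair)
    also have "\<dots> = 0" using delta that Suc by (intro sum.neutral) auto
    finally show ?thesis unfolding e .
  qed
  \<comment> \<open>The dual action therefore sends level J into level J + 1 and kills level L,
    where the index set is empty.\<close>
  have xr: "gdual \<rho>' (GX i) *\<^sub>v r (J,l) \<in> sp d (if J = L then {} else Pair (Suc J) ` {..c0 (Suc J)}) r" if "J \<le> L" "l \<le> c0 J" "i \<le> ?m" for i J l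
  proof -
    have "gdual \<rho>' (GX i) *\<^sub>v r (J,l) = lc d ?I (\<lambda>y. - (r (J,l) \<bullet> (\<rho>' (GX i) *\<^sub>v lev q0 y))) r" using rc that by (intro act) simp
    also have "\<dots> = lc d (if J = L then {} else Pair (Suc J) ` {..c0 (Suc J)}) (\<lambda>y. - (r (J,l) \<bullet> (\<rho>' (GX i) *\<^sub>v lev q0 y))) r"
    proof (rule lc_mono[symmetric])
      fix y assume y: "y \<in> ?I - (if J = L then {} else Pair (Suc J) ` {..c0 (Suc J)})"
      obtain J' l' where y': "y = (J',l')" by (cases y)
      show "- (r (J,l) \<bullet> (\<rho>' (GX i) *\<^sub>v lev q0 y)) = 0"
        unfolding y' using y y' that by (subst xq) (auto split: if_splits)
    qed (use that in auto)
    finally show ?thesis by simp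
  qed
  \<comment> \<open>Some x_i maps a vector of level J + 1 to a nonzero vector of level J; a dual
    basis vector that detects this image is not killed by x_i.\<close>
  have xnz: "\<exists>i\<le>?m. \<exists>l\<le>c0 J. gdual \<rho>' (GX i) *\<^sub>v r (J,l) \<noteq> 0\<^sub>v d" if J: "J < L" for J
  proof -
    obtain i l' where i: "i \<le> ?m" "l' \<le> c0 (Suc J)" "\<rho>' (GX i) *\<^sub>v q0 (Suc J) l' \<noteq> 0\<^sub>v d" "\<rho>' (GX i) *\<^sub>v q0 (Suc J) l' \<in> sp d {..c0 J} (q0 J)"
      using z J unfolding zgraded_def by meson
    let ?u = "\<rho>' (GX i) *\<^sub>v q0 (Suc J) l'"
    have "\<exists>l\<le>c0 J. r (J,l) \<bullet> ?u \<noteq> 0"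
    proof (rule ccontr)
      assume a: "\<not> ?thesis"
      have "?u \<in> sp d (Pair J ` {..c0 J}) (lev q0)" using i(4) by (simp add: sp_level)
      then obtain e where e: "?u = lc d (Pair J ` {..c0 J}) e (lev q0)" by (rule sp_E)
      have "e (J,l) = 0" if l: "l \<le> c0 J" for l
      proof -
        have "r (J,l) \<bullet> ?u = (\<Sum>s<d. \<Sum>y\<in>Pair J ` {..c0 J}. e y * (r (J,l) $ s * lev q0 y $ s))"
          unfolding e by (simp add: scalar_prod_def lessThan_atLeast0 sum_distrib_left mult_ac)
        also have "\<dots> = (\<Sum>y\<in>Pair J ` {..c0 J}. \<Sum>s<d. e y * (r (J,l) $ s * lev q0 y $ s))" by (rule sum.swap)
        also have "\<dots> = (\<Sum>y\<in>Pair J ` {..c0 J}. e y * (r (J,l) \<bullet> lev q0 y))"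
          using lc0 J by (intro sum.cong refl) (auto simp: scalar_prod_def lessThan_atLeast0 sum_distrib_left carrier_vecD[of _ d] simp del: lev_pair)
        also have "\<dots> = (if (J,l) \<in> Pair J ` {..c0 J} then e (J,l) * (r (J,l) \<bullet> lev q0 (J,l)) else 0)"
          using delta J l by (intro sum_at) (auto simp del: lev_pair split: if_splits)
        also have "\<dots> = e (J,l)" using delta[of "(J,l)" "(J,l)"] J l by (auto simp del: lev_pair)
        finally show ?thesis using a l by auto
      qed
      then have "?u = 0\<^sub>v d" unfolding e by (intro lc_zero) auto
      then show False using i(3) by simp
    qed
    then obtain l where l: "l \<le> c0 J" "r (J,l) \<bullet> ?u \<noteq> 0" by blast
    have a: "gdual \<rho>' (GX i) *\<^sub>v r (J,l) = lc d ?I (\<lambda>y. - (r (J,l) \<bullet> (\<rho>' (GX i) *\<^sub>v lev q0 y))) r" using rc J l by (intro act) simp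
    have "gdual \<rho>' (GX i) *\<^sub>v r (J,l) \<noteq> 0\<^sub>v d"
    proof
      assume "gdual \<rho>' (GX i) *\<^sub>v r (J,l) = 0\<^sub>v d"
      then have "- (r (J,l) \<bullet> (\<rho>' (GX i) *\<^sub>v lev q0 (Suc J,l'))) = 0"
        using indepD[OF rind, of "\<lambda>y. - (r (J,l) \<bullet> (\<rho>' (GX i) *\<^sub>v lev q0 y))" "(Suc J,l')"] a J i by simp
      then show False using l by simp
    qed
    then show ?thesis using i l by blast
  qed

  \<comment> \<open>Levels are reversed by j -> L - j and positions by l -> c j - l. The sign (-1)^l
    in \<open>s\<close> compensates the minus sign of the dual action of F.\<close>
  define \<phi> where "\<phi> = (\<lambda>(j,l). (L - j, c0 (L - j) - l))"
  define s where "s j l = (-1) ^ l \<cdot>\<^sub>v r (\<phi> (j,l))" for j l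
  have \<phi>I: "\<phi> (j,l) \<in> ?I" if "j \<le> L" "l \<le> c j" for j l by (auto simp: \<phi>_def)
  have bij: "bij_betw \<phi> (idx L c) ?I"
    by (rule bij_betwI[where g = "\<lambda>(j,l). (L - j, c0 j - l)"]) (auto simp: \<phi>_def c_def)
  have scar: "s j l \<in> carrier_vec d" if "j \<le> L" "l \<le> c j" for j l using rc[OF \<phi>I[OF that]] by (simp add: s_def)
  have sind: "indep d (idx L c) (lev s)"
  proof -
    have "lev s = (\<lambda>x. (-1) ^ (snd x) \<cdot>\<^sub>v r (\<phi> x))" by (auto simp: lev_def s_def)
    then show ?thesis using indep_rescale[OF rind bij, of "\<lambda>x. (-1) ^ (snd x)"] by simp
  qed
  have rs: "r (L - j, l) \<in> sp d {..c j} (s j)" if "j \<le> L" "l \<le> c j" for j l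
  proof -
    have "s j (c j - l) \<in> sp d {..c j} (s j)" using scar that by (intro sp_member) auto
    moreover have "s j (c j - l) = (-1) ^ (c j - l) \<cdot>\<^sub>v r (L - j, l)" using that by (simp add: s_def \<phi>_def c_def)
    ultimately show ?thesis using subspace_smult_cancel[OF subspace_sp] by (metis power_eq_0_iff zero_neq_neg_one)
  qed
  have sspan: "sp d (idx L c) (lev s) = carrier_vec d"
  proof (intro equalityI subsetI)
    fix w :: "'a vec" assume w: "w \<in> carrier_vec d"
    have "r x \<in> sp d (idx L c) (lev s)" if "x \<in> ?I" for x
    proof -
      obtain J l where "x = (J,l)" by (cases x)
      then have x: "x = (J,l)" "J \<le> L" "l \<le> c0 J" using that by auto
      have "sp d {..c (L - J)} (s (L - J)) \<subseteq> sp d (idx L c) (lev s)"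
        using scar[of "L - J"] sp_member[of "idx L c" "(L - J, _)" "lev s" d] by (intro sp_least subspace_sp) auto
      then show ?thesis using rs[of "L - J" l] x by (auto simp: c_def)
    qed
    then have "lc d ?I (\<lambda>i. w \<bullet> lev q0 i) r \<in> sp d (idx L c) (lev s)" using rc by (intro subspace_lc subspace_sp) auto
    then show "w \<in> sp d (idx L c) (lev s)" using rexp[OF w] by simp
  qed (use sp_carrier in blast)
  have sch: "chain d (gdual \<rho>' GE) (gdual \<rho>' GF) (gdual \<rho>' GH) (c j) (s j)" if j: "j \<le> L" for j
  proof -
    let ?J = "L - j"
    have sl: "s j l = (-1) ^ l \<cdot>\<^sub>v r (?J, c j - l)" for l by (simp add: s_def \<phi>_def c_def)
    have rcJ: "r (?J, c j - l) \<in> carrier_vec d" for l by (rule rc) (auto simp: c_def)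
    have sm: "gdual \<rho>' b *\<^sub>v s j l = (-1) ^ l \<cdot>\<^sub>v (gdual \<rho>' b *\<^sub>v r (?J, c j - l))" for b l
      unfolding sl by (rule mult_mat_vec[OF dc rcJ])
    have cJ: "c0 ?J = c j" by (simp add: c_def)
    show ?thesis unfolding chain_def
    proof (intro conjI allI impI)
      fix l assume l: "l \<le> c j"
      show "s j l \<in> carrier_vec d" by (rule scar[OF j l])
      have "- (int (c j) - 2 * int (c j - l)) = int (c j) - 2 * int l" using l by simp
      then have "- of_int (int (c j) - 2 * int (c j - l)) = (of_int (int (c j) - 2 * int l) :: 'a)" by (simp only: of_int_minus[symmetric])
      then show "gdual \<rho>' GH *\<^sub>v s j l = of_int (int (c j) - 2 * int l) \<cdot>\<^sub>v s j l"
        using rH[of ?J "c j - l"] unfolding sm unfolding sl cJ by (simp add: smult_smult_assoc mult.commute)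
      show "gdual \<rho>' GE *\<^sub>v s j l = of_nat (l * (c j + 1 - l)) \<cdot>\<^sub>v s j (l - 1)"
      proof (cases l)
        case 0
        then show ?thesis using rE[of ?J "c j - l"] scar[OF j, of 0] unfolding sm cJ by (simp add: smult_0_vec)
      next
        case (Suc k)
        have A: "c j - (c j - l) = l" "c j - l + 1 = c j + 1 - l" "c j + 1 - l = c j - k" using l Suc by simp_all
        have B: "(c j - l + 1) * (c j - (c j - l)) = l * (c j + 1 - l)" by (simp only: A(1,2) mult.commute)
        have "gdual \<rho>' GE *\<^sub>v r (?J, c j - l) = (- of_nat ((c j - l + 1) * (c j - (c j - l)))) \<cdot>\<^sub>v r (?J, c j - l + 1)"
          using rE[of ?J "c j - l"] l Suc unfolding cJ by (simp del: of_nat_mult of_nat_add mult_Suc mult_Suc_right)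
        then have "gdual \<rho>' GE *\<^sub>v r (?J, c j - l) = (- of_nat (l * (c j + 1 - l))) \<cdot>\<^sub>v r (?J, c j - k)" unfolding B unfolding A(2,3) .
        moreover have "(-1) ^ l * (- x) = x * (-1 :: 'a) ^ k" for x using Suc by simp
        ultimately show ?thesis unfolding sm unfolding sl using Suc by (simp only: smult_smult_assoc diff_Suc_1)
      qed
    next
      fix l assume l: "l < c j"
      then have "gdual \<rho>' GF *\<^sub>v r (?J, c j - l) = (-1) \<cdot>\<^sub>v r (?J, c j - (l + 1))" using rF[of ?J "c j - l"] unfolding cJ by simp
      then show "gdual \<rho>' GF *\<^sub>v s j l = s j (l + 1)" unfolding sm unfolding sl by (simp add: smult_smult_assoc)
    next
      show "gdual \<rho>' GF *\<^sub>v s j (c j) = 0\<^sub>v d" using rF[of ?J 0] unfolding sm by simp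
      show "s j 0 \<noteq> 0\<^sub>v d" using indep_nonzero[OF sind, of "(j,0)"] j by simp
    qed
  qed

  obtain P where P: "P \<in> carrier_mat d d" "invertible_mat P" "\<And>b. b \<in> gbasis n \<Longrightarrow> P * gdual \<rho>' b = \<rho> b * P"
    using iso unfolding giso_def by blast
  obtain Q where Q: "P * Q = 1\<^sub>m d" "Q * P = 1\<^sub>m (dim_row Q)"
    using P(1,2) unfolding invertible_mat_def inverts_mat_def by auto
  have Qc: "Q \<in> carrier_mat d d"
  proof
    have "dim_col (P * Q) = d" using Q(1) by simp
    then show "dim_col Q = d" by simp
    have "dim_col (Q * P) = dim_row Q" using Q(2) by simp
    then show "dim_row Q = d" using P(1) by simp
  qed
  have Pinj: "v = 0\<^sub>v d" if "v \<in> carrier_vec d" "P *\<^sub>v v = 0\<^sub>v d" for v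
  proof -
    have "v = (Q * P) *\<^sub>v v" using Q(2) Qc that(1) by simp
    also have "\<dots> = Q *\<^sub>v (P *\<^sub>v v)" by (rule assoc_mult_mat_vec[OF Qc P(1) that(1)])
    finally show ?thesis using that Qc by simp
  qed
  have Psurj: "\<exists>w\<in>carrier_vec d. v = P *\<^sub>v w" if "v \<in> carrier_vec d" for v
  proof
    show "v = P *\<^sub>v (Q *\<^sub>v v)" using assoc_mult_mat_vec[OF P(1) Qc that] Q(1) that by simp
    show "Q *\<^sub>v v \<in> carrier_vec d" using Qc by simp
  qed
  have Pact: "\<rho> b *\<^sub>v (P *\<^sub>v v) = P *\<^sub>v (gdual \<rho>' b *\<^sub>v v)" if "b \<in> gbasis n" "v \<in> carrier_vec d" for b v
    using assoc_mult_mat_vec[OF cr P(1) that(2), of b] assoc_mult_mat_vec[OF P(1) dc that(2), of b] P(3)[OF that(1)] by simp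
  have bas: "GE \<in> gbasis n" "GF \<in> gbasis n" "GH \<in> gbasis n" "GZ \<in> gbasis n" "\<And>i. i \<le> ?m \<Longrightarrow> GX i \<in> gbasis n" by (auto simp: gbasis_def)
  define q where "q j l = P *\<^sub>v s j l" for j l
  have Pimg: "P *\<^sub>v w \<in> sp d A (\<lambda>x. P *\<^sub>v b x)" if "w \<in> sp d A b" "\<And>x. x \<in> A \<Longrightarrow> b x \<in> carrier_vec d" for w and b :: "'k \<Rightarrow> 'a vec" and A
    using that mult_lc[OF P(1), of A b] by (auto elim!: sp_E)
  have levq: "lev q = (\<lambda>x. P *\<^sub>v lev s x)" by (auto simp: lev_def q_def)
  have sc': "lev s x \<in> carrier_vec d" if "x \<in> idx L c" for x using indep_carrier[OF sind that] .
  have "graded d \<rho> L c q" unfolding graded_def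
  proof (intro conjI allI impI)
    fix j assume "j \<le> L"
    then have "chain d (\<rho> GE) (\<rho> GF) (\<rho> GH) (c j) (\<lambda>l. P *\<^sub>v s j l)"
      using Pact bas by (intro chain_map[OF sch P(1) Pinj]) auto
    then show "chain d (\<rho> GE) (\<rho> GF) (\<rho> GH) (c j) (q j)" by (simp add: q_def[abs_def])
  next
    show "indep d (idx L c) (lev q)" unfolding levq by (rule indep_map[OF sind P(1) Pinj])
    show "sp d (idx L c) (lev q) = carrier_vec d"
    proof (intro equalityI subsetI)
      fix v :: "'a vec" assume "v \<in> carrier_vec d"
      then obtain w where "w \<in> sp d (idx L c) (lev s)" "v = P *\<^sub>v w" using Psurj unfolding sspan by blast
      then show "v \<in> sp d (idx L c) (lev q)" unfolding levq using Pimg sc' by blast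
    qed (use sp_carrier in blast)
  qed
  moreover have "inj_on c {..L}" using n by (auto simp: inj_on_def c_def c0_def)
  moreover have "\<rho> GZ *\<^sub>v v = 0\<^sub>v d" if v: "v \<in> carrier_vec d" for v
  proof -
    obtain w where w: "w \<in> carrier_vec d" "v = P *\<^sub>v w" using Psurj[OF v] by blast
    have "gdual \<rho>' GZ *\<^sub>v w = 0\<^sub>v d" unfolding act[OF w(1)] using z lc0 w(1) by (intro lc_zero) (auto simp: zgraded_def)
    then show ?thesis using w Pact bas P(1) by simp
  qed
  moreover have "\<rho> (GX i) *\<^sub>v q 0 l = 0\<^sub>v d" if "i \<le> ?m" "l \<le> c 0" for i l
  proof -
    have "r (L, c 0 - l) \<in> carrier_vec d" by (rule rc) (simp add: c_def)
    moreover have "gdual \<rho>' (GX i) *\<^sub>v r (L, c 0 - l) = 0\<^sub>v d" using xr[of L "c 0 - l" i] that by (auto simp: c_def sp_def)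
    ultimately have "gdual \<rho>' (GX i) *\<^sub>v s 0 l = 0\<^sub>v d" using mult_mat_vec[OF dc] by (simp add: s_def \<phi>_def c_def)
    then show ?thesis using Pact[OF bas(5)[OF that(1)] scar[of 0 l]] that P(1) by (simp add: q_def)
  qed
  moreover have "\<rho> (GX i) *\<^sub>v q (Suc j) l \<in> sp d {..c j} (q j)" if "j < L" "i \<le> ?m" "l \<le> c (Suc j)" for i j l
  proof -
    have rcJ: "r (L - Suc j, c (Suc j) - l) \<in> carrier_vec d" by (rule rc) (auto simp: c_def)
    have J: "Suc (L - Suc j) = L - j" "L - Suc j \<noteq> L" using that by auto
    have "gdual \<rho>' (GX i) *\<^sub>v r (L - Suc j, c (Suc j) - l) \<in> sp d (Pair (L - j) ` {..c0 (L - j)}) r"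
      using xr[of "L - Suc j" "c (Suc j) - l" i] that J by (auto simp: c_def)
    also have "sp d (Pair (L - j) ` {..c0 (L - j)}) r \<subseteq> sp d {..c j} (s j)"
      using rs[of j] that by (intro sp_least subspace_sp) (auto simp: c_def)
    finally have "gdual \<rho>' (GX i) *\<^sub>v s (Suc j) l \<in> sp d {..c j} (s j)"
      using mult_mat_vec[OF dc rcJ] by (simp add: s_def \<phi>_def c_def subspace_smult[OF subspace_sp])
    then have "P *\<^sub>v (gdual \<rho>' (GX i) *\<^sub>v s (Suc j) l) \<in> sp d {..c j} (\<lambda>l. P *\<^sub>v s j l)" using scar that by (intro Pimg) auto
    then show ?thesis using Pact[OF bas(5)[OF that(2)] scar[of "Suc j" l]] that by (simp add: q_def[abs_def])
  qed
  moreover have "\<exists>i\<le>?m. \<exists>l\<le>c (Suc j). \<rho> (GX i) *\<^sub>v q (Suc j) l \<noteq> 0\<^sub>v d" if j: "j < L" for j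
  proof -
    obtain i l where il: "i \<le> ?m" "l \<le> c0 (L - Suc j)" "gdual \<rho>' (GX i) *\<^sub>v r (L - Suc j, l) \<noteq> 0\<^sub>v d" using xnz[of "L - Suc j"] j by auto
    let ?l = "c (Suc j) - l"
    have rcJ: "r (L - Suc j, l) \<in> carrier_vec d" using il by (intro rc) auto
    have "s (Suc j) ?l = (-1) ^ ?l \<cdot>\<^sub>v r (L - Suc j, l)" using il by (simp add: s_def \<phi>_def c_def)
    then have "gdual \<rho>' (GX i) *\<^sub>v s (Suc j) ?l = (-1) ^ ?l \<cdot>\<^sub>v (gdual \<rho>' (GX i) *\<^sub>v r (L - Suc j, l))" using mult_mat_vec[OF dc rcJ] by simp
    then have nz: "gdual \<rho>' (GX i) *\<^sub>v s (Suc j) ?l \<noteq> 0\<^sub>v d" using smult_eq_0D[of "(-1) ^ ?l" _ d] il(3) by auto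
    have "\<rho> (GX i) *\<^sub>v q (Suc j) ?l = P *\<^sub>v (gdual \<rho>' (GX i) *\<^sub>v s (Suc j) ?l)"
      unfolding q_def using j il scar[of "Suc j" ?l] by (intro Pact bas) auto
    then have "\<rho> (GX i) *\<^sub>v q (Suc j) ?l \<noteq> 0\<^sub>v d" using Pinj nz dc by (metis mult_mat_vec_sq)
    then show ?thesis using il(1) by (meson diff_le_self)
  qed
  ultimately have "zgraded ?m d \<rho> L c q" unfolding zgraded_def by blast
  then show ?thesis unfolding c_def c0_def by blast
qed

section \<open>Matching a given socle decomposition with the levels\<close>

lemma subspace_lsum: "(\<And>W. W \<in> set Ws \<Longrightarrow> subspace d W) \<Longrightarrow> subspace d (lsum d Ws)"
  by (induction Ws) (auto intro: subspace_ssum subspace_0)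

lemma ssum_0: "subspace d U \<Longrightarrow> ssum U {0\<^sub>v d} = U"
  by (rule subset_antisym) (rule ssum_least, auto intro: ssum_upper(1)[THEN subsetD] subspace_0 subspace_zero)

lemma sl2_iso_subspace:
  assumes rep: "g_rep m d \<rho>" and i: "sl2_iso d \<rho> W [k]" shows "subspace d W"
proof -
  obtain p where "W = sp d {..k} p" using i sl2_iso_single[OF g_repD(1)[OF rep] g_repD(2)[OF rep], of W k] by blast
  then show ?thesis by (simp add: subspace_sp)
qed

lemma sp_two_levels:
  assumes "i \<noteq> j" shows "sp d (Pair i ` {..a} \<union> Pair j ` {..b}) (lev q) = ssum (sp d {..a} (q i)) (sp d {..b} (q j))"
  using assms by (subst sp_Un) (auto simp: sp_level)

text \<open>By \<open>graded_submodule\<close> each summand is a level. The first summand and the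
  sum of the first two are g-submodules. A first summand other than level 0 would be moved outside
  itself by some x_i; likewise a second summand of level above 1 would be moved outside the sum, and
  directness excludes level 0.\<close>

lemma socle_match:
  assumes rep: "g_rep (2 * n - 1) d \<rho>" and z: "zgraded (2 * n - 1) d \<rho> L c q"
    and sd: "socle_decomp n d \<rho> Ws bs" and len: "length bs \<ge> 2"
  shows "1 \<le> L" "bs ! 0 = c 0" "bs ! 1 = c 1" "Ws ! 0 = sp d {..c 0} (q 0)" "Ws ! 1 = sp d {..c 1} (q 1)"
proof -
  let ?m = "2 * n - 1"
  note cr = g_repD(1)[OF rep] and sl = g_repD(2)[OF rep]
  have g: "graded d \<rho> L c q" and inj: "inj_on c {..L}" using z by (auto simp: zgraded_def)
  have lW: "length Ws = length bs" and iso: "\<And>i. i < length Ws \<Longrightarrow> sl2_iso d \<rho> (Ws ! i) [bs ! i]"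
    and dir: "direct_list d Ws" and soc: "\<And>i. i < length Ws \<Longrightarrow> gsoc_i n d \<rho> (Suc i) = lsum d (take (Suc i) Ws)"
    using sd by (auto simp: socle_decomp_def)
  obtain W0 W1 R where Ws: "Ws = W0 # W1 # R" using lW len by (metis One_nat_def Suc_1 Suc_le_length_iff)
  have sub: "subspace d W" if "W \<in> set Ws" for W
    using that iso sl2_iso_subspace[OF rep] by (metis in_set_conv_nth)
  have match: "\<exists>J\<le>L. bs ! i = c J \<and> Ws ! i = sp d {..c J} (q J)" if i: "i < length Ws" for i
  proof -
    obtain p where p: "chain d (\<rho> GE) (\<rho> GF) (\<rho> GH) (bs ! i) p" "Ws ! i = sp d {..bs ! i} p"
      using iso[OF i] sl2_iso_single[OF cr sl] by blast
    then show ?thesis using graded_submodule[OF rep g inj p(1)] by auto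
  qed
  obtain J0 where J0: "J0 \<le> L" "bs ! 0 = c J0" "W0 = sp d {..c J0} (q J0)" using match[of 0] Ws by auto
  obtain J1 where J1: "J1 \<le> L" "bs ! 1 = c J1" "W1 = sp d {..c J1} (q J1)" using match[of 1] Ws by auto
  have g0: "gsubmod n d \<rho> W0"
    using soc[of 0] gsubmod_gsoc_i[where \<rho> = \<rho> and d = d, OF cr, where n = n and i = "Suc 0"] Ws ssum_0[OF sub[of W0]] by simp
  have g1: "gsubmod n d \<rho> (ssum W0 W1)"
    using soc[of 1] gsubmod_gsoc_i[where \<rho> = \<rho> and d = d, OF cr, where n = n and i = "Suc (Suc 0)"] Ws ssum_0[OF sub[of W1]] by simp
  have bas: "\<And>i. i \<le> ?m \<Longrightarrow> GX i \<in> gbasis n" by (auto simp: gbasis_def)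
  have qm: "q j l \<in> sp d {..c j} (q j)" if "j \<le> L" "l \<le> c j" for j l using that gradedD(4)[OF g] by (intro sp_member) auto
  have J00: "J0 = 0"
  proof (rule ccontr)
    assume "J0 \<noteq> 0"
    then obtain j where j: "J0 = Suc j" using not0_implies_Suc by blast
    obtain i l where il: "i \<le> ?m" "l \<le> c J0" "\<rho> (GX i) *\<^sub>v q J0 l \<noteq> 0\<^sub>v d" "\<rho> (GX i) *\<^sub>v q J0 l \<in> sp d {..c j} (q j)"
      using z J0(1) j unfolding zgraded_def by (metis Suc_le_lessD)
    have "\<rho> (GX i) *\<^sub>v q J0 l \<in> W0" using g0 bas[OF il(1)] qm[OF J0(1) il(2)] J0(3) by (auto simp: gsubmod_def)
    then have "\<rho> (GX i) *\<^sub>v q J0 l \<in> sp d (Pair J0 ` {..c J0}) (lev q)" by (simp add: J0(3) sp_level)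
    moreover have "(j, l) \<notin> Pair J0 ` {..c J0}" for l using j by auto
    ultimately show False using level_disjoint[OF g il(4) _ _ level_subset[OF J0(1)]] il(3) J0(1) j by (metis Suc_leD)
  qed
  have nz: "J1 \<noteq> 0"
  proof
    assume J: "J1 = 0"
    have "q 0 0 \<in> W0" "q 0 0 \<in> W1" using qm[of 0 0] J0 J1 J00 J by auto
    moreover have "subspace d (lsum d R)" using sub Ws by (intro subspace_lsum) auto
    then have "W1 \<subseteq> lsum d (W1 # R)" using ssum_upper(1)[of d W1 "lsum d R"] sub[of W1] Ws by simp
    moreover have "W0 \<inter> lsum d (W1 # R) = {0\<^sub>v d}" using dir Ws by simp
    ultimately have "q 0 0 = 0\<^sub>v d" by blast
    then show False using indep_nonzero[OF gradedD(2)[OF g], of "(0,0)"] by simp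
  qed
  have J11: "J1 = 1"
  proof (rule ccontr)
    assume ne: "J1 \<noteq> 1"
    then obtain j where j: "J1 = Suc j" "j \<noteq> 0" using nz not0_implies_Suc by fastforce
    obtain i l where il: "i \<le> ?m" "l \<le> c J1" "\<rho> (GX i) *\<^sub>v q J1 l \<noteq> 0\<^sub>v d" "\<rho> (GX i) *\<^sub>v q J1 l \<in> sp d {..c j} (q j)"
      using z J1(1) j unfolding zgraded_def by (metis Suc_le_lessD)
    have "q J1 l \<in> ssum W0 W1" using qm[OF J1(1) il(2)] J1(3) ssum_upper(2)[of d W0 W1] sub Ws by auto
    then have "\<rho> (GX i) *\<^sub>v q J1 l \<in> ssum W0 W1" using g1 bas[OF il(1)] by (auto simp: gsubmod_def)
    then have "\<rho> (GX i) *\<^sub>v q J1 l \<in> sp d (Pair 0 ` {..c 0} \<union> Pair J1 ` {..c J1}) (lev q)"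
      using sp_two_levels[of 0 J1 d "c 0" "c J1" q] nz J0 J1 J00 by simp
    moreover have "Pair 0 ` {..c 0} \<union> Pair J1 ` {..c J1} \<subseteq> idx L c" using J1(1) by auto
    moreover have "(j, l) \<notin> Pair 0 ` {..c 0} \<union> Pair J1 ` {..c J1}" for l using j by auto
    ultimately show False using level_disjoint[OF g il(4)] il(3) J1(1) j(1) by (metis Suc_leD)
  qed
  show "1 \<le> L" "bs ! 0 = c 0" "bs ! 1 = c 1" "Ws ! 0 = sp d {..c 0} (q 0)" "Ws ! 1 = sp d {..c 1} (q 1)"
    using J0 J1 J00 J11 Ws by auto
qed

lemma lc_support:
  assumes ind: "indep d I b" and v: "lc d I e b \<in> sp d B b" and B: "B \<subseteq> I" and x: "x \<in> I - B"
  shows "e x = 0"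
proof -
  obtain f where f: "lc d I e b = lc d B f b" using v by (rule sp_E)
  have "lc d B f b = lc d I (\<lambda>x. if x \<in> B then f x else 0) b"
    using lc_mono[OF indep_finite[OF ind] B, of "\<lambda>x. if x \<in> B then f x else 0" d b] by (simp cong: lc_cong)
  from indep_eqD[OF ind f[unfolded this], of x] x show ?thesis by simp
qed

text \<open>On the top level only z is explicit: it is the scalar \<gamma> onto level 0. For x_i on
  that level it is enough to record that the image lies in the two lower levels.\<close>

definition fgraded :: "nat \<Rightarrow> nat \<Rightarrow> (gen \<Rightarrow> 'a::field_char_0 mat) \<Rightarrow> (nat \<Rightarrow> nat) \<Rightarrow> (nat \<Rightarrow> nat \<Rightarrow> 'a vec) \<Rightarrow> 'a \<Rightarrow> bool" where
  "fgraded m d \<rho> c p \<gamma> \<longleftrightarrow> graded d \<rho> 2 c p \<and> c 2 = c 0 \<and> \<gamma> \<noteq> 0 \<and>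
     (\<forall>i\<le>m. \<forall>l\<le>c 0. \<rho> (GX i) *\<^sub>v p 0 l = 0\<^sub>v d) \<and> (\<forall>l\<le>c 0. \<rho> GZ *\<^sub>v p 0 l = 0\<^sub>v d) \<and>
     (\<forall>i\<le>m. \<forall>l\<le>c 1. \<rho> (GX i) *\<^sub>v p 1 l \<in> sp d {..c 0} (p 0)) \<and> (\<forall>l\<le>c 1. \<rho> GZ *\<^sub>v p 1 l = 0\<^sub>v d) \<and>
     (\<exists>i\<le>m. \<exists>l\<le>c 1. \<rho> (GX i) *\<^sub>v p 1 l \<noteq> 0\<^sub>v d) \<and>
     (\<forall>i\<le>m. \<forall>l\<le>c 2. \<rho> (GX i) *\<^sub>v p 2 l \<in> sp d (Pair 0 ` {..c 0} \<union> Pair 1 ` {..c 1}) (lev p)) \<and>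
     (\<forall>l\<le>c 2. \<rho> GZ *\<^sub>v p 2 l = \<gamma> \<cdot>\<^sub>v p 0 l)"

text \<open>The x_i have no component between levels of equal parity; combined with the submodules
  of the socle series this makes them lower the level strictly. Hence z = [x_0, x_m] kills the two
  lower levels and sends level 2 to level 0. As z commutes with sl(2), it is there a scalar
  \<gamma>, nonzero by faithfulness, and this forces a2 = a0.\<close>

lemma faithful_fgraded:
  fixes \<rho> :: "gen \<Rightarrow> 'a::field_char_0 mat"
  assumes n: "n \<ge> 1" and rep: "g_rep (2 * n - 1) d \<rho>" and sd: "socle_decomp n d \<rho> Ws [a0, a1, a2]" and faith: "faithful n d \<rho>"
  shows "\<exists>p \<gamma>. fgraded (2 * n - 1) d \<rho> (\<lambda>j. [a0, a1, a2] ! j) p \<gamma> \<and> Ws ! 0 = sp d {..a0} (p 0) \<and> Ws ! 1 = sp d {..a1} (p 1)"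
proof -
  define m where "m = 2 * n - 1"
  have odd: "odd m" using n by (simp add: m_def)
  note rep = rep[folded m_def]
  define c where "c j = [a0, a1, a2] ! j" for j
  have c012: "c 0 = a0" "c 1 = a1" "c 2 = a2" "c (Suc 0) = a1" by (auto simp: c_def)
  note cr = g_repD(1)[OF rep] and sl = g_repD(2)[OF rep]
  have lW: "length Ws = Suc 2" and iso: "\<And>i. i \<le> 2 \<Longrightarrow> sl2_iso d \<rho> (Ws ! i) [c i]"
    and dir: "direct_list d Ws" and tot: "lsum d Ws = carrier_vec d"
    and soc: "\<And>i. i \<le> 2 \<Longrightarrow> gsoc_i n d \<rho> (Suc i) = lsum d (take (Suc i) Ws)"
    using sd by (auto simp: socle_decomp_def c_def)
  obtain p where g: "graded d \<rho> 2 c p" and W: "\<And>j. j \<le> 2 \<Longrightarrow> Ws ! j = sp d {..c j} (p j)"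
    using graded_of_decomp[OF rep lW iso dir tot] by blast
  obtain W0 W1 R where Ws: "Ws = W0 # W1 # R" using lW by (metis Suc_length_conv numeral_2_eq_2)
  have W0: "W0 = sp d {..c 0} (p 0)" and W1: "W1 = sp d {..c 1} (p 1)" using W[of 0] W[of 1] Ws by auto
  let ?I = "idx 2 c"
  define B :: "(nat \<times> nat) set" where "B = Pair 0 ` {..c 0} \<union> Pair 1 ` {..c 1}"
  have BI: "B \<subseteq> ?I" by (auto simp: B_def c012)
  have W01: "ssum W0 W1 = sp d B (lev p)" unfolding B_def W0 W1 by (rule sp_two_levels[symmetric]) simp
  have sW: "subspace d W0" "subspace d W1" unfolding W0 W1 by (rule subspace_sp)+
  have g0: "gsubmod n d \<rho> W0"
    using soc[of 0] gsubmod_gsoc_i[where \<rho> = \<rho> and d = d, OF cr, where n = n and i = "Suc 0"] Ws ssum_0[OF sW(1)] by simp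
  have g1: "gsubmod n d \<rho> (sp d B (lev p))"
    using soc[of 1] gsubmod_gsoc_i[where \<rho> = \<rho> and d = d, OF cr, where n = n and i = "Suc (Suc 0)"] Ws ssum_0[OF sW(2)] by (simp add: W01)
  have bas: "\<And>i. i \<le> m \<Longrightarrow> GX i \<in> gbasis n" by (auto simp: gbasis_def m_def)
  note ind = gradedD(2)[OF g] and pc = gradedD(4)[OF g]
  \<comment> \<open>All weights of level j have the parity of c j, and x_i shifts weights by the odd
    number m - 2i.\<close>
  have parity: "e (j',l') = 0" if e: "\<rho> (GX i) *\<^sub>v p j l = lc d ?I e (lev p)" and i: "i \<le> m" "j \<le> 2" "l \<le> c j" "j' \<le> 2" "l' \<le> c j'"
    and par: "even (c j + c j')" for i j l e j' l'
  proof (rule ccontr)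
    assume nz: "e (j',l') \<noteq> 0"
    have "\<rho> GH *\<^sub>v lc d ?I e (lev p) = of_int (int m - 2 * int i + (int (c j) - 2 * int l)) \<cdot>\<^sub>v lc d ?I e (lev p)"
      using x_weight[OF rep gradedD(1)[OF g i(2)] i(1,3)] unfolding e .
    then have "int (c j') - 2 * int l' = int m - 2 * int i + (int (c j) - 2 * int l)"
      using weight_coeff[OF graded_weights[OF g] cr, of e _ "(j',l')"] nz i by auto
    then have "int m = int (c j') - int (c j) + 2 * (int l + int i - int l')" by simp
    moreover have "even (int (c j') - int (c j))" using par by simp
    ultimately have "even (int m)" by simp
    then show False using odd by simp
  qed
  have coord: "\<exists>e. v = lc d ?I e (lev p)" if "v \<in> carrier_vec d" for v
    using that gradedD(3)[OF g] by (auto elim: sp_E)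
  have pm: "p j l \<in> sp d {..c j} (p j)" if "j \<le> 2" "l \<le> c j" for j l using that pc by (intro sp_member) auto
  have x0: "\<rho> (GX i) *\<^sub>v p 0 l = 0\<^sub>v d" if i: "i \<le> m" "l \<le> c 0" for i l
  proof -
    obtain e where e: "\<rho> (GX i) *\<^sub>v p 0 l = lc d ?I e (lev p)" using coord[of "\<rho> (GX i) *\<^sub>v p 0 l"] cr[of "GX i"] by auto
    have "\<rho> (GX i) *\<^sub>v p 0 l \<in> W0" using g0 bas[OF i(1)] pm[of 0 l] i W0 by (auto simp: gsubmod_def)
    then have s: "lc d ?I e (lev p) \<in> sp d (Pair 0 ` {..c 0}) (lev p)" unfolding e[symmetric] W0 by (simp add: sp_level)
    have "e x = 0" if "x \<in> ?I" for x
    proof (cases "x \<in> Pair 0 ` {..c 0}")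
      case True
      then show ?thesis using parity[OF e] i by auto
    next
      case False
      then show ?thesis using lc_support[OF ind s level_subset, of x] that by simp
    qed
    then show ?thesis unfolding e by (intro lc_zero) auto
  qed
  have xW0: "\<rho> (GX i) *\<^sub>v v = 0\<^sub>v d" if i: "i \<le> m" and v: "v \<in> sp d {..c 0} (p 0)" for i v
  proof -
    obtain e where e: "v = lc d {..c 0} e (p 0)" using v by (rule sp_E)
    have "\<rho> (GX i) *\<^sub>v v = lc d {..c 0} e (\<lambda>l. \<rho> (GX i) *\<^sub>v p 0 l)" unfolding e using pc by (intro mult_lc cr) auto
    also have "\<dots> = 0\<^sub>v d" using x0[OF i] by (intro lc_zero) auto
    finally show ?thesis .
  qed
  \<comment> \<open>The bracket of x_0 and x_m is z itself, with structure constant (-1)^0; so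
    everything about z follows from two applications of the x_i.\<close>
  have zx: "\<rho> GZ *\<^sub>v v = \<rho> (GX 0) *\<^sub>v (\<rho> (GX m) *\<^sub>v v) + (-1) \<cdot>\<^sub>v (\<rho> (GX m) *\<^sub>v (\<rho> (GX 0) *\<^sub>v v))" if "v \<in> carrier_vec d" for v
  proof -
    have "\<rho> (GX 0) *\<^sub>v (\<rho> (GX m) *\<^sub>v v) = \<rho> (GX m) *\<^sub>v (\<rho> (GX 0) *\<^sub>v v) + 1 \<cdot>\<^sub>v (\<rho> GZ *\<^sub>v v)"
      using relD[OF g_repD(7)[OF rep, of 0] that] by simp
    then show ?thesis using carrier_matD(1)[OF cr] by (intro eq_vecI) simp_all
  qed
  have z0: "\<rho> GZ *\<^sub>v p 0 l = 0\<^sub>v d" if l: "l \<le> c 0" for l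
    using zx[OF pc[of 0 l]] x0[of 0 l] x0[of m l] l cr by simp
  have x1: "\<rho> (GX i) *\<^sub>v p 1 l \<in> sp d {..c 0} (p 0)" if i: "i \<le> m" "l \<le> c 1" for i l
  proof -
    obtain e where e: "\<rho> (GX i) *\<^sub>v p 1 l = lc d ?I e (lev p)" using coord[of "\<rho> (GX i) *\<^sub>v p 1 l"] cr[of "GX i"] by auto
    have "p 1 l \<in> ssum W0 W1" using pm[of 1 l] i W1 ssum_upper(2)[of d W0 W1] W0 subspace_sp by auto
    then have s: "lc d ?I e (lev p) \<in> sp d B (lev p)"
      using g1 bas[OF i(1)] unfolding e[symmetric] W01 by (auto simp: gsubmod_def)
    have "lc d ?I e (lev p) = lc d (Pair 0 ` {..c 0}) e (lev p)"
    proof (rule lc_mono[symmetric])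
      fix x assume x: "x \<in> ?I - Pair 0 ` {..c 0}"
      show "e x = 0"
      proof (cases "x \<in> B")
        case True
        then obtain l' where "x = (1,l')" "l' \<le> c 1" using x by (auto simp: B_def)
        then show ?thesis using parity[OF e] i by auto
      next
        case False
        then show ?thesis using lc_support[OF ind s BI, of x] x by simp
      qed
    qed auto
    then have "\<rho> (GX i) *\<^sub>v p 1 l = lc d (Pair 0 ` {..c 0}) e (lev p)" using e by simp
    then show ?thesis by (simp add: lc_level)
  qed
  have z1: "\<rho> GZ *\<^sub>v p 1 l = 0\<^sub>v d" if l: "l \<le> c 1" for l
    using zx[OF pc[of 1 l]] xW0[OF _ x1[OF _ l]] l by simp
  have x2: "\<rho> (GX i) *\<^sub>v p 2 l \<in> sp d B (lev p)" if i: "i \<le> m" "l \<le> c 2" for i l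
  proof -
    obtain e where e: "\<rho> (GX i) *\<^sub>v p 2 l = lc d ?I e (lev p)" using coord[of "\<rho> (GX i) *\<^sub>v p 2 l"] cr[of "GX i"] by auto
    have "lc d ?I e (lev p) = lc d B e (lev p)"
    proof (rule lc_mono[symmetric])
      fix x assume x: "x \<in> ?I - B"
      obtain j l' where "x = (j,l')" by (cases x)
      moreover have "j = 0 \<or> j = 1 \<or> j = 2" using x \<open>x = (j,l')\<close> by auto
      ultimately have "x = (2,l')" "l' \<le> c 2" using x by (auto simp: B_def)
      then show "e x = 0" using parity[OF e] i by auto
    qed (use BI in auto)
    then show ?thesis using e by simp
  qed
  have xB: "\<rho> (GX i) *\<^sub>v v \<in> sp d {..c 0} (p 0)" if i: "i \<le> m" and v: "v \<in> sp d B (lev p)" for i v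
  proof -
    obtain e where e: "v = lc d B e (lev p)" using v by (rule sp_E)
    have pB: "lev p x \<in> carrier_vec d" if "x \<in> B" for x by (rule indep_carrier[OF ind]) (use BI that in blast)
    have "\<rho> (GX i) *\<^sub>v v = lc d B e (\<lambda>x. \<rho> (GX i) *\<^sub>v lev p x)" unfolding e using pB by (intro mult_lc cr) auto
    also have "\<dots> \<in> sp d {..c 0} (p 0)"
    proof (rule subspace_lc[OF subspace_sp])
      show "finite B" by (simp add: B_def)
      fix x assume x: "x \<in> B"
      show "\<rho> (GX i) *\<^sub>v lev p x \<in> carrier_vec d" using cr[of "GX i"] by simp
      show "\<rho> (GX i) *\<^sub>v lev p x \<in> sp d {..c 0} (p 0)" using x x0[OF i] x1[OF i] subspace_zero[OF subspace_sp] by (auto simp: B_def)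
    qed
    finally show ?thesis .
  qed
  have zp2: "\<rho> GZ *\<^sub>v p 2 l \<in> sp d {..c 0} (p 0)" if l: "l \<le> c 2" for l
    using zx[OF pc[of 2 l]] xB[OF _ x2[OF _ l]] l by (auto intro!: subspace_add[OF subspace_sp] subspace_smult[OF subspace_sp])
  have com: "\<rho> a *\<^sub>v (\<rho> GZ *\<^sub>v v) = \<rho> GZ *\<^sub>v (\<rho> a *\<^sub>v v)" if "a \<in> {GE, GF, GH}" "v \<in> carrier_vec d" for a v
  proof -
    have "\<rho> a *\<^sub>v (\<rho> GZ *\<^sub>v v) = \<rho> GZ *\<^sub>v (\<rho> a *\<^sub>v v) + 0 \<cdot>\<^sub>v (\<rho> GZ *\<^sub>v v)" by (rule relD[OF g_repD(3)[OF rep that(1)] that(2)])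
    then show ?thesis using carrier_matD(1)[OF cr] by (intro eq_vecI) simp_all
  qed
  note ch0 = gradedD(1)[OF g, of 0, simplified] and ch2 = gradedD(1)[OF g, of 2, simplified]
  have p2c: "p 2 l \<in> carrier_vec d" if "l \<le> c 2" for l using pc[of 2 l] that by simp
  obtain e where e: "\<rho> GZ *\<^sub>v p 2 0 = lc d {..c 0} e (p 0)" using zp2[of 0] by (auto elim: sp_E)
  \<comment> \<open>Schur's lemma by hand: z commutes with E, so it sends \<open>p 2 0\<close> to a
    vector of level 0 killed by E, hence to a multiple of \<open>p 0 0\<close>.\<close>
  have "\<rho> GE *\<^sub>v (\<rho> GZ *\<^sub>v p 2 0) = 0\<^sub>v d"
    using com[of GE "p 2 0"] p2c[of 0] chainD(4)[OF ch2, of 0] cr[of GZ] by (simp add: smult_0_vec)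
  then have "lc d {..c 0} (\<lambda>l. if l < c 0 then e (l + 1) * of_nat ((l + 1) * (c 0 - l)) else 0) (p 0) = 0\<^sub>v d"
    unfolding e chain_lc(1)[OF sl ch0] .
  from indepD[OF sl2.chain_indep[OF sl ch0] this] have eS: "e (l + 1) * of_nat ((l + 1) * (c 0 - l)) = 0" if "l < c 0" for l
    using that by (metis (mono_tags, lifting) atMost_iff less_imp_le)
  have e0: "e l = 0" if l: "l \<le> c 0" "l \<noteq> 0" for l
  proof -
    have "e l * of_nat (l * (c 0 - (l - 1))) = 0" using eS[of "l - 1"] l by simp
    then show ?thesis using l by (simp only: mult_eq_0_iff of_nat_eq_0_iff) auto
  qed
  define \<gamma> where "\<gamma> = e 0"
  have zg: "\<rho> GZ *\<^sub>v p 2 0 = \<gamma> \<cdot>\<^sub>v p 0 0"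
    unfolding e \<gamma>_def using e0 pc[of 0 0] by (intro lc_single) auto
  have zstep: "\<rho> GZ *\<^sub>v p 2 (Suc l) = \<rho> GF *\<^sub>v (\<rho> GZ *\<^sub>v p 2 l)" if "Suc l \<le> c 2" for l
    using com[of GF "p 2 l"] p2c[of l] chainD(5)[OF ch2, of l] that by simp
  \<comment> \<open>If \<gamma> were 0, z would act by 0 on all levels, and the element z would
    contradict faithfulness.\<close>
  have \<gamma>: "\<gamma> \<noteq> 0"
  proof
    assume "\<gamma> = 0"
    then have 0: "\<rho> GZ *\<^sub>v p 2 0 = 0\<^sub>v d" using zg pc[of 0 0] by (simp add: smult_0_vec)
    have z2: "l \<le> c 2 \<Longrightarrow> \<rho> GZ *\<^sub>v p 2 l = 0\<^sub>v d" for l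
    proof (induction l)
      case (Suc l)
      then show ?case using zstep[of l] cr[of GF] by simp
    qed (use 0 in simp)
    have zl: "\<rho> GZ *\<^sub>v lev p x = 0\<^sub>v d" if x: "x \<in> ?I" for x
    proof -
      obtain j l where jl: "x = (j,l)" by (cases x)
      then have "j = 0 \<or> j = 1 \<or> j = 2" "l \<le> c j" using x by auto
      then show ?thesis using z0[of l] z1[of l] z2[of l] jl by auto
    qed
    have zv: "\<rho> GZ *\<^sub>v v = 0\<^sub>v d" if v: "v \<in> carrier_vec d" for v
    proof -
      obtain f where f: "v = lc d ?I f (lev p)" using coord[OF v] by blast
      have "\<rho> GZ *\<^sub>v v = lc d ?I f (\<lambda>x. \<rho> GZ *\<^sub>v lev p x)" unfolding f using indep_carrier[OF ind] by (intro mult_lc cr) auto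
      then show ?thesis using zl by (simp add: lc_zero)
    qed
    have "\<rho> GZ = 0\<^sub>m d d"
    proof (rule eq_matI)
      fix r s assume "r < dim_row (0\<^sub>m d d :: 'a mat)" "s < dim_col (0\<^sub>m d d :: 'a mat)"
      then have rs: "r < d" "s < d" by auto
      have "(\<rho> GZ *\<^sub>v unit_vec d s) $ r = 0" using zv[of "unit_vec d s"] rs by simp
      then show "\<rho> GZ $$ (r,s) = 0\<^sub>m d d $$ (r,s)"
        using mult_mat_vec_index[OF cr _ rs(1), of "unit_vec d s" GZ] rs by (simp add: unit_vec_def if_distrib cong: if_cong)
    qed (use carrier_matD[OF cr[of GZ]] in auto)
    then have "lin_rep n d \<rho> (\<lambda>b. if b = GZ then 1 else 0) = 0\<^sub>m d d"
      using lin_rep_single[of n "\<lambda>b. if b = GZ then 1 else 0" GZ 1 \<rho> d] cr[of GZ] by (auto simp: gbasis_def intro!: eq_matI)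
    then have "(1::'a) = 0" using faith unfolding faithful_def by (auto simp: gbasis_def dest!: spec[of _ "\<lambda>b. if b = GZ then 1 else 0"])
    then show False by simp
  qed
  \<comment> \<open>z preserves weights and sends \<open>p 2 0\<close> to a nonzero multiple of
    \<open>p 0 0\<close>, so the two highest weights agree.\<close>
  have c20: "c 2 = c 0"
  proof -
    have p00: "p 0 0 \<in> carrier_vec d" using pc[of 0 0] by simp
    have "\<rho> GH *\<^sub>v (\<rho> GZ *\<^sub>v p 2 0) = \<rho> GZ *\<^sub>v (\<rho> GH *\<^sub>v p 2 0)" using p2c[of 0] by (intro com) auto
    also have "\<dots> = of_int (int (c 2)) \<cdot>\<^sub>v (\<rho> GZ *\<^sub>v p 2 0)"
      using chainD(3)[OF ch2, of 0] mult_mat_vec[OF cr p2c[of 0], of GZ] by simp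
    finally have "\<rho> GH *\<^sub>v (\<gamma> \<cdot>\<^sub>v p 0 0) = of_int (int (c 2)) \<cdot>\<^sub>v (\<gamma> \<cdot>\<^sub>v p 0 0)" unfolding zg .
    moreover have "\<rho> GH *\<^sub>v (\<gamma> \<cdot>\<^sub>v p 0 0) = of_int (int (c 0)) \<cdot>\<^sub>v (\<gamma> \<cdot>\<^sub>v p 0 0)"
      using chainD(3)[OF ch0, of 0] mult_mat_vec[OF cr p00, of GH \<gamma>] by (simp add: smult_smult_assoc mult.commute)
    moreover have "\<gamma> \<cdot>\<^sub>v p 0 0 \<noteq> 0\<^sub>v d" using smult_eq_0D[OF _ \<gamma>] chainD(2)[OF ch0] by blast
    ultimately have "of_int (int (c 2)) = (of_int (int (c 0)) :: 'a)"
      using smult_eq_cancel[of "of_int (int (c 2))" "\<gamma> \<cdot>\<^sub>v p 0 0" "of_int (int (c 0))" d] smult_carrier_vec[THEN iffD2, OF p00] by metis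
    then show ?thesis by (simp only: of_int_eq_iff)
  qed
  have z2: "l \<le> c 2 \<Longrightarrow> \<rho> GZ *\<^sub>v p 2 l = \<gamma> \<cdot>\<^sub>v p 0 l" for l
  proof (induction l)
    case (Suc l)
    have "\<rho> GZ *\<^sub>v p 2 (Suc l) = \<rho> GF *\<^sub>v (\<gamma> \<cdot>\<^sub>v p 0 l)" using zstep[of l] Suc by simp
    also have "\<dots> = \<gamma> \<cdot>\<^sub>v (\<rho> GF *\<^sub>v p 0 l)" using pc[of 0 l] Suc.prems c20 by (intro mult_mat_vec[OF cr]) auto
    finally show ?case using chainD(5)[OF ch0, of l] Suc.prems c20 by simp
  qed (use zg in simp)
  \<comment> \<open>If the x_i killed level 1, every product of two of them would vanish on level 2,
    and so would their bracket z.\<close>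
  have x1nz: "\<exists>i\<le>m. \<exists>l\<le>c 1. \<rho> (GX i) *\<^sub>v p 1 l \<noteq> 0\<^sub>v d"
  proof (rule ccontr)
    assume a: "\<not> ?thesis"
    have xB0: "\<rho> (GX i) *\<^sub>v v = 0\<^sub>v d" if i: "i \<le> m" and v: "v \<in> sp d B (lev p)" for i v
    proof -
      obtain e where e: "v = lc d B e (lev p)" using v by (rule sp_E)
      have pB: "lev p x \<in> carrier_vec d" if "x \<in> B" for x by (rule indep_carrier[OF ind]) (use BI that in blast)
      have "\<rho> (GX i) *\<^sub>v v = lc d B e (\<lambda>x. \<rho> (GX i) *\<^sub>v lev p x)" unfolding e using pB by (intro mult_lc cr) auto
      also have "\<dots> = 0\<^sub>v d" using x0[OF i] a i by (intro lc_zero) (auto simp: B_def)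
      finally show ?thesis .
    qed
    have "\<rho> GZ *\<^sub>v p 2 0 = 0\<^sub>v d" using zx[OF p2c[of 0]] xB0[OF _ x2[of _ 0]] by simp
    then show False using zg smult_eq_0D[OF _ \<gamma>] chainD(2)[OF ch0] by metis
  qed
  have "fgraded m d \<rho> c p \<gamma>"
    unfolding fgraded_def using g c20 \<gamma> x0 z0 x1 z1 x1nz x2 z2 by (simp add: B_def)
  moreover have "(\<lambda>j. [a0, a1, a2] ! j) = c" by (auto simp: c_def)
  ultimately show ?thesis using W0 W1 Ws c012 unfolding m_def by (intro exI[of _ p] exI[of _ \<gamma>]) simp
qed

text \<open>Level j has order at most j + 1; on level 2 this uses that z lands even in level
  0.\<close>

lemma fgraded_nilp:
  assumes rep: "g_rep m d \<rho>" and f: "fgraded m d \<rho> c p \<gamma>"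
  shows "carrier_vec d \<subseteq> nilp m d \<rho> 3"
proof -
  note sN = subspace_nilp[OF rep]
  have g: "graded d \<rho> 2 c p" using f by (simp add: fgraded_def)
  note pc = gradedD(4)[OF g]
  have s: "\<rho> b *\<^sub>v v \<in> nilp m d \<rho> t" if "\<rho> b *\<^sub>v v = 0\<^sub>v d" for b v t using that subspace_zero[OF sN] by simp
  have 0: "p 0 l \<in> nilp m d \<rho> 1" if "l \<le> c 0" for l
    using f that pc[of 0 l] by (auto simp: fgraded_def)
  then have W0: "sp d {..c 0} (p 0) \<subseteq> nilp m d \<rho> 1" by (intro sp_least[OF sN]) auto
  have 1: "p 1 l \<in> nilp m d \<rho> 2" if "l \<le> c 1" for l
  proof -
    have "\<rho> GZ *\<^sub>v p 1 l \<in> nilp m d \<rho> 1" using f that by (intro s) (auto simp: fgraded_def)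
    moreover have "\<rho> (GX i) *\<^sub>v p 1 l \<in> nilp m d \<rho> 1" if "i \<le> m" for i using f \<open>l \<le> c 1\<close> that W0 unfolding fgraded_def by blast
    moreover have "(2::nat) = Suc 1" by simp
    ultimately show ?thesis using pc[of 1 l] that by (simp only: nilp.simps(2)[of m d \<rho> 1]) simp
  qed
  have B: "sp d (Pair 0 ` {..c 0} \<union> Pair 1 ` {..c 1}) (lev p) \<subseteq> nilp m d \<rho> 2"
    using 0 1 nilp_le[OF rep, of 1 2] by (intro sp_least[OF sN]) auto
  have 2: "p 2 l \<in> nilp m d \<rho> 3" if l: "l \<le> c 2" for l
  proof -
    have "\<rho> GZ *\<^sub>v p 2 l = \<gamma> \<cdot>\<^sub>v p 0 l" "l \<le> c 0" using f l by (auto simp: fgraded_def)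
    then have "\<rho> GZ *\<^sub>v p 2 l \<in> nilp m d \<rho> 2" using 0[of l] nilp_le[OF rep, of 1 2] subspace_smult[OF sN] by auto
    moreover have "\<rho> (GX i) *\<^sub>v p 2 l \<in> nilp m d \<rho> 2" if "i \<le> m" for i using f l that B unfolding fgraded_def by blast
    moreover have "(3::nat) = Suc 2" by simp
    ultimately show ?thesis using pc[of 2 l] l by (simp only: nilp.simps(2)[of m d \<rho> 2]) simp
  qed
  have "lev p ` idx 2 c \<subseteq> nilp m d \<rho> 3"
  proof
    fix v assume "v \<in> lev p ` idx 2 c"
    then obtain j l where "j \<le> 2" "l \<le> c j" "v = p j l" by auto
    moreover from this have "j = 0 \<or> j = 1 \<or> j = 2" by auto
    ultimately show "v \<in> nilp m d \<rho> 3" using 0[of l] 1[of l] 2[of l] nilp_le[OF rep, of 1 3] nilp_le[OF rep, of 2 3] by auto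
  qed
  then have "sp d (idx 2 c) (lev p) \<subseteq> nilp m d \<rho> 3" by (intro sp_least[OF sN]) auto
  then show ?thesis using gradedD(3)[OF g] by simp
qed

section \<open>The Clebsch--Gordan decomposition\<close>

abbreviation tb :: "('i \<Rightarrow> 'a::semiring_1 vec) \<Rightarrow> ('j \<Rightarrow> 'a vec) \<Rightarrow> 'i \<times> 'j \<Rightarrow> 'a vec" where
  "tb p q \<equiv> \<lambda>(i,j). kron_vec (p i) (q j)"

text \<open>With the coefficients arranged as a matrix e, the action is A e + e B^T, where A and B
  are the matrices on the two factors.\<close>

lemma tens_coords:
  fixes p :: "'i \<Rightarrow> 'a::field_char_0 vec" and q :: "'j \<Rightarrow> 'a vec"
  assumes c: "\<And>b. \<rho>1 b \<in> carrier_mat d1 d1" "\<And>b. \<rho>2 b \<in> carrier_mat d2 d2"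
    and p: "\<And>i. i \<in> I \<Longrightarrow> p i \<in> carrier_vec d1" and q: "\<And>j. j \<in> J \<Longrightarrow> q j \<in> carrier_vec d2"
    and fin: "finite I" "finite J"
    and A: "\<And>x. x \<in> I \<Longrightarrow> \<rho>1 b *\<^sub>v p x = lc d1 I (\<lambda>x'. A x' x) p"
    and B: "\<And>y. y \<in> J \<Longrightarrow> \<rho>2 b *\<^sub>v q y = lc d2 J (\<lambda>y'. B y' y) q"
  shows "tens_rep d1 \<rho>1 d2 \<rho>2 b *\<^sub>v lc (d1 * d2) (I \<times> J) e (tb p q) =
    lc (d1 * d2) (I \<times> J) (\<lambda>(x,y). (\<Sum>x'\<in>I. A x x' * e (x',y)) + (\<Sum>y'\<in>J. e (x,y') * B y y')) (tb p q)"
proof -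
  let ?L = "lc (d1 * d2) (I \<times> J)"
  have unit1: "p x = lc d1 I (\<lambda>x'. if x' = x then 1 else 0) p" if "x \<in> I" for x
    using lc_single[of I x p d1 "\<lambda>x'. if x' = x then 1 else 0"] fin p[OF that] that by simp
  have unit2: "q y = lc d2 J (\<lambda>y'. if y' = y then 1 else 0) q" if "y \<in> J" for y
    using lc_single[of J y q d2 "\<lambda>y'. if y' = y then 1 else 0"] fin q[OF that] that by simp
  have summand: "kron_vec (\<rho>1 b *\<^sub>v p x) (q y) + kron_vec (p x) (\<rho>2 b *\<^sub>v q y) =
      ?L (\<lambda>(x',y'). A x' x * (if y' = y then 1 else 0) + (if x' = x then 1 else 0) * B y' y) (tb p q)" if "x \<in> I" "y \<in> J" for x y
  proof -
    have "kron_vec (\<rho>1 b *\<^sub>v p x) (q y) = kron_vec (lc d1 I (\<lambda>x'. A x' x) p) (lc d2 J (\<lambda>y'. if y' = y then 1 else 0) q)"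
      using A[OF that(1)] unit2[OF that(2)] by simp
    moreover have "kron_vec (p x) (\<rho>2 b *\<^sub>v q y) = kron_vec (lc d1 I (\<lambda>x'. if x' = x then 1 else 0) p) (lc d2 J (\<lambda>y'. B y' y) q)"
      using B[OF that(2)] unit1[OF that(1)] by simp
    ultimately show ?thesis using p q by (simp add: kron_lc lc_add case_prod_unfold)
  qed
  have "tens_rep d1 \<rho>1 d2 \<rho>2 b *\<^sub>v ?L e (tb p q) = ?L e (\<lambda>(x,y). kron_vec (\<rho>1 b *\<^sub>v p x) (q y) + kron_vec (p x) (\<rho>2 b *\<^sub>v q y))"
    by (rule tens_lc[OF c p q])
  also have "\<dots> = ?L e (\<lambda>xy. ?L (\<lambda>(x',y'). A x' (fst xy) * (if y' = snd xy then 1 else 0) + (if x' = fst xy then 1 else 0) * B y' (snd xy)) (tb p q))"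
    by (rule lc_cong) (auto simp: summand)
  also have "\<dots> = ?L (\<lambda>(x,y). (\<Sum>x'\<in>I. A x x' * e (x',y)) + (\<Sum>y'\<in>J. e (x,y') * B y y')) (tb p q)"
    unfolding lc_lc
  proof (rule lc_cong)
    fix z assume "z \<in> I \<times> J"
    then obtain x y where z: "z = (x,y)" and xy: "x \<in> I" "y \<in> J" by auto
    have 1: "(\<Sum>u\<in>J. A x x' * (e (x',u) * (if y = u then 1 else 0))) = A x x' * e (x',y)" for x'
      using xy fin by (subst sum_at[where i = y]) auto
    have "(\<Sum>w\<in>I \<times> J. e w * (A x (fst w) * (if y = snd w then 1 else 0) + (if x = fst w then 1 else 0) * B y (snd w))) =
      (\<Sum>x'\<in>I. \<Sum>u\<in>J. A x x' * (e (x',u) * (if y = u then 1 else 0)) + (if x = x' then e (x',u) * B y u else 0))"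
      unfolding sum.cartesian_product by (rule sum.cong) (auto simp: algebra_simps)
    also have "\<dots> = (\<Sum>x'\<in>I. A x x' * e (x',y)) + (\<Sum>x'\<in>I. if x = x' then (\<Sum>u\<in>J. e (x,u) * B y u) else 0)"
      unfolding sum.distrib 1 by (rule arg_cong2[of _ _ _ _ "(+)"]) (auto intro!: sum.cong)
    also have "\<dots> = (\<Sum>x'\<in>I. A x x' * e (x',y)) + (\<Sum>u\<in>J. e (x,u) * B y u)" using xy fin by simp
    finally show "(\<Sum>w\<in>I \<times> J. e w * (case z of (x',y') \<Rightarrow> A x' (fst w) * (if y' = snd w then 1 else 0) + (if x' = fst w then 1 else 0) * B y' (snd w))) =
      (case z of (x,y) \<Rightarrow> (\<Sum>x'\<in>I. A x x' * e (x',y)) + (\<Sum>y'\<in>J. e (x,y') * B y y'))"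
      by (simp add: z)
  qed simp
  finally show ?thesis .
qed

lemma chain_coords:
  fixes p :: "nat \<Rightarrow> 'a::field_char_0 vec"
  assumes sl: "sl2 d E F H" and ch: "chain d E F H a p" and x: "x \<in> {..a}"
  shows "E *\<^sub>v p x = lc d {..a} (\<lambda>x'. if x' + 1 = x then of_nat (x * (a + 1 - x)) else 0) p"
    and "F *\<^sub>v p x = lc d {..a} (\<lambda>x'. if x' = x + 1 then 1 else 0) p"
    and "H *\<^sub>v p x = lc d {..a} (\<lambda>x'. if x' = x then of_int (int a - 2 * int x) else 0) p"
proof -
  have px: "p x = lc d {..a} (\<lambda>x'. if x' = x then 1 else 0) p"
    using lc_single[of "{..a}" x p d "\<lambda>x'. if x' = x then 1 else 0"] x chainD(1)[OF ch] by simp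
  show "E *\<^sub>v p x = lc d {..a} (\<lambda>x'. if x' + 1 = x then of_nat (x * (a + 1 - x)) else 0) p"
  proof (subst px, subst chain_lc(1)[OF sl ch], rule lc_cong)
    fix i assume "i \<in> {..a}"
    then show "(if i < a then (if i + 1 = x then 1 else 0) * of_nat ((i + 1) * (a - i)) else 0) = (if i + 1 = x then of_nat (x * (a + 1 - x)) else 0 :: 'a)"
      using x by (cases "i + 1 = x") (auto simp del: of_nat_mult)
  qed simp
  show "F *\<^sub>v p x = lc d {..a} (\<lambda>x'. if x' = x + 1 then 1 else 0) p"
    by (subst px, subst chain_lc(2)[OF sl ch]) (rule lc_cong, use x in auto)
  show "H *\<^sub>v p x = lc d {..a} (\<lambda>x'. if x' = x then of_int (int a - 2 * int x) else 0) p"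
    by (subst px, subst chain_lc(3)[OF sl ch]) (rule lc_cong, use x in auto)
qed

lemma tens_chain_coords:
  fixes p q :: "nat \<Rightarrow> 'a::field_char_0 vec"
  assumes r1: "g_rep m d1 \<rho>1" and r2: "g_rep m d2 \<rho>2"
    and p: "chain d1 (\<rho>1 GE) (\<rho>1 GF) (\<rho>1 GH) a p" and q: "chain d2 (\<rho>2 GE) (\<rho>2 GF) (\<rho>2 GH) b q"
  defines "L \<equiv> \<lambda>e. lc (d1 * d2) ({..a} \<times> {..b}) e (tb p q)"
  shows "tens_rep d1 \<rho>1 d2 \<rho>2 GE *\<^sub>v L e = L (\<lambda>(x,y). (if x < a then of_nat ((x + 1) * (a - x)) * e (x + 1,y) else 0) +
      (if y < b then of_nat ((y + 1) * (b - y)) * e (x,y + 1) else 0))"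
    and "tens_rep d1 \<rho>1 d2 \<rho>2 GF *\<^sub>v L e = L (\<lambda>(x,y). (if x = 0 then 0 else e (x - 1,y)) + (if y = 0 then 0 else e (x,y - 1)))"
    and "tens_rep d1 \<rho>1 d2 \<rho>2 GH *\<^sub>v L e = L (\<lambda>(x,y). of_int (int a + int b - 2 * int (x + y)) * e (x,y))"
proof -
  note c = g_repD(1)[OF r1] g_repD(1)[OF r2]
  have pc: "p i \<in> carrier_vec d1" if "i \<in> {..a}" for i using chainD(1)[OF p] that by simp
  have qc: "q i \<in> carrier_vec d2" if "i \<in> {..b}" for i using chainD(1)[OF q] that by simp
  note T = tens_coords[where ?\<rho>1.0 = \<rho>1 and ?\<rho>2.0 = \<rho>2 and p = p and q = q and I = "{..a}" and J = "{..b}", OF c pc qc finite_atMost finite_atMost]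
  note cp = chain_coords[OF g_repD(2)[OF r1] p] and cq = chain_coords[OF g_repD(2)[OF r2] q]
  show "tens_rep d1 \<rho>1 d2 \<rho>2 GE *\<^sub>v L e = L (\<lambda>(x,y). (if x < a then of_nat ((x + 1) * (a - x)) * e (x + 1,y) else 0) +
      (if y < b then of_nat ((y + 1) * (b - y)) * e (x,y + 1) else 0))"
    unfolding L_def
  proof (rule trans[OF T], assumption, assumption, (rule cp(1), assumption), (rule cq(1), assumption), rule lc_cong)
      fix z assume "z \<in> {..a} \<times> {..b}"
      then obtain x y where z: "z = (x,y)" "x \<le> a" "y \<le> b" by auto
      have "(\<Sum>x'\<le>a. (if x + 1 = x' then of_nat (x' * (a + 1 - x')) else 0) * e (x',y)) =
         (if x + 1 \<in> {..a} then (if x + 1 = x + 1 then of_nat ((x + 1) * (a + 1 - (x + 1))) else 0) * e (x + 1,y) else 0)"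
        by (rule sum_at) auto
      moreover have "(\<Sum>y'\<le>b. e (x,y') * (if y + 1 = y' then of_nat (y' * (b + 1 - y')) else 0)) =
         (if y + 1 \<in> {..b} then e (x,y + 1) * (if y + 1 = y + 1 then of_nat ((y + 1) * (b + 1 - (y + 1))) else 0) else 0)"
        by (rule sum_at) auto
      ultimately show "(case z of (x,y) \<Rightarrow> (\<Sum>x'\<le>a. (if x + 1 = x' then of_nat (x' * (a + 1 - x')) else 0) * e (x',y)) +
          (\<Sum>y'\<le>b. e (x,y') * (if y + 1 = y' then of_nat (y' * (b + 1 - y')) else 0))) =
        (case z of (x,y) \<Rightarrow> (if x < a then of_nat ((x + 1) * (a - x)) * e (x + 1,y) else 0) +
          (if y < b then of_nat ((y + 1) * (b - y)) * e (x,y + 1) else 0))"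
        using z by (simp add: Suc_le_eq mult.commute)
  qed simp
  show "tens_rep d1 \<rho>1 d2 \<rho>2 GF *\<^sub>v L e = L (\<lambda>(x,y). (if x = 0 then 0 else e (x - 1,y)) + (if y = 0 then 0 else e (x,y - 1)))"
    unfolding L_def
  proof (rule trans[OF T], assumption, assumption, (rule cp(2), assumption), (rule cq(2), assumption), rule lc_cong)
      fix z assume "z \<in> {..a} \<times> {..b}"
      then obtain x y where z: "z = (x,y)" "x \<le> a" "y \<le> b" by auto
      have 1: "(\<Sum>x'\<le>a. (if x = x' + 1 then 1 else 0) * e (x',y)) = (if x = 0 then 0 else e (x - 1,y))"
        using z by (subst sum_at[where i = "x - 1"]) auto
      have 2: "(\<Sum>y'\<le>b. e (x,y') * (if y = y' + 1 then 1 else 0)) = (if y = 0 then 0 else e (x,y - 1))"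
        using z by (subst sum_at[where i = "y - 1"]) auto
      show "(case z of (x,y) \<Rightarrow> (\<Sum>x'\<le>a. (if x = x' + 1 then 1 else 0) * e (x',y)) + (\<Sum>y'\<le>b. e (x,y') * (if y = y' + 1 then 1 else 0))) =
        (case z of (x,y) \<Rightarrow> (if x = 0 then 0 else e (x - 1,y)) + (if y = 0 then 0 else e (x,y - 1)))"
        unfolding z prod.case 1 2 ..
  qed simp
  show "tens_rep d1 \<rho>1 d2 \<rho>2 GH *\<^sub>v L e = L (\<lambda>(x,y). of_int (int a + int b - 2 * int (x + y)) * e (x,y))"
    unfolding L_def
  proof (rule trans[OF T], assumption, assumption, (rule cp(3), assumption), (rule cq(3), assumption), rule lc_cong)
      fix z assume "z \<in> {..a} \<times> {..b}"
      then obtain x y where z: "z = (x,y)" "x \<le> a" "y \<le> b" by auto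
      have 1: "(\<Sum>x'\<le>a. (if x = x' then of_int (int a - 2 * int x') else 0) * e (x',y)) = of_int (int a - 2 * int x) * e (x,y)"
        using z by (subst sum_at[where i = x]) auto
      have 2: "(\<Sum>y'\<le>b. e (x,y') * (if y = y' then of_int (int b - 2 * int y') else 0)) = e (x,y) * of_int (int b - 2 * int y)"
        using z by (subst sum_at[where i = y]) auto
      show "(case z of (x,y) \<Rightarrow> (\<Sum>x'\<le>a. (if x = x' then of_int (int a - 2 * int x') else 0) * e (x',y)) +
          (\<Sum>y'\<le>b. e (x,y') * (if y = y' then of_int (int b - 2 * int y') else 0))) =
        (case z of (x,y) \<Rightarrow> of_int (int a + int b - 2 * int (x + y)) * e (x,y))"
        unfolding z prod.case 1 2 by (simp add: algebra_simps)
  qed simp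
qed

text \<open>The equations determine e along the antidiagonal x + y = N up to one scalar. At the
  edges y = b and x = a one term is missing, so e vanishes at the points (x, b) with x > 0 and (a,
  y) with y > 0. The antidiagonal avoids all these points if N <= min a b and meets one of them, or
  is empty, otherwise.\<close>

lemma clebsch_gordan_hw:
  fixes e :: "nat \<times> nat \<Rightarrow> 'a::field_char_0"
  assumes E: "\<And>x y. x \<le> a \<Longrightarrow> y \<le> b \<Longrightarrow> (if x < a then of_nat ((x + 1) * (a - x)) * e (x + 1,y) else 0) +
      (if y < b then of_nat ((y + 1) * (b - y)) * e (x,y + 1) else 0) = 0"
    and supp: "\<And>x y. x \<le> a \<Longrightarrow> y \<le> b \<Longrightarrow> e (x,y) \<noteq> 0 \<Longrightarrow> x + y = N"
  shows "\<exists>t. (\<forall>x\<le>a. \<forall>y\<le>b. e (x,y) = (if x + y = N then t * ((-1) ^ x * fact (a - x) * fact (b - y) / (fact x * fact y)) else 0)) \<and>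
    (t \<noteq> 0 \<longrightarrow> N \<le> min a b)"
proof -
  \<comment> \<open>In this scaling the highest weight equation says that g is constant along antidiagonals.\<close>
  define g where "g x y = (-1) ^ x * fact x * fact y / (fact (a - x) * fact (b - y)) * e (x,y)" for x y
  have step: "g x y = g (x + 1) (y - 1)" if xy: "x < a" "1 \<le> y" "y \<le> b" for x y
  proof -
    obtain y' where y: "y = Suc y'" using xy by (cases y) auto
    obtain s where s: "a = Suc (x + s)" using less_imp_Suc_add[OF xy(1)] by blast
    obtain u where u: "b = Suc (y' + u)" using less_imp_Suc_add[of y' b] xy y by auto
    have f: "fact (a - x) = (of_nat (Suc s) * fact s :: 'a)" "fact (b - y') = (of_nat (Suc u) * fact u :: 'a)"
      "a - Suc x = s" "b - y = u" using s u y by (simp_all only: fact_Suc, auto)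
    have "of_nat (x + 1) * of_nat (Suc s) * e (Suc x,y') = - (of_nat (y' + 1) * of_nat (Suc u) * e (x,Suc y'))"
      using E[of x y'] xy y s u unfolding eq_neg_iff_add_eq_0 of_nat_mult[symmetric] by simp
    then have "of_nat (x + 1) * e (Suc x,y') / of_nat (Suc u) = - (of_nat (y' + 1) * e (x,Suc y') / of_nat (Suc s))"
      by (simp add: divide_simps del: of_nat_Suc of_nat_add) (simp add: mult.commute mult.left_commute del: of_nat_Suc of_nat_add)
    then have "(-1) ^ Suc x * (fact x * fact y' / (fact s * fact u)) * (of_nat (x + 1) * e (Suc x,y') / of_nat (Suc u)) =
      (-1) ^ Suc x * (fact x * fact y' / (fact s * fact u)) * - (of_nat (y' + 1) * e (x,Suc y') / of_nat (Suc s))" by (simp only:)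
    moreover have "g (x + 1) (y - 1) = (-1) ^ Suc x * (fact x * fact y' / (fact s * fact u)) * (of_nat (x + 1) * e (Suc x,y') / of_nat (Suc u))"
      using f y by (simp add: g_def mult_ac del: of_nat_Suc of_nat_add)
    moreover have "g x y = (-1) ^ Suc x * (fact x * fact y' / (fact s * fact u)) * - (of_nat (y' + 1) * e (x,Suc y') / of_nat (Suc s))"
      using f y by (simp add: g_def mult_ac del: of_nat_Suc of_nat_add)
    ultimately show ?thesis by (simp only:)
  qed
  have z1: "g (Suc x) b = 0" if "x < a" for x
  proof -
    have "of_nat ((x + 1) * (a - x)) * e (x + 1,b) = 0" using E[of x b] that by (simp del: of_nat_mult)
    then show ?thesis using that unfolding mult_eq_0_iff of_nat_eq_0_iff by (auto simp: g_def)
  qed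
  have z2: "g a (Suc y) = 0" if "y < b" for y
  proof -
    have "of_nat ((y + 1) * (b - y)) * e (a,y + 1) = 0" using E[of a y] that by (simp del: of_nat_mult)
    then show ?thesis using that unfolding mult_eq_0_iff of_nat_eq_0_iff by (auto simp: g_def)
  qed
  note ad = antidiagonal[of a b g, OF step]
  have eg: "e (x,y) = g x y * ((-1) ^ x * fact (a - x) * fact (b - y) / (fact x * fact y))" for x y
    by (simp add: g_def field_simps)
  show ?thesis
  proof (cases "N \<le> min a b")
    case True
    have "e (x,y) = (if x + y = N then g 0 N * ((-1) ^ x * fact (a - x) * fact (b - y) / (fact x * fact y)) else 0)" if "x \<le> a" "y \<le> b" for x y
    proof (cases "x + y = N")
      case xy: True
      then have "g x y = g 0 N" using ad[of 0 x N] that True by auto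
      then show ?thesis using eg[of x y] xy by simp
    qed (use supp that in auto)
    then show ?thesis using True by blast
  next
    case False
    have "e (x,y) = 0" if xy: "x \<le> a" "y \<le> b" for x y
    proof (cases "x + y = N")
      case N: True
      have "g x y = 0"
      proof (cases "a < N")
        case True
        have "g x y = g (x + (a - x)) (y - (a - x))" by (rule ad) (use xy N True in auto)
        moreover have "x + (a - x) = a" "y - (a - x) = Suc (N - a - 1)" "N - a - 1 < b" using xy N True by auto
        ultimately show ?thesis using z2 by metis
      next
        case aN: False
        then have "b < N" using False by auto
        have "g (N - b) b = g (N - b + (x - (N - b))) (b - (x - (N - b)))" by (rule ad) (use xy N \<open>b < N\<close> aN in auto)
        moreover have "N - b + (x - (N - b)) = x" "b - (x - (N - b)) = y" "N - b = Suc (N - b - 1)" "N - b - 1 < a" using xy N \<open>b < N\<close> by auto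
        ultimately show ?thesis using z1 by metis
      qed
      then show ?thesis using eg[of x y] by simp
    qed (use supp xy in auto)
    then show ?thesis by (intro exI[of _ 0]) auto
  qed
qed

lemma lsum_stable:
  assumes A: "A \<in> carrier_mat d d"
  shows "(\<And>W. W \<in> set Ws \<Longrightarrow> subspace d W) \<Longrightarrow> (\<And>W v. W \<in> set Ws \<Longrightarrow> v \<in> W \<Longrightarrow> A *\<^sub>v v \<in> W) \<Longrightarrow>
    v \<in> lsum d Ws \<Longrightarrow> A *\<^sub>v v \<in> lsum d Ws"
proof (induction Ws arbitrary: v)
  case (Cons W Ws)
  obtain u w where uw: "v = u + w" "u \<in> W" "w \<in> lsum d Ws" using Cons.prems(3) by (auto simp: ssum_def)
  have "subspace d (lsum d Ws)" using Cons.prems(1) by (intro subspace_lsum) auto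
  then have "A *\<^sub>v v = A *\<^sub>v u + A *\<^sub>v w"
    using uw Cons.prems(1)[of W] subspace_carrier by (auto intro!: mult_add_distrib_mat_vec[OF A])
  moreover have "A *\<^sub>v u \<in> W" "A *\<^sub>v w \<in> lsum d Ws" using Cons uw by auto
  ultimately show ?case by (auto simp: ssum_def)
qed (use A in auto)

lemma lsum_member: "(\<And>W. W \<in> set Ws \<Longrightarrow> subspace d W) \<Longrightarrow> W \<in> set Ws \<Longrightarrow> W \<subseteq> lsum d Ws"
proof (induction Ws)
  case (Cons U Ws)
  have "subspace d U" "subspace d (lsum d Ws)" using Cons.prems(1) by (auto intro!: subspace_lsum)
  from ssum_upper[OF this] show ?case using Cons by auto
qed simp

text \<open>The vector \<open>g N\<close> is the solution found in \<open>clebsch_gordan_hw\<close>,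
  of weight a + b - 2N, and generates \<open>X N\<close>. The sum of the \<open>X N\<close> is
  direct because F preserves the filtration \<open>Q N\<close> by total index x + y >= N, while
  \<open>g N\<close> is not in the next step. It exhausts the tensor product by
  \<open>hw_generate\<close>.\<close>

lemma clebsch_gordan:
  fixes p q :: "nat \<Rightarrow> 'a::field_char_0 vec"
  assumes r1: "g_rep m d1 \<rho>1" and r2: "g_rep m d2 \<rho>2"
    and w1: "weights d1 (\<rho>1 GH) I1 b1 v1" and w2: "weights d2 (\<rho>2 GH) I2 b2 v2"
    and p: "chain d1 (\<rho>1 GE) (\<rho>1 GF) (\<rho>1 GH) a p" and q: "chain d2 (\<rho>2 GE) (\<rho>2 GF) (\<rho>2 GH) b q"
  shows "sl2_iso (d1 * d2) (tens_rep d1 \<rho>1 d2 \<rho>2) (sp (d1 * d2) ({..a} \<times> {..b}) (tb p q)) [a + b - 2 * k. k \<leftarrow> [0..<Suc (min a b)]]"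
proof -
  define D where "D = d1 * d2"
  define T where "T = tens_rep d1 \<rho>1 d2 \<rho>2"
  define I where "I = {..a} \<times> {..b}"
  define t where "t = tb p q"
  define M where "M = min a b"
  have rep: "g_rep m D T" unfolding D_def T_def by (rule tens_g_rep[OF r1 r2])
  note cr = g_repD(1)[OF rep]
  interpret sl2 D "T GE" "T GF" "T GH" by (rule g_repD(2)[OF rep])
  note wt = tens_weights[OF r1 r2 w1 w2, folded D_def T_def]
  have fin: "finite I" by (simp add: I_def)
  have finS: "finite {(x,y)\<in>I. P x y}" for P by (rule finite_subset[OF _ fin]) auto
  have ind: "indep D I t" unfolding I_def t_def D_def
    by (rule kron_indep[OF sl2.chain_indep[OF g_repD(2)[OF r1] p] sl2.chain_indep[OF g_repD(2)[OF r2] q]])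
  note co = tens_chain_coords[OF r1 r2 p q, folded D_def T_def I_def t_def]
  have st: "T x *\<^sub>v v \<in> sp D I t" if "x \<in> {GE, GF, GH}" "v \<in> sp D I t" for x v
    using that co by (auto elim!: sp_E)
  define \<gamma> :: "nat \<times> nat \<Rightarrow> 'a" where "\<gamma> = (\<lambda>(x,y). (-1) ^ x * fact (a - x) * fact (b - y) / (fact x * fact y))"
  define g where "g N = lc D I (\<lambda>(x,y). if x + y = N then \<gamma> (x,y) else 0) t" for N
  have gsup: "g N \<in> sp D {(x,y)\<in>I. x + y = N} t" for N
  proof -
    have "lc D {(x,y)\<in>I. x + y = N} (\<lambda>(x,y). if x + y = N then \<gamma> (x,y) else 0) t = g N"
      unfolding g_def by (rule lc_mono[OF fin]) (auto split: if_splits)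
    then show ?thesis by (rule subst[where P = "\<lambda>v. v \<in> sp D {(x,y)\<in>I. x + y = N} t"]) (rule lc_in_sp)
  qed
  have gn: "g N \<noteq> 0\<^sub>v D" if "N \<le> M" for N
  proof
    assume "g N = 0\<^sub>v D"
    from indepD[OF ind this[unfolded g_def], of "(0,N)"] that show False by (simp add: \<gamma>_def I_def M_def)
  qed
  have gH: "T GH *\<^sub>v g N = of_int (int a + int b - 2 * int N) \<cdot>\<^sub>v g N" for N
    unfolding g_def co(3) lc_smult by (rule lc_cong) (auto simp del: of_int_diff of_int_add of_int_mult)
  have gE: "T GE *\<^sub>v g N = 0\<^sub>v D" if N: "N \<le> M" for N
    unfolding g_def co(1)
  proof (rule lc_zero)
    fix z assume z: "z \<in> I" and nz: "(case z of (x,y) \<Rightarrow> (if x < a then of_nat ((x + 1) * (a - x)) * (case (x + 1,y) of (x,y) \<Rightarrow> if x + y = N then \<gamma> (x,y) else 0) else 0) +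
      (if y < b then of_nat ((y + 1) * (b - y)) * (case (x,y + 1) of (x,y) \<Rightarrow> if x + y = N then \<gamma> (x,y) else 0) else 0)) \<noteq> 0"
    obtain x y where xy: "z = (x,y)" by (cases z)
    have "Suc (x + y) = N" using nz xy by (auto split: if_splits)
    then have "x < a" "y < b" using N by (auto simp: M_def)
    then obtain s u where s: "a = Suc (x + s)" "b = Suc (y + u)" by (metis less_imp_Suc_add)
    have "of_nat ((x + 1) * (a - x)) * \<gamma> (x + 1,y) + of_nat ((y + 1) * (b - y)) * \<gamma> (x,y + 1) = 0"
    proof -
      have "of_nat ((x + 1) * (a - x)) * \<gamma> (x + 1,y) = - ((-1) ^ x * fact (a - x) * fact (b - y) / (fact x * fact y))"
        unfolding \<gamma>_def s by (simp add: divide_simps mult_ac del: of_nat_Suc) (simp add: algebra_simps)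
      moreover have "of_nat ((y + 1) * (b - y)) * \<gamma> (x,y + 1) = (-1) ^ x * fact (a - x) * fact (b - y) / (fact x * fact y)"
        unfolding \<gamma>_def s by (simp add: divide_simps mult_ac del: of_nat_Suc) (simp add: algebra_simps)
      ultimately show ?thesis by simp
    qed
    then show "t z = 0\<^sub>v D" using nz xy \<open>Suc (x + y) = N\<close> s by simp
  qed
  define X where "X N = sp D {..a + b - 2 * N} (\<lambda>j. pw (T GF) j (g N))" for N
  have gc: "g N \<in> carrier_vec D" for N by (simp add: g_def)
  have ch: "chain D (T GE) (T GF) (T GH) (a + b - 2 * N) (\<lambda>j. pw (T GF) j (g N))" if N: "N \<le> M" for N
  proof -
    obtain k where k: "int a + int b - 2 * int N = int k" "chain D (T GE) (T GF) (T GH) k (\<lambda>j. pw (T GF) j (g N))"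
      using hw_chain_weights[OF wt gc gn[OF N] gH gE[OF N]] by blast
    have "k = a + b - 2 * N" using k(1) N by (auto simp: M_def)
    then show ?thesis using k(2) by simp
  qed
  have sX: "subspace D (X N)" for N unfolding X_def by (rule subspace_sp)
  have gX: "g N \<in> X N" for N
    unfolding X_def using sp_member[of "{..a + b - 2 * N}" 0 "\<lambda>j. pw (T GF) j (g N)" D] gc by simp
  have stX: "T x *\<^sub>v v \<in> X N" if "x \<in> {GE, GF, GH}" "v \<in> X N" "N \<le> M" for x v N
    using chain_stable[OF ch[OF that(3)] cr cr cr] that unfolding X_def by auto
  define Q where "Q N = sp D {(x,y)\<in>I. x + y \<ge> N} t" for N
  have stQ: "T GF *\<^sub>v v \<in> Q N" if "v \<in> Q N" for v N
  proof -
    obtain e where e: "v = lc D {(x,y)\<in>I. x + y \<ge> N} e t" using \<open>v \<in> Q N\<close> unfolding Q_def by (rule sp_E)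
    have "lc D {(x,y)\<in>I. x + y \<ge> N} e t = lc D {(x,y)\<in>I. x + y \<ge> N} (\<lambda>(x,y). if x + y \<ge> N then e (x,y) else 0) t" by (rule lc_cong) auto
    also have "\<dots> = lc D I (\<lambda>(x,y). if x + y \<ge> N then e (x,y) else 0) t" by (rule lc_mono[OF fin]) (auto split: if_splits)
    finally have v: "v = lc D I (\<lambda>(x,y). if x + y \<ge> N then e (x,y) else 0) t" using e by simp
    have "T GF *\<^sub>v v = lc D {(x,y)\<in>I. x + y \<ge> N} (\<lambda>(x,y). (if x = 0 then 0 else case (x - 1,y) of (x,y) \<Rightarrow> if x + y \<ge> N then e (x,y) else 0) +
        (if y = 0 then 0 else case (x,y - 1) of (x,y) \<Rightarrow> if x + y \<ge> N then e (x,y) else 0)) t"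
      unfolding v co(2) by (rule lc_mono[OF fin, symmetric]) (auto split: if_splits)
    then show ?thesis unfolding Q_def by simp
  qed
  have XQ: "X N \<subseteq> Q N" for N
  proof -
    have "g N \<in> Q N" using gsup[of N] lc_in_sp
    proof -
      have "sp D {(x,y)\<in>I. x + y = N} t \<subseteq> Q N" unfolding Q_def
        by (rule sp_least[OF subspace_sp]) (use finS indep_carrier[OF ind] in \<open>auto intro!: sp_member\<close>)
      then show ?thesis using gsup by blast
    qed
    then have "pw (T GF) j (g N) \<in> Q N" for j using stQ by (intro pw_in) auto
    then show ?thesis unfolding X_def by (intro sp_least) (auto simp: Q_def subspace_sp)
  qed
  have Qmono: "Q (Suc N) \<subseteq> Q N" for N unfolding Q_def
    by (rule sp_least[OF subspace_sp]) (use finS indep_carrier[OF ind] in \<open>auto intro!: sp_member\<close>)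
  let ?Y = "\<lambda>N. lsum D (map X [N..<Suc M])"
  have sY: "subspace D (?Y N)" for N by (rule subspace_lsum) (auto simp: sX)
  have stY: "T x *\<^sub>v v \<in> ?Y N" if "x \<in> {GE, GF, GH}" "v \<in> ?Y N" for x v N
    using that(2) by (rule lsum_stable[OF cr, rotated 2]) (auto simp: sX intro!: stX[OF that(1)])
  have main: "sl2_iso D T (?Y 0) (map (\<lambda>k. a + b - 2 * k) [0..<Suc M]) \<and> ?Y 0 \<subseteq> Q 0"
  proof (rule inc_induct[of 0 "Suc M" "\<lambda>N. sl2_iso D T (?Y N) (map (\<lambda>k. a + b - 2 * k) [N..<Suc M]) \<and> ?Y N \<subseteq> Q N"])
    show "sl2_iso D T (?Y (Suc M)) (map (\<lambda>k. a + b - 2 * k) [Suc M..<Suc M]) \<and> ?Y (Suc M) \<subseteq> Q (Suc M)"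
      using sl2_iso_Nil[OF cr] subspace_zero[OF subspace_sp] by (simp add: Q_def)
  next
    fix N assume N: "N < Suc M" and IH: "sl2_iso D T (?Y (Suc N)) (map (\<lambda>k. a + b - 2 * k) [Suc N..<Suc M]) \<and> ?Y (Suc N) \<subseteq> Q (Suc N)"
    have u: "[N..<Suc M] = N # [Suc N..<Suc M]" using N by (rule upt_conv_Cons)
    have Yu: "?Y N = ssum (X N) (?Y (Suc N))" unfolding u by simp
    \<comment> \<open>\<open>X N\<close> is irreducible, so a nonzero common vector would put all of
      it, in particular \<open>g N\<close>, into \<open>Q (Suc N)\<close>, whose index set is
      disjoint from the support of \<open>g N\<close>.\<close>
    have "v = 0\<^sub>v D" if v: "v \<in> X N" "v \<in> ?Y (Suc N)" for v
    proof (rule ccontr)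
      assume nz: "v \<noteq> 0\<^sub>v D"
      have "X N \<subseteq> ?Y (Suc N)" unfolding X_def[of N]
        by (rule chain_min[OF ch sY _ _ v(2) _ nz]) (use N v(1) X_def[of N] in \<open>auto intro: stY simp del: upt_Suc\<close>)
      then have "g N \<in> Q (Suc N)" using gX IH by blast
      then have "g N = 0\<^sub>v D"
        unfolding Q_def by (intro indep_sp_disjoint[OF ind _ _ _ gsup[of N]]) auto
      then show False using gn[of N] N by simp
    qed
    then have int: "X N \<inter> ?Y (Suc N) = {0\<^sub>v D}" using subspace_zero[OF sX] subspace_zero[OF sY] by blast
    have "sl2_iso D T (X N) [a + b - 2 * N]"
      using sl2_iso_single[OF cr g_repD(2)[OF rep], of "X N"] ch[of N] N unfolding X_def by auto
    from sl2_iso_Cons[OF cr this conjunct1[OF IH] int]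
    have "sl2_iso D T (?Y N) (map (\<lambda>k. a + b - 2 * k) [N..<Suc M])" unfolding Yu u by simp
    moreover have "?Y N \<subseteq> Q N" unfolding Yu
    proof (rule ssum_least)
      show "subspace D (Q N)" unfolding Q_def by (rule subspace_sp)
    qed (use IH XQ Qmono[of N] in blast)+
    ultimately show "sl2_iso D T (?Y N) (map (\<lambda>k. a + b - 2 * k) [N..<Suc M]) \<and> ?Y N \<subseteq> Q N" by blast
  qed simp
  have Q0: "Q 0 = sp D I t" by (simp add: Q_def)
  have "sp D I t \<subseteq> ?Y 0"
  proof (rule hw_generate[OF wt])
    show "subspace D (sp D I t)" by (rule subspace_sp)
    show "subspace D (?Y 0)" by (rule sY)
    fix v \<mu> assume v: "v \<in> sp D I t" "T GE *\<^sub>v v = 0\<^sub>v D" "T GH *\<^sub>v v = of_int \<mu> \<cdot>\<^sub>v v"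
    obtain e where e: "v = lc D I e t" using v(1) by (rule sp_E)
    \<comment> \<open>The only total index x + y that a vector of weight \<mu> can involve. For
      other \<mu> the support is empty and the value of N is immaterial.\<close>
    define N where "N = nat ((int a + int b - \<mu>) div 2)"
    have eqE: "(if x < a then of_nat ((x + 1) * (a - x)) * e (x + 1,y) else 0) +
      (if y < b then of_nat ((y + 1) * (b - y)) * e (x,y + 1) else 0) = 0" if "x \<le> a" "y \<le> b" for x y
      using indepD[OF ind v(2)[unfolded e co(1)], of "(x,y)"] that by (simp add: I_def)
    have supp: "x + y = N" if "x \<le> a" "y \<le> b" "e (x,y) \<noteq> 0" for x y
    proof -
      have "lc D I (\<lambda>(x,y). of_int (int a + int b - 2 * int (x + y)) * e (x,y)) t = lc D I (\<lambda>z. of_int \<mu> * e z) t"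
        using v(3) unfolding e co(3) lc_smult .
      from indep_eqD[OF ind this, of "(x,y)"] that have "(of_int (int a + int b - 2 * int (x + y)) :: 'a) = of_int \<mu>" by (simp add: I_def)
      then have "int a + int b - 2 * int (x + y) = \<mu>" by (simp only: of_int_eq_iff)
      then show ?thesis unfolding N_def by simp
    qed
    obtain s where s: "\<And>x y. x \<le> a \<Longrightarrow> y \<le> b \<Longrightarrow> e (x,y) = (if x + y = N then s * \<gamma> (x,y) else 0)" "s \<noteq> 0 \<Longrightarrow> N \<le> M"
      using clebsch_gordan_hw[where e = e and a = a and b = b and N = N, OF eqE supp] unfolding \<gamma>_def M_def by auto
    have vg: "v = s \<cdot>\<^sub>v g N" unfolding e g_def lc_smult by (rule lc_cong) (auto simp: I_def s(1))
    show "v \<in> ?Y 0"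
    proof (cases "s = 0")
      case True
      then show ?thesis using vg smult_0_vec[OF gc[of N]] subspace_zero[OF sY[of 0]] by (simp del: upt_Suc)
    next
      case False
      then have "X N \<subseteq> ?Y 0" using s(2) sX by (intro lsum_member) (auto simp del: upt_Suc)
      then show ?thesis using vg gX subspace_smult[OF sY] by blast
    qed
  qed ((rule stY st, simp, assumption)+)
  then have "sp D I t = ?Y 0" using main Q0 by blast
  then show ?thesis using main unfolding D_def T_def I_def t_def M_def by simp
qed

section \<open>Invariants of the tensor product\<close>

text \<open>A choice of coefficients; for an independent family they are unique on the index
  set.\<close>

definition coords :: "nat \<Rightarrow> 'i set \<Rightarrow> ('i \<Rightarrow> 'a::field vec) \<Rightarrow> 'a vec \<Rightarrow> 'i \<Rightarrow> 'a" where
  "coords d I b v = (SOME e. v = lc d I e b)"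

lemma coords: "v \<in> sp d I b \<Longrightarrow> v = lc d I (coords d I b v) b"
  unfolding coords_def by (rule someI_ex[of "\<lambda>e. v = lc d I e b"]) (auto elim: sp_E)

lemma sum_level:
  assumes "j \<le> L" "\<And>x. x \<in> idx L c \<Longrightarrow> fst x \<noteq> j \<Longrightarrow> f x = 0"
  shows "sum f (idx L c) = (\<Sum>k\<le>c j. f (j,k))"
proof -
  have "sum f (idx L c) = sum f (Pair j ` {..c j})"
    by (rule sum.mono_neutral_right) (use assms(1) in \<open>auto simp: image_iff intro!: assms(2)\<close>)
  also have "\<dots> = (\<Sum>k\<le>c j. f (j,k))" by (subst sum.reindex) (auto simp: inj_on_def)
  finally show ?thesis .
qed

lemma sol_basisD:
  assumes "sol_basis m a0 a1 b0 b1 M1 M2 K A B"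
  shows "N \<le> K \<Longrightarrow> sol m a0 a1 b0 b1 M1 M2 (A N) (B N)"
    and "N \<le> K \<Longrightarrow> k \<le> a0 \<Longrightarrow> j \<le> b1 \<Longrightarrow> A N k j \<noteq> 0 \<Longrightarrow> int a0 + int b1 - 2 * (int k + int j) = int K - 2 * int N"
    and "N \<le> K \<Longrightarrow> k \<le> a1 \<Longrightarrow> j \<le> b0 \<Longrightarrow> B N k j \<noteq> 0 \<Longrightarrow> int a1 + int b0 - 2 * (int k + int j) = int K - 2 * int N"
    and "N \<le> K \<Longrightarrow> (\<exists>k\<le>a0. \<exists>j\<le>b1. A N k j \<noteq> 0) \<or> (\<exists>k\<le>a1. \<exists>j\<le>b0. B N k j \<noteq> 0)"
    and "sol m a0 a1 b0 b1 M1 M2 \<alpha> \<beta> \<Longrightarrow> \<exists>t. (\<forall>k\<le>a0. \<forall>j\<le>b1. \<alpha> k j = (\<Sum>N\<le>K. t N * A N k j)) \<and>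
        (\<forall>k\<le>a1. \<forall>j\<le>b0. \<beta> k j = (\<Sum>N\<le>K. t N * B N k j))"
proof -
  note u = assms[unfolded sol_basis_def]
  note u2 = u[THEN conjunct2] note u3 = u2[THEN conjunct2] note u4 = u3[THEN conjunct2]
  show "N \<le> K \<Longrightarrow> sol m a0 a1 b0 b1 M1 M2 (A N) (B N)" by (rule u[THEN conjunct1, rule_format])
  show "N \<le> K \<Longrightarrow> k \<le> a0 \<Longrightarrow> j \<le> b1 \<Longrightarrow> A N k j \<noteq> 0 \<Longrightarrow> int a0 + int b1 - 2 * (int k + int j) = int K - 2 * int N"
    by (rule u2[THEN conjunct1, rule_format])
  show "N \<le> K \<Longrightarrow> k \<le> a1 \<Longrightarrow> j \<le> b0 \<Longrightarrow> B N k j \<noteq> 0 \<Longrightarrow> int a1 + int b0 - 2 * (int k + int j) = int K - 2 * int N"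
    by (rule u3[THEN conjunct1, rule_format])
  show "N \<le> K \<Longrightarrow> (\<exists>k\<le>a0. \<exists>j\<le>b1. A N k j \<noteq> 0) \<or> (\<exists>k\<le>a1. \<exists>j\<le>b0. B N k j \<noteq> 0)"
    by (rule u4[THEN conjunct1, rule_format])
  show "sol m a0 a1 b0 b1 M1 M2 \<alpha> \<beta> \<Longrightarrow> \<exists>t. (\<forall>k\<le>a0. \<forall>j\<le>b1. \<alpha> k j = (\<Sum>N\<le>K. t N * A N k j)) \<and>
        (\<forall>k\<le>a1. \<forall>j\<le>b0. \<beta> k j = (\<Sum>N\<le>K. t N * B N k j))"
    using u4[THEN conjunct2] by (elim allE impE) assumption+
qed

text \<open>The level weights of the two factors are \<open>a\<close> and \<open>c\<close>, so the
  numbers a_0, a_1, b_0, b_1 of the theorem appear as \<open>a 0\<close>, \<open>a 1\<close>,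
  \<open>c 0\<close>, \<open>c 1\<close>.\<close>

locale faithful_tensor_z =
  fixes m d1 d2 L :: nat and \<rho>1 \<rho>2 :: "gen \<Rightarrow> 'a::field_char_0 mat" and a c :: "nat \<Rightarrow> nat"
    and p q :: "nat \<Rightarrow> nat \<Rightarrow> 'a vec" and \<gamma> :: 'a
  assumes r1: "g_rep m d1 \<rho>1" and r2: "g_rep m d2 \<rho>2"
    and fg: "fgraded m d1 \<rho>1 a p \<gamma>" and zg: "zgraded m d2 \<rho>2 L c q" and L: "1 \<le> L"
begin

definition "D = d1 * d2"
definition "T = tens_rep d1 \<rho>1 d2 \<rho>2"
definition "I = idx 2 a"
definition "J = idx L c"
definition "t = tb (lev p) (lev q)"
text \<open>Matrix entries of x_i on the first factor, in row x' and column x. The blocks from level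
  1 to level 0, \<open>M1\<close> and \<open>M2\<close>, are the ones that enter the linear
  system.\<close>

definition "A i x' x = coords d1 I (lev p) (\<rho>1 (GX i) *\<^sub>v lev p x) x'"
definition "B i y' y = coords d2 J (lev q) (\<rho>2 (GX i) *\<^sub>v lev q y) y'"
definition "M1 i k k' = A i (0,k) (1,k')"
definition "M2 i l l' = B i (0,l) (1,l')"
definition "block i j = Pair i ` {..a i} \<times> Pair j ` {..c j}"
definition "W i j = sp D (block i j) t"
text \<open>The invariants in the blocks (0,1) and (1,0); for the socle decompositions of the
  theorem this is its S_1.\<close>

definition "S1 = {v \<in> ssum (W 0 1) (W 1 0). killed m D T v}"

lemma gp: "graded d1 \<rho>1 2 a p" and gq: "graded d2 \<rho>2 L c q" and a2: "a 2 = a 0" and \<gamma>: "\<gamma> \<noteq> 0"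
  using fg zg by (auto simp: fgraded_def zgraded_def)

lemma rep: "g_rep m D T"
  unfolding D_def T_def by (rule tens_g_rep[OF r1 r2])

lemma ind1: "indep d1 I (lev p)" and ind2: "indep d2 J (lev q)"
  unfolding I_def J_def by (rule gradedD(2)[OF gp] gradedD(2)[OF gq])+

lemma fin: "finite I" "finite J"
  by (auto simp: I_def J_def)

lemma ind: "indep D (I \<times> J) t"
  unfolding D_def t_def by (rule kron_indep[OF ind1 ind2])

lemma total: "sp D (I \<times> J) t = carrier_vec D"
  unfolding D_def t_def I_def J_def
  by (rule kron_span[OF gradedD(3)[OF gp] finite_idx _ gradedD(3)[OF gq] finite_idx])
     (use indep_carrier[OF gradedD(2)[OF gp]] indep_carrier[OF gradedD(2)[OF gq]] in blast)+

lemma wt: "weights D (T GH) (I \<times> J) t (\<lambda>(x,y). (case x of (j,l) \<Rightarrow> int (a j) - 2 * int l) + (case y of (j,l) \<Rightarrow> int (c j) - 2 * int l))"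
  unfolding D_def T_def t_def I_def J_def by (rule tens_weights[OF r1 r2 graded_weights[OF gp] graded_weights[OF gq]])

lemma block_subset: "i \<le> 2 \<Longrightarrow> j \<le> L \<Longrightarrow> block i j \<subseteq> I \<times> J"
  by (auto simp: block_def I_def J_def)

lemma finite_block [simp]: "finite (block i j)"
  by (simp add: block_def)

lemma subspace_W: "subspace D (W i j)"
  unfolding W_def by (rule subspace_sp)

lemma tens_sub_W:
  assumes "i \<le> 2" "j \<le> L" shows "tens_sub d1 d2 (sp d1 {..a i} (p i)) (sp d2 {..c j} (q j)) = W i j"
proof -
  have "tens_sub d1 d2 (sp d1 (Pair i ` {..a i}) (lev p)) (sp d2 (Pair j ` {..c j}) (lev q)) = W i j"
    unfolding W_def D_def t_def block_def
    by (rule tens_sub_sp) (use assms gradedD(4)[OF gp] gradedD(4)[OF gq] in auto)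
  then show ?thesis by (simp add: sp_level)
qed

lemma W_alt:
  assumes "i \<le> 2" "j \<le> L" shows "W i j = sp D ({..a i} \<times> {..c j}) (tb (p i) (q j))"
  unfolding tens_sub_W[OF assms, symmetric] D_def
  by (rule tens_sub_sp) (use assms gradedD(4)[OF gp] gradedD(4)[OF gq] in auto)

lemma W_stable:
  assumes "i \<le> 2" "j \<le> L" "x \<in> {GE, GF, GH}" "v \<in> W i j" shows "T x *\<^sub>v v \<in> W i j"
  using assms(3,4) tens_chain_coords[OF r1 r2 gradedD(1)[OF gp assms(1)] gradedD(1)[OF gq assms(2)]]
  unfolding W_alt[OF assms(1,2)] D_def T_def by (auto elim!: sp_E)

lemma A_eq: "x \<in> I \<Longrightarrow> \<rho>1 (GX i) *\<^sub>v lev p x = lc d1 I (\<lambda>x'. A i x' x) (lev p)"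
  unfolding A_def by (rule coords) (use g_repD(1)[OF r1, of "GX i"] gradedD(3)[OF gp] in \<open>simp add: I_def\<close>)

lemma B_eq: "y \<in> J \<Longrightarrow> \<rho>2 (GX i) *\<^sub>v lev q y = lc d2 J (\<lambda>y'. B i y' y) (lev q)"
  unfolding B_def by (rule coords) (use g_repD(1)[OF r2, of "GX i"] gradedD(3)[OF gq] in \<open>simp add: J_def\<close>)

text \<open>The image of each level lies in the span of the strictly lower ones, and coordinates
  vanish outside the indices of such a span (\<open>lc_support\<close>).\<close>

lemma A_0:
  assumes i: "i \<le> m" and x: "x \<in> I" "x' \<in> I" and le: "fst x \<le> fst x'"
  shows "A i x' x = 0"
proof -
  obtain j k where "x = (j,k)" by (cases x)
  then have jk: "x = (j,k)" "k \<le> a j" "j = 0 \<or> j = 1 \<or> j = 2" using x(1) by (auto simp: I_def)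
  have "\<exists>S\<subseteq>I. x' \<notin> S \<and> \<rho>1 (GX i) *\<^sub>v lev p x \<in> sp d1 S (lev p)"
    using jk(3)
  proof (elim disjE)
    assume j: "j = 0"
    have "\<rho>1 (GX i) *\<^sub>v lev p x = 0\<^sub>v d1" using fg i jk j by (simp add: fgraded_def)
    then show ?thesis using subspace_zero[OF subspace_sp] by (intro exI[of _ "{}"]) auto
  next
    assume j: "j = 1"
    have "\<rho>1 (GX i) *\<^sub>v lev p x \<in> sp d1 (Pair 0 ` {..a 0}) (lev p)" using fg i jk j by (simp add: fgraded_def sp_level)
    moreover have "Pair 0 ` {..a 0} \<subseteq> I" by (auto simp: I_def)
    ultimately show ?thesis using le jk j by (intro exI[of _ "Pair 0 ` {..a 0}"]) auto
  next
    assume j: "j = 2"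
    have "\<rho>1 (GX i) *\<^sub>v lev p x \<in> sp d1 (Pair 0 ` {..a 0} \<union> Pair 1 ` {..a 1}) (lev p)" using fg i jk j by (simp add: fgraded_def)
    moreover have "Pair 0 ` {..a 0} \<union> Pair 1 ` {..a 1} \<subseteq> I" by (auto simp: I_def)
    ultimately show ?thesis using le jk j by (intro exI[of _ "Pair 0 ` {..a 0} \<union> Pair 1 ` {..a 1}"]) auto
  qed
  then show ?thesis
    using A_eq[OF x(1), of i] lc_support[OF ind1, of "\<lambda>x'. A i x' x"] x(2) by fastforce
qed

lemma B_0:
  assumes i: "i \<le> m" and y: "y \<in> J" "y' \<in> J" and ne: "fst y \<noteq> Suc (fst y')"
  shows "B i y' y = 0"
proof -
  obtain j k where "y = (j,k)" by (cases y)
  then have jk: "y = (j,k)" "k \<le> c j" "j \<le> L" using y(1) by (auto simp: J_def)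
  have "\<exists>S\<subseteq>J. y' \<notin> S \<and> \<rho>2 (GX i) *\<^sub>v lev q y \<in> sp d2 S (lev q)"
  proof (cases j)
    case 0
    have "\<rho>2 (GX i) *\<^sub>v lev q y = 0\<^sub>v d2" using zg i jk 0 by (simp add: zgraded_def)
    then show ?thesis using subspace_zero[OF subspace_sp] by (intro exI[of _ "{}"]) auto
  next
    case (Suc j')
    have "\<rho>2 (GX i) *\<^sub>v lev q y \<in> sp d2 (Pair j' ` {..c j'}) (lev q)" using zg i jk Suc by (simp add: zgraded_def sp_level)
    moreover have "Pair j' ` {..c j'} \<subseteq> J" using jk Suc by (auto simp: J_def)
    ultimately show ?thesis using ne jk Suc by (intro exI[of _ "Pair j' ` {..c j'}"]) auto
  qed
  then show ?thesis
    using B_eq[OF y(1), of i] lc_support[OF ind2, of "\<lambda>y'. B i y' y"] y(2) by fastforce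
qed

lemma B_level:
  assumes "i \<le> m" "j < L" "l' \<le> c (Suc j)"
  shows "\<rho>2 (GX i) *\<^sub>v q (Suc j) l' = lc d2 {..c j} (\<lambda>l. B i (j,l) (Suc j,l')) (q j)"
proof -
  have "\<rho>2 (GX i) *\<^sub>v lev q (Suc j,l') = lc d2 J (\<lambda>y'. B i y' (Suc j,l')) (lev q)" by (rule B_eq) (use assms in \<open>simp add: J_def\<close>)
  also have "\<dots> = lc d2 (Pair j ` {..c j}) (\<lambda>y'. B i y' (Suc j,l')) (lev q)"
    by (rule lc_mono[symmetric]) (use assms in \<open>auto simp: J_def image_iff intro!: B_0\<close>)
  finally show ?thesis by (simp add: lc_level)
qed

lemma A_level:
  assumes "i \<le> m" "k \<le> a 1"
  shows "\<rho>1 (GX i) *\<^sub>v p 1 k = lc d1 {..a 0} (\<lambda>l. A i (0,l) (1,k)) (p 0)"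
proof -
  have "\<rho>1 (GX i) *\<^sub>v lev p (1,k) = lc d1 I (\<lambda>y'. A i y' (1,k)) (lev p)" by (rule A_eq) (use assms in \<open>simp add: I_def\<close>)
  also have "\<dots> = lc d1 (Pair 0 ` {..a 0}) (\<lambda>y'. A i y' (1,k)) (lev p)"
    by (rule lc_mono[symmetric]) (use assms in \<open>auto simp: I_def image_iff Suc_le_eq intro!: A_0 gr0I\<close>)
  finally show ?thesis by (simp add: lc_level)
qed

lemma equivariant_M1: "equivariant m (a 0) (a 1) M1"
  by (rule level_equivariant[OF r1 gradedD(1)[OF gp] gradedD(1)[OF gp]]) (simp_all add: A_level[simplified] M1_def)

lemma equivariant_M2: "equivariant m (c 0) (c 1) M2"
  by (rule level_equivariant[OF r2 gradedD(1)[OF gq] gradedD(1)[OF gq]])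
     (use L B_level[of _ 0] in \<open>simp_all add: M2_def\<close>)

lemma M1_nonzero: "\<exists>i\<le>m. \<exists>l\<le>a 0. \<exists>k\<le>a 1. M1 i l k \<noteq> 0"
proof (rule ccontr)
  assume n: "\<not> ?thesis"
  have "\<rho>1 (GX i) *\<^sub>v p 1 k = 0\<^sub>v d1" if "i \<le> m" "k \<le> a 1" for i k
    unfolding A_level[OF that] by (rule lc_zero) (use n that in \<open>auto simp: M1_def\<close>)
  then show False using fg by (auto simp: fgraded_def)
qed

lemma M2_nonzero: "\<exists>i\<le>m. \<exists>l\<le>c 0. \<exists>k\<le>c 1. M2 i l k \<noteq> 0"
proof (rule ccontr)
  assume n: "\<not> ?thesis"
  have "\<rho>2 (GX i) *\<^sub>v q (Suc 0) k = 0\<^sub>v d2" if "i \<le> m" "k \<le> c 1" for i k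
    by (subst B_level) (use n that L in \<open>auto simp: M2_def intro!: lc_zero\<close>)
  moreover have "0 < L" using L by simp
  ultimately show False using zg unfolding zgraded_def One_nat_def by blast
qed

text \<open>\<open>zgraded_level_injective\<close> in coordinates: the sums are the coordinates of
  the image under x_i of the combination with coefficients f.\<close>

lemma B_injective:
  assumes j: "j < L" and f: "\<And>i l. i \<le> m \<Longrightarrow> l \<le> c j \<Longrightarrow> (\<Sum>l'\<le>c (Suc j). f l' * B i (j,l) (Suc j,l')) = 0"
    and l: "l' \<le> c (Suc j)"
  shows "f l' = 0"
proof -
  note ch = gradedD(1)[OF gq, of "Suc j"]
  have "lc d2 {..c (Suc j)} f (q (Suc j)) = 0\<^sub>v d2"
  proof (rule zgraded_level_injective[OF r2 zg j lc_in_sp])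
    fix i assume i: "i \<le> m"
    have "\<rho>2 (GX i) *\<^sub>v lc d2 {..c (Suc j)} f (q (Suc j)) = lc d2 {..c (Suc j)} f (\<lambda>l'. \<rho>2 (GX i) *\<^sub>v q (Suc j) l')"
      by (rule mult_lc[OF g_repD(1)[OF r2]]) (use gradedD(4)[OF gq] j in auto)
    also have "\<dots> = lc d2 {..c (Suc j)} f (\<lambda>l'. lc d2 {..c j} (\<lambda>l. B i (j,l) (Suc j,l')) (q j))"
      by (rule lc_cong) (simp_all add: B_level[OF i j])
    also have "\<dots> = 0\<^sub>v d2" unfolding lc_lc by (rule lc_zero) (use f[OF i] in auto)
    finally show "\<rho>2 (GX i) *\<^sub>v lc d2 {..c (Suc j)} f (q (Suc j)) = 0\<^sub>v d2" .
  qed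
  then show ?thesis using indepD[OF sl2.chain_indep[OF g_repD(2)[OF r2] ch]] j l by simp
qed

text \<open>z acts by 0 on the second factor and by \<gamma> from level 2 to level 0 on the first,
  so its equation is the vanishing of the level 2 coefficients. The other equations are those of the
  x_i.\<close>

lemma killed_coords:
  "killed m D T (lc D (I \<times> J) e t) \<longleftrightarrow> (\<forall>k\<le>a 0. \<forall>y\<in>J. e ((2,k),y) = 0) \<and>
     (\<forall>i\<le>m. \<forall>x\<in>I. \<forall>y\<in>J. (\<Sum>x'\<in>I. A i x x' * e (x',y)) + (\<Sum>y'\<in>J. e (x,y') * B i y y') = 0)"
proof -
  note cr = g_repD(1)[OF r1] g_repD(1)[OF r2]
  note car = indep_carrier[OF ind1] indep_carrier[OF ind2]
  have X: "T (GX i) *\<^sub>v lc D (I \<times> J) e t = lc D (I \<times> J) (\<lambda>(x,y). (\<Sum>x'\<in>I. A i x x' * e (x',y)) + (\<Sum>y'\<in>J. e (x,y') * B i y y')) t" for i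
    unfolding D_def T_def t_def
    by (rule tens_coords[where ?\<rho>1.0 = \<rho>1 and ?\<rho>2.0 = \<rho>2, OF cr car fin A_eq B_eq]) assumption+
  have Z1: "\<rho>1 GZ *\<^sub>v lev p x = lc d1 I (\<lambda>x'. if fst x = 2 \<and> x' = (0,snd x) then \<gamma> else 0) (lev p)" if xI: "x \<in> I" for x
  proof -
    obtain j k where "x = (j,k)" by (cases x)
    then have jk: "x = (j,k)" "k \<le> a j" "j = 0 \<or> j = 1 \<or> j = 2" using xI by (auto simp: I_def)
    show ?thesis
    proof (cases "j = 2")
      case True
      then show ?thesis using fg jk a2 gradedD(4)[OF gp, of 0 k] fin
        by (subst lc_single[where i = "(0,k)"]) (auto simp: fgraded_def I_def)
    next
      case False
      then show ?thesis using fg jk by (subst lc_zero) (auto simp: fgraded_def)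
    qed
  qed
  have Z2: "\<rho>2 GZ *\<^sub>v lev q y = lc d2 J (\<lambda>y'. 0) (lev q)" if "y \<in> J" for y
    using zg car(2)[OF that] by (subst lc_zero) (auto simp: zgraded_def)
  have Z: "T GZ *\<^sub>v lc D (I \<times> J) e t = lc D (I \<times> J) (\<lambda>(x,y). (\<Sum>x'\<in>I. (if fst x' = 2 \<and> x = (0,snd x') then \<gamma> else 0) * e (x',y)) + (\<Sum>y'\<in>J. e (x,y') * 0)) t"
    unfolding D_def T_def t_def
    by (rule tens_coords[where ?\<rho>1.0 = \<rho>1 and ?\<rho>2.0 = \<rho>2, OF cr car fin Z1 Z2]) assumption+
  have zero: "lc D (I \<times> J) f t = 0\<^sub>v D \<longleftrightarrow> (\<forall>x\<in>I. \<forall>y\<in>J. f (x,y) = 0)" for f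
  proof
    assume "lc D (I \<times> J) f t = 0\<^sub>v D"
    then show "\<forall>x\<in>I. \<forall>y\<in>J. f (x,y) = 0" using indepD[OF ind] by blast
  qed (auto intro!: lc_zero)
  have zsum: "(\<Sum>x'\<in>I. (if fst x' = 2 \<and> x = (0,snd x') then \<gamma> else 0) * e (x',y)) = (if fst x = 0 then \<gamma> * e ((2,snd x),y) else 0)"
    if "x \<in> I" for x y
  proof (cases "fst x = 0")
    case True
    then have "(2,snd x) \<in> I" using that a2 by (cases x) (auto simp: I_def)
    then show ?thesis using True fin by (subst sum_at[where i = "(2,snd x)"]) (auto simp: prod_eq_iff)
  next
    case False
    then show ?thesis by (auto intro!: sum.neutral)
  qed
  have "T GZ *\<^sub>v lc D (I \<times> J) e t = 0\<^sub>v D \<longleftrightarrow> (\<forall>x\<in>I. \<forall>y\<in>J. fst x = 0 \<longrightarrow> e ((2,snd x),y) = 0)"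
    unfolding Z zero using \<gamma> by (auto simp: zsum)
  also have "\<dots> \<longleftrightarrow> (\<forall>k\<le>a 0. \<forall>y\<in>J. e ((2,k),y) = 0)" by (auto simp: I_def idx_def)
  finally show ?thesis unfolding killed_def X zero by simp
qed

text \<open>Coefficients are eliminated from the top. With level 2 of V_1 gone, the component of x_i
  v in block (1,j) involves only block (1,j+1), so \<open>B_injective\<close> kills the latter;
  after that, the component in block (0,j) with j >= 1 involves only block (0,j+1). The component
  left over, in block (0,0), is the system \<open>sol\<close>.\<close>

lemma killed_iff:
  "killed m D T (lc D (I \<times> J) e t) \<longleftrightarrow>
     (\<forall>z\<in>I \<times> J. z \<notin> block 0 0 \<union> block 0 1 \<union> block 1 0 \<longrightarrow> e z = 0) \<and>
     sol m (a 0) (a 1) (c 0) (c 1) M1 M2 (\<lambda>k l. e ((0,k),(1,l))) (\<lambda>k l. e ((1,k),(0,l)))"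
  (is "_ \<longleftrightarrow> ?supp \<and> ?sol")
proof -
  have bl: "((i,k),(j,l)) \<in> block i' j' \<longleftrightarrow> i = i' \<and> j = j' \<and> k \<le> a i \<and> l \<le> c j" for i j k l i' j' by (auto simp: block_def)
  let ?Z = "\<forall>k\<le>a 0. \<forall>y\<in>J. e ((2,k),y) = 0"
  \<comment> \<open>In a row of level 0 the columns of level 0 have entry 0 and those of level 2
    have coefficient 0; only level 1 is left.\<close>
  have S1: "(\<Sum>x'\<in>I. A i (0,k) x' * e (x',y)) = (\<Sum>k'\<le>a 1. M1 i k k' * e ((1,k'),y))"
    if z: ?Z and i: "i \<le> m" "k \<le> a 0" "y \<in> J" for i k y
    unfolding M1_def I_def
  proof (rule sum_level)
    fix x assume x: "x \<in> idx 2 a" "fst x \<noteq> 1"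
    obtain j k' where jk: "x = (j,k')" by (cases x)
    then have "j = 0 \<or> j = 2" using x by auto
    then show "A i (0,k) x * e (x,y) = 0" using A_0[OF i(1), of x "(0,k)"] z i x(1) jk a2 by (auto simp: I_def)
  qed simp
  have S1': "(\<Sum>x'\<in>I. A i x x' * e (x',y)) = 0" if z: ?Z and i: "i \<le> m" "x \<in> I" "fst x \<noteq> 0" "y \<in> J" for i x y
  proof (rule sum.neutral, rule ballI)
    fix x' assume x': "x' \<in> I"
    obtain j k where jk: "x' = (j,k)" by (cases x')
    show "A i x x' * e (x',y) = 0"
    proof (cases "fst x' \<le> fst x")
      case True
      then show ?thesis using A_0[OF i(1) x' i(2)] by simp
    next
      case False
      then have "j = 2" using jk x' i(3) by (auto simp: I_def)
      then show ?thesis using z x' jk a2 i(4) by (auto simp: I_def)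
    qed
  qed
  have S2: "(\<Sum>y'\<in>J. e (x,y') * B i (j,l) y') = (if j < L then \<Sum>l'\<le>c (Suc j). e (x,(Suc j,l')) * B i (j,l) (Suc j,l') else 0)"
    if i: "i \<le> m" "(j,l) \<in> J" for i j l x
  proof (cases "j < L")
    case True
    then have "(\<Sum>y'\<in>J. e (x,y') * B i (j,l) y') = (\<Sum>l'\<le>c (Suc j). e (x,(Suc j,l')) * B i (j,l) (Suc j,l'))"
      unfolding J_def by (intro sum_level) (use i B_0[OF i(1) _ i(2)] in \<open>auto simp: J_def\<close>)
    then show ?thesis using True by simp
  next
    case False
    have "e (x,y') * B i (j,l) y' = 0" if "y' \<in> J" for y'
    proof -
      have "fst y' \<le> L" using that by (cases y') (auto simp: J_def)
      then show ?thesis using B_0[OF i(1) that i(2)] False by simp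
    qed
    then show ?thesis using False by (simp add: sum.neutral)
  qed
  show ?thesis
  proof
    assume k: "killed m D T (lc D (I \<times> J) e t)"
    then have Z: ?Z and eq: "\<And>i x y. i \<le> m \<Longrightarrow> x \<in> I \<Longrightarrow> y \<in> J \<Longrightarrow>
        (\<Sum>x'\<in>I. A i x x' * e (x',y)) + (\<Sum>y'\<in>J. e (x,y') * B i y y') = 0"
      unfolding killed_coords by blast+
    have e1: "e ((1,k),(Suc j,l)) = 0" if kl: "k \<le> a 1" "j < L" "l \<le> c (Suc j)" for k j l
    proof (rule B_injective[OF kl(2) _ kl(3), of "\<lambda>l. e ((1,k),(Suc j,l))"])
      fix i l' assume i: "i \<le> m" "l' \<le> c j"
      have kI: "(1,k) \<in> I" and lJ: "(j,l') \<in> J" using kl i by (auto simp: I_def J_def)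
      show "(\<Sum>l\<le>c (Suc j). e ((1,k),(Suc j,l)) * B i (j,l') (Suc j,l)) = 0"
        using eq[OF i(1) kI lJ] S1'[OF Z i(1) kI _ lJ] S2[OF i(1) lJ, of "(1,k)"] kl(2) by simp
    qed
    \<comment> \<open>For j = 0 the block (1,0), which need not vanish, contributes as well, so
      there only the joint relation in \<open>sol\<close> remains.\<close>
    have e0: "e ((0,k),(Suc j,l)) = 0" if kl: "k \<le> a 0" "j < L" "j \<noteq> 0" "l \<le> c (Suc j)" for k j l
    proof (rule B_injective[OF kl(2) _ kl(4), of "\<lambda>l. e ((0,k),(Suc j,l))"])
      fix i l' assume i: "i \<le> m" "l' \<le> c j"
      obtain j' where j': "j = Suc j'" using kl(3) not0_implies_Suc by blast
      have kI: "(0,k) \<in> I" and lJ: "(j,l') \<in> J" using kl i by (auto simp: I_def J_def)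
      have "(\<Sum>k'\<le>a 1. M1 i k k' * e ((1,k'),(j,l'))) = 0"
        by (rule sum.neutral) (use e1[of _ j' l'] j' kl(2) i(2) in auto)
      then show "(\<Sum>l\<le>c (Suc j). e ((0,k),(Suc j,l)) * B i (j,l') (Suc j,l)) = 0"
        using eq[OF i(1) kI lJ] S1[OF Z i(1) kl(1) lJ] S2[OF i(1) lJ, of "(0,k)"] kl(2) by simp
    qed
    have ?supp
    proof (intro ballI impI)
      fix z assume z: "z \<in> I \<times> J" "z \<notin> block 0 0 \<union> block 0 1 \<union> block 1 0"
      obtain i k j l where zz: "z = ((i,k),(j,l))" by (metis surj_pair)
      have b: "i \<le> 2" "k \<le> a i" "j \<le> L" "l \<le> c j" using z(1) zz by (auto simp: I_def J_def)
      consider "i = 2" | "i = 1" "j \<noteq> 0" | "i = 0" "j \<ge> 2" using z(2) b unfolding zz Un_iff bl by force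
      then show "e z = 0"
      proof cases
        case 1
        then show ?thesis using Z b zz a2 by (auto simp: J_def)
      next
        case 2
        then show ?thesis using e1[of k "j - 1" l] b zz by simp
      next
        case 3
        then show ?thesis using e0[of k "j - 1" l] b zz by simp
      qed
    qed
    moreover have ?sol unfolding sol_def
    proof (intro allI impI)
      fix i k l assume i: "i \<le> m" "k \<le> a 0" "l \<le> c 0"
      have kI: "(0,k) \<in> I" and lJ: "(0,l) \<in> J" using i by (auto simp: I_def J_def)
      show "(\<Sum>j\<le>c 1. e ((0,k),(1,j)) * M2 i l j) + (\<Sum>k'\<le>a 1. M1 i k k' * e ((1,k'),(0,l))) = 0"
        using eq[OF i(1) kI lJ] S1[OF Z i(1,2) lJ] S2[OF i(1) lJ, of "(0,k)"] L by (simp add: M2_def add.commute)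
    qed
    ultimately show "?supp \<and> ?sol" by blast
  next
    assume a: "?supp \<and> ?sol"
    have Z: ?Z using a a2 by (auto simp: bl I_def J_def)
    have e1: "e ((1,k),(Suc j,l)) = 0" if "k \<le> a 1" "Suc j \<le> L" "l \<le> c (Suc j)" for k j l using a that by (auto simp: bl I_def J_def)
    have e0: "e ((0,k),(Suc j,l)) = 0" if "k \<le> a 0" "Suc j \<le> L" "j \<noteq> 0" "l \<le> c (Suc j)" for k j l using a that by (auto simp: bl I_def J_def)
    have "(\<Sum>x'\<in>I. A i x x' * e (x',y)) + (\<Sum>y'\<in>J. e (x,y') * B i y y') = 0" if ixy: "i \<le> m" "x \<in> I" "y \<in> J" for i x y
    proof -
      obtain i' k j l where xy: "x = (i',k)" "y = (j,l)" by (metis surj_pair)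
      have b: "i' \<le> 2" "k \<le> a i'" "j \<le> L" "l \<le> c j" using ixy xy by (auto simp: I_def J_def)
      consider "i' = 0" "j = 0" | "i' = 0" "j \<noteq> 0" | "i' = 1" | "i' = 2" using b(1) by force
      then show ?thesis
      proof cases
        case 1
        have "(\<Sum>j\<le>c 1. e ((0,k),(1,j)) * M2 i l j) + (\<Sum>k'\<le>a 1. M1 i k k' * e ((1,k'),(0,l))) = 0"
          using a ixy(1) b 1 unfolding sol_def by blast
        then show ?thesis using S1[OF Z ixy(1) _ ixy(3), of k] S2[of i j l x] 1 b ixy xy L by (simp add: M2_def add.commute)
      next
        case 2
        then obtain j' where j': "j = Suc j'" using not0_implies_Suc by blast
        have "(\<Sum>k'\<le>a 1. M1 i k k' * e ((1,k'),y)) = 0"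
          by (rule sum.neutral) (use e1[of _ j' l] j' b xy in auto)
        moreover have "(\<Sum>l'\<le>c (Suc j). e (x,(Suc j,l')) * B i (j,l) (Suc j,l')) = 0" if "j < L"
          by (rule sum.neutral) (use e0[of k j] 2 that b xy in auto)
        ultimately show ?thesis using S1[OF Z ixy(1) _ ixy(3), of k] S2[of i j l x] 2 b ixy xy by simp
      next
        case 3
        have "(\<Sum>l'\<le>c (Suc j). e (x,(Suc j,l')) * B i (j,l) (Suc j,l')) = 0" if "j < L"
          by (rule sum.neutral) (use e1[of k j] 3 that b xy in auto)
        then show ?thesis using S1'[OF Z ixy(1,2) _ ixy(3)] S2[of i j l x] 3 b ixy xy by simp
      next
        case 4
        have "(\<Sum>l'\<le>c (Suc j). e (x,(Suc j,l')) * B i (j,l) (Suc j,l')) = 0" if "j < L"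
          by (rule sum.neutral) (use Z 4 that b xy a2 in \<open>auto simp: J_def\<close>)
        then show ?thesis using S1'[OF Z ixy(1,2) _ ixy(3)] S2[of i j l x] 4 b ixy xy by simp
      qed
    qed
    then show "killed m D T (lc D (I \<times> J) e t)" unfolding killed_coords using Z by blast
  qed
qed

lemma coordsE:
  assumes "v \<in> carrier_vec D" obtains e where "v = lc D (I \<times> J) e t"
  using assms total by (auto elim: sp_E)

lemma supported:
  assumes "S \<subseteq> I \<times> J"
  shows "lc D (I \<times> J) e t \<in> sp D S t \<longleftrightarrow> (\<forall>z\<in>I \<times> J. z \<notin> S \<longrightarrow> e z = 0)"
proof
  assume "lc D (I \<times> J) e t \<in> sp D S t"
  then show "\<forall>z\<in>I \<times> J. z \<notin> S \<longrightarrow> e z = 0" using lc_support[OF ind _ assms] by blast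
next
  assume z: "\<forall>z\<in>I \<times> J. z \<notin> S \<longrightarrow> e z = 0"
  have "lc D S e t = lc D (I \<times> J) e t" by (rule lc_mono) (use fin assms z in auto)
  then show "lc D (I \<times> J) e t \<in> sp D S t" using lc_in_sp[of D S e t] by simp
qed

lemma W_sum: "ssum (W 0 1) (W 1 0) = sp D (block 0 1 \<union> block 1 0) t"
  unfolding W_def by (rule sp_Un[symmetric]) (auto simp: block_def)

lemma blocks: "block 0 0 \<subseteq> I \<times> J" "block 0 1 \<union> block 1 0 \<subseteq> I \<times> J" "block 0 0 \<inter> (block 0 1 \<union> block 1 0) = {}"
  using block_subset[of 0 0] block_subset[of 0 1] block_subset[of 1 0] L by (auto simp: block_def)

lemma mem_block: "((i,k),(j,l)) \<in> block i' j' \<longleftrightarrow> i = i' \<and> j = j' \<and> k \<le> a i \<and> l \<le> c j"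
  by (auto simp: block_def)

lemma W00_killed: "v \<in> W 0 0 \<Longrightarrow> killed m D T v"
proof -
  assume v: "v \<in> W 0 0"
  obtain e where e: "v = lc D (I \<times> J) e t" using coordsE subspace_carrier[OF subspace_W v] by blast
  have s: "e z = 0" if "z \<in> I \<times> J" "z \<notin> block 0 0" for z
    using v that unfolding e W_def supported[OF blocks(1)] by blast
  have "sol m (a 0) (a 1) (c 0) (c 1) M1 M2 (\<lambda>k l. e ((0,k),(1,l))) (\<lambda>k l. e ((1,k),(0,l)))"
    unfolding sol_def using s L by (auto simp: mem_block I_def J_def intro!: sum.neutral)
  then show ?thesis unfolding e killed_iff using s by blast
qed

lemma subspace_S1: "subspace D S1"
proof -
  note cr = g_repD(1)[OF rep]
  have "S1 = ssum (W 0 1) (W 1 0) \<inter> (carrier_vec D \<inter> \<Inter>((\<lambda>x. {v \<in> carrier_vec D. T x *\<^sub>v v \<in> {0\<^sub>v D}}) ` insert GZ (GX ` {..m})))"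
    using subspace_carrier[OF subspace_ssum[OF subspace_W subspace_W]] by (auto simp: S1_def killed_def)
  moreover have "subspace D (carrier_vec D \<inter> \<Inter>((\<lambda>x. {v \<in> carrier_vec D. T x *\<^sub>v v \<in> {0\<^sub>v D}}) ` insert GZ (GX ` {..m})))"
    by (rule subspace_INT) (use subspace_preimage[OF cr subspace_0] in blast)
  ultimately show ?thesis using subspace_Int[OF subspace_ssum[OF subspace_W subspace_W]] by simp
qed

text \<open>The block (0,0) is invariant without any condition and the system involves only the two
  other blocks, so an invariant may be split along blocks.\<close>

lemma killed_decomp: "{v \<in> carrier_vec D. killed m D T v} = ssum (W 0 0) S1"
proof (intro equalityI subsetI)
  fix v assume "v \<in> {v \<in> carrier_vec D. killed m D T v}"
  then have v: "v \<in> carrier_vec D" "killed m D T v" by auto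
  obtain e where e: "v = lc D (I \<times> J) e t" using coordsE[OF v(1)] by blast
  have k: "\<And>z. z \<in> I \<times> J \<Longrightarrow> z \<notin> block 0 0 \<union> block 0 1 \<union> block 1 0 \<Longrightarrow> e z = 0"
    and s: "sol m (a 0) (a 1) (c 0) (c 1) M1 M2 (\<lambda>k l. e ((0,k),(1,l))) (\<lambda>k l. e ((1,k),(0,l)))"
    using v(2) unfolding e killed_iff by blast+
  define e0 where "e0 z = (if z \<in> block 0 0 then e z else 0)" for z
  define e1 where "e1 z = (if z \<in> block 0 0 then 0 else e z)" for z
  have "v = lc D (I \<times> J) e0 t + lc D (I \<times> J) e1 t" unfolding e lc_add by (rule lc_cong) (auto simp: e0_def e1_def)
  moreover have "lc D (I \<times> J) e0 t \<in> W 0 0" unfolding W_def supported[OF blocks(1)] by (simp add: e0_def)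
  moreover have "lc D (I \<times> J) e1 t \<in> S1"
  proof -
    have "sol m (a 0) (a 1) (c 0) (c 1) M1 M2 (\<lambda>k l. e1 ((0,k),(1,l))) (\<lambda>k l. e1 ((1,k),(0,l)))"
      using s by (simp add: e1_def mem_block)
    then show ?thesis unfolding S1_def mem_Collect_eq W_sum supported[OF blocks(2)] killed_iff using k by (auto simp: e1_def)
  qed
  ultimately show "v \<in> ssum (W 0 0) S1" unfolding ssum_def by blast
next
  fix v assume "v \<in> ssum (W 0 0) S1"
  then obtain u w where v: "v = u + w" "u \<in> W 0 0" "w \<in> S1" by (auto simp: ssum_def)
  have c: "u \<in> carrier_vec D" "w \<in> carrier_vec D" using subspace_carrier[OF subspace_W v(2)] subspace_carrier[OF subspace_S1 v(3)] by auto
  have "killed m D T u" "killed m D T w" using W00_killed v by (auto simp: S1_def)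
  then have "killed m D T v"
    using mult_add_distrib_mat_vec[OF g_repD(1)[OF rep] c] unfolding killed_def v(1) by (auto simp: right_zero_vec)
  then show "v \<in> {v \<in> carrier_vec D. killed m D T v}" using c v(1) by simp
qed

lemma decomp_disjoint: "W 0 0 \<inter> S1 = {0\<^sub>v D}"
proof -
  have "v = 0\<^sub>v D" if "v \<in> W 0 0" "v \<in> S1" for v
    using indep_sp_disjoint[OF ind blocks] that unfolding S1_def mem_Collect_eq W_sum unfolding W_def by blast
  then show ?thesis using subspace_zero[OF subspace_W] subspace_zero[OF subspace_S1] by blast
qed

lemma S1_E:
  assumes "v \<in> S1"
  obtains e where "v = lc D (I \<times> J) e t" "\<And>z. z \<in> I \<times> J \<Longrightarrow> z \<notin> block 0 1 \<union> block 1 0 \<Longrightarrow> e z = 0"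
    "sol m (a 0) (a 1) (c 0) (c 1) M1 M2 (\<lambda>k l. e ((0,k),(1,l))) (\<lambda>k l. e ((1,k),(0,l)))"
proof -
  obtain e where e: "v = lc D (I \<times> J) e t" using coordsE subspace_carrier[OF subspace_S1 assms] by blast
  show ?thesis using assms that[OF e] unfolding S1_def mem_Collect_eq W_sum e supported[OF blocks(2)] killed_iff by blast
qed

lemma S1_zero:
  assumes "sol_zero m (a 0) (a 1) (c 0) (c 1) M1 M2" shows "S1 = {0\<^sub>v D}"
proof -
  have "v = 0\<^sub>v D" if v: "v \<in> S1" for v
  proof -
    obtain e where e: "v = lc D (I \<times> J) e t" "\<And>z. z \<in> I \<times> J \<Longrightarrow> z \<notin> block 0 1 \<union> block 1 0 \<Longrightarrow> e z = 0"
      "sol m (a 0) (a 1) (c 0) (c 1) M1 M2 (\<lambda>k l. e ((0,k),(1,l))) (\<lambda>k l. e ((1,k),(0,l)))" using S1_E[OF v] by blast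
    have z: "\<forall>k\<le>a 0. \<forall>l\<le>c 1. e ((0,k),(1,l)) = 0" "\<forall>k\<le>a 1. \<forall>l\<le>c 0. e ((1,k),(0,l)) = 0"
      using assms e(3) unfolding sol_zero_def by blast+
    have "e x = 0" if "x \<in> I \<times> J" for x using e(2)[OF that] z by (cases "x \<in> block 0 1 \<union> block 1 0") (auto simp: block_def)
    then show ?thesis unfolding e(1) by (intro lc_zero) auto
  qed
  then show ?thesis using subspace_zero[OF subspace_S1] by blast
qed

text \<open>The N-th basic solution becomes a vector of S1 of weight K - 2N, and
  \<open>weight_line_chain\<close> recognises V(K).\<close>

lemma S1_line:
  assumes "sol_line m (a 0) (a 1) (c 0) (c 1) M1 M2 K" shows "sl2_iso D T S1 [K]"
proof -
  note cr = g_repD(1)[OF rep]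
  obtain X Y where XY: "sol_basis m (a 0) (a 1) (c 0) (c 1) M1 M2 K X Y" using assms unfolding sol_line_def by blast
  define e :: "nat \<Rightarrow> (nat \<times> nat) \<times> (nat \<times> nat) \<Rightarrow> 'a" where
    "e N = (\<lambda>((i,k),(j,l)). if i = 0 \<and> j = 1 then X N k l else if i = 1 \<and> j = 0 then Y N k l else 0)" for N
  define u where "u N = lc D (I \<times> J) (e N) t" for N
  have supp: "e N z = 0" if "z \<in> I \<times> J" "z \<notin> block 0 1 \<union> block 1 0" for N z
    using that by (auto simp: e_def block_def I_def J_def split: if_splits)
  have uS: "u N \<in> S1" if "N \<le> K" for N
  proof -
    have "sol m (a 0) (a 1) (c 0) (c 1) M1 M2 (\<lambda>k l. e N ((0,k),(1,l))) (\<lambda>k l. e N ((1,k),(0,l)))"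
      using sol_basisD(1)[OF XY that] by (simp add: e_def)
    then show ?thesis unfolding u_def S1_def mem_Collect_eq W_sum supported[OF blocks(2)] killed_iff using supp[of _ N] by blast
  qed
  have w: "(case z of (x,y) \<Rightarrow> (case x of (j,l) \<Rightarrow> int (a j) - 2 * int l) + (case y of (j,l) \<Rightarrow> int (c j) - 2 * int l)) = int K - 2 * int N"
    if z: "z \<in> I \<times> J" "e N z \<noteq> 0" and N: "N \<le> K" for z N
  proof -
    obtain i k j l where zz: "z = ((i,k),(j,l))" by (metis surj_pair)
    consider "i = 0" "j = 1" "k \<le> a 0" "l \<le> c 1" "X N k l \<noteq> 0" | "i = 1" "j = 0" "k \<le> a 1" "l \<le> c 0" "Y N k l \<noteq> 0"
      using z unfolding zz by (auto simp: e_def I_def J_def split: if_splits)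
    then show ?thesis
    proof cases
      case 1
      then have "int (a 0) + int (c 1) - 2 * (int k + int l) = int K - 2 * int N" by (intro sol_basisD(2)[OF XY N])
      then show ?thesis using 1 zz by simp
    next
      case 2
      then have "int (a 1) + int (c 0) - 2 * (int k + int l) = int K - 2 * int N" by (intro sol_basisD(3)[OF XY N])
      then show ?thesis using 2 zz by simp
    qed
  qed
  have "\<exists>f. chain D (T GE) (T GF) (T GH) K f \<and> S1 = sp D {..K} f"
  proof (rule sl2.weight_line_chain[OF g_repD(2)[OF rep] subspace_S1 _ _ uS])
    have st: "T x *\<^sub>v v \<in> S1" if x: "x \<in> {GE, GF, GH}" and v: "v \<in> S1" for x v
    proof -
      have vc: "v \<in> carrier_vec D" using subspace_carrier[OF subspace_S1 v] .
      have "v \<in> lsum D [W 0 1, W 1 0]" using v by (simp add: S1_def ssum_0[OF subspace_W])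
      then have "T x *\<^sub>v v \<in> lsum D [W 0 1, W 1 0]"
        by (rule lsum_stable[OF cr, rotated 2]) (use subspace_W W_stable[OF _ _ x] L in auto)
      then show ?thesis using killed_stable[OF rep vc _ x] v by (simp add: S1_def ssum_0[OF subspace_W])
    qed
    show "T GE *\<^sub>v v \<in> S1" "T GF *\<^sub>v v \<in> S1" if "v \<in> S1" for v using st that by auto
    fix N assume N: "N \<le> K"
    have "\<exists>z\<in>I \<times> J. e N z \<noteq> 0"
    proof -
      consider k l where "k \<le> a 0" "l \<le> c 1" "X N k l \<noteq> 0" | k l where "k \<le> a 1" "l \<le> c 0" "Y N k l \<noteq> 0"
        using sol_basisD(4)[OF XY N] by blast
      then show ?thesis
      proof cases
        case (1 k l)
        then show ?thesis using L by (intro bexI[of _ "((0,k),(1,l))"]) (auto simp: e_def I_def J_def)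
      next
        case (2 k l)
        then show ?thesis using L by (intro bexI[of _ "((1,k),(0,l))"]) (auto simp: e_def I_def J_def)
      qed
    qed
    then show "u N \<noteq> 0\<^sub>v D" unfolding u_def using indepD[OF ind] by blast
    have tc: "\<And>z. z \<in> I \<times> J \<Longrightarrow> t z \<in> carrier_vec D" using indep_carrier[OF ind] .
    have "T GH *\<^sub>v u N = lc D (I \<times> J) (e N) (\<lambda>z. T GH *\<^sub>v t z)" unfolding u_def by (rule mult_lc[OF cr tc])
    also have "\<dots> = lc D (I \<times> J) (e N) (\<lambda>z. of_int (int K - 2 * int N) \<cdot>\<^sub>v t z)"
    proof (rule lc_cong)
      fix z assume z: "z \<in> I \<times> J" "e N z \<noteq> 0"
      have "T GH *\<^sub>v t z = of_int (case z of (x,y) \<Rightarrow> (case x of (j,l) \<Rightarrow> int (a j) - 2 * int l) + (case y of (j,l) \<Rightarrow> int (c j) - 2 * int l)) \<cdot>\<^sub>v t z"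
        using wt z(1) unfolding weights_def by blast
      then show "T GH *\<^sub>v t z = of_int (int K - 2 * int N) \<cdot>\<^sub>v t z" unfolding w[OF z N] .
    qed simp
    also have "\<dots> = of_int (int K - 2 * int N) \<cdot>\<^sub>v u N"
      unfolding u_def lc_smult by (subst lc_smult2[OF tc]) (auto intro!: lc_cong simp: mult.commute)
    finally show "T GH *\<^sub>v u N = of_int (int K - 2 * int N) \<cdot>\<^sub>v u N" .
  next
    fix v assume v: "v \<in> S1"
    obtain f where f: "v = lc D (I \<times> J) f t" "\<And>z. z \<in> I \<times> J \<Longrightarrow> z \<notin> block 0 1 \<union> block 1 0 \<Longrightarrow> f z = 0"
      "sol m (a 0) (a 1) (c 0) (c 1) M1 M2 (\<lambda>k l. f ((0,k),(1,l))) (\<lambda>k l. f ((1,k),(0,l)))" using S1_E[OF v] by blast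
    obtain s where s: "\<forall>k\<le>a 0. \<forall>l\<le>c 1. f ((0,k),(1,l)) = (\<Sum>N\<le>K. s N * X N k l)" "\<forall>k\<le>a 1. \<forall>l\<le>c 0. f ((1,k),(0,l)) = (\<Sum>N\<le>K. s N * Y N k l)"
      using sol_basisD(5)[OF XY f(3)] by blast
    have "lc D {..K} s u = lc D {..K} s (\<lambda>N. lc D (I \<times> J) (e N) t)" unfolding u_def ..
    also have "\<dots> = v" unfolding lc_lc f(1)
    proof (rule lc_cong)
      fix z assume z: "z \<in> I \<times> J"
      show "(\<Sum>N\<le>K. s N * e N z) = f z"
      proof (cases "z \<in> block 0 1 \<union> block 1 0")
        case True
        then show ?thesis using s by (auto simp: block_def e_def)
      next
        case False
        then show ?thesis using f(2)[OF z] supp[OF z] by simp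
      qed
    qed simp
    finally show "\<exists>s. v = lc D {..K} s u" by blast
  qed
  then show ?thesis using sl2_iso_single[OF cr g_repD(2)[OF rep]] by blast
qed

text \<open>The uniqueness results provide a scalar, and it is nonzero because some x_i acts
  nontrivially from level 1 to level 0.\<close>

lemma M1_cases:
  shows "a 1 = a 0 + m \<Longrightarrow> \<exists>s. s \<noteq> 0 \<and> (\<forall>i\<le>m. \<forall>l\<le>a 0. \<forall>j\<le>a 1. M1 i l j = s * raise m i l j)"
    and "a 0 = a 1 + m \<Longrightarrow> \<exists>s. s \<noteq> 0 \<and> (\<forall>i\<le>m. \<forall>l\<le>a 0. \<forall>j\<le>a 1. M1 i l j = s * lower m (a 0) i l j)"
    and "m \<ge> 1 \<Longrightarrow> a 0 = 1 \<Longrightarrow> a 1 = m - 1 \<Longrightarrow> \<exists>s. s \<noteq> 0 \<and> (\<forall>i\<le>m. \<forall>l\<le>a 0. \<forall>j\<le>a 1. M1 i l j = s * special m i l j)"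
proof -
  have nz: "\<exists>s. s \<noteq> 0 \<and> (\<forall>i\<le>m. \<forall>l\<le>a 0. \<forall>j\<le>a 1. M1 i l j = s * N i l j)" if "\<exists>s. \<forall>i\<le>m. \<forall>l\<le>a 0. \<forall>j\<le>a 1. M1 i l j = s * N i l j" for N
    using that M1_nonzero by fastforce
  show "\<exists>s. s \<noteq> 0 \<and> (\<forall>i\<le>m. \<forall>l\<le>a 0. \<forall>j\<le>a 1. M1 i l j = s * raise m i l j)" if "a 1 = a 0 + m"
    by (rule nz[OF equivariant_raise[OF equivariant_M1 that]])
  show "\<exists>s. s \<noteq> 0 \<and> (\<forall>i\<le>m. \<forall>l\<le>a 0. \<forall>j\<le>a 1. M1 i l j = s * lower m (a 0) i l j)" if "a 0 = a 1 + m"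
    by (rule nz[OF equivariant_lower[OF equivariant_M1 that]])
  show "\<exists>s. s \<noteq> 0 \<and> (\<forall>i\<le>m. \<forall>l\<le>a 0. \<forall>j\<le>a 1. M1 i l j = s * special m i l j)" if "m \<ge> 1" "a 0 = 1" "a 1 = m - 1"
    by (rule nz[OF equivariant_special[OF equivariant_M1 that(2,3,1)]])
qed

lemma M2_cases:
  shows "c 1 = c 0 + m \<Longrightarrow> \<exists>s. s \<noteq> 0 \<and> (\<forall>i\<le>m. \<forall>l\<le>c 0. \<forall>j\<le>c 1. M2 i l j = s * raise m i l j)"
    and "c 0 = c 1 + m \<Longrightarrow> \<exists>s. s \<noteq> 0 \<and> (\<forall>i\<le>m. \<forall>l\<le>c 0. \<forall>j\<le>c 1. M2 i l j = s * lower m (c 0) i l j)"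
proof -
  have nz: "\<exists>s. s \<noteq> 0 \<and> (\<forall>i\<le>m. \<forall>l\<le>c 0. \<forall>j\<le>c 1. M2 i l j = s * N i l j)" if "\<exists>s. \<forall>i\<le>m. \<forall>l\<le>c 0. \<forall>j\<le>c 1. M2 i l j = s * N i l j" for N
    using that M2_nonzero by fastforce
  show "\<exists>s. s \<noteq> 0 \<and> (\<forall>i\<le>m. \<forall>l\<le>c 0. \<forall>j\<le>c 1. M2 i l j = s * raise m i l j)" if "c 1 = c 0 + m"
    by (rule nz[OF equivariant_raise[OF equivariant_M2 that]])
  show "\<exists>s. s \<noteq> 0 \<and> (\<forall>i\<le>m. \<forall>l\<le>c 0. \<forall>j\<le>c 1. M2 i l j = s * lower m (c 0) i l j)" if "c 0 = c 1 + m"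
    by (rule nz[OF equivariant_lower[OF equivariant_M2 that]])
qed

section \<open>S_1 for each combination of map types\<close>

lemma S1_raise_raise:
  assumes m: "m \<ge> 1" and "a 1 = a 0 + m" "c 1 = c 0 + m" shows "sl2_iso D T S1 [a 0 + c 0 + m]"
proof -
  obtain s1 s2 where s: "s1 \<noteq> 0" "s2 \<noteq> 0" "\<And>i l j. i \<le> m \<Longrightarrow> l \<le> a 0 \<Longrightarrow> j \<le> a 1 \<Longrightarrow> M1 i l j = s1 * raise m i l j"
    "\<And>i l j. i \<le> m \<Longrightarrow> l \<le> c 0 \<Longrightarrow> j \<le> c 1 \<Longrightarrow> M2 i l j = s2 * raise m i l j" using M1_cases(1)[OF assms(2)] M2_cases(1)[OF assms(3)] by metis
  show ?thesis by (rule S1_line[OF sol_raise_raise[OF s(1,2) m s(3) assms(2) s(4) assms(3)]])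
qed

lemma S1_raise_lower:
  assumes m: "m \<ge> 1" and "a 1 = a 0 + m" "c 0 = c 1 + m"
  shows "a 0 \<le> c 1 \<Longrightarrow> sl2_iso D T S1 [c 1 - a 0]" "c 1 < a 0 \<Longrightarrow> S1 = {0\<^sub>v D}"
proof -
  obtain s1 s2 where s: "s1 \<noteq> 0" "s2 \<noteq> 0" "\<And>i l j. i \<le> m \<Longrightarrow> l \<le> a 0 \<Longrightarrow> j \<le> a 1 \<Longrightarrow> M1 i l j = s1 * raise m i l j"
    "\<And>i l j. i \<le> m \<Longrightarrow> l \<le> c 0 \<Longrightarrow> j \<le> c 1 \<Longrightarrow> M2 i l j = s2 * lower m (c 0) i l j" using M1_cases(1)[OF assms(2)] M2_cases(2)[OF assms(3)] by metis
  note r = sol_raise_lower[OF s(1,2) m s(3) assms(2) s(4) assms(3)]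
  show "a 0 \<le> c 1 \<Longrightarrow> sl2_iso D T S1 [c 1 - a 0]" by (rule S1_line[OF r(1)])
  show "c 1 < a 0 \<Longrightarrow> S1 = {0\<^sub>v D}" by (rule S1_zero[OF r(2)])
qed

text \<open>The mirror image of \<open>S1_raise_lower\<close> under exchange of the factors: V_2 now
  supplies the raising map, so the comparison is between \<open>c 0\<close> and
  \<open>a 1\<close>.\<close>

lemma S1_lower_raise:
  assumes m: "m \<ge> 1" and "a 0 = a 1 + m" "c 1 = c 0 + m"
  shows "c 0 \<le> a 1 \<Longrightarrow> sl2_iso D T S1 [a 1 - c 0]" "a 1 < c 0 \<Longrightarrow> S1 = {0\<^sub>v D}"
proof -
  obtain s1 s2 where s: "s1 \<noteq> 0" "s2 \<noteq> 0" "\<And>i l j. i \<le> m \<Longrightarrow> l \<le> a 0 \<Longrightarrow> j \<le> a 1 \<Longrightarrow> M1 i l j = s1 * lower m (a 0) i l j"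
    "\<And>i l j. i \<le> m \<Longrightarrow> l \<le> c 0 \<Longrightarrow> j \<le> c 1 \<Longrightarrow> M2 i l j = s2 * raise m i l j" using M1_cases(2)[OF assms(2)] M2_cases(1)[OF assms(3)] by metis
  note r = sol_raise_lower[OF s(2,1) m s(4) assms(3) s(3) assms(2)]
  show "c 0 \<le> a 1 \<Longrightarrow> sl2_iso D T S1 [a 1 - c 0]" by (rule S1_line[OF sol_line_swap[OF r(1)]])
  show "a 1 < c 0 \<Longrightarrow> S1 = {0\<^sub>v D}" by (rule S1_zero[OF sol_zero_swap[OF r(2)]])
qed

lemma S1_lower_lower:
  assumes m: "m \<ge> 1" and "a 0 = a 1 + m" "c 0 = c 1 + m" shows "S1 = {0\<^sub>v D}"
proof -
  obtain s1 s2 where s: "s1 \<noteq> 0" "s2 \<noteq> 0" "\<And>i l j. i \<le> m \<Longrightarrow> l \<le> a 0 \<Longrightarrow> j \<le> a 1 \<Longrightarrow> M1 i l j = s1 * lower m (a 0) i l j"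
    "\<And>i l j. i \<le> m \<Longrightarrow> l \<le> c 0 \<Longrightarrow> j \<le> c 1 \<Longrightarrow> M2 i l j = s2 * lower m (c 0) i l j" using M1_cases(2)[OF assms(2)] M2_cases(2)[OF assms(3)] by metis
  show ?thesis by (rule S1_zero[OF sol_lower_lower[OF s(1,2) m s(3) assms(2) s(4) assms(3)]])
qed

lemma S1_special_raise:
  assumes m: "m \<ge> 1" and "a 0 = 1" "a 1 = m - 1" "c 1 = c 0 + m"
  shows "c 0 = 0 \<Longrightarrow> sl2_iso D T S1 [m - 1]" "c 0 \<noteq> 0 \<Longrightarrow> S1 = {0\<^sub>v D}"
proof -
  obtain s1 s2 where s: "s1 \<noteq> 0" "s2 \<noteq> 0" "\<And>i l j. i \<le> m \<Longrightarrow> l \<le> a 0 \<Longrightarrow> j \<le> a 1 \<Longrightarrow> M1 i l j = s1 * special m i l j"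
    "\<And>i l j. i \<le> m \<Longrightarrow> l \<le> c 0 \<Longrightarrow> j \<le> c 1 \<Longrightarrow> M2 i l j = s2 * raise m i l j" using M1_cases(3)[OF assms(1-3)] M2_cases(1)[OF assms(4)] by metis
  note r = sol_special_raise[OF s(1,2) m s(3) assms(2,3) s(4) assms(4)]
  show "c 0 = 0 \<Longrightarrow> sl2_iso D T S1 [m - 1]" by (rule S1_line[OF r(1)])
  show "c 0 \<noteq> 0 \<Longrightarrow> S1 = {0\<^sub>v D}" by (rule S1_zero[OF r(2)])
qed

lemma S1_special_lower:
  assumes m: "m \<ge> 1" and "a 0 = 1" "a 1 = m - 1" "c 0 = c 1 + m" shows "S1 = {0\<^sub>v D}"
proof -
  obtain s1 s2 where s: "s1 \<noteq> 0" "s2 \<noteq> 0" "\<And>i l j. i \<le> m \<Longrightarrow> l \<le> a 0 \<Longrightarrow> j \<le> a 1 \<Longrightarrow> M1 i l j = s1 * special m i l j"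
    "\<And>i l j. i \<le> m \<Longrightarrow> l \<le> c 0 \<Longrightarrow> j \<le> c 1 \<Longrightarrow> M2 i l j = s2 * lower m (c 0) i l j" using M1_cases(3)[OF assms(1-3)] M2_cases(2)[OF assms(4)] by metis
  show ?thesis by (rule S1_zero[OF sol_special_lower[OF s(1,2) m s(3) assms(2,3) s(4) assms(4)]])
qed

lemma W00_iso: "sl2_iso D T (W 0 0) [a 0 + c 0 - 2 * k. k \<leftarrow> [0..<Suc (min (a 0) (c 0))]]"
  unfolding W_alt[of 0 0, simplified] unfolding D_def T_def
  by (rule clebsch_gordan[OF r1 r2 graded_weights[OF gp] graded_weights[OF gq] gradedD(1)[OF gp] gradedD(1)[OF gq]]) simp_all

lemma nilpotent: "carrier_vec D \<subseteq> nilp m D T (3 + Suc L)"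
  unfolding D_def T_def by (rule tens_nilp[OF r1 r2 fgraded_nilp[OF r1 fg] zgraded_nilp[OF r2 zg]])

end

section \<open>Transfer to the given socle decompositions and the individual cases\<close>

theorem theorem4p6:
  fixes n d1 d2 l a0 a1 a2 :: nat and bs :: "nat list"
    and \<rho>1 \<rho>2 :: "gen \<Rightarrow> 'a::field_char_0 mat"
    and Ws1 Ws2 :: "'a vec set list"
  assumes n: "n \<ge> 1"
    and mod1: "gmod n d1 \<rho>1" and mod2: "gmod n d2 \<rho>2"
    and uni1: "uniserial n d1 \<rho>1" and uni2: "uniserial n d2 \<rho>2"
    and sd1: "socle_decomp n d1 \<rho>1 Ws1 [a0, a1, a2]"
    and sd2: "socle_decomp n d2 \<rho>2 Ws2 bs" and len: "length bs = l + 1" and l: "l \<ge> 1"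
    and faith: "faithful n d1 \<rho>1" and notFU434: "\<not> (n = 2 \<and> [a0, a1, a2] = [4, 3, 4])"
    and tZ: "typeZ n d2 \<rho>2"
  shows
    "let m = 2 * n - 1; b0 = bs ! 0; b1 = bs ! 1; D = d1 * d2;
         T = tens_rep d1 \<rho>1 d2 \<rho>2;
         S0 = S_t n d1 \<rho>1 Ws1 d2 \<rho>2 Ws2 0;
         S1 = S_t n d1 \<rho>1 Ws1 d2 \<rho>2 Ws2 1;
         Zp = is_Zmod n d2 \<rho>2 b0 l;
         Zm = (\<exists>\<rho>'. is_Zmod n d2 \<rho>' (bs ! l) l \<and> giso n d2 \<rho>2 d2 (gdual \<rho>'))
     in gsoc n D T = ssum S0 S1 \<and> S0 \<inter> S1 = {0\<^sub>v D} \<and>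
        S0 = tens_sub d1 d2 (gsoc n d1 \<rho>1) (gsoc n d2 \<rho>2) \<and>
        sl2_iso D T S0 [a0 + b0 - 2 * k. k \<leftarrow> [0..<Suc (min a0 b0)]] \<and>
        (n = 1 \<longrightarrow>
           (a1 = a0 + 1 \<and> Zp \<longrightarrow> sl2_iso D T S1 [a0 + b0 + m]) \<and>
           (a1 = a0 + 1 \<and> Zm \<longrightarrow>
              (b1 \<ge> a0 \<longrightarrow> sl2_iso D T S1 [b1 - a0]) \<and> (b1 < a0 \<longrightarrow> S1 = {0\<^sub>v D})) \<and>
           (a0 \<ge> 1 \<and> a1 = a0 - 1 \<and> Zp \<longrightarrow>
              (a0 \<ge> b1 \<longrightarrow> sl2_iso D T S1 [a0 - b1]) \<and> (a0 < b1 \<longrightarrow> S1 = {0\<^sub>v D})) \<and>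
           (a0 \<ge> 1 \<and> a1 = a0 - 1 \<and> Zm \<longrightarrow> S1 = {0\<^sub>v D})) \<and>
        (n > 1 \<longrightarrow>
           (a0 \<le> 1 \<and> a1 = a0 + m \<and> Zp \<longrightarrow> sl2_iso D T S1 [a0 + b0 + m]) \<and>
           (a0 \<le> 1 \<and> a1 = a0 + m \<and> Zm \<longrightarrow>
              (a0 \<le> b1 \<longrightarrow> sl2_iso D T S1 [b1 - a0]) \<and> (a0 > b1 \<longrightarrow> S1 = {0\<^sub>v D})) \<and>
           (a0 = 1 \<and> a1 = m - 1 \<and> Zp \<longrightarrow>
              (b0 = 0 \<longrightarrow> sl2_iso D T S1 [m - 1]) \<and> (b0 \<noteq> 0 \<longrightarrow> S1 = {0\<^sub>v D})) \<and>
           (a0 = 1 \<and> a1 = m - 1 \<and> Zm \<longrightarrow> S1 = {0\<^sub>v D}))"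
proof -
  define m where "m = 2 * n - 1"
  have m: "m \<ge> 1" using n by (simp add: m_def)
  have r1: "g_rep m d1 \<rho>1" and r2: "g_rep m d2 \<rho>2" unfolding m_def by (rule gmod_g_rep[OF mod1 n] gmod_g_rep[OF mod2 n])+
  have lenbs: "length bs \<ge> 2" using len l by simp
  note match = socle_match[OF r2[unfolded m_def] _ sd2 lenbs, folded m_def]
  obtain L c q where z: "zgraded m d2 \<rho>2 L c q"
    using tZ Zmod_zgraded[OF n, of d2 \<rho>2] Zmod_dual_zgraded[OF n mod2] unfolding typeZ_def m_def by blast
  note match0 = match[OF z]
  define a where "a j = [a0, a1, a2] ! j" for j
  have a01: "a 0 = a0" "a 1 = a1" by (simp_all add: a_def)
  obtain p \<gamma> where f: "fgraded m d1 \<rho>1 a p \<gamma>" and W1: "Ws1 ! 0 = sp d1 {..a0} (p 0)" "Ws1 ! 1 = sp d1 {..a1} (p 1)"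
    using faithful_fgraded[OF n r1[unfolded m_def] sd1 faith] unfolding m_def a_def[abs_def] by blast
  interpret X: faithful_tensor_z m d1 d2 L \<rho>1 \<rho>2 a c p q \<gamma>
    by unfold_locales (rule r1 r2 f z match0(1))+
  have lenW: "length Ws1 = 3" "length Ws2 = l + 1" using sd1 sd2 len by (auto simp: socle_decomp_def)
  have T: "tens_rep d1 \<rho>1 d2 \<rho>2 = X.T" "d1 * d2 = X.D" by (simp_all add: X.T_def X.D_def)
  have Wij: "tens_sub d1 d2 (Ws1 ! 0) (Ws2 ! 0) = X.W 0 0" "tens_sub d1 d2 (Ws1 ! 0) (Ws2 ! 1) = X.W 0 1"
    "tens_sub d1 d2 (Ws1 ! 1) (Ws2 ! 0) = X.W 1 0"
    using X.tens_sub_W[of 0 0] X.tens_sub_W[of 0 1] X.tens_sub_W[of 1 0] match0 W1 a01 by simp_all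
  have "S_t n d1 \<rho>1 Ws1 d2 \<rho>2 Ws2 0 = hinv n X.D X.T (lsum X.D [X.W 0 0])"
    unfolding S_t_def T using lenW Wij by simp
  also have "\<dots> = X.W 0 0" using X.W00_killed by (auto simp: hinv_eq ssum_0[OF X.subspace_W] m_def)
  finally have S0: "S_t n d1 \<rho>1 Ws1 d2 \<rho>2 Ws2 0 = X.W 0 0" .
  \<comment> \<open>Both factors have at least two levels, so exactly the index pairs (0,1) and
    (1,0) pass the length conditions.\<close>
  have "S_t n d1 \<rho>1 Ws1 d2 \<rho>2 Ws2 1 = hinv n X.D X.T (lsum X.D [X.W 0 1, X.W 1 0])"
    unfolding S_t_def T using lenW l Wij by (simp add: upt_rec)
  also have "\<dots> = X.S1" unfolding hinv_eq m_def[symmetric] X.S1_def by (simp add: ssum_0[OF X.subspace_W])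
  finally have S1: "S_t n d1 \<rho>1 Ws1 d2 \<rho>2 Ws2 1 = X.S1" .
  have soc1: "gsoc n d1 \<rho>1 = Ws1 ! 0"
  proof -
    have "gsoc n d1 \<rho>1 = lsum d1 (take (Suc 0) Ws1)" using sd1 lenW unfolding socle_decomp_def gsoc_i_1[symmetric] by simp
    also have "take (Suc 0) Ws1 = [Ws1 ! 0]" using lenW by (cases Ws1) auto
    finally show ?thesis unfolding W1 by (simp add: ssum_0[OF subspace_sp])
  qed
  have soc2: "gsoc n d2 \<rho>2 = Ws2 ! 0"
  proof -
    have "gsoc n d2 \<rho>2 = lsum d2 (take (Suc 0) Ws2)" using sd2 lenW(2) unfolding socle_decomp_def gsoc_i_1[symmetric] by (metis zero_less_Suc Suc_eq_plus1)
    also have "take (Suc 0) Ws2 = [Ws2 ! 0]" using lenW by (cases Ws2) auto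
    finally show ?thesis unfolding match0 by (simp add: ssum_0[OF subspace_sp])
  qed
  have soc: "gsoc n X.D X.T = ssum (X.W 0 0) X.S1"
    using gsoc_eq_hinv[OF X.rep[unfolded m_def] X.wt X.nilpotent[unfolded m_def]] X.killed_decomp by (simp add: hinv_eq m_def)
  \<comment> \<open>The grading coming from the case hypothesis and the grading fixed above are
    matched with the same socle decomposition, so their first two weights agree.\<close>
  have Zp: "c 1 = c 0 + m" if Z: "is_Zmod n d2 \<rho>2 (c 0) l"
  proof -
    obtain q' where "zgraded m d2 \<rho>2 l (\<lambda>j. c 0 + j * m) q'" using Zmod_zgraded[OF n Z] unfolding m_def by blast
    from match(3)[OF this] show ?thesis using match0(3) by simp
  qed
  \<comment> \<open>For the dual, b_j = b_l + (l-j) m is evaluated at j = 0 and j = 1; since l is at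
    least 1, the truncated differences behave and the two values differ by m.\<close>
  have Zm: "c 0 = c 1 + m" if Z: "is_Zmod n d2 \<rho>' (bs ! l) l" "giso n d2 \<rho>2 d2 (gdual \<rho>')" for \<rho>'
  proof -
    obtain q' where "zgraded m d2 \<rho>2 l (\<lambda>j. bs ! l + (l - j) * m) q'" using Zmod_dual_zgraded[OF n mod2 Z] unfolding m_def by blast
    from match(2,3)[OF this] have "c 0 = bs ! l + l * m" "c 1 = bs ! l + (l - 1) * m" using match0(2,3) by simp_all
    moreover obtain k where "l = Suc k" using l by (cases l) auto
    ultimately show ?thesis by simp
  qed
  have m1: "m = 1" if "n = 1" using that by (simp add: m_def)
  show ?thesis
    unfolding Let_def T S0 S1 soc1 soc2 Wij m_def[symmetric] match0(2,3)
  proof (intro conjI impI)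
    show "gsoc n X.D X.T = ssum (X.W 0 0) X.S1" by (rule soc)
    show "X.W 0 0 \<inter> X.S1 = {0\<^sub>v X.D}" by (rule X.decomp_disjoint)
    show "sl2_iso X.D X.T (X.W 0 0) [a0 + c 0 - 2 * k. k \<leftarrow> [0..<Suc (min a0 (c 0))]]" using X.W00_iso a01 by simp
  next
    assume "n = 1" "a1 = a0 + 1 \<and> is_Zmod n d2 \<rho>2 (c 0) l"
    then show "sl2_iso X.D X.T X.S1 [a0 + c 0 + m]" using X.S1_raise_raise[OF m] Zp m1 a01 by simp
  next
    assume "n = 1" "a1 = a0 + 1 \<and> (\<exists>\<rho>'. is_Zmod n d2 \<rho>' (bs ! l) l \<and> giso n d2 \<rho>2 d2 (gdual \<rho>'))" "a0 \<le> c 1"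
    then show "sl2_iso X.D X.T X.S1 [c 1 - a0]" using X.S1_raise_lower(1)[OF m] Zm m1 a01 by auto
  next
    assume "n = 1" "a1 = a0 + 1 \<and> (\<exists>\<rho>'. is_Zmod n d2 \<rho>' (bs ! l) l \<and> giso n d2 \<rho>2 d2 (gdual \<rho>'))" "c 1 < a0"
    then show "X.S1 = {0\<^sub>v X.D}" using X.S1_raise_lower(2)[OF m] Zm m1 a01 by auto
  next
    assume "n = 1" "1 \<le> a0 \<and> a1 = a0 - 1 \<and> is_Zmod n d2 \<rho>2 (c 0) l" "c 1 \<le> a0"
    \<comment> \<open>Here m = 1, so the condition \<open>c 0 \<le> a 1\<close> and the weight
      \<open>a 1 - c 0\<close> become \<open>c 1 \<le> a0\<close> and \<open>a0 - c 1\<close>: both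
      numbers are shifted by one.\<close>
    moreover from this have "c 1 = c 0 + 1" "a0 = a1 + 1" using Zp m1 by auto
    ultimately show "sl2_iso X.D X.T X.S1 [a0 - c 1]" using X.S1_lower_raise(1)[OF m] m1 a01 by simp
  next
    assume "n = 1" "1 \<le> a0 \<and> a1 = a0 - 1 \<and> is_Zmod n d2 \<rho>2 (c 0) l" "a0 < c 1"
    moreover from this have "c 1 = c 0 + 1" "a0 = a1 + 1" using Zp m1 by auto
    ultimately show "X.S1 = {0\<^sub>v X.D}" using X.S1_lower_raise(2)[OF m] m1 a01 by simp
  next
    assume "n = 1" "1 \<le> a0 \<and> a1 = a0 - 1 \<and> (\<exists>\<rho>'. is_Zmod n d2 \<rho>' (bs ! l) l \<and> giso n d2 \<rho>2 d2 (gdual \<rho>'))"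
    then show "X.S1 = {0\<^sub>v X.D}" using X.S1_lower_lower[OF m] Zm m1 a01 by auto
  next
    assume "n > 1" "a0 \<le> 1 \<and> a1 = a0 + m \<and> is_Zmod n d2 \<rho>2 (c 0) l"
    then show "sl2_iso X.D X.T X.S1 [a0 + c 0 + m]" using X.S1_raise_raise[OF m] Zp a01 by simp
  next
    assume "n > 1" "a0 \<le> 1 \<and> a1 = a0 + m \<and> (\<exists>\<rho>'. is_Zmod n d2 \<rho>' (bs ! l) l \<and> giso n d2 \<rho>2 d2 (gdual \<rho>'))" "a0 \<le> c 1"
    then show "sl2_iso X.D X.T X.S1 [c 1 - a0]" using X.S1_raise_lower(1)[OF m] Zm a01 by auto
  next
    assume "n > 1" "a0 \<le> 1 \<and> a1 = a0 + m \<and> (\<exists>\<rho>'. is_Zmod n d2 \<rho>' (bs ! l) l \<and> giso n d2 \<rho>2 d2 (gdual \<rho>'))" "c 1 < a0"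
    then show "X.S1 = {0\<^sub>v X.D}" using X.S1_raise_lower(2)[OF m] Zm a01 by auto
  next
    assume "n > 1" "a0 = 1 \<and> a1 = m - 1 \<and> is_Zmod n d2 \<rho>2 (c 0) l" "c 0 = 0"
    then show "sl2_iso X.D X.T X.S1 [m - 1]" using X.S1_special_raise(1)[OF m] Zp a01 by simp
  next
    assume "n > 1" "a0 = 1 \<and> a1 = m - 1 \<and> is_Zmod n d2 \<rho>2 (c 0) l" "c 0 \<noteq> 0"
    then show "X.S1 = {0\<^sub>v X.D}" using X.S1_special_raise(2)[OF m] Zp a01 by simp
  next
    assume "n > 1" "a0 = 1 \<and> a1 = m - 1 \<and> (\<exists>\<rho>'. is_Zmod n d2 \<rho>' (bs ! l) l \<and> giso n d2 \<rho>2 d2 (gdual \<rho>'))"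
    then show "X.S1 = {0\<^sub>v X.D}" using X.S1_special_lower[OF m] Zm a01 by auto
  qed (rule refl)
qed

end
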